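(* Let $1<p<\infty$, and let $(\Omega,d,\mu)$ be a bounded, locally compact, non-complete metric measure space such that $\Omega$ is a uniform domain in its completion, $\mu$ is doubling, and $(\Omega,d,\mu)$ supports a $p$-Poincaré inequality. Let $\partial\Omega=\overline\Omega\setminus\Omega$ carry a Borel regular measure $\nu$ that is $\Theta$-codimensional to $\mu$ for some $0<\Theta<p$, and put $\theta=1-\Theta/p$. Then for every bounded linear functional $L\in (HB^\theta_{p,p}(\partial\Omega))^*$ there exists a solution $u_L\in HN^{1,p}(\Omega)$ to the Neumann problem with boundary data $L$; that is, there exists $u_L\in HN^{1,p}(\Omega)$ such that $$\frac1p\int_\Omega |\nabla u_L|^p\,d\mu-L(\mathrm{Tr}(u_L))\le \frac1p\int_\Omega|\nabla v|^p\,d\mu-L(\mathrm{Tr}(v))\quad\text{for all } v\in HN^{1,p}(\Omega).$$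
   Context: **Domain.** $\overline\Omega$ is the completion of $\Omega$ and $\partial\Omega=\overline\Omega\setminus\Omega$. $\Omega$ is a uniform domain if there is $C\ge1$ such that every pair $x\ne y$ in $\Omega$ is joined by a curve $\gamma$ in $\Omega$ with length $\ell(\gamma)\le C\,d(x,y)$ and, for every $z$ on $\gamma$ and subcurves $\gamma_{x,z},\gamma_{z,y}$ of $\gamma$ from $x$ to $z$ and from $z$ to $y$, $\min\{\ell(\gamma_{x,z}),\ell(\gamma_{z,y})\}\le C\,\mathrm{dist}(z,\partial\Omega)$. $\mu$ is a Borel regular measure with $0<\mu(B)<\infty$ for all balls $B$; it is doubling if $\mu(2B)\le C\mu(B)$ for all balls. **Upper gradients, Poincaré.** A Borel $g:\Omega\to[0,\infty]$ is an upper gradient of $u:\Omega\to\mathbb R$ if $|u(y)-u(x)|\le\int_\gamma g\,ds$ for every non-constant compact rectifiable curve $\gamma$ joining $x,y$; it is a $p$-weak upper gradient if this holds for all such curves except a family $\Gamma$ for which there is a nonnegative Borel $\rho\in L^p(\Omega)$ with $\int_\gamma\rho\,ds=\infty$ for all $\gamma\in\Gamma$. The $p$-Poincaré inequality: there are $C>0,\lambda\ge1$ with $\frac1{\mu(B)}\int_B|u-u_B|\,d\mu\le C\,\mathrm{rad}(B)\big(\frac1{\mu(\lambda B)}\int_{\lambda B}g^p\,d\mu\big)^{1/p}$ for all balls $B$, all $u$ and all upper gradients $g$ of $u$, where $u_B=\frac1{\mu(B)}\int_Bu\,d\mu$. **Codimension.** $\nu$ is $\Theta$-codimensional to $\mu$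 if there is $C>0$ with $C^{-1}\mu(B(x,r)\cap\Omega)r^{-\Theta}\le\nu(B(x,r)\cap\partial\Omega)\le C\mu(B(x,r)\cap\Omega)r^{-\Theta}$ for all $x\in\partial\Omega$, $0<r<2\,\mathrm{diam}(\partial\Omega)$. Balls are balls of $\overline\Omega$; $\nu$ is regarded as a measure on $\overline\Omega$ supported on $\partial\Omega$. **Sobolev spaces.** $N^{1,p}(\Omega)$ is the space of functions in $L^p(\Omega)$ having a $p$-weak upper gradient in $L^p(\Omega)$, normed by $\|u\|_{L^p}+\inf_g\|g\|_{L^p}$ (infimum over $p$-weak upper gradients $g$ of $u$), modulo functions of norm zero. $HN^{1,p}(\Omega)$ is the quotient of $N^{1,p}(\Omega)$ by constant functions, with norm $\inf_g\|g\|_{L^p(\Omega)}$. **Cheeger gradient.** Fix a Cheeger differential structure on $\Omega$ of some dimension $N$: countably many measurable coordinate patches $\Omega_\alpha$ of positive measure covering $\mu$-almost all of $\Omega$, Lipschitz maps $\varphi_\alpha:\Omega_\alpha\to\mathbb R^N$, and measurable inner products $\langle\cdot,\cdot\rangle_x$ on $\mathbb R^N$, so that each $u\in N^{1,p}(\Omega)$ has, for $\mu$-a.e. $x\in\Omega_\alpha$, a vector $\nabla u(x)\in\mathbb R^N$ with $\operatorname{ess\,lim\,sup}_{\Omega_\alpha\ni y\to x}|u(y)-u(x)-\langle\nabla u(x),\varphi_\alpha(y)-\varphi_\alpha(x)\rangle_x|/d(x,y)=0$. The map $u\mapsto\nabla u$ is linear, and the structure is chosen so that $|\nabla u(x)|=\langle\nabla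 u(x),\nabla u(x)\rangle_x^{1/2}$ is comparable, with uniform constants, $\mu$-a.e. to the minimal $p$-weak upper gradient of $u$. $\nabla u$ is well defined for $u\in HN^{1,p}(\Omega)$. **Besov space.** $\dot B^\theta_{p,p}(\partial\Omega)$ is the set of measurable $f$ on $\partial\Omega$ with $$\|f\|^p_{HB^\theta_{p,p}(\partial\Omega)}=\int_{\partial\Omega}\int_{\partial\Omega}\frac{|f(y)-f(x)|^p}{d(y,x)^{\theta p}\,\nu(B(y,d(y,x)))}\,d\nu(x)\,d\nu(y)<\infty,$$ and $HB^\theta_{p,p}(\partial\Omega)=\dot B^\theta_{p,p}(\partial\Omega)/\mathbb R$ (modulo constants), with this norm. $(HB^\theta_{p,p}(\partial\Omega))^*$ is its dual (bounded linear functionals). **Trace (known result of Malý).** When $1<p<\infty$, $\Omega$ is a bounded, locally compact, non-complete metric space that is a uniform domain in its completion, $\mu$ is doubling, $(\Omega,d,\mu)$ supports a $p$-Poincaré inequality, $\nu$ is a Borel regular measure on $\partial\Omega$ that is $\Theta$-codimensional to $\mu$ with $0<\Theta<p$, and $\theta=1-\Theta/p$, there is a surjective bounded linear trace operator $\mathrm{Tr}:N^{1,p}(\Omega)\to\dot B^\theta_{p,p}(\partial\Omega)$, where $\mathrm{Tr}(u)(\xi)$ is characterized for $\nu$-a.e. $\xi$ by $\lim_{r\to0^+}\frac1{\mu(B(\xi,r))}\int_{B(\xi,r)}|u-\mathrm{Tr}(u)(\xi)|\,d\mu=0$, and $\|\mathrm{Tr}(u)\|_{HB^\theta_{p,p}(\partial\Omega)}\le\|\mathrm{Tr}\|\,\|\nabla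 u\|_{L^p(\Omega)}$. It induces a bounded linear operator $\mathrm{Tr}:HN^{1,p}(\Omega)\to HB^\theta_{p,p}(\partial\Omega)$, which is the one used here. *)

theory Defs
  imports "HOL-Analysis.Analysis"
begin

text \<open>
  The space \<open>\<Omega>\<close> is a subset of a type of class \<open>complete_space\<close>, so that its completion is
  \<open>closure \<Omega>\<close>; every metric space arises in this way up to isometry. A Borel regular (outer)
  measure is represented by its restriction to the Borel sets, which determines it, and the sets
  measurable for it are those of \<open>completion \<mu>\<close>. A measure on \<open>\<Omega>\<close> has \<open>space \<mu> = \<Omega>\<close>, so below
  \<open>space \<mu>\<close> plays the role of \<open>\<Omega>\<close> and \<open>space \<nu>\<close> the role of the boundary. Balls
  \<open>ball x r \<inter> space \<mu>\<close> carry their centre and radius.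
\<close>

definition bdry :: "'a::metric_space set \<Rightarrow> 'a set" where
  "bdry \<Omega> = closure \<Omega> - \<Omega>"

definition borel_measure_on :: "'a::metric_space set \<Rightarrow> 'a measure \<Rightarrow> bool" where
  "borel_measure_on A \<mu> \<longleftrightarrow> sets \<mu> = sets (restrict_space borel A)"

subsection \<open>Powers and \<open>L\<^sup>p\<close> norms with values in \<open>[0,\<infinity>]\<close>\<close>

text \<open>For \<open>a > 0\<close> this is the continuous extension of the power, with \<open>\<infinity>\<close> raised to \<open>a\<close> equal to \<open>\<infinity>\<close>.\<close>

definition epowr :: "ennreal \<Rightarrow> real \<Rightarrow> ennreal" where
  "epowr x a = (if x = \<infinity> then \<infinity> else ennreal (enn2real x powr a))"

definition Lp_norm :: "real \<Rightarrow> 'a measure \<Rightarrow> ('a \<Rightarrow> ennreal) \<Rightarrow> ennreal" where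
  "Lp_norm p \<mu> g = epowr (\<integral>\<^sup>+ x. epowr (g x) p \<partial>(completion \<mu>)) (1 / p)"

subsection \<open>Curves\<close>

definition curve_length :: "(real \<Rightarrow> 'a::metric_space) \<Rightarrow> real \<Rightarrow> real \<Rightarrow> ennreal" where
  "curve_length \<gamma> a b =
    (SUP (n, t) \<in> {(n::nat, t::nat \<Rightarrow> real). mono_on {..n} t \<and> t ` {..n} \<subseteq> {a..b}}.
       \<Sum>i<n. ennreal (dist (\<gamma> (t i)) (\<gamma> (t (Suc i)))))"

definition rect_curves :: "'a::metric_space set \<Rightarrow> (real \<Rightarrow> 'a) set" where
  "rect_curves \<Omega> = {\<gamma>. path \<gamma> \<and> path_image \<gamma> \<subseteq> \<Omega> \<and> \<not> \<gamma> constant_on {0..1}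
                        \<and> curve_length \<gamma> 0 1 < \<infinity>}"

text \<open>The arc-length parametrization: all parameters \<open>t\<close> at arc length \<open>s\<close> give the same point.\<close>

definition arc_param :: "(real \<Rightarrow> 'a::metric_space) \<Rightarrow> real \<Rightarrow> 'a" where
  "arc_param \<gamma> s = \<gamma> (SOME t. t \<in> {0..1} \<and> curve_length \<gamma> 0 t = ennreal s)"

definition curve_integral :: "(real \<Rightarrow> 'a::metric_space) \<Rightarrow> ('a \<Rightarrow> ennreal) \<Rightarrow> ennreal" where
  "curve_integral \<gamma> g =
    (\<integral>\<^sup>+ s \<in> {0..enn2real (curve_length \<gamma> 0 1)}. g (arc_param \<gamma> s) \<partial>lborel)"

subsection \<open>Assumptions on the metric measure space\<close>

definition uniform_domain :: "'a::metric_space set \<Rightarrow> bool" where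
  "uniform_domain \<Omega> \<longleftrightarrow>
    (\<exists>C::real. C \<ge> 1 \<and>
      (\<forall>x\<in>\<Omega>. \<forall>y\<in>\<Omega>. x \<noteq> y \<longrightarrow>
        (\<exists>\<gamma>. path \<gamma> \<and> path_image \<gamma> \<subseteq> \<Omega> \<and> pathstart \<gamma> = x \<and> pathfinish \<gamma> = y \<and>
             curve_length \<gamma> 0 1 \<le> ennreal (C * dist x y) \<and>
             (\<forall>t\<in>{0..1}. min (curve_length \<gamma> 0 t) (curve_length \<gamma> t 1)
                           \<le> ennreal (C * infdist (\<gamma> t) (bdry \<Omega>))))))"

definition balls_pos_finite :: "'a::metric_space measure \<Rightarrow> bool" where
  "balls_pos_finite \<mu> \<longleftrightarrow>
    (\<forall>x\<in>space \<mu>. \<forall>r>0. 0 < emeasure \<mu> (ball x r \<inter> space \<mu>) \<and> emeasure \<mu> (ball x r \<inter> space \<mu>) < \<infinity>)"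

definition doubling :: "'a::metric_space measure \<Rightarrow> bool" where
  "doubling \<mu> \<longleftrightarrow>
    (\<exists>C::real. \<forall>x\<in>space \<mu>. \<forall>r>0.
      emeasure \<mu> (ball x (2 * r) \<inter> space \<mu>) \<le> ennreal C * emeasure \<mu> (ball x r \<inter> space \<mu>))"

definition upper_gradient_along ::
  "('a::metric_space \<Rightarrow> real) \<Rightarrow> ('a \<Rightarrow> ennreal) \<Rightarrow> (real \<Rightarrow> 'a) \<Rightarrow> bool" where
  "upper_gradient_along u g \<gamma> \<longleftrightarrow>
    ennreal \<bar>u (pathfinish \<gamma>) - u (pathstart \<gamma>)\<bar> \<le> curve_integral \<gamma> g"

definition upper_gradient :: "'a::metric_space measure \<Rightarrow> ('a \<Rightarrow> real) \<Rightarrow> ('a \<Rightarrow> ennreal) \<Rightarrow> bool" where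
  "upper_gradient \<mu> u g \<longleftrightarrow>
    g \<in> borel_measurable \<mu> \<and> (\<forall>\<gamma>\<in>rect_curves (space \<mu>). upper_gradient_along u g \<gamma>)"

definition exceptional :: "real \<Rightarrow> 'a::metric_space measure \<Rightarrow> (real \<Rightarrow> 'a) set \<Rightarrow> bool" where
  "exceptional p \<mu> \<Gamma> \<longleftrightarrow>
    (\<exists>\<rho>::'a \<Rightarrow> ennreal. \<rho> \<in> borel_measurable \<mu> \<and> Lp_norm p \<mu> \<rho> < \<infinity> \<and>
       (\<forall>\<gamma>\<in>\<Gamma>. curve_integral \<gamma> \<rho> = \<infinity>))"

definition weak_upper_gradient ::
  "real \<Rightarrow> 'a::metric_space measure \<Rightarrow> ('a \<Rightarrow> real) \<Rightarrow> ('a \<Rightarrow> ennreal) \<Rightarrow> bool" where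
  "weak_upper_gradient p \<mu> u g \<longleftrightarrow>
    g \<in> borel_measurable \<mu> \<and>
    (\<exists>\<Gamma>. exceptional p \<mu> \<Gamma> \<and> (\<forall>\<gamma>\<in>rect_curves (space \<mu>) - \<Gamma>. upper_gradient_along u g \<gamma>))"

definition mean :: "'a measure \<Rightarrow> 'a set \<Rightarrow> ('a \<Rightarrow> real) \<Rightarrow> real" where
  "mean \<mu> B u = (LINT x:B|completion \<mu>. u x) / measure \<mu> B"

definition emean :: "'a measure \<Rightarrow> 'a set \<Rightarrow> ('a \<Rightarrow> ennreal) \<Rightarrow> ennreal" where
  "emean \<mu> B g = (\<integral>\<^sup>+ x \<in> B. g x \<partial>(completion \<mu>)) / emeasure \<mu> B"

text \<open>Integrability of \<open>u\<close> on the ball is exactly what makes its mean value meaningful.\<close>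

definition poincare :: "real \<Rightarrow> 'a::metric_space measure \<Rightarrow> bool" where
  "poincare p \<mu> \<longleftrightarrow>
    (\<exists>C::real. \<exists>l::real. C > 0 \<and> l \<ge> 1 \<and>
      (\<forall>x\<in>space \<mu>. \<forall>r>0. \<forall>u g.
        upper_gradient \<mu> u g \<longrightarrow>
        set_integrable (completion \<mu>) (ball x r \<inter> space \<mu>) u \<longrightarrow>
        emean \<mu> (ball x r \<inter> space \<mu>) (\<lambda>y. ennreal \<bar>u y - mean \<mu> (ball x r \<inter> space \<mu>) u\<bar>)
          \<le> ennreal (C * r) * epowr (emean \<mu> (ball x (l * r) \<inter> space \<mu>) (\<lambda>y. epowr (g y) p)) (1 / p)))"

definition codimensional ::
  "real \<Rightarrow> 'a::metric_space measure \<Rightarrow> 'a measure \<Rightarrow> bool" where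
  "codimensional \<Theta> \<mu> \<nu> \<longleftrightarrow>
    (\<exists>C::real. C > 0 \<and>
      (\<forall>x\<in>space \<nu>. \<forall>r. 0 < r \<and> r < 2 * diameter (space \<nu>) \<longrightarrow>
        ennreal (r powr (- \<Theta>) / C) * emeasure \<mu> (ball x r \<inter> space \<mu>) \<le> emeasure \<nu> (ball x r \<inter> space \<nu>) \<and>
        emeasure \<nu> (ball x r \<inter> space \<nu>) \<le> ennreal (C * r powr (- \<Theta>)) * emeasure \<mu> (ball x r \<inter> space \<mu>)))"

subsection \<open>Sobolev spaces\<close>

definition N1p :: "real \<Rightarrow> 'a::metric_space measure \<Rightarrow> ('a \<Rightarrow> real) set" where
  "N1p p \<mu> = {u. u \<in> borel_measurable (completion \<mu>) \<and> Lp_norm p \<mu> (\<lambda>x. ennreal \<bar>u x\<bar>) < \<infinity> \<and>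
                 (\<exists>g. weak_upper_gradient p \<mu> u g \<and> Lp_norm p \<mu> g < \<infinity>)}"

definition N1p_norm :: "real \<Rightarrow> 'a::metric_space measure \<Rightarrow> ('a \<Rightarrow> real) \<Rightarrow> ennreal" where
  "N1p_norm p \<mu> u =
    Lp_norm p \<mu> (\<lambda>x. ennreal \<bar>u x\<bar>) + (INF g \<in> {g. weak_upper_gradient p \<mu> u g}. Lp_norm p \<mu> g)"

definition HN_rel :: "real \<Rightarrow> 'a::metric_space measure \<Rightarrow> (('a \<Rightarrow> real) \<times> ('a \<Rightarrow> real)) set" where
  "HN_rel p \<mu> = {(u, v). u \<in> N1p p \<mu> \<and> v \<in> N1p p \<mu> \<and> (\<exists>c. N1p_norm p \<mu> (\<lambda>x. u x - v x - c) = 0)}"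

definition HN :: "real \<Rightarrow> 'a::metric_space measure \<Rightarrow> ('a \<Rightarrow> real) set set" where
  "HN p \<mu> = N1p p \<mu> // HN_rel p \<mu>"

subsection \<open>Cheeger differential structures\<close>

definition minimal_weak_upper_gradient ::
  "real \<Rightarrow> 'a::metric_space measure \<Rightarrow> ('a \<Rightarrow> real) \<Rightarrow> ('a \<Rightarrow> ennreal) \<Rightarrow> bool" where
  "minimal_weak_upper_gradient p \<mu> u g \<longleftrightarrow>
    weak_upper_gradient p \<mu> u g \<and> Lp_norm p \<mu> g < \<infinity> \<and>
    (\<forall>g'. weak_upper_gradient p \<mu> u g' \<and> Lp_norm p \<mu> g' < \<infinity> \<longrightarrow> (AE x in \<mu>. g x \<le> g' x))"

definition ess_limsup :: "'a::metric_space measure \<Rightarrow> 'a set \<Rightarrow> 'a \<Rightarrow> ('a \<Rightarrow> ennreal) \<Rightarrow> ennreal" where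
  "ess_limsup \<mu> A x q =
    (INF r \<in> {0<..}. Inf {t. AE y in completion \<mu>. y \<in> A \<inter> ball x r - {x} \<longrightarrow> q y \<le> t})"

definition inner_product :: "('v::real_vector \<Rightarrow> 'v \<Rightarrow> real) \<Rightarrow> bool" where
  "inner_product b \<longleftrightarrow>
    bilinear b \<and> (\<forall>v w. b v w = b w v) \<and> (\<forall>v. v \<noteq> 0 \<longrightarrow> b v v > 0)"

text \<open>
  The patches \<open>U \<alpha>\<close> (\<open>\<alpha> \<in> I\<close>) have coordinate maps \<open>\<phi> \<alpha>\<close>; \<open>ip x\<close> is the inner product at
  \<open>x\<close>, and \<open>D u x\<close> is the gradient of \<open>u\<close> at \<open>x\<close>. Linearity of \<open>D\<close> is understood almost
  everywhere.
\<close>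

definition cheeger_structure ::
  "real \<Rightarrow> 'a::metric_space measure \<Rightarrow> nat set \<Rightarrow> (nat \<Rightarrow> 'a set) \<Rightarrow> (nat \<Rightarrow> 'a \<Rightarrow> real ^ 'n::finite) \<Rightarrow>
   ('a \<Rightarrow> real ^ 'n \<Rightarrow> real ^ 'n \<Rightarrow> real) \<Rightarrow> (('a \<Rightarrow> real) \<Rightarrow> 'a \<Rightarrow> real ^ 'n) \<Rightarrow> bool" where
  "cheeger_structure p \<mu> I U \<phi> ip D \<longleftrightarrow>
    (\<forall>\<alpha>\<in>I. U \<alpha> \<in> sets (completion \<mu>) \<and> emeasure (completion \<mu>) (U \<alpha>) > 0
             \<and> (\<exists>K. K-lipschitz_on (U \<alpha>) (\<phi> \<alpha>))) \<and>
    (AE x in completion \<mu>. x \<in> (\<Union>\<alpha>\<in>I. U \<alpha>)) \<and>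
    (\<forall>x\<in>space \<mu>. inner_product (ip x)) \<and>
    (\<forall>v w. (\<lambda>x. ip x v w) \<in> borel_measurable (completion \<mu>)) \<and>
    (\<forall>u\<in>N1p p \<mu>. D u \<in> borel_measurable (completion \<mu>)) \<and>
    (\<forall>u\<in>N1p p \<mu>. \<forall>\<alpha>\<in>I. AE x in completion \<mu>. x \<in> U \<alpha> \<longrightarrow>
       ess_limsup \<mu> (U \<alpha>) x
         (\<lambda>y. ennreal (\<bar>u y - u x - ip x (D u x) (\<phi> \<alpha> y - \<phi> \<alpha> x)\<bar> / dist x y)) = 0) \<and>
    (\<forall>u\<in>N1p p \<mu>. \<forall>v\<in>N1p p \<mu>. \<forall>a b.
       AE x in completion \<mu>. D (\<lambda>y. a * u y + b * v y) x = a *\<^sub>R D u x + b *\<^sub>R D v x) \<and>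
    (\<exists>K::real. K \<ge> 1 \<and> (\<forall>u\<in>N1p p \<mu>. \<exists>g. minimal_weak_upper_gradient p \<mu> u g \<and>
       (AE x in completion \<mu>.
          g x \<le> ennreal (K * sqrt (ip x (D u x) (D u x))) \<and>
          ennreal (sqrt (ip x (D u x) (D u x))) \<le> ennreal K * g x)))"

definition cheeger_energy ::
  "real \<Rightarrow> 'a measure \<Rightarrow> ('a \<Rightarrow> real ^ 'n \<Rightarrow> real ^ 'n \<Rightarrow> real) \<Rightarrow>
   (('a \<Rightarrow> real) \<Rightarrow> 'a \<Rightarrow> real ^ 'n::finite) \<Rightarrow> ('a \<Rightarrow> real) \<Rightarrow> real" where
  "cheeger_energy p \<mu> ip D u = (LINT x|completion \<mu>. sqrt (ip x (D u x) (D u x)) powr p)"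

text \<open>Energy of a class: the common value on its representatives.\<close>

definition HN_energy ::
  "real \<Rightarrow> 'a measure \<Rightarrow> ('a \<Rightarrow> real ^ 'n \<Rightarrow> real ^ 'n \<Rightarrow> real) \<Rightarrow>
   (('a \<Rightarrow> real) \<Rightarrow> 'a \<Rightarrow> real ^ 'n::finite) \<Rightarrow> ('a \<Rightarrow> real) set \<Rightarrow> real" where
  "HN_energy p \<mu> ip D u = the_elem (cheeger_energy p \<mu> ip D ` u)"

subsection \<open>Besov spaces on the boundary\<close>

text \<open>On the diagonal the integrand is \<open>0 / 0\<close>, which is \<open>0\<close> here.\<close>

definition besov_norm :: "real \<Rightarrow> real \<Rightarrow> 'a::metric_space measure \<Rightarrow> ('a \<Rightarrow> real) \<Rightarrow> ennreal" where
  "besov_norm \<theta> p \<nu> f = epowr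
    (\<integral>\<^sup>+ y. (\<integral>\<^sup>+ x. ennreal (\<bar>f y - f x\<bar> powr p) /
       (ennreal (dist y x powr (\<theta> * p)) * emeasure \<nu> (ball y (dist y x) \<inter> space \<nu>))
       \<partial>(completion \<nu>)) \<partial>(completion \<nu>)) (1 / p)"

definition besov :: "real \<Rightarrow> real \<Rightarrow> 'a::metric_space measure \<Rightarrow> ('a \<Rightarrow> real) set" where
  "besov \<theta> p \<nu> = {f. f \<in> borel_measurable (completion \<nu>) \<and> besov_norm \<theta> p \<nu> f < \<infinity>}"

definition HB_rel :: "real \<Rightarrow> real \<Rightarrow> 'a::metric_space measure \<Rightarrow> (('a \<Rightarrow> real) \<times> ('a \<Rightarrow> real)) set" where
  "HB_rel \<theta> p \<nu> = {(f, g). f \<in> besov \<theta> p \<nu> \<and> g \<in> besov \<theta> p \<nu> \<and>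
                            (\<exists>c. AE x in completion \<nu>. f x - g x = c)}"

abbreviation HB_class :: "real \<Rightarrow> real \<Rightarrow> 'a::metric_space measure \<Rightarrow> ('a \<Rightarrow> real) \<Rightarrow> ('a \<Rightarrow> real) set" where
  "HB_class \<theta> p \<nu> f \<equiv> HB_rel \<theta> p \<nu> `` {f}"

text \<open>
  Functionals on the quotient \<open>besov \<theta> p \<nu> // HB_rel \<theta> p \<nu>\<close>; only their values on that set matter.
\<close>

definition HB_dual :: "real \<Rightarrow> real \<Rightarrow> 'a::metric_space measure \<Rightarrow> (('a \<Rightarrow> real) set \<Rightarrow> real) set" where
  "HB_dual \<theta> p \<nu> = {L.
    (\<forall>f\<in>besov \<theta> p \<nu>. \<forall>g\<in>besov \<theta> p \<nu>. \<forall>a b.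
       L (HB_class \<theta> p \<nu> (\<lambda>x. a * f x + b * g x))
         = a * L (HB_class \<theta> p \<nu> f) + b * L (HB_class \<theta> p \<nu> g)) \<and>
    (\<exists>C::real. \<forall>f\<in>besov \<theta> p \<nu>. ennreal \<bar>L (HB_class \<theta> p \<nu> f)\<bar> \<le> ennreal C * besov_norm \<theta> p \<nu> f)}"

subsection \<open>Trace\<close>

definition has_trace_value :: "'a::metric_space measure \<Rightarrow> ('a \<Rightarrow> real) \<Rightarrow> 'a \<Rightarrow> real \<Rightarrow> bool" where
  "has_trace_value \<mu> u \<xi> a \<longleftrightarrow>
    ((\<lambda>r. emean \<mu> (ball \<xi> r \<inter> space \<mu>) (\<lambda>x. ennreal \<bar>u x - a\<bar>)) \<longlongrightarrow> 0) (at_right 0)"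

text \<open>
  The trace value is unique if it exists, and it exists at \<open>\<nu>\<close>-almost every boundary point by
  the trace theorem; elsewhere the trace is set to \<open>0\<close>.
\<close>

definition trace :: "'a::metric_space measure \<Rightarrow> ('a \<Rightarrow> real) \<Rightarrow> 'a \<Rightarrow> real" where
  "trace \<mu> u \<xi> = (if \<exists>a. has_trace_value \<mu> u \<xi> a then THE a. has_trace_value \<mu> u \<xi> a else 0)"

text \<open>The map induced on classes, with values in \<open>besov \<theta> p \<nu> // HB_rel \<theta> p \<nu>\<close>.\<close>

definition HN_trace ::
  "real \<Rightarrow> real \<Rightarrow> 'a::metric_space measure \<Rightarrow> 'a measure \<Rightarrow> ('a \<Rightarrow> real) set \<Rightarrow> ('a \<Rightarrow> real) set" where
  "HN_trace \<theta> p \<mu> \<nu> u = (\<Union>w\<in>u. HB_class \<theta> p \<nu> (trace \<mu> w))"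

end

theory Submission
  imports Defs
begin

text \<open>
  The functional \<open>J v = E v / p - L (Tr v)\<close> is minimized by the direct method. Uniform convexity of
  \<open>t \<mapsto> t\<^sup>p\<close>, with a modulus independent of the inner product, makes the gradients of a minimizing
  sequence Cauchy; by the Poincare inequality the sequence, corrected by constants, converges in the
  Sobolev space, and \<open>J\<close> passes to the limit.

  Coercivity and continuity of \<open>J\<close> rest on a trace estimate. Telescoping the
  Poincare inequality over balls shrinking to a boundary point shows that averages converge
  \<open>\<nu>\<close>-almost everywhere, since \<open>\<Theta> < p\<close>. For the Besov bound, balls centred at the boundary would lose a
  logarithm; instead, averages at consecutive scales are compared along chains of balls inside Whitney
  layers, which the curves of a uniform domain provide, and which overlap boundedly.
\<close>

subsection \<open>Arc length\<close>

text \<open>Two obstacles shape the proof. The trace is defined point by point with default value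
  \<open>0\<close>, so \<open>L\<close> of a trace has a meaning only once the trace is known to
  exist \<nu>-almost everywhere and to lie in the Besov space; both facts are derived here.
  Moreover, Sobolev functions are measurable only for \<open>completion \<mu>\<close>. They are
  replaced by Borel functions equal to them almost everywhere before averages are formed, which
  changes neither averages nor traces.

  The pointwise estimates are made for an abstract measure \<open>m\<close> that is
  \<Theta>-codimensional to \<mu>, with \<Theta> = 0 allowed. For \<open>m\<close> = \<nu> they
  yield the trace. For \<open>m\<close> = \<mu> and \<Theta> = 0 they yield Lebesgue differentiation
  and a global Poincare inequality for p-th powers, which supplies the constants that correct a
  minimizing sequence.

  Sums over dyadic scales carry the weight 2^(\<open>decay\<close> k), where \<open>decay\<close> is
  half of the gap p - \<Theta>: one half of the gap pays for moving the power p inside the sum, the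
  other half keeps the integrated series geometric.\<close>

lemma curve_length_upper:
  assumes "mono_on {..n} t" "t ` {..n} \<subseteq> {a..b}"
  shows "(\<Sum>i<n. ennreal (dist (\<gamma> (t i)) (\<gamma> (t (Suc i))))) \<le> curve_length \<gamma> a b"
  unfolding curve_length_def using assms by (intro SUP_upper2[of "(n, t)"]) auto

lemma curve_length_least:
  assumes "\<And>n t. mono_on {..n} t \<Longrightarrow> t ` {..n} \<subseteq> {a..b} \<Longrightarrow>
    (\<Sum>i<n. ennreal (dist (\<gamma> (t i)) (\<gamma> (t (Suc i))))) \<le> c"
  shows "curve_length \<gamma> a b \<le> c"
  unfolding curve_length_def using assms by (intro SUP_least) auto

lemma dist_le_curve_length:
  assumes "a \<le> b"
  shows "ennreal (dist (\<gamma> a) (\<gamma> b)) \<le> curve_length \<gamma> a b"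
proof -
  have "mono_on {..1} (\<lambda>i::nat. if i = 0 then a else b)" "(\<lambda>i::nat. if i = 0 then a else b) ` {..1} \<subseteq> {a..b}"
    using assms by (auto simp: monotone_on_def image_subset_iff)
  from curve_length_upper[OF this, of \<gamma>] show ?thesis by simp
qed

text \<open>The partitions are listed one after the other, the second from index
  \<open>Suc n\<close> on. The jump from \<open>t n\<close> to \<open>t' 0\<close>, at index
  \<open>n\<close>, is the one distance that the two sums do not contain; it only enlarges the
  length.\<close>

lemma curve_length_concat:
  assumes ab: "a \<le> b" and bc: "b \<le> c"
    and t: "mono_on {..n} t" "t ` {..n} \<subseteq> {a..b}"
    and t': "mono_on {..m} t'" "t' ` {..m} \<subseteq> {b..c}"
  shows "(\<Sum>i<n. ennreal (dist (\<gamma> (t i)) (\<gamma> (t (Suc i)))))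
         + (\<Sum>i<m. ennreal (dist (\<gamma> (t' i)) (\<gamma> (t' (Suc i))))) \<le> curve_length \<gamma> a c"
proof -
  define T where "T i = (if i \<le> n then t i else t' (i - Suc n))" for i
  have tr: "t i \<in> {a..b}" if "i \<le> n" for i using t(2) that by auto
  have tr': "t' i \<in> {b..c}" if "i \<le> m" for i using t'(2) that by auto
  have "T i \<le> T j" if "i \<le> j" "j \<le> n + Suc m" for i j
  proof -
    consider "j \<le> n" | "i \<le> n" "n < j" | "n < i" using that by linarith
    then show ?thesis
    proof cases
      case 1 then show ?thesis using t(1) that by (auto simp: T_def monotone_on_def)
    next
      case 2
      then show ?thesis using tr[of i] tr'[of "j - Suc n"] that by (fastforce simp: T_def)
    next
      case 3
      then have "i - Suc n \<le> j - Suc n" "j - Suc n \<le> m" using that by auto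
      then show ?thesis using t'(1) 3 that by (auto simp: T_def monotone_on_def)
    qed
  qed
  then have m: "mono_on {..n + Suc m} T" by (auto simp: monotone_on_def)
  have r: "T ` {..n + Suc m} \<subseteq> {a..c}"
  proof (rule image_subsetI)
    fix i assume "i \<in> {..n + Suc m}"
    then show "T i \<in> {a..c}" using tr[of i] tr'[of "i - Suc n"] ab bc by (fastforce simp: T_def)
  qed
  define D where "D i = ennreal (dist (\<gamma> (T i)) (\<gamma> (T (Suc i))))" for i
  have "(\<Sum>i<n. ennreal (dist (\<gamma> (t i)) (\<gamma> (t (Suc i))))) = sum D {..<n}"
    by (intro sum.cong) (auto simp: T_def D_def)
  moreover have "(\<Sum>i<m. ennreal (dist (\<gamma> (t' i)) (\<gamma> (t' (Suc i))))) = sum (\<lambda>i. D (Suc n + i)) {..<m}"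
    by (intro sum.cong) (auto simp: T_def D_def)
  moreover have "sum (\<lambda>i. D (Suc n + i)) {..<m} = sum D {Suc n..<Suc n + m}"
    using sum.shift_bounds_nat_ivl[of D 0 "Suc n" m] by (simp add: atLeast0LessThan add.commute)
  moreover have "sum D {..<n} + sum D {Suc n..<Suc n + m} = sum D ({..<n} \<union> {Suc n..<Suc n + m})"
    by (intro sum.union_disjoint[symmetric]) auto
  moreover have "\<dots> \<le> sum D {..<n + Suc m}" by (intro sum_mono2) auto
  moreover have "sum D {..<n + Suc m} \<le> curve_length \<gamma> a c"
    unfolding D_def by (rule curve_length_upper[OF m r])
  ultimately show ?thesis by simp
qed

text \<open>Points beyond \<open>b\<close> collapse to \<open>b\<close> and then contribute distance
  zero, so a partition can be cut at \<open>b\<close> without locating \<open>b\<close> among its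
  points.\<close>

lemma clamp_partition:
  fixes t :: "nat \<Rightarrow> real"
  assumes t: "mono_on {..n} t" "t ` {..n} \<subseteq> {a..c}" and "a \<le> b" "b \<le> c"
  shows "mono_on {..n} (\<lambda>i. min (t i) b)" "(\<lambda>i. min (t i) b) ` {..n} \<subseteq> {a..b}"
    "mono_on {..n} (\<lambda>i. max (t i) b)" "(\<lambda>i. max (t i) b) ` {..n} \<subseteq> {b..c}"
proof -
  show "mono_on {..n} (\<lambda>i. min (t i) b)" "mono_on {..n} (\<lambda>i. max (t i) b)"
    using t(1) unfolding monotone_on_def by (meson max.mono min.mono order_refl)+
  show "(\<lambda>i. min (t i) b) ` {..n} \<subseteq> {a..b}" "(\<lambda>i. max (t i) b) ` {..n} \<subseteq> {b..c}"
    using assms by auto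
qed

lemma curve_length_add:
  assumes ab: "a \<le> b" and bc: "b \<le> c"
  shows "curve_length \<gamma> a c = curve_length \<gamma> a b + curve_length \<gamma> b c"
proof (rule antisym)
  show "curve_length \<gamma> a c \<le> curve_length \<gamma> a b + curve_length \<gamma> b c"
  proof (rule curve_length_least)
    fix n :: nat and t :: "nat \<Rightarrow> real" assume t: "mono_on {..n} t" "t ` {..n} \<subseteq> {a..c}"
    note cl = clamp_partition[OF t ab bc]
    \<comment> \<open>Only a step across \<open>b\<close> needs the triangle inequality; for every
      other step one of the two summands vanishes.\<close>
    have "(\<Sum>i<n. ennreal (dist (\<gamma> (t i)) (\<gamma> (t (Suc i)))))
        \<le> (\<Sum>i<n. ennreal (dist (\<gamma> (min (t i) b)) (\<gamma> (min (t (Suc i)) b)))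
               + ennreal (dist (\<gamma> (max (t i) b)) (\<gamma> (max (t (Suc i)) b))))"
    proof (rule sum_mono)
      fix i assume "i \<in> {..<n}"
      then have "t i \<le> t (Suc i)" using t(1) by (auto simp: monotone_on_def)
      then show "ennreal (dist (\<gamma> (t i)) (\<gamma> (t (Suc i))))
        \<le> ennreal (dist (\<gamma> (min (t i) b)) (\<gamma> (min (t (Suc i)) b)))
               + ennreal (dist (\<gamma> (max (t i) b)) (\<gamma> (max (t (Suc i)) b)))"
        by (auto simp: min_def max_def ennreal_plus[symmetric] dist_triangle simp del: ennreal_plus
            intro!: ennreal_leI)
    qed
    also have "\<dots> \<le> curve_length \<gamma> a b + curve_length \<gamma> b c"
      unfolding sum.distrib by (intro add_mono curve_length_upper cl)
    finally show "(\<Sum>i<n. ennreal (dist (\<gamma> (t i)) (\<gamma> (t (Suc i))))) \<le> curve_length \<gamma> a b + curve_length \<gamma> b c" .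
  qed
next
  let ?P = "\<lambda>a b. {(n::nat, t::nat \<Rightarrow> real). mono_on {..n} t \<and> t ` {..n} \<subseteq> {a..b}}"
  let ?S = "\<lambda>(n::nat, t::nat \<Rightarrow> real). \<Sum>i<n. ennreal (dist (\<gamma> (t i)) (\<gamma> (t (Suc i))))"
  have ne: "?P a b \<noteq> {}" "?P b c \<noteq> {}"
    using ab bc by (auto simp: monotone_on_def intro!: exI[of _ "\<lambda>_. b"])
  have "?S x + curve_length \<gamma> b c \<le> curve_length \<gamma> a c" if x: "x \<in> ?P a b" for x
  proof -
    have "?S x + ?S y \<le> curve_length \<gamma> a c" if "y \<in> ?P b c" for y
      using curve_length_concat[OF ab bc, of "fst x" "snd x" "fst y" "snd y" \<gamma>] x that
      by (auto simp: case_prod_beta)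
    then show ?thesis
      unfolding curve_length_def[of \<gamma> b c] ennreal_SUP_add_right[OF ne(2)] by (intro SUP_least)
  qed
  then show "curve_length \<gamma> a b + curve_length \<gamma> b c \<le> curve_length \<gamma> a c"
    unfolding curve_length_def[of \<gamma> a b] ennreal_SUP_add_left[OF ne(1), symmetric] by (intro SUP_least)
qed

lemma curve_length_refl [simp]: "curve_length \<gamma> a a = 0"
proof -
  have "curve_length \<gamma> a a \<le> 0"
  proof (rule curve_length_least)
    fix n :: nat and t :: "nat \<Rightarrow> real" assume "mono_on {..n} t" "t ` {..n} \<subseteq> {a..a}"
    then have "t i = a" if "i \<le> n" for i using that by force
    then show "(\<Sum>i<n. ennreal (dist (\<gamma> (t i)) (\<gamma> (t (Suc i))))) \<le> 0"
      by (intro sum_nonpos) auto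
  qed
  then show ?thesis by simp
qed

lemma tendsto_ennreal_dist_clamp:
  fixes \<gamma> :: "real \<Rightarrow> 'a::metric_space"
  assumes "path \<gamma>" "continuous_on {0..1} f" "continuous_on {0..1} h"
    "f ` {0..1} \<subseteq> {0..1}" "h ` {0..1} \<subseteq> {0..1}" "t0 \<in> {0..1}"
  shows "((\<lambda>s. ennreal (dist (\<gamma> (f s)) (\<gamma> (h s)))) \<longlongrightarrow> ennreal (dist (\<gamma> (f t0)) (\<gamma> (h t0)))) (at t0 within {0..1})"
proof -
  have "continuous_on {0..1} (\<gamma> \<circ> f)" "continuous_on {0..1} (\<gamma> \<circ> h)"
    using assms continuous_on_subset by (intro continuous_on_compose; force simp: path_def)+
  then have "continuous_on {0..1} (\<lambda>s. dist (\<gamma> (f s)) (\<gamma> (h s)))"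
    by (auto intro!: continuous_on_dist simp: o_def)
  then show ?thesis using assms(6) by (auto simp: continuous_on_def intro!: tendsto_ennrealI)
qed

text \<open>Clamping a fixed partition to \<open>[0, s]\<close> gives a lower bound that
  depends continuously on \<open>s\<close>.\<close>

lemma curve_length_lsc_left:
  assumes "path \<gamma>" "t0 \<in> {0..1}" "c < curve_length \<gamma> 0 t0"
  shows "\<forall>\<^sub>F s in at t0 within {0..1}. c < curve_length \<gamma> 0 s"
proof -
  obtain n t where t: "mono_on {..n} t" "t ` {..n} \<subseteq> {0..t0}"
    and c: "c < (\<Sum>i<n. ennreal (dist (\<gamma> (t i)) (\<gamma> (t (Suc i)))))"
    using assms(3) unfolding curve_length_def less_SUP_iff by auto
  define \<Phi> where "\<Phi> s = (\<Sum>i<n. ennreal (dist (\<gamma> (min (t i) s)) (\<gamma> (min (t (Suc i)) s))))" for s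
  have r: "t i \<in> {0..t0}" if "i \<le> n" for i using t(2) that by auto
  have "(\<Phi> \<longlongrightarrow> \<Phi> t0) (at t0 within {0..1})"
    unfolding \<Phi>_def
  proof (intro tendsto_sum tendsto_ennreal_dist_clamp assms continuous_intros)
    fix i assume "i \<in> {..<n}"
    then show "(\<lambda>s. min (t i) s) ` {0..1} \<subseteq> {0..1}" "(\<lambda>s. min (t (Suc i)) s) ` {0..1} \<subseteq> {0..1}"
      using r[of i] r[of "Suc i"] assms(2) by auto
  qed
  moreover have "\<Phi> t0 = (\<Sum>i<n. ennreal (dist (\<gamma> (t i)) (\<gamma> (t (Suc i)))))"
    unfolding \<Phi>_def using r by (intro sum.cong) (auto simp: min_def)
  ultimately have "\<forall>\<^sub>F s in at t0 within {0..1}. c < \<Phi> s" using c order_tendstoD(1) by metis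
  moreover have "\<Phi> s \<le> curve_length \<gamma> 0 s" if "s \<in> {0..1}" for s
  proof -
    have "t ` {..n} \<subseteq> {0..1}" using t(2) assms(2) by fastforce
    from clamp_partition(1,2)[OF t(1) this, of s] that show ?thesis
      unfolding \<Phi>_def by (intro curve_length_upper) auto
  qed
  ultimately show ?thesis
    unfolding eventually_at_filter by (auto elim!: eventually_mono intro: less_le_trans)
qed

lemma curve_length_lsc_right:
  assumes "path \<gamma>" "t0 \<in> {0..1}" "c < curve_length \<gamma> t0 1"
  shows "\<forall>\<^sub>F s in at t0 within {0..1}. c < curve_length \<gamma> s 1"
proof -
  obtain n t where t: "mono_on {..n} t" "t ` {..n} \<subseteq> {t0..1}"
    and c: "c < (\<Sum>i<n. ennreal (dist (\<gamma> (t i)) (\<gamma> (t (Suc i)))))"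
    using assms(3) unfolding curve_length_def less_SUP_iff by auto
  define \<Phi> where "\<Phi> s = (\<Sum>i<n. ennreal (dist (\<gamma> (max (t i) s)) (\<gamma> (max (t (Suc i)) s))))" for s
  have r: "t i \<in> {t0..1}" if "i \<le> n" for i using t(2) that by auto
  have "(\<Phi> \<longlongrightarrow> \<Phi> t0) (at t0 within {0..1})"
    unfolding \<Phi>_def
  proof (intro tendsto_sum tendsto_ennreal_dist_clamp assms continuous_intros)
    fix i assume "i \<in> {..<n}"
    then show "(\<lambda>s. max (t i) s) ` {0..1} \<subseteq> {0..1}" "(\<lambda>s. max (t (Suc i)) s) ` {0..1} \<subseteq> {0..1}"
      using r[of i] r[of "Suc i"] assms(2) by auto
  qed
  moreover have "\<Phi> t0 = (\<Sum>i<n. ennreal (dist (\<gamma> (t i)) (\<gamma> (t (Suc i)))))"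
    unfolding \<Phi>_def using r by (intro sum.cong) (auto simp: max_absorb1)
  ultimately have "\<forall>\<^sub>F s in at t0 within {0..1}. c < \<Phi> s" using c order_tendstoD(1) by metis
  moreover have "\<Phi> s \<le> curve_length \<gamma> s 1" if "s \<in> {0..1}" for s
  proof -
    have "t ` {..n} \<subseteq> {0..1}" using t(2) assms(2) by fastforce
    from clamp_partition(3,4)[OF t(1) this, of s] that show ?thesis
      unfolding \<Phi>_def by (intro curve_length_upper) auto
  qed
  ultimately show ?thesis
    unfolding eventually_at_filter by (auto elim!: eventually_mono intro: less_le_trans)
qed

text \<open>The lengths of the pieces before and after \<open>t\<close> are both lower
  semicontinuous in \<open>t\<close>, and their sum is the finite total length. Hence both are
  continuous, and the intermediate value theorem applies.\<close>

lemma arc_length_surj: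
  assumes p: "path \<gamma>" and fin: "curve_length \<gamma> 0 1 < \<infinity>" and s: "s \<in> {0..enn2real (curve_length \<gamma> 0 1)}"
  shows "\<exists>t\<in>{0..1}. curve_length \<gamma> 0 t = ennreal s"
proof -
  define l where "l t = enn2real (curve_length \<gamma> 0 t)" for t
  define l' where "l' t = enn2real (curve_length \<gamma> t 1)" for t
  have f: "curve_length \<gamma> 0 t < \<infinity>" "curve_length \<gamma> t 1 < \<infinity>" if "t \<in> {0..1}" for t
    using curve_length_add[of 0 t 1 \<gamma>] fin that by (auto simp: ennreal_add_eq_top less_top)
  have e: "curve_length \<gamma> 0 t = ennreal (l t)" "curve_length \<gamma> t 1 = ennreal (l' t)" if "t \<in> {0..1}" for t
    using f[OF that] by (auto simp: l_def l'_def)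
  have nn: "l t \<ge> 0" "l' t \<ge> 0" for t by (auto simp: l_def l'_def)
  have s1: "l t + l' t = l 1" if "t \<in> {0..1}" for t
    using curve_length_add[of 0 t 1 \<gamma>] that e[OF that] e[of 1] nn[of t] nn[of 1]
    by (auto simp: ennreal_plus[symmetric] simp del: ennreal_plus)
  have "(l \<longlongrightarrow> l t0) (at t0 within {0..1})" if t0: "t0 \<in> {0..1}" for t0
  proof (rule order_tendstoI)
    fix a assume "a < l t0"
    show "\<forall>\<^sub>F s in at t0 within {0..1}. a < l s"
    proof (cases "a < 0")
      case False
      then have "ennreal a < curve_length \<gamma> 0 t0" using \<open>a < l t0\<close> e[OF t0] by (auto simp: ennreal_less_iff)
      from curve_length_lsc_left[OF p t0 this] show ?thesis
        unfolding eventually_at_filter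
        by eventually_elim (use e False in \<open>auto simp: ennreal_less_iff\<close>)
    next
      case True
      then show ?thesis using less_le_trans[OF True nn(1)] by (intro always_eventually) simp
    qed
  next
    fix a assume a: "l t0 < a"
    show "\<forall>\<^sub>F s in at t0 within {0..1}. l s < a"
    proof (cases "l 1 < a")
      case False
      then have "ennreal (l 1 - a) < curve_length \<gamma> t0 1" using a e[OF t0] s1[OF t0]
        by (auto simp: ennreal_less_iff)
      from curve_length_lsc_right[OF p t0 this] show ?thesis
        unfolding eventually_at_filter
        by eventually_elim (use e False s1 in \<open>fastforce simp: ennreal_less_iff\<close>)
    next
      case True
      have "l s < a" if "s \<in> {0..1}" for s using s1[OF that] nn(2)[of s] True by linarith
      then show ?thesis unfolding eventually_at_filter by (intro always_eventually) simp
    qed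
  qed
  then have "continuous_on {0..1} l" by (auto simp: continuous_on_def)
  moreover have "l 0 = 0" by (simp add: l_def)
  ultimately obtain t where "t \<in> {0..1}" "l t = s"
    using IVT'[of l 0 s 1] s by (auto simp: l_def)
  then show ?thesis using e by auto
qed

section \<open>The arc-length parametrization and integrals along curves\<close>

lemma arc_param_eq:
  assumes "path \<gamma>" "curve_length \<gamma> 0 1 < \<infinity>" "s \<in> {0..enn2real (curve_length \<gamma> 0 1)}"
  obtains t where "t \<in> {0..1}" "curve_length \<gamma> 0 t = ennreal s" "arc_param \<gamma> s = \<gamma> t"
  using someI_ex[of "\<lambda>t. t \<in> {0..1} \<and> curve_length \<gamma> 0 t = ennreal s"] arc_length_surj[OF assms] that
  unfolding arc_param_def by blast

text \<open>The order of \<open>t\<close> and \<open>t'\<close> is left open. If \<open>t'\<close>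
  comes first, both lengths agree and the piece between them has length zero. In particular
  parameters at the same arc length give the same point, so the choice made in
  \<open>arc_param\<close> does not matter.\<close>

lemma dist_le_length_diff:
  assumes "t \<in> {0..1}" "t' \<in> {0..1}" "curve_length \<gamma> 0 t = ennreal s" "curve_length \<gamma> 0 t' = ennreal s'"
    "0 \<le> s" "s \<le> s'"
  shows "dist (\<gamma> t) (\<gamma> t') \<le> s' - s"
proof (cases "t \<le> t'")
  case True
  have "curve_length \<gamma> 0 t' = curve_length \<gamma> 0 t + curve_length \<gamma> t t'"
    using curve_length_add[of 0 t t' \<gamma>] True assms(1,2) by auto
  with dist_le_curve_length[OF True, of \<gamma>] assms
  have "ennreal s + ennreal (dist (\<gamma> t) (\<gamma> t')) \<le> ennreal s'" by (metis add_left_mono)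
  then show ?thesis using assms by (simp add: ennreal_plus[symmetric] del: ennreal_plus)
next
  case False
  have *: "curve_length \<gamma> 0 t = curve_length \<gamma> 0 t' + curve_length \<gamma> t' t"
    using curve_length_add[of 0 t' t \<gamma>] False assms by auto
  then have "s' \<le> s" using assms by (metis ennreal_le_iff le_iff_add)
  then have "s = s'" using assms by simp
  have "ennreal s + curve_length \<gamma> t' t = ennreal s + 0" using * assms \<open>s = s'\<close> by simp
  then have "curve_length \<gamma> t' t = 0"
    using ennreal_add_left_cancel[of "ennreal s"] by simp
  with dist_le_curve_length[of t' t \<gamma>] False \<open>s = s'\<close> show ?thesis by (auto simp: dist_commute)
qed

lemma arc_param_lipschitz:
  assumes p: "path \<gamma>" "curve_length \<gamma> 0 1 < \<infinity>" and s: "0 \<le> s" "s \<le> s'" "s' \<le> enn2real (curve_length \<gamma> 0 1)"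
  shows "dist (arc_param \<gamma> s) (arc_param \<gamma> s') \<le> s' - s"
proof -
  obtain t where "t \<in> {0..1}" "curve_length \<gamma> 0 t = ennreal s" "arc_param \<gamma> s = \<gamma> t"
    using arc_param_eq[OF p, of s] s by auto
  moreover obtain t' where "t' \<in> {0..1}" "curve_length \<gamma> 0 t' = ennreal s'" "arc_param \<gamma> s' = \<gamma> t'"
    using arc_param_eq[OF p, of s'] s by auto
  ultimately show ?thesis using dist_le_length_diff[of t t' \<gamma> s s'] s by auto
qed

lemma arc_param_ends:
  assumes p: "path \<gamma>" "curve_length \<gamma> 0 1 < \<infinity>"
  shows "arc_param \<gamma> 0 = \<gamma> 0" "arc_param \<gamma> (enn2real (curve_length \<gamma> 0 1)) = \<gamma> 1"
proof -
  obtain t where t: "t \<in> {0..1}" "curve_length \<gamma> 0 t = ennreal 0" "arc_param \<gamma> 0 = \<gamma> t"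
    using arc_param_eq[OF p, of 0] by auto
  show "arc_param \<gamma> 0 = \<gamma> 0"
    using dist_le_length_diff[of 0 t \<gamma> 0 0] t by simp
  obtain t where t: "t \<in> {0..1}" "curve_length \<gamma> 0 t = ennreal (enn2real (curve_length \<gamma> 0 1))"
      "arc_param \<gamma> (enn2real (curve_length \<gamma> 0 1)) = \<gamma> t"
    using arc_param_eq[OF p, of "enn2real (curve_length \<gamma> 0 1)"] by auto
  show "arc_param \<gamma> (enn2real (curve_length \<gamma> 0 1)) = \<gamma> 1"
    using dist_le_length_diff[OF t(1) _ t(2), of 1 "enn2real (curve_length \<gamma> 0 1)"] p t by simp
qed

text \<open>\<open>arc_param\<close> is 1-Lipschitz on the interval of arc lengths, hence continuous
  there. Outside of it the value is an arbitrary choice, which is why the indicator belongs to the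
  function.\<close>

lemma arc_param_measurable:
  assumes "\<gamma> \<in> rect_curves (space \<mu>)" "sets \<mu> = sets (restrict_space borel (space \<mu>))"
    and g: "(g :: _ \<Rightarrow> ennreal) \<in> borel_measurable \<mu>"
  shows "(\<lambda>s. g (arc_param \<gamma> s) * indicator {0..enn2real (curve_length \<gamma> 0 1)} s) \<in> borel_measurable lborel"
proof -
  let ?J = "{0..enn2real (curve_length \<gamma> 0 1)}"
  have p: "path \<gamma>" "curve_length \<gamma> 0 1 < \<infinity>" "path_image \<gamma> \<subseteq> space \<mu>"
    using assms(1) by (auto simp: rect_curves_def)
  have "continuous_on ?J (arc_param \<gamma>)"
    unfolding continuous_on_iff
  proof (intro ballI allI impI)
    fix x e :: real assume x: "x \<in> ?J" and "0 < e"
    have "dist (arc_param \<gamma> y) (arc_param \<gamma> x) \<le> dist y x" if "y \<in> ?J" for y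
      using arc_param_lipschitz[OF p(1,2), of x y] arc_param_lipschitz[OF p(1,2), of y x] x that
      by (cases "x \<le> y") (auto simp: dist_commute dist_real_def)
    then show "\<exists>d>0. \<forall>x'\<in>?J. dist x' x < d \<longrightarrow> dist (arc_param \<gamma> x') (arc_param \<gamma> x) < e"
      using \<open>0 < e\<close> by (intro exI[of _ e]) (meson le_less_trans)
  qed
  then have "arc_param \<gamma> \<in> measurable (restrict_space borel ?J) borel"
    by (rule borel_measurable_continuous_on_restrict)
  moreover have "arc_param \<gamma> s \<in> space \<mu>" if "s \<in> ?J" for s
    using arc_param_eq[OF p(1,2) that] p(3) unfolding path_image_def by (metis image_subset_iff)
  ultimately have "arc_param \<gamma> \<in> measurable (restrict_space borel ?J) (restrict_space borel (space \<mu>))"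
    by (intro measurable_restrict_space2) (auto simp: space_restrict_space)
  moreover have "g \<in> borel_measurable (restrict_space borel (space \<mu>))"
    using g measurable_cong_sets[OF assms(2) refl] by blast
  ultimately have "(\<lambda>s. g (arc_param \<gamma> s)) \<in> borel_measurable (restrict_space borel ?J)"
    using measurable_comp[of "arc_param \<gamma>"] by (auto simp: o_def)
  then have "(\<lambda>s. g (arc_param \<gamma> s) * indicator ?J s) \<in> borel_measurable borel"
    using borel_measurable_restrict_space_iff_ennreal[of ?J borel "\<lambda>s. g (arc_param \<gamma> s)"] by simp
  then show ?thesis by (simp add: measurable_lborel1)
qed

context
  fixes \<mu> :: "'a::metric_space measure" and \<gamma>
  assumes \<gamma>: "\<gamma> \<in> rect_curves (space \<mu>)" and sets: "sets \<mu> = sets (restrict_space borel (space \<mu>))"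
begin

lemma curve_integral_add:
  assumes "g \<in> borel_measurable \<mu>" "h \<in> borel_measurable \<mu>"
  shows "curve_integral \<gamma> (\<lambda>x. g x + h x) = curve_integral \<gamma> g + curve_integral \<gamma> h"
  unfolding curve_integral_def
  using arc_param_measurable[OF \<gamma> sets assms(1)] arc_param_measurable[OF \<gamma> sets assms(2)]
  by (subst nn_integral_add[symmetric]) (auto simp: distrib_right)

lemma curve_integral_cmult:
  assumes "g \<in> borel_measurable \<mu>"
  shows "curve_integral \<gamma> (\<lambda>x. c * g x) = c * curve_integral \<gamma> g"
  unfolding curve_integral_def
  using arc_param_measurable[OF \<gamma> sets assms(1)]
  by (subst nn_integral_cmult[symmetric]) (auto simp: mult.assoc)

lemma curve_integral_suminf:
  assumes "\<And>i::nat. g i \<in> borel_measurable \<mu>"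
  shows "curve_integral \<gamma> (\<lambda>x. \<Sum>i. g i x) = (\<Sum>i. curve_integral \<gamma> (g i))"
  unfolding curve_integral_def
  using arc_param_measurable[OF \<gamma> sets assms]
  by (subst nn_integral_suminf[symmetric]) simp_all

end

subsection \<open>Upper gradients\<close>

lemma epowr_0 [simp]: "epowr 0 a = 0"
  by (simp add: epowr_def)

lemma epowr_top [simp]: "epowr top a = top"
  by (simp add: epowr_def)

lemma epowr_ennreal: "0 \<le> x \<Longrightarrow> epowr (ennreal x) a = ennreal (x powr a)"
  by (simp add: epowr_def)

lemma epowr_one [simp]: "epowr x 1 = x"
  by (cases x) (auto simp: epowr_ennreal)

lemma epowr_mono: "0 \<le> a \<Longrightarrow> x \<le> y \<Longrightarrow> epowr x a \<le> epowr y a"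
  by (cases x; cases y) (auto simp: epowr_ennreal ennreal_le_iff top_unique intro: powr_mono2)

lemma epowr_epowr: "epowr (epowr x a) b = epowr x (a * b)"
  by (cases x) (auto simp: epowr_ennreal powr_powr)

lemma epowr_inverse: "a \<noteq> 0 \<Longrightarrow> epowr (epowr x a) (1 / a) = x"
  by (simp add: epowr_epowr)

lemma epowr_mult: "epowr (x * y) a = epowr x a * epowr y a"
proof (cases x)
  case (real r)
  show ?thesis
  proof (cases y)
    case top
    then show ?thesis using real by (cases "r = 0") (auto simp: ennreal_mult_top epowr_ennreal)
  qed (use real in \<open>auto simp: epowr_ennreal ennreal_mult[symmetric] powr_mult\<close>)
next
  case top
  then show ?thesis
    by (cases y) (auto simp: ennreal_top_mult epowr_ennreal)
qed

lemma epowr_eq_0_iff [simp]: "epowr x a = 0 \<longleftrightarrow> x = 0"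
  by (cases x) (auto simp: epowr_ennreal ennreal_eq_0_iff)

lemma epowr_less_top_iff [simp]: "epowr x a < top \<longleftrightarrow> x < top"
  by (cases x) (auto simp: epowr_ennreal)

lemma epowr_add_le:
  assumes "0 \<le> a"
  shows "epowr (x + y) a \<le> ennreal (2 powr a) * (epowr x a + epowr y a)"
proof -
  have "x + y \<le> ennreal 2 * max x y"
    by (simp add: mult_2 add_mono)
  then have "epowr (x + y) a \<le> ennreal (2 powr a) * epowr (max x y) a"
    using epowr_mono[OF assms] by (fastforce simp: epowr_mult epowr_ennreal simp del: ennreal_numeral)
  also have "epowr (max x y) a \<le> epowr x a + epowr y a"
    by (auto simp: max_def)
  finally show ?thesis by (simp add: mult_left_mono)
qed

lemma epowr_measurable [measurable]:
  assumes [measurable]: "f \<in> borel_measurable M"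
  shows "(\<lambda>x. epowr (f x) a) \<in> borel_measurable M"
  unfolding epowr_def by measurable

text \<open>A substitute for Hoelder's and Minkowski's inequality.\<close>

lemma epowr_suminf_le:
  assumes "0 < p" "0 < w"
  shows "epowr (\<Sum>i. a i) p
    \<le> ennreal ((1 / (1 - 2 powr (- w / p))) powr p) * (\<Sum>i. ennreal (2 powr (w * real i)) * epowr (a i) p)"
proof -
  define S where "S = (\<Sum>i. ennreal (2 powr (w * real i)) * epowr (a i) p)"
  define q where "q = 2 powr (- w / p)"
  have q: "0 < q" "q < 1" unfolding q_def using assms by (auto simp: powr_less_one)
  \<comment> \<open>A single term never exceeds the weighted sum \<open>S\<close>; dividing by its
    weight makes \<open>a i\<close> a geometric sequence times a fixed factor.\<close>
  have "a i \<le> ennreal (q ^ i) * epowr S (1 / p)" for i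
  proof -
    have "ennreal (2 powr (w * real i)) * epowr (a i) p \<le> S"
      unfolding S_def using sum_le_suminf[of "\<lambda>i. ennreal (2 powr (w * real i)) * epowr (a i) p" "{i}"] by simp
    then have "epowr (ennreal (2 powr (w * real i)) * epowr (a i) p) (1 / p) \<le> epowr S (1 / p)"
      using assms by (intro epowr_mono) auto
    then have "ennreal (2 powr (w * real i / p)) * a i \<le> epowr S (1 / p)"
      using assms by (simp add: epowr_mult epowr_inverse epowr_ennreal powr_powr)
    then have "ennreal (q ^ i) * (ennreal (2 powr (w * real i / p)) * a i) \<le> ennreal (q ^ i) * epowr S (1 / p)"
      by (intro mult_left_mono) auto
    moreover have "q ^ i * 2 powr (w * real i / p) = 1"
      unfolding q_def by (simp add: powr_realpow[symmetric] powr_powr powr_add[symmetric])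
    ultimately show ?thesis
      by (simp add: mult.assoc[symmetric] ennreal_mult[symmetric] q less_imp_le)
  qed
  then have "(\<Sum>i. a i) \<le> (\<Sum>i. ennreal (q ^ i) * epowr S (1 / p))"
    by (intro suminf_le) auto
  also have "\<dots> = ennreal (1 / (1 - q)) * epowr S (1 / p)"
    using q geometric_sums[of q] by (simp add: suminf_ennreal_eq[of "\<lambda>i. q ^ i"] sums_iff)
  finally have "epowr (\<Sum>i. a i) p \<le> epowr (ennreal (1 / (1 - q)) * epowr S (1 / p)) p"
    using assms by (intro epowr_mono) auto
  also have "\<dots> = ennreal ((1 / (1 - q)) powr p) * S"
    using assms q by (simp add: epowr_mult epowr_epowr epowr_ennreal)
  finally show ?thesis by (simp add: S_def q_def)
qed

text \<open>The p-th power of \<open>Lp_norm\<close>, taken over the measure instead of its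
  completion. Only finiteness and convergence to zero are asked of it, so the factor
  \<open>2 powr p\<close> of \<open>pint_add\<close> can stand in for Minkowski's
  inequality.\<close>

definition pint :: "real \<Rightarrow> 'a measure \<Rightarrow> ('a \<Rightarrow> ennreal) \<Rightarrow> ennreal" where
  "pint p \<mu> g = (\<integral>\<^sup>+ x. epowr (g x) p \<partial>\<mu>)"

lemma Lp_norm_pint: "Lp_norm p \<mu> g = epowr (pint p \<mu> g) (1 / p)"
  by (simp add: Lp_norm_def pint_def nn_integral_completion)

lemma Lp_norm_less_top_iff [simp]: "Lp_norm p \<mu> g < top \<longleftrightarrow> pint p \<mu> g < top"
  by (simp add: Lp_norm_pint)

lemma Lp_norm_eq_0_iff [simp]: "Lp_norm p \<mu> g = 0 \<longleftrightarrow> pint p \<mu> g = 0"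
  by (simp add: Lp_norm_pint)

lemma pint_mono_AE: "0 \<le> p \<Longrightarrow> (AE x in \<mu>. g x \<le> h x) \<Longrightarrow> pint p \<mu> g \<le> pint p \<mu> h"
  unfolding pint_def by (intro nn_integral_mono_AE) (auto elim!: eventually_mono intro: epowr_mono)

lemma pint_cmult:
  assumes "g \<in> borel_measurable \<mu>"
  shows "pint p \<mu> (\<lambda>x. c * g x) = epowr c p * pint p \<mu> g"
  unfolding pint_def epowr_mult using assms by (intro nn_integral_cmult) auto

lemma pint_add:
  assumes "0 \<le> p" and [measurable]: "g \<in> borel_measurable \<mu>" "h \<in> borel_measurable \<mu>"
  shows "pint p \<mu> (\<lambda>x. g x + h x) \<le> ennreal (2 powr p) * (pint p \<mu> g + pint p \<mu> h)"
proof -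
  have "pint p \<mu> (\<lambda>x. g x + h x) \<le> (\<integral>\<^sup>+ x. ennreal (2 powr p) * (epowr (g x) p + epowr (h x) p) \<partial>\<mu>)"
    unfolding pint_def by (intro nn_integral_mono epowr_add_le assms)
  also have "\<dots> = ennreal (2 powr p) * (pint p \<mu> g + pint p \<mu> h)"
    unfolding pint_def by (simp add: nn_integral_cmult nn_integral_add)
  finally show ?thesis .
qed

section \<open>Calculus of upper gradients and of Sobolev functions\<close>

lemma upper_gradient_imp_weak:
  assumes "upper_gradient \<mu> u g"
  shows "weak_upper_gradient p \<mu> u g"
proof -
  have "exceptional p \<mu> {}" unfolding exceptional_def
    by (intro exI[of _ "\<lambda>_. 0"]) (auto simp: pint_def)
  then show ?thesis using assms by (auto simp: upper_gradient_def weak_upper_gradient_def)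
qed

context
  fixes \<mu> :: "'a::metric_space measure" and p :: real
  assumes p: "0 < p" and sets: "sets \<mu> = sets (restrict_space borel (space \<mu>))"
begin

text \<open>Adding a small multiple of the function that certifies the exceptional family turns a weak
  upper gradient into an upper gradient.\<close>

lemma weak_upper_gradient_improve:
  assumes g: "weak_upper_gradient p \<mu> u g" and d: "0 < d"
  obtains g' where "upper_gradient \<mu> u g'" "pint p \<mu> g' \<le> ennreal (2 powr p) * pint p \<mu> g + ennreal d"
proof -
  obtain \<Gamma> \<rho> where gm[measurable]: "g \<in> borel_measurable \<mu>" and \<rho>[measurable]: "\<rho> \<in> borel_measurable \<mu>"
    and fin: "pint p \<mu> \<rho> < top" and inf: "\<And>\<gamma>. \<gamma> \<in> \<Gamma> \<Longrightarrow> curve_integral \<gamma> \<rho> = top"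
    and ug: "\<And>\<gamma>. \<gamma> \<in> rect_curves (space \<mu>) - \<Gamma> \<Longrightarrow> upper_gradient_along u g \<gamma>"
    using g unfolding weak_upper_gradient_def exceptional_def by auto
  obtain R where R: "pint p \<mu> \<rho> = ennreal R" "R \<ge> 0" using fin by (cases "pint p \<mu> \<rho>") auto
  \<comment> \<open>Chosen to make \<open>2 powr p * e powr p * R\<close> at most \<open>d\<close>;
    \<open>R + 1\<close> stands in for \<open>R\<close>, which may be zero.\<close>
  define e where "e = (d / (2 powr p * (R + 1))) powr (1 / p)"
  have e: "e > 0" using d R by (simp add: e_def)
  let ?g = "\<lambda>x. g x + ennreal e * \<rho> x"
  have "upper_gradient \<mu> u ?g"
    unfolding upper_gradient_def
  proof (intro conjI ballI)
    fix \<gamma> assume \<gamma>: "\<gamma> \<in> rect_curves (space \<mu>)"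
    have eq: "curve_integral \<gamma> ?g = curve_integral \<gamma> g + ennreal e * curve_integral \<gamma> \<rho>"
      by (simp add: curve_integral_add[OF \<gamma> sets] curve_integral_cmult[OF \<gamma> sets])
    show "upper_gradient_along u ?g \<gamma>"
    proof (cases "\<gamma> \<in> \<Gamma>")
      case True
      then show ?thesis using inf e unfolding upper_gradient_along_def eq by (simp add: ennreal_mult_top)
    next
      case False
      then have "upper_gradient_along u g \<gamma>" using ug \<gamma> by auto
      then show ?thesis unfolding upper_gradient_along_def eq by (simp add: add_increasing2)
    qed
  qed measurable
  moreover have "pint p \<mu> ?g \<le> ennreal (2 powr p) * pint p \<mu> g + ennreal d"
  proof -
    have "pint p \<mu> ?g \<le> ennreal (2 powr p) * (pint p \<mu> g + epowr (ennreal e) p * pint p \<mu> \<rho>)"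
      using pint_add[of p g \<mu> "\<lambda>x. ennreal e * \<rho> x"] p by (simp add: pint_cmult)
    also have "\<dots> = ennreal (2 powr p) * pint p \<mu> g + ennreal (2 powr p * e powr p * R)"
      using e R by (simp add: epowr_ennreal distrib_left ennreal_mult mult.assoc)
    also have "2 powr p * e powr p * R \<le> d"
    proof -
      have "e powr p = d / (2 powr p * (R + 1))" using d R p by (simp add: e_def powr_powr)
      then have "2 powr p * e powr p * R = d * (R / (R + 1))" using R by simp
      also have "\<dots> \<le> d * 1" using d R by (intro mult_left_mono) auto
      finally show ?thesis by simp
    qed
    finally show ?thesis by (simp add: add_left_mono ennreal_leI)
  qed
  ultimately show ?thesis using that by blast
qed

lemma upper_gradient_lincomb:
  assumes "upper_gradient \<mu> u g" "upper_gradient \<mu> v h"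
  shows "upper_gradient \<mu> (\<lambda>x. a * u x + b * v x) (\<lambda>x. ennreal \<bar>a\<bar> * g x + ennreal \<bar>b\<bar> * h x)"
proof -
  have [measurable]: "g \<in> borel_measurable \<mu>" "h \<in> borel_measurable \<mu>"
    using assms by (auto simp: upper_gradient_def)
  show ?thesis unfolding upper_gradient_def
  proof (intro conjI ballI)
    fix \<gamma> assume \<gamma>: "\<gamma> \<in> rect_curves (space \<mu>)"
    have 1: "ennreal \<bar>u (pathfinish \<gamma>) - u (pathstart \<gamma>)\<bar> \<le> curve_integral \<gamma> g"
      "ennreal \<bar>v (pathfinish \<gamma>) - v (pathstart \<gamma>)\<bar> \<le> curve_integral \<gamma> h"
      using assms \<gamma> by (auto simp: upper_gradient_def upper_gradient_along_def)
    have "\<bar>a * u (pathfinish \<gamma>) + b * v (pathfinish \<gamma>) - (a * u (pathstart \<gamma>) + b * v (pathstart \<gamma>))\<bar>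
      \<le> \<bar>a\<bar> * \<bar>u (pathfinish \<gamma>) - u (pathstart \<gamma>)\<bar> + \<bar>b\<bar> * \<bar>v (pathfinish \<gamma>) - v (pathstart \<gamma>)\<bar>"
      unfolding abs_mult[symmetric]
      by (rule order_trans[OF _ abs_triangle_ineq]) (simp add: algebra_simps)
    then have "ennreal \<bar>a * u (pathfinish \<gamma>) + b * v (pathfinish \<gamma>) - (a * u (pathstart \<gamma>) + b * v (pathstart \<gamma>))\<bar>
      \<le> ennreal \<bar>a\<bar> * ennreal \<bar>u (pathfinish \<gamma>) - u (pathstart \<gamma>)\<bar> + ennreal \<bar>b\<bar> * ennreal \<bar>v (pathfinish \<gamma>) - v (pathstart \<gamma>)\<bar>"
      by (simp add: ennreal_mult[symmetric] ennreal_plus[symmetric] ennreal_leI del: ennreal_plus)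
    also have "\<dots> \<le> ennreal \<bar>a\<bar> * curve_integral \<gamma> g + ennreal \<bar>b\<bar> * curve_integral \<gamma> h"
      by (intro add_mono mult_left_mono 1) auto
    finally show "upper_gradient_along (\<lambda>x. a * u x + b * v x) (\<lambda>x. ennreal \<bar>a\<bar> * g x + ennreal \<bar>b\<bar> * h x) \<gamma>"
      unfolding upper_gradient_along_def
      by (simp add: curve_integral_add[OF \<gamma> sets] curve_integral_cmult[OF \<gamma> sets])
  qed measurable
qed

text \<open>With genuine upper gradients no exceptional families have to be combined when functions
  are added, and the Poincare inequality, which speaks of upper gradients only, becomes
  applicable.\<close>

lemma N1p_iff:
  "u \<in> N1p p \<mu> \<longleftrightarrow> u \<in> borel_measurable (completion \<mu>) \<and> pint p \<mu> (\<lambda>x. ennreal \<bar>u x\<bar>) < top \<and>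
     (\<exists>g. upper_gradient \<mu> u g \<and> pint p \<mu> g < top)"
proof -
  have "\<exists>g. upper_gradient \<mu> u g \<and> pint p \<mu> g < top" if g: "weak_upper_gradient p \<mu> u g" "pint p \<mu> g < top" for g
  proof -
    obtain g' where g': "upper_gradient \<mu> u g'" "pint p \<mu> g' \<le> ennreal (2 powr p) * pint p \<mu> g + ennreal 1"
      using weak_upper_gradient_improve[OF g(1), of 1] by auto
    have "ennreal (2 powr p) * pint p \<mu> g + ennreal 1 < top"
      using g(2) by (simp add: ennreal_mult_less_top)
    with g' show ?thesis by (meson le_less_trans)
  qed
  then show ?thesis unfolding N1p_def using upper_gradient_imp_weak[of \<mu> u _ p] by auto
qed

lemma pint_lincomb:
  assumes [measurable]: "u \<in> borel_measurable (completion \<mu>)" "v \<in> borel_measurable (completion \<mu>)"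
    and "pint p \<mu> (\<lambda>x. ennreal \<bar>u x\<bar>) < top" "pint p \<mu> (\<lambda>x. ennreal \<bar>v x\<bar>) < top"
  shows "pint p \<mu> (\<lambda>x. ennreal \<bar>a * u x + b * v x\<bar>) < top"
proof -
  have c: "pint p (completion \<mu>) g = pint p \<mu> g" for g by (simp add: pint_def nn_integral_completion)
  have cm: "pint p \<mu> (\<lambda>x. a * ennreal \<bar>w x\<bar>) = epowr a p * pint p \<mu> (\<lambda>x. ennreal \<bar>w x\<bar>)"
    if [measurable]: "w \<in> borel_measurable (completion \<mu>)" for a w
    unfolding c[symmetric] by (intro pint_cmult) measurable
  have "pint p (completion \<mu>) (\<lambda>x. ennreal \<bar>a * u x + b * v x\<bar>)
     \<le> pint p (completion \<mu>) (\<lambda>x. ennreal \<bar>a\<bar> * ennreal \<bar>u x\<bar> + ennreal \<bar>b\<bar> * ennreal \<bar>v x\<bar>)"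
    using p by (intro pint_mono_AE AE_I2)
      (auto simp: ennreal_mult[symmetric] ennreal_plus[symmetric] abs_mult[symmetric] simp del: ennreal_plus
         intro!: ennreal_leI abs_triangle_ineq)
  also have "\<dots> \<le> ennreal (2 powr p) * (pint p (completion \<mu>) (\<lambda>x. ennreal \<bar>a\<bar> * ennreal \<bar>u x\<bar>)
      + pint p (completion \<mu>) (\<lambda>x. ennreal \<bar>b\<bar> * ennreal \<bar>v x\<bar>))"
    using p by (intro pint_add) auto
  also have "\<dots> < top"
    using assms(3,4) by (simp add: cm c epowr_ennreal ennreal_mult_less_top)
  finally show ?thesis by (simp add: c)
qed

lemma N1p_lincomb:
  assumes "u \<in> N1p p \<mu>" "v \<in> N1p p \<mu>"
  shows "(\<lambda>x. a * u x + b * v x) \<in> N1p p \<mu>"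
proof -
  obtain g h where g: "upper_gradient \<mu> u g" "pint p \<mu> g < top" and h: "upper_gradient \<mu> v h" "pint p \<mu> h < top"
    using assms unfolding N1p_iff by auto
  have [measurable]: "g \<in> borel_measurable \<mu>" "h \<in> borel_measurable \<mu>"
    using g h by (auto simp: upper_gradient_def)
  have [measurable]: "u \<in> borel_measurable (completion \<mu>)" "v \<in> borel_measurable (completion \<mu>)"
    using assms by (auto simp: N1p_def)
  have "pint p \<mu> (\<lambda>x. ennreal \<bar>a\<bar> * g x + ennreal \<bar>b\<bar> * h x)
     \<le> ennreal (2 powr p) * (pint p \<mu> (\<lambda>x. ennreal \<bar>a\<bar> * g x) + pint p \<mu> (\<lambda>x. ennreal \<bar>b\<bar> * h x))"
    using p by (intro pint_add) auto
  also have "\<dots> < top" using g(2) h(2) by (simp add: pint_cmult epowr_ennreal ennreal_mult_less_top)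
  finally show ?thesis
    unfolding N1p_iff
    using upper_gradient_lincomb[OF g(1) h(1), of a b] pint_lincomb[of u v a b] assms
    by (auto simp: N1p_iff)
qed

lemma upper_gradient_const: "upper_gradient \<mu> (\<lambda>_. c) (\<lambda>_. 0)"
  by (auto simp: upper_gradient_def upper_gradient_along_def)

lemma N1p_const:
  assumes "emeasure \<mu> (space \<mu>) < top"
  shows "(\<lambda>_. c) \<in> N1p p \<mu>"
  unfolding N1p_iff using assms upper_gradient_const[of c]
  by (auto simp: pint_def epowr_ennreal ennreal_mult_less_top intro!: exI[of _ "\<lambda>_. 0"])

lemma minimal_le_upper_gradient:
  assumes "minimal_weak_upper_gradient p \<mu> u g" "weak_upper_gradient p \<mu> u h"
  shows "pint p \<mu> g \<le> pint p \<mu> h"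
proof (cases "pint p \<mu> h < top")
  case True
  then show ?thesis using assms p by (intro pint_mono_AE) (auto simp: minimal_weak_upper_gradient_def)
qed (simp add: less_top[symmetric])

text \<open>Two points are in the same class if the differences of the values at them converge;
  normalising the sequence on each class by its values at a representative gives a limit function on
  all of the space, so no subcurves have to be considered.\<close>

lemma upper_gradient_limit:
  fixes u :: "nat \<Rightarrow> 'a \<Rightarrow> real"
  assumes ug: "\<And>k. upper_gradient \<mu> (\<lambda>x. u (Suc k) x - u k x) (g k)"
    and fin: "pint p \<mu> (\<lambda>x. \<Sum>j. g j x) < top"
  obtains U where "\<And>x. convergent (\<lambda>k. u k x) \<Longrightarrow> (\<lambda>k. u k x) \<longlonglongrightarrow> U x"
    "\<And>k. weak_upper_gradient p \<mu> (\<lambda>x. U x - u k x) (\<lambda>x. \<Sum>j. g (j + k) x)"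
proof -
  have gm [measurable]: "g k \<in> borel_measurable \<mu>" for k using ug by (auto simp: upper_gradient_def)
  define R where "R x y \<longleftrightarrow> convergent (\<lambda>k. u k x - u k y)" for x y
  have R_refl: "R x x" for x by (simp add: R_def convergent_const)
  have R_sym: "R y x" if "R x y" for x y
    using convergent_minus_iff[of "\<lambda>k. u k x - u k y"] that by (simp add: R_def)
  have R_trans: "R x z" if "R x y" "R y z" for x y z
    using convergent_add[of "\<lambda>k. u k x - u k y" "\<lambda>k. u k y - u k z"] that by (simp add: R_def)
  \<comment> \<open>The sequence to subtract on the class of \<open>x\<close>: zero where the values
    converge, so that \<open>U\<close> is the true limit there, and otherwise the values at a
    representative. \<open>SOME\<close> picks the same representative throughout a class, because
    \<open>R x = R y\<close> as predicates.\<close>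
  define b where "b x = (if convergent (\<lambda>k. u k x) then (\<lambda>k. 0) else (\<lambda>k. u k (SOME y. R x y)))" for x
  define U where "U x = lim (\<lambda>k. u k x - b x k)" for x
  have b_eq: "b x = b y" if xy: "R x y" for x y
  proof -
    have "convergent (\<lambda>k. u k y) \<longleftrightarrow> convergent (\<lambda>k. u k x)"
      using convergent_add[of "\<lambda>k. u k x - u k y" "\<lambda>k. u k y"]
        convergent_diff[of "\<lambda>k. u k x" "\<lambda>k. u k x - u k y"] xy by (auto simp: R_def)
    moreover have "R x = R y" using xy R_sym R_trans by blast
    ultimately show ?thesis by (simp add: b_def)
  qed
  have Ulim: "(\<lambda>k. u k x - b x k) \<longlonglongrightarrow> U x" for x
  proof -
    have "R x (SOME y. R x y)" using R_refl by (rule someI)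
    then have "convergent (\<lambda>k. u k x - b x k)" by (auto simp: b_def R_def)
    then show ?thesis unfolding U_def by (simp add: convergent_LIMSEQ_iff)
  qed
  have "(\<lambda>k. u k x) \<longlonglongrightarrow> U x" if "convergent (\<lambda>k. u k x)" for x
    using Ulim[of x] that by (simp add: b_def)
  moreover have "weak_upper_gradient p \<mu> (\<lambda>x. U x - u k x) (\<lambda>x. \<Sum>j. g (j + k) x)" for k
    unfolding weak_upper_gradient_def
  proof (intro conjI exI ballI)
    \<comment> \<open>The family does not depend on \<open>k\<close>; the sum of all
      \<open>g j\<close> certifies it.\<close>
    let ?\<Gamma> = "{\<gamma>. curve_integral \<gamma> (\<lambda>x. \<Sum>j. g j x) = top}"
    show "exceptional p \<mu> ?\<Gamma>"
      unfolding exceptional_def using fin by (intro exI[of _ "\<lambda>x. \<Sum>j. g j x"]) auto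
    fix \<gamma> assume \<gamma>': "\<gamma> \<in> rect_curves (space \<mu>) - ?\<Gamma>"
    then have \<gamma>: "\<gamma> \<in> rect_curves (space \<mu>)" by simp
    have I: "curve_integral \<gamma> (\<lambda>x. \<Sum>j. g (j + k) x) = (\<Sum>j. curve_integral \<gamma> (g (j + k)))" for k
      using gm by (rule curve_integral_suminf[OF \<gamma> sets])
    define x where "x = pathfinish \<gamma>"
    define y where "y = pathstart \<gamma>"
    define c where "c j = enn2real (curve_integral \<gamma> (g j))" for j
    define d where "d j = (u (Suc j) x - u j x) - (u (Suc j) y - u j y)" for j
    have fin': "(\<Sum>j. curve_integral \<gamma> (g j)) < top" using \<gamma>' I[of 0] by (simp add: less_top)
    then have "curve_integral \<gamma> (g j) < top" for j
      using sum_le_suminf[of "\<lambda>j. curve_integral \<gamma> (g j)" "{j}"] by (auto intro: le_less_trans)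
    then have c: "curve_integral \<gamma> (g j) = ennreal (c j)" "c j \<ge> 0" for j by (auto simp: c_def)
    have dc: "\<bar>d j\<bar> \<le> c j" for j
    proof -
      have "ennreal \<bar>d j\<bar> \<le> curve_integral \<gamma> (g j)"
        using ug[of j] \<gamma> unfolding upper_gradient_def upper_gradient_along_def d_def x_def y_def by auto
      then show ?thesis using c[of j] by simp
    qed
    have sc: "summable c"
      using fin' c by (intro summable_suminf_not_top) auto
    have sd: "summable (\<lambda>j. \<bar>d j\<bar>)" using dc sc by (intro summable_comparison_test[OF _ sc]) auto
    have tel: "(\<Sum>j<m. d (j + k)) = (u (m + k) x - u (m + k) y) - (u k x - u k y)" for k m
      by (induction m) (auto simp: d_def)
    \<comment> \<open>Off the exceptional family the increments along the curve are dominated by a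
      summable sequence, so both ends of the curve lie in the same class and \<open>b\<close>
      cancels from the difference.\<close>
    have "convergent (\<lambda>m. \<Sum>j<m. d j)" using sd summable_rabs_cancel summable_iff_convergent by blast
    then have "convergent (\<lambda>m. (\<Sum>j<m. d j) + (u 0 x - u 0 y))" by (intro convergent_add convergent_const)
    then have "R x y" unfolding R_def using tel[where k = 0] by simp
    then have "b x = b y" by (rule b_eq)
    then have "(\<lambda>m. u m x - u m y) \<longlonglongrightarrow> U x - U y"
      using tendsto_diff[OF Ulim[of x] Ulim[of y]] by simp
    then have "(\<lambda>m. u (m + k) x - u (m + k) y - (u k x - u k y)) \<longlonglongrightarrow> (U x - U y) - (u k x - u k y)"
      by (rule tendsto_diff[OF LIMSEQ_ignore_initial_segment tendsto_const])
    then have "(\<lambda>j. d (j + k)) sums ((U x - U y) - (u k x - u k y))" unfolding sums_def tel .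
    then have eq: "(U x - U y) - (u k x - u k y) = (\<Sum>j. d (j + k))" by (simp add: sums_iff)
    have "\<bar>\<Sum>j. d (j + k)\<bar> \<le> (\<Sum>j. \<bar>d (j + k)\<bar>)"
      using sd by (intro summable_rabs summable_ignore_initial_segment[of "\<lambda>j. \<bar>d j\<bar>"])
    also have "\<dots> \<le> (\<Sum>j. c (j + k))"
      using sd sc dc by (intro suminf_le summable_ignore_initial_segment[of "\<lambda>j. \<bar>d j\<bar>"] summable_ignore_initial_segment[of c]) auto
    finally have "ennreal \<bar>(U x - U y) - (u k x - u k y)\<bar> \<le> ennreal (\<Sum>j. c (j + k))"
      unfolding eq by (rule ennreal_leI)
    also have "\<dots> = (\<Sum>j. curve_integral \<gamma> (g (j + k)))"
      using c sc by (subst c) (auto intro!: suminf_ennreal2[symmetric] summable_ignore_initial_segment)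
    finally show "upper_gradient_along (\<lambda>x. U x - u k x) (\<lambda>x. \<Sum>j. g (j + k) x) \<gamma>"
      unfolding upper_gradient_along_def I x_def[symmetric] y_def[symmetric]
      by (simp add: algebra_simps)
  qed measurable
  ultimately show ?thesis using that by blast
qed

end

subsection \<open>Doubling measures and the Poincare inequality\<close>

definition vol :: "'a::metric_space measure \<Rightarrow> 'a \<Rightarrow> real \<Rightarrow> real" where
  "vol M x r = measure M (ball x r \<inter> space M)"

definition avg :: "'a::metric_space measure \<Rightarrow> ('a \<Rightarrow> real) \<Rightarrow> 'a \<Rightarrow> real \<Rightarrow> real" where
  "avg M f x r = (LINT y:ball x r \<inter> space M|M. f y) / vol M x r"

lemma vol_nonneg [simp]: "0 \<le> vol M x r"
  by (simp add: vol_def)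

lemma ball_subset_ball: "dist x y + r \<le> s \<Longrightarrow> ball x r \<subseteq> ball y s"
proof (rule subsetI)
  fix z assume "dist x y + r \<le> s" "z \<in> ball x r"
  then show "z \<in> ball y s" using dist_triangle[of y z x] by (simp add: dist_commute)
qed

locale finite_borel = finite_measure M for M :: "'a::metric_space measure" +
  assumes sets_eq: "sets M = sets (restrict_space borel (space M))"
begin

lemma ball_in_sets [measurable]: "ball x r \<inter> space M \<in> sets M"
  unfolding sets_eq by (auto simp: sets_restrict_space image_iff)

lemma measurable_id_borel: "(\<lambda>x. x) \<in> measurable M borel"
  unfolding measurable_cong_sets[OF sets_eq refl] by (intro measurable_restrict_space1) simp

lemma emeasure_ball: "emeasure M (ball x r \<inter> space M) = ennreal (vol M x r)"
  by (simp add: vol_def emeasure_eq_measure)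

lemma vol_mono: "dist x y + r \<le> s \<Longrightarrow> vol M x r \<le> vol M y s"
  unfolding vol_def using ball_subset_ball[of x y r s]
  by (intro finite_measure_mono ball_in_sets) auto

lemma set_integrable_ball: "integrable M f \<Longrightarrow> set_integrable M (ball x r \<inter> space M) (f :: 'a \<Rightarrow> real)"
  unfolding set_integrable_def by (intro integrable_mult_indicator ball_in_sets)

lemma avg_const: "0 < vol M x r \<Longrightarrow> avg M (\<lambda>_. c) x r = c"
  using set_integral_const[of "ball x r \<inter> space M" M c] ball_in_sets[of x r] by (simp add: avg_def vol_def)

lemma avg_diff: "integrable M f \<Longrightarrow> integrable M g \<Longrightarrow> avg M (\<lambda>y. f y - g y) x r = avg M f x r - avg M g x r"
  by (simp add: avg_def set_integrable_ball diff_divide_distrib)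

lemma avg_add: "integrable M f \<Longrightarrow> integrable M g \<Longrightarrow> avg M (\<lambda>y. f y + g y) x r = avg M f x r + avg M g x r"
  by (simp add: avg_def set_integrable_ball add_divide_distrib)

lemma avg_nonneg: "(\<And>y. 0 \<le> f y) \<Longrightarrow> 0 \<le> avg M f x r"
  unfolding avg_def set_lebesgue_integral_def by (intro divide_nonneg_nonneg Bochner_Integration.integral_nonneg) auto

lemma avg_mono: "integrable M f \<Longrightarrow> integrable M g \<Longrightarrow> (\<And>y. f y \<le> g y) \<Longrightarrow> avg M f x r \<le> avg M g x r"
  unfolding avg_def by (intro divide_right_mono set_integral_mono set_integrable_ball) auto

lemma integrable_abs_diff: "integrable M f \<Longrightarrow> integrable M (\<lambda>y. \<bar>f y - c\<bar> :: real)"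
  by (intro integrable_abs Bochner_Integration.integrable_diff) auto

lemma abs_avg_diff_le:
  assumes "integrable M f" "0 < vol M x r"
  shows "\<bar>avg M f x r - c\<bar> \<le> avg M (\<lambda>y. \<bar>f y - c\<bar>) x r"
proof -
  have "avg M f x r - c = avg M (\<lambda>y. f y - c) x r"
    using avg_diff[of f "\<lambda>_. c" x r] avg_const[of x r c] assms by simp
  moreover have "\<bar>avg M (\<lambda>y. f y - c) x r\<bar> \<le> avg M (\<lambda>y. \<bar>f y - c\<bar>) x r"
    unfolding avg_def abs_divide
    using set_integral_norm_bound[OF set_integrable_ball, of "\<lambda>y. f y - c" x r] assms
    by (auto intro!: divide_right_mono)
  ultimately show ?thesis by simp
qed

lemma avg_abs_diff_triangle:
  assumes "integrable M f" "0 < vol M x r"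
  shows "avg M (\<lambda>y. \<bar>f y - c\<bar>) x r \<le> avg M (\<lambda>y. \<bar>f y - d\<bar>) x r + \<bar>d - c\<bar>"
proof -
  have "avg M (\<lambda>y. \<bar>f y - c\<bar>) x r \<le> avg M (\<lambda>y. \<bar>f y - d\<bar> + \<bar>d - c\<bar>) x r"
    using assms by (intro avg_mono integrable_abs_diff Bochner_Integration.integrable_add) auto
  then show ?thesis
    using avg_add[of "\<lambda>y. \<bar>f y - d\<bar>" "\<lambda>_. \<bar>d - c\<bar>" x r] avg_const[of x r] assms
    by (simp add: integrable_abs_diff)
qed

end

text \<open>Positivity and doubling are demanded for centres in the closure, since traces are
  computed from balls centred at boundary points. \<open>doubling_space_exists\<close> transfers
  them from centres in the space.\<close>

locale doubling_space = finite_borel \<mu> for \<mu> :: "'a::metric_space measure" +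
  fixes Cd :: real
  assumes bounded_space: "bounded (space \<mu>)"
    and Cd: "1 \<le> Cd"
    and vol_pos: "x \<in> closure (space \<mu>) \<Longrightarrow> 0 < r \<Longrightarrow> 0 < vol \<mu> x r"
    and vol_double: "x \<in> closure (space \<mu>) \<Longrightarrow> 0 < r \<Longrightarrow> vol \<mu> x (2 * r) \<le> Cd * vol \<mu> x r"
begin

lemma vol_le:
  assumes y: "y \<in> closure (space \<mu>)" "0 < r" and s: "dist x y + s \<le> 2 ^ n * r"
  shows "vol \<mu> x s \<le> Cd ^ n * vol \<mu> y r"
proof -
  have "vol \<mu> y (2 ^ n * r) \<le> Cd ^ n * vol \<mu> y r"
  proof (induction n)
    case (Suc n)
    have "vol \<mu> y (2 * (2 ^ n * r)) \<le> Cd * vol \<mu> y (2 ^ n * r)"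
      using y by (intro vol_double) auto
    also have "\<dots> \<le> Cd * (Cd ^ n * vol \<mu> y r)" using Suc Cd by (intro mult_left_mono) auto
    finally show ?case by (simp add: mult.assoc)
  qed simp
  then show ?thesis using vol_mono[OF s] by simp
qed

text \<open>The integral over the smaller ball is at most the one over the larger ball; only the
  normalisations differ, and doubling bounds their quotient by \<open>Cd ^ n\<close>. All
  comparisons of averages at nearby balls go through this inequality.\<close>

lemma avg_abs_diff_le:
  assumes f: "integrable \<mu> f" and y: "y \<in> closure (space \<mu>)" "0 < s"
    and x: "x \<in> closure (space \<mu>)" "0 < r" and s: "dist y x + s \<le> r" and r: "dist x y + r \<le> 2 ^ n * s"
  shows "avg \<mu> (\<lambda>z. \<bar>f z - c\<bar>) y s \<le> Cd ^ n * avg \<mu> (\<lambda>z. \<bar>f z - c\<bar>) x r"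
proof -
  let ?I = "\<lambda>x r. LINT z:ball x r \<inter> space \<mu>|\<mu>. \<bar>f z - c\<bar>"
  have "?I y s \<le> ?I x r"
    unfolding set_lebesgue_integral_def using ball_subset_ball[OF s] f
    by (intro integral_mono integrable_mult_indicator ball_in_sets integrable_abs_diff)
      (auto split: split_indicator)
  moreover have "0 \<le> ?I x r" unfolding set_lebesgue_integral_def by (intro Bochner_Integration.integral_nonneg) auto
  ultimately have "?I y s * vol \<mu> x r \<le> ?I x r * (Cd ^ n * vol \<mu> y s)"
    using vol_le[OF y r] by (intro mult_mono) auto
  then have "?I y s \<le> ?I x r * (Cd ^ n * vol \<mu> y s) / vol \<mu> x r"
    using vol_pos[OF x] by (simp add: pos_le_divide_eq)
  then show ?thesis
    using vol_pos[OF y] unfolding avg_def by (simp add: pos_divide_le_eq mult_ac)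
qed

text \<open>A separated set of maximal size is a net. Its size is bounded because the balls of
  radius \<open>e / 2\<close> about its points are disjoint and each carries, by doubling, a fixed
  fraction of the total mass. The lemma serves to obtain a countable dense set.\<close>

lemma finite_net:
  assumes e: "0 < e"
  shows "\<exists>F. finite F \<and> F \<subseteq> space \<mu> \<and> (\<forall>x\<in>space \<mu>. \<exists>y\<in>F. dist x y < e)"
proof -
  obtain D where D: "\<And>x y. x \<in> space \<mu> \<Longrightarrow> y \<in> space \<mu> \<Longrightarrow> dist x y \<le> D"
    using bounded_space unfolding bounded_two_points by auto
  obtain n where n: "D + 1 \<le> 2 ^ n * (e / 2)"
  proof -
    obtain n where "(D + 1) / (e / 2) < 2 ^ n" using real_arch_pow[of 2] by auto
    then show ?thesis using that[of n] e by (simp add: field_simps)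
  qed
  define w where "w = measure \<mu> (space \<mu>)"
  have w: "w \<le> Cd ^ n * vol \<mu> x (e / 2)" if "x \<in> space \<mu>" for x
  proof -
    have "dist x y < D + 1" if "y \<in> space \<mu>" for y using D[OF \<open>x \<in> space \<mu>\<close> that] by simp
    then have "vol \<mu> x (D + 1) = w" unfolding vol_def w_def
      by (intro arg_cong[where f = "measure \<mu>"]) auto
    then show ?thesis using vol_le[of x "e / 2" x "D + 1" n] that e n closure_subset by auto
  qed
  define P where "P F \<longleftrightarrow> finite F \<and> F \<subseteq> space \<mu> \<and> (\<forall>x\<in>F. \<forall>y\<in>F. x \<noteq> y \<longrightarrow> e \<le> dist x y)" for F
  obtain N where N: "Cd ^ n \<le> real N" using real_arch_simple by blast
  have bound: "card F \<le> N" if "P F" for F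
  proof (cases "F = {}")
    case False
    then obtain x0 where x0: "x0 \<in> F" "x0 \<in> space \<mu>" using \<open>P F\<close> by (auto simp: P_def)
    have "0 < w"
    proof -
      have "0 < vol \<mu> x0 1" using x0 closure_subset by (intro vol_pos) auto
      also have "\<dots> \<le> w" unfolding vol_def w_def by (intro finite_measure_mono) auto
      finally show ?thesis .
    qed
    have "(\<Sum>x\<in>F. measure \<mu> (ball x (e / 2) \<inter> space \<mu>)) = measure \<mu> (\<Union>x\<in>F. ball x (e / 2) \<inter> space \<mu>)"
    proof (intro finite_measure_finite_Union[symmetric])
      show "disjoint_family_on (\<lambda>x. ball x (e / 2) \<inter> space \<mu>) F"
        unfolding disjoint_family_on_def
      proof (intro ballI impI equals0I)
        fix x y z assume xy: "x \<in> F" "y \<in> F" "x \<noteq> y" and z: "z \<in> (ball x (e / 2) \<inter> space \<mu>) \<inter> (ball y (e / 2) \<inter> space \<mu>)"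
        then have "dist x y < e" using dist_triangle2[of x y z] by auto
        moreover have "e \<le> dist x y" using xy(1-3) \<open>P F\<close> unfolding P_def by blast
        ultimately show False by simp
      qed
    qed (use \<open>P F\<close> in \<open>auto simp: P_def ball_in_sets\<close>)
    also have "\<dots> \<le> w" unfolding w_def by (intro finite_measure_mono) auto
    finally have "(\<Sum>x\<in>F. vol \<mu> x (e / 2)) \<le> w" by (simp add: vol_def)
    moreover have "(\<Sum>x\<in>F. w / Cd ^ n) \<le> (\<Sum>x\<in>F. vol \<mu> x (e / 2))"
      using w Cd \<open>P F\<close> by (intro sum_mono) (auto simp: P_def field_simps)
    ultimately have "real (card F) * (w / Cd ^ n) \<le> w" by simp
    then have "real (card F) \<le> Cd ^ n" using \<open>0 < w\<close> Cd by (simp add: field_simps)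
    then show ?thesis using N by simp
  qed simp
  have "P {}" by (simp add: P_def)
  then obtain F where F: "P F" "\<forall>G. P G \<longrightarrow> card G \<le> card F"
    using ex_has_greatest_nat[of P "{}" card "Suc N"] bound by (metis le_imp_less_Suc less_imp_le)
  have "\<exists>y\<in>F. dist x y < e" if x: "x \<in> space \<mu>" for x
  proof (rule ccontr)
    assume *: "\<not> ?thesis"
    then have "x \<notin> F" using e by force
    have "P (insert x F)" using * F(1) x unfolding P_def
      by (auto simp: dist_commute not_less)
    then have "card (insert x F) \<le> card F" using F by blast
    then show False using \<open>x \<notin> F\<close> F(1) by (simp add: P_def)
  qed
  moreover have "finite F" "F \<subseteq> space \<mu>" using F(1) by (simp_all add: P_def)
  ultimately show ?thesis by (intro exI[of _ F]) simp
qed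

lemma countable_dense:
  obtains S where "countable S" "\<And>x e. x \<in> closure (space \<mu>) \<Longrightarrow> 0 < e \<Longrightarrow> \<exists>s\<in>S. dist x s < e"
proof -
  have "\<forall>n. \<exists>F. finite F \<and> F \<subseteq> space \<mu> \<and> (\<forall>x\<in>space \<mu>. \<exists>y\<in>F. dist x y < inverse (real (Suc n)))"
    using finite_net by simp
  then obtain F where F: "\<And>n. finite (F n)" "\<And>n x. x \<in> space \<mu> \<Longrightarrow> \<exists>y\<in>F n. dist x y < inverse (real (Suc n))"
    by metis
  have "\<exists>s\<in>(\<Union>n. F n). dist x s < e" if x: "x \<in> closure (space \<mu>)" "0 < e" for x e
  proof -
    obtain y where y: "y \<in> space \<mu>" "dist y x < e / 2" using x closure_approachable by (metis half_gt_zero)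
    obtain n where n: "inverse (real (Suc n)) < e / 2" using x reals_Archimedean by (metis half_gt_zero)
    obtain s where s: "s \<in> F n" "dist y s < inverse (real (Suc n))" using F(2) y by blast
    then have "dist x s < e" using y n dist_triangle_half_l[of y x e s]
      by (metis dist_commute dist_triangle_half_r less_trans)
    then show ?thesis using s by blast
  qed
  then show ?thesis using F(1) by (intro that[of "\<Union>n. F n"]) (blast intro: countable_finite)+
qed

text \<open>The ambient type need not be separable, so continuity of \<open>dist\<close> does not
  make it measurable for a product sigma-algebra. With a countable set dense in the closure of the
  space, the distance is a countable infimum of sums of functions of one variable each.\<close>

lemma dist_measurable:
  assumes f: "f \<in> measurable K M" and g: "g \<in> measurable K N"
    and M: "sets M = sets (restrict_space borel (space M))" "space M \<subseteq> closure (space \<mu>)"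
    and N: "sets N = sets (restrict_space borel (space N))"
  shows "(\<lambda>z. dist (f z) (g z)) \<in> borel_measurable K"
proof -
  obtain S where S: "countable S" "\<And>x e. x \<in> closure (space \<mu>) \<Longrightarrow> 0 < e \<Longrightarrow> \<exists>s\<in>S. dist x s < e"
    using countable_dense by blast
  have "(\<lambda>x. x) \<in> measurable L borel" if "sets L = sets (restrict_space borel (space L))" for L :: "'a measure"
    unfolding measurable_cong_sets[OF that refl] by (intro measurable_restrict_space1) simp
  then have [measurable]: "f \<in> measurable K borel" "g \<in> measurable K borel"
    using measurable_compose[OF f, of "\<lambda>x. x"] measurable_compose[OF g, of "\<lambda>x. x"] M(1) N by auto
  have "(\<lambda>z. INF s\<in>S. ennreal (dist (f z) s + dist s (g z))) \<in> borel_measurable K"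
  proof (intro borel_measurable_INF[OF S(1)] measurable_compose[OF _ measurable_ennreal] borel_measurable_add)
    fix s :: 'a
    have "(\<lambda>x. dist x s) \<in> borel_measurable borel" "(\<lambda>x. dist s x) \<in> borel_measurable borel"
      by (intro borel_measurable_continuous_onI continuous_intros)+
    then show "(\<lambda>z. dist (f z) s) \<in> borel_measurable K" "(\<lambda>z. dist s (g z)) \<in> borel_measurable K"
      by measurable
  qed
  moreover have "(INF s\<in>S. ennreal (dist (f z) s + dist s (g z))) = ennreal (dist (f z) (g z))"
    if "z \<in> space K" for z
  proof (rule antisym)
    show "(INF s\<in>S. ennreal (dist (f z) s + dist s (g z))) \<le> ennreal (dist (f z) (g z))"
    proof (rule ennreal_le_epsilon)
      fix e :: real assume "0 < e"
      have "f z \<in> closure (space \<mu>)" using measurable_space[OF f that] M(2) by blast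
      then obtain s where s: "s \<in> S" "dist (f z) s < e / 2" using S(2) \<open>0 < e\<close> by (metis half_gt_zero)
      have "dist s (g z) \<le> dist (f z) s + dist (f z) (g z)" by (metis dist_commute dist_triangle)
      then have "ennreal (dist (f z) s + dist s (g z)) \<le> ennreal (dist (f z) (g z) + e)"
        using s by (intro ennreal_leI) linarith
      then show "(INF s\<in>S. ennreal (dist (f z) s + dist s (g z))) \<le> ennreal (dist (f z) (g z)) + ennreal e"
        using s(1) \<open>0 < e\<close> by (simp add: INF_lower2)
    qed
    show "ennreal (dist (f z) (g z)) \<le> (INF s\<in>S. ennreal (dist (f z) s + dist s (g z)))"
      by (intro INF_greatest ennreal_leI dist_triangle)
  qed
  ultimately have "(\<lambda>z. ennreal (dist (f z) (g z))) \<in> borel_measurable K"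
    by (simp cong: measurable_cong)
  then have "(\<lambda>z. enn2real (ennreal (dist (f z) (g z)))) \<in> borel_measurable K" by measurable
  then show ?thesis by simp
qed

end

lemma doubling_space_exists:
  assumes sets: "sets \<mu> = sets (restrict_space borel (space \<mu>))" and "bounded (space \<mu>)" "space \<mu> \<noteq> {}"
    and bp: "balls_pos_finite \<mu>" and "doubling \<mu>"
  shows "\<exists>Cd. doubling_space \<mu> Cd"
proof -
  obtain x0 where x0: "x0 \<in> space \<mu>" using assms(3) by blast
  obtain D where D: "\<And>x. x \<in> space \<mu> \<Longrightarrow> dist x0 x \<le> D"
    using assms(2) unfolding bounded_any_center[of _ x0] by auto
  have "dist x0 x < max 0 D + 1" if "x \<in> space \<mu>" for x using D[OF that] by simp
  then have "ball x0 (max 0 D + 1) \<inter> space \<mu> = space \<mu>" by auto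
  moreover have "0 < max 0 D + 1" by simp
  then have "emeasure \<mu> (ball x0 (max 0 D + 1) \<inter> space \<mu>) < \<infinity>"
    using bp x0 unfolding balls_pos_finite_def by blast
  ultimately have "emeasure \<mu> (space \<mu>) \<noteq> \<infinity>" by simp
  then interpret finite_borel \<mu>
    by (intro finite_borel.intro finite_borel_axioms.intro finite_measureI sets)
  obtain C where C: "\<And>x r. x \<in> space \<mu> \<Longrightarrow> 0 < r \<Longrightarrow>
      emeasure \<mu> (ball x (2 * r) \<inter> space \<mu>) \<le> ennreal C * emeasure \<mu> (ball x r \<inter> space \<mu>)"
    using assms(5) unfolding doubling_def by auto
  define K where "K = max 1 C"
  have K: "vol \<mu> x (2 * r) \<le> K * vol \<mu> x r" if "x \<in> space \<mu>" "0 < r" for x r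
  proof -
    have "ennreal (vol \<mu> x (2 * r)) \<le> ennreal C * ennreal (vol \<mu> x r)"
      using C[OF that] by (simp add: emeasure_ball)
    also have "\<dots> \<le> ennreal (K * vol \<mu> x r)"
      by (simp add: K_def ennreal_mult'' ennreal_leI mult_right_mono)
    finally show ?thesis by (simp add: ennreal_le_iff K_def mult_nonneg_nonneg)
  qed
  have pos: "0 < vol \<mu> x r" if "x \<in> space \<mu>" "0 < r" for x r
    using bp that unfolding balls_pos_finite_def emeasure_ball by auto
  have "doubling_space \<mu> (K ^ 3)"
  proof unfold_locales
    fix x and r :: real assume x: "x \<in> closure (space \<mu>)" and r: "0 < r"
    \<comment> \<open>About the nearby interior point \<open>y\<close>, the ball of radius
      \<open>r / 2\<close> lies in the given ball and the ball of radius \<open>4 * r\<close>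
      contains the doubled one. These radii differ by three doublings, whence
      \<open>K ^ 3\<close>.\<close>
    then obtain y where y: "y \<in> space \<mu>" "dist y x < r / 4"
      using closure_approachable by (metis zero_less_divide_iff zero_less_numeral)
    have "vol \<mu> y (r / 2) \<le> vol \<mu> x r" using y r by (intro vol_mono) auto
    moreover have "0 < vol \<mu> y (r / 2)" using y r by (intro pos) auto
    ultimately show "0 < vol \<mu> x r" by simp
    have K0: "0 \<le> K" by (simp add: K_def)
    have "vol \<mu> x (2 * r) \<le> vol \<mu> y (2 * (2 * (2 * (r / 2))))" using y r by (intro vol_mono) (simp add: dist_commute)
    also have "\<dots> \<le> K * vol \<mu> y (2 * (2 * (r / 2)))" using y r by (intro K) auto
    also have "\<dots> \<le> K * (K * vol \<mu> y (2 * (r / 2)))" using y r K0 by (intro K mult_left_mono) auto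
    also have "\<dots> \<le> K * (K * (K * vol \<mu> y (r / 2)))" using y r K0 by (intro K mult_left_mono) auto
    also have "\<dots> \<le> K * (K * (K * vol \<mu> x r))" using y r K0 by (intro mult_left_mono vol_mono) auto
    finally show "vol \<mu> x (2 * r) \<le> K ^ 3 * vol \<mu> x r" by (simp add: power3_eq_cube mult.assoc)
  qed (use assms(2) in \<open>auto simp: K_def\<close>)
  then show ?thesis by blast
qed

lemma borel_measurable_completion_AE:
  fixes f g :: "'a \<Rightarrow> 'b::topological_space"
  assumes [measurable]: "g \<in> borel_measurable M" and ae: "AE x in M. f x = g x"
  shows "f \<in> borel_measurable (completion M)"
proof (rule measurableI)
  fix B :: "'b set" assume [measurable]: "B \<in> sets borel"
  have [measurable]: "Measurable.pred (completion M) (\<lambda>x. f x \<noteq> g x)"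
      "Measurable.pred (completion M) (\<lambda>x. f x \<noteq> g x \<and> f x \<in> B)"
    using ae by (auto intro!: sets_completion_AE elim!: eventually_mono)
  have [measurable]: "g \<in> borel_measurable (completion M)"
    by (intro measurable_completion) measurable
  have "Measurable.pred (completion M) (\<lambda>x. (g x \<in> B \<and> \<not> f x \<noteq> g x) \<or> (f x \<noteq> g x \<and> f x \<in> B))"
    by measurable
  also have "(\<lambda>x. (g x \<in> B \<and> \<not> f x \<noteq> g x) \<or> (f x \<noteq> g x \<and> f x \<in> B)) = (\<lambda>x. f x \<in> B)"
    by (intro ext) metis
  finally show "f -` B \<inter> space (completion M) \<in> sets (completion M)"
    by (simp add: pred_def vimage_def Int_def conj_commute)
qed simp

lemma dyadic_scale:
  fixes r R :: real
  assumes "0 < r" "r \<le> R"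
  obtains k :: nat where "R / 2 ^ Suc k < r" "r \<le> R / 2 ^ k"
proof -
  obtain n where n: "R / r < 2 ^ n" using real_arch_pow[of 2] by auto
  define P where "P k \<longleftrightarrow> R / 2 ^ Suc k < r" for k
  have "P n" using n assms by (simp add: P_def field_simps)
  then have L: "P (LEAST k. P k)" by (rule LeastI)
  have "r \<le> R / 2 ^ (LEAST k. P k)"
  proof (cases "LEAST k. P k")
    case (Suc j)
    then have "\<not> P j" using not_less_Least[of j P] by simp
    then show ?thesis using Suc by (simp add: P_def)
  qed (use assms in simp)
  then show ?thesis using that L by (simp add: P_def)
qed

section \<open>Functions with a Poincare inequality and pointwise convergence of their
  averages\<close>

locale pi_space = doubling_space \<mu> Cd for \<mu> :: "'a::metric_space measure" and Cd +
  fixes p Cp l :: real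
  assumes p: "1 < p" and Cp: "0 < Cp" and l: "1 \<le> l"
begin

text \<open>The measure \<open>mg\<close> stands for \<open>g\<^sup>p d\<mu>\<close>, where \<open>g\<close> is an upper gradient of \<open>u\<close>.\<close>

definition pi_pair :: "('a \<Rightarrow> real) \<Rightarrow> 'a measure \<Rightarrow> bool" where
  "pi_pair u mg \<longleftrightarrow> integrable \<mu> u \<and> finite_measure mg \<and> sets mg = sets \<mu> \<and>
    (\<forall>x\<in>space \<mu>. \<forall>r>0. avg \<mu> (\<lambda>y. \<bar>u y - avg \<mu> u x r\<bar>) x r
       \<le> Cp * r * (vol mg x (l * r) / vol \<mu> x r) powr (1 / p))"

lemma pi_pairD:
  assumes "pi_pair u mg"
  shows "integrable \<mu> u" "finite_borel mg" "space mg = space \<mu>" "sets mg = sets \<mu>"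
    "x \<in> space \<mu> \<Longrightarrow> 0 < r \<Longrightarrow> avg \<mu> (\<lambda>y. \<bar>u y - avg \<mu> u x r\<bar>) x r
       \<le> Cp * r * (vol mg x (l * r) / vol \<mu> x r) powr (1 / p)"
proof -
  show "integrable \<mu> u" and s: "sets mg = sets \<mu>" using assms by (auto simp: pi_pair_def)
  show sp: "space mg = space \<mu>" using s by (rule sets_eq_imp_space_eq)
  show "finite_borel mg"
    using assms s sp sets_eq by (intro finite_borel.intro finite_borel_axioms.intro) (auto simp: pi_pair_def)
qed (use assms in \<open>auto simp: pi_pair_def\<close>)

definition C1 :: real where "C1 = 4 * Cd ^ 2 * Cp"

lemma C1_pos: "0 < C1" using Cd Cp by (simp add: C1_def)

lemma emean_avg:
  assumes u_int: "integrable \<mu> u" and x: "\<xi> \<in> closure (space \<mu>)" "0 < r"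
  shows "emean \<mu> (ball \<xi> r \<inter> space \<mu>) (\<lambda>x. ennreal \<bar>u x - a\<bar>) = ennreal (avg \<mu> (\<lambda>x. \<bar>u x - a\<bar>) \<xi> r)"
proof -
  have "(\<integral>\<^sup>+x. ennreal \<bar>u x - a\<bar> * indicator (ball \<xi> r \<inter> space \<mu>) x \<partial>\<mu>)
      = (\<integral>\<^sup>+x. ennreal (indicator (ball \<xi> r \<inter> space \<mu>) x *\<^sub>R \<bar>u x - a\<bar>) \<partial>\<mu>)"
    by (intro nn_integral_cong) (auto split: split_indicator)
  also have "\<dots> = ennreal (LINT x:ball \<xi> r \<inter> space \<mu>|\<mu>. \<bar>u x - a\<bar>)"
    unfolding set_lebesgue_integral_def
    using set_integrable_ball[OF integrable_abs_diff[OF u_int, of a], of \<xi> r]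
    by (intro nn_integral_eq_integral) (auto simp: set_integrable_def)
  finally show ?thesis
    using vol_pos[OF x] unfolding emean_def nn_integral_completion
    by (simp add: emeasure_ball avg_def divide_ennreal set_lebesgue_integral_def)
qed

lemma has_trace_value_iff:
  assumes u_int: "integrable \<mu> u" and x: "\<xi> \<in> closure (space \<mu>)"
  shows "has_trace_value \<mu> u \<xi> a \<longleftrightarrow> ((\<lambda>r. avg \<mu> (\<lambda>y. \<bar>u y - a\<bar>) \<xi> r) \<longlongrightarrow> 0) (at_right 0)"
proof -
  have "\<forall>\<^sub>F r in at_right 0. emean \<mu> (ball \<xi> r \<inter> space \<mu>) (\<lambda>x. ennreal \<bar>u x - a\<bar>) = ennreal (avg \<mu> (\<lambda>x. \<bar>u x - a\<bar>) \<xi> r)"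
    using emean_avg[OF u_int x, of _ a] by (auto simp: eventually_at_right_field intro!: exI[of _ 1])
  then have "has_trace_value \<mu> u \<xi> a \<longleftrightarrow> ((\<lambda>r. ennreal (avg \<mu> (\<lambda>y. \<bar>u y - a\<bar>) \<xi> r)) \<longlongrightarrow> ennreal 0) (at_right 0)"
    unfolding has_trace_value_def by (simp add: tendsto_cong)
  also have "\<dots> \<longleftrightarrow> ((\<lambda>r. avg \<mu> (\<lambda>y. \<bar>u y - a\<bar>) \<xi> r) \<longlongrightarrow> 0) (at_right 0)"
    using avg_nonneg[of "\<lambda>y. \<bar>u y - a\<bar>"] by (subst tendsto_ennreal_iff) auto
  finally show ?thesis .
qed

lemma trace_eq:
  assumes u_int: "integrable \<mu> u" and x: "\<xi> \<in> closure (space \<mu>)" and a: "has_trace_value \<mu> u \<xi> a"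
  shows "trace \<mu> u \<xi> = a"
proof -
  have "b = a" if b: "has_trace_value \<mu> u \<xi> b" for b
  proof -
    have "((\<lambda>r. avg \<mu> (\<lambda>y. \<bar>u y - a\<bar>) \<xi> r + avg \<mu> (\<lambda>y. \<bar>u y - b\<bar>) \<xi> r) \<longlongrightarrow> 0 + 0) (at_right 0)"
      using a b has_trace_value_iff[OF u_int x] by (intro tendsto_add) auto
    moreover have "\<forall>\<^sub>F r in at_right 0. \<bar>a - b\<bar> \<le> avg \<mu> (\<lambda>y. \<bar>u y - a\<bar>) \<xi> r + avg \<mu> (\<lambda>y. \<bar>u y - b\<bar>) \<xi> r"
    proof -
      have "\<bar>a - b\<bar> \<le> avg \<mu> (\<lambda>y. \<bar>u y - a\<bar>) \<xi> r + avg \<mu> (\<lambda>y. \<bar>u y - b\<bar>) \<xi> r" if "0 < r" for r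
        using abs_avg_diff_le[OF u_int vol_pos[OF x that], of a] abs_avg_diff_le[OF u_int vol_pos[OF x that], of b]
        by linarith
      then show ?thesis by (auto simp: eventually_at_right_field intro!: exI[of _ 1])
    qed
    ultimately have "\<bar>a - b\<bar> \<le> 0 + 0" by (intro tendsto_lowerbound) (auto simp: trivial_limit_at_right_real)
    then show ?thesis by simp
  qed
  with a have "(THE b. has_trace_value \<mu> u \<xi> b) = a" by (rule the_equality)
  moreover have "\<exists>b. has_trace_value \<mu> u \<xi> b" using a by (rule exI)
  ultimately show ?thesis by (simp only: trace_def if_True)
qed

text \<open>Up to the constant \<open>C1\<close>, the right-hand side of the Poincare inequality on
  the ball of radius \<open>R / 2 ^ k\<close> about \<xi>; the dilation \<open>3 * l\<close> is that
  of \<open>poincare_closure\<close>.\<close>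

definition osc_bound :: "'a measure \<Rightarrow> real \<Rightarrow> 'a \<Rightarrow> nat \<Rightarrow> real" where
  "osc_bound mg R \<xi> k = R / 2 ^ k * (vol mg \<xi> (3 * l * (R / 2 ^ k)) / vol \<mu> \<xi> (R / 2 ^ k)) powr (1 / p)"

context
  fixes u mg
  assumes um: "pi_pair u mg"
begin

interpretation mg: finite_borel mg using pi_pairD[OF um] by simp

lemmas u_int = pi_pairD(1)[OF um]

text \<open>The ball about \<open>y\<close> of radius \<open>s\<close> lies in the ball about
  \<open>x\<close> of radius \<open>2 * s\<close>, which in turn lies in the ball about
  \<open>y\<close> of radius \<open>4 * s\<close>; hence the exponent 2 of
  \<open>Cd\<close>.\<close>

lemma avg_abs_diff_step:
  assumes "x \<in> space \<mu>" "y \<in> closure (space \<mu>)" "0 < s" "dist x y \<le> s"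
  shows "avg \<mu> (\<lambda>z. \<bar>u z - avg \<mu> u x (2 * s)\<bar>) y s
    \<le> Cd ^ 2 * Cp * (2 * s) * (vol mg x (2 * l * s) / vol \<mu> x (2 * s)) powr (1 / p)"
proof -
  have "avg \<mu> (\<lambda>z. \<bar>u z - avg \<mu> u x (2 * s)\<bar>) y s \<le> Cd ^ 2 * avg \<mu> (\<lambda>z. \<bar>u z - avg \<mu> u x (2 * s)\<bar>) x (2 * s)"
    using assms closure_subset by (intro avg_abs_diff_le u_int) (auto simp: dist_commute)
  also have "\<dots> \<le> Cd ^ 2 * (Cp * (2 * s) * (vol mg x (l * (2 * s)) / vol \<mu> x (2 * s)) powr (1 / p))"
    using assms Cd by (intro mult_left_mono pi_pairD[OF um]) auto
  finally show ?thesis by (simp add: mult_ac)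
qed

text \<open>The inequality is given only for centres in the space. A ball of radius
  \<open>2 * r\<close> about a nearby interior point covers the given ball, and its dilate by
  \<open>l\<close> lies within radius \<open>3 * l * r\<close> of \<xi>. In \<open>C1\<close> one
  factor 2 is that radius, and another 2 is the price of exchanging the mean \<open>c\<close> for
  the mean over the ball itself.\<close>

lemma poincare_closure:
  assumes x: "\<xi> \<in> closure (space \<mu>)" and r: "0 < r"
  shows "avg \<mu> (\<lambda>z. \<bar>u z - avg \<mu> u \<xi> r\<bar>) \<xi> r \<le> C1 * (r * (vol mg \<xi> (3 * l * r) / vol \<mu> \<xi> r) powr (1 / p))"
proof -
  obtain x where x': "x \<in> space \<mu>" "dist x \<xi> < r"
    using x r closure_approachable by metis
  define c where "c = avg \<mu> u x (2 * r)"
  have "avg \<mu> (\<lambda>z. \<bar>u z - avg \<mu> u \<xi> r\<bar>) \<xi> r \<le> avg \<mu> (\<lambda>z. \<bar>u z - c\<bar>) \<xi> r + \<bar>c - avg \<mu> u \<xi> r\<bar>"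
    using x r by (intro avg_abs_diff_triangle u_int vol_pos)
  also have "\<bar>c - avg \<mu> u \<xi> r\<bar> \<le> avg \<mu> (\<lambda>z. \<bar>u z - c\<bar>) \<xi> r"
    using abs_avg_diff_le[OF u_int vol_pos[OF x r], of c] by (simp add: abs_minus_commute)
  also have "avg \<mu> (\<lambda>z. \<bar>u z - c\<bar>) \<xi> r
      \<le> Cd ^ 2 * Cp * (2 * r) * (vol mg x (2 * l * r) / vol \<mu> x (2 * r)) powr (1 / p)"
    unfolding c_def using x x' r by (intro avg_abs_diff_step) auto
  also have "(vol mg x (2 * l * r) / vol \<mu> x (2 * r)) powr (1 / p)
      \<le> (vol mg \<xi> (3 * l * r) / vol \<mu> \<xi> r) powr (1 / p)"
  proof (intro powr_mono2 frac_le)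
    have "r * 1 \<le> r * l" using l r by (intro mult_left_mono) auto
    then show "vol mg x (2 * l * r) \<le> vol mg \<xi> (3 * l * r)"
      using x' by (intro mg.vol_mono) (simp add: algebra_simps)
    show "vol \<mu> \<xi> r \<le> vol \<mu> x (2 * r)" using x' by (intro vol_mono) (simp add: dist_commute)
  qed (use p vol_pos[OF x r] in auto)
  finally show ?thesis using Cd Cp r by (simp add: C1_def mult_left_mono mult_ac)
qed

text \<open>Averages over consecutive dyadic balls differ by at most a multiple of
  \<open>osc_bound\<close>, so summability makes them a Cauchy sequence. An intermediate radius is
  compared with the next larger dyadic one.\<close>

lemma avg_converges:
  assumes x: "\<xi> \<in> closure (space \<mu>)" and R: "0 < R" and s: "summable (osc_bound mg R \<xi>)"
  shows "\<exists>a. (\<forall>k. \<bar>avg \<mu> u \<xi> (R / 2 ^ k) - a\<bar> \<le> Cd * C1 * (\<Sum>j. osc_bound mg R \<xi> (j + k))) \<and>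
    ((\<lambda>r. avg \<mu> (\<lambda>y. \<bar>u y - a\<bar>) \<xi> r) \<longlongrightarrow> 0) (at_right 0)"
proof -
  define r where "r k = R / 2 ^ k" for k :: nat
  define c where "c k = avg \<mu> u \<xi> (r k)" for k
  define A where "A = osc_bound mg R \<xi>"
  have r: "0 < r k" "r k = 2 * r (Suc k)" for k using R by (auto simp: r_def)
  have osc: "avg \<mu> (\<lambda>z. \<bar>u z - c k\<bar>) \<xi> (r k) \<le> C1 * A k" for k
    using poincare_closure[OF x r(1)[of k]] by (simp add: A_def osc_bound_def c_def r_def)
  have A0: "0 \<le> A k" for k using R by (simp add: A_def osc_bound_def)
  have step: "\<bar>c (Suc k) - c k\<bar> \<le> Cd * C1 * A k" for k
  proof -
    have "\<bar>c (Suc k) - c k\<bar> \<le> avg \<mu> (\<lambda>z. \<bar>u z - c k\<bar>) \<xi> (r (Suc k))"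
      unfolding c_def[of "Suc k"] by (intro abs_avg_diff_le u_int vol_pos x r)
    also have "\<dots> \<le> Cd ^ 1 * avg \<mu> (\<lambda>z. \<bar>u z - c k\<bar>) \<xi> (r k)"
      using r(2)[of k] r(1)[of "Suc k"] by (intro avg_abs_diff_le u_int x r) auto
    also have "\<dots> \<le> Cd ^ 1 * (C1 * A k)" using osc Cd by (intro mult_left_mono) auto
    finally show ?thesis by simp
  qed
  have sA: "summable (\<lambda>j. Cd * C1 * A (j + k))" for k
    using s by (intro summable_mult summable_ignore_initial_segment) (simp add: A_def)
  have sabs: "summable (\<lambda>j. \<bar>c (Suc (j + k)) - c (j + k)\<bar>)" for k
    using step by (intro summable_comparison_test[OF _ sA[of k]]) auto
  have tel: "(\<Sum>j<n. c (Suc (j + k)) - c (j + k)) = c (n + k) - c k" for n k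
    by (induction n) auto
  have "convergent (\<lambda>n. c n - c 0)"
    using summable_rabs_cancel[OF sabs[of 0]] tel[where k = 0] by (simp add: summable_iff_convergent)
  then have "convergent (\<lambda>n. (c n - c 0) + c 0)" by (intro convergent_add convergent_const)
  then obtain a where a: "c \<longlonglongrightarrow> a" by (auto simp: convergent_def)
  have bound: "\<bar>c k - a\<bar> \<le> Cd * C1 * (\<Sum>j. A (j + k))" for k
  proof -
    have "(\<lambda>n. c (n + k) - c k) \<longlonglongrightarrow> a - c k"
      using LIMSEQ_ignore_initial_segment[OF a, of k] by (intro tendsto_diff tendsto_const)
    then have "(\<lambda>j. c (Suc (j + k)) - c (j + k)) sums (a - c k)" by (simp add: sums_def tel)
    then have "a - c k = (\<Sum>j. c (Suc (j + k)) - c (j + k))" by (simp add: sums_iff)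
    then have "\<bar>c k - a\<bar> \<le> (\<Sum>j. \<bar>c (Suc (j + k)) - c (j + k)\<bar>)"
      using summable_rabs[OF sabs[of k]] by (simp add: abs_minus_commute)
    also have "\<dots> \<le> (\<Sum>j. Cd * C1 * A (j + k))" using step sabs sA by (intro suminf_le) auto
    also have "\<dots> = Cd * C1 * (\<Sum>j. A (j + k))"
      using s by (intro suminf_mult summable_ignore_initial_segment) (simp add: A_def)
    finally show ?thesis .
  qed
  \<comment> \<open>Bounds the mean deviation from \<open>a\<close> for every radius between
    \<open>r (Suc k)\<close> and \<open>r k\<close>: oscillation on the dyadic ball plus the
    distance of its average to \<open>a\<close>.\<close>
  define B where "B k = Cd * (C1 * A k + Cd * C1 * (\<Sum>j. A (j + k)))" for k
  have B: "avg \<mu> (\<lambda>y. \<bar>u y - a\<bar>) \<xi> t \<le> B k" if t: "r (Suc k) < t" "t \<le> r k" for k t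
  proof -
    have "0 < t" using t(1) r(1)[of "Suc k"] by simp
    then have "avg \<mu> (\<lambda>y. \<bar>u y - a\<bar>) \<xi> t \<le> Cd ^ 1 * avg \<mu> (\<lambda>y. \<bar>u y - a\<bar>) \<xi> (r k)"
      using t r(2)[of k] by (intro avg_abs_diff_le u_int x r) auto
    also have "avg \<mu> (\<lambda>y. \<bar>u y - a\<bar>) \<xi> (r k) \<le> avg \<mu> (\<lambda>y. \<bar>u y - c k\<bar>) \<xi> (r k) + \<bar>c k - a\<bar>"
      by (intro avg_abs_diff_triangle u_int vol_pos x r)
    also have "\<dots> \<le> C1 * A k + Cd * C1 * (\<Sum>j. A (j + k))" using osc[of k] bound[of k] by simp
    finally show ?thesis using Cd unfolding B_def by (simp add: mult_left_mono)
  qed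
  have "A \<longlonglongrightarrow> 0" using s summable_LIMSEQ_zero by (simp add: A_def)
  moreover have "(\<lambda>k. \<Sum>j. A (j + k)) \<longlonglongrightarrow> 0" using s suminf_exist_split2[of A] by (simp add: A_def)
  ultimately have "B \<longlonglongrightarrow> Cd * (C1 * 0 + Cd * C1 * 0)" unfolding B_def by (intro tendsto_intros)
  then have B0: "B \<longlonglongrightarrow> 0" by simp
  have "((\<lambda>r. avg \<mu> (\<lambda>y. \<bar>u y - a\<bar>) \<xi> r) \<longlongrightarrow> 0) (at_right 0)"
  proof (rule tendstoI)
    fix e :: real assume "0 < e"
    then obtain k0 where k0: "\<And>k. k \<ge> k0 \<Longrightarrow> B k < e"
      using order_tendstoD(2)[OF B0] by (auto simp: eventually_sequentially)
    have "avg \<mu> (\<lambda>y. \<bar>u y - a\<bar>) \<xi> t < e" if t: "0 < t" "t < r k0" for t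
    proof -
      have "r k0 \<le> R" using R by (simp add: r_def field_simps)
      then obtain k where k: "r (Suc k) < t" "t \<le> r k" using dyadic_scale[of t R] t unfolding r_def by force
      have "k0 \<le> k"
      proof (rule ccontr)
        assume "\<not> k0 \<le> k"
        then have "r k0 \<le> r (Suc k)" unfolding r_def using R
          by (intro divide_left_mono power_increasing) auto
        then show False using k t by simp
      qed
      then show ?thesis using B[OF k] k0[of k] by simp
    qed
    then show "\<forall>\<^sub>F t in at_right 0. dist (avg \<mu> (\<lambda>y. \<bar>u y - a\<bar>) \<xi> t) 0 < e"
      unfolding eventually_at_right_field using r(1)[of k0]
      by (intro exI[of _ "r k0"]) (auto simp: abs_of_nonneg avg_nonneg)
  qed
  then show ?thesis using bound unfolding c_def r_def A_def by blast
qed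

lemma trace_of_summable:
  assumes x: "\<xi> \<in> closure (space \<mu>)" and R: "0 < R" and s: "summable (osc_bound mg R \<xi>)"
  shows "has_trace_value \<mu> u \<xi> (trace \<mu> u \<xi>)"
    "\<bar>avg \<mu> u \<xi> (R / 2 ^ k) - trace \<mu> u \<xi>\<bar> \<le> Cd * C1 * (\<Sum>j. osc_bound mg R \<xi> (j + k))"
    "(\<lambda>k. avg \<mu> u \<xi> (R / 2 ^ k)) \<longlonglongrightarrow> trace \<mu> u \<xi>"
proof -
  obtain a where a: "\<And>k. \<bar>avg \<mu> u \<xi> (R / 2 ^ k) - a\<bar> \<le> Cd * C1 * (\<Sum>j. osc_bound mg R \<xi> (j + k))"
    "((\<lambda>r. avg \<mu> (\<lambda>y. \<bar>u y - a\<bar>) \<xi> r) \<longlongrightarrow> 0) (at_right 0)"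
    using avg_converges[OF assms] by blast
  have t: "has_trace_value \<mu> u \<xi> a" using a(2) has_trace_value_iff[OF u_int x] by simp
  then have e: "trace \<mu> u \<xi> = a" using trace_eq[OF u_int x] by simp
  show "has_trace_value \<mu> u \<xi> (trace \<mu> u \<xi>)" using t e by simp
  show "\<bar>avg \<mu> u \<xi> (R / 2 ^ k) - trace \<mu> u \<xi>\<bar> \<le> Cd * C1 * (\<Sum>j. osc_bound mg R \<xi> (j + k))" using a(1) e by simp
  have "(\<lambda>k. \<Sum>j. osc_bound mg R \<xi> (j + k)) \<longlonglongrightarrow> 0" using suminf_exist_split2[of "osc_bound mg R \<xi>"] s by simp
  then have z: "(\<lambda>k. Cd * C1 * (\<Sum>j. osc_bound mg R \<xi> (j + k))) \<longlonglongrightarrow> 0" by (rule tendsto_mult_right_zero)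
  then have "(\<lambda>k. avg \<mu> u \<xi> (R / 2 ^ k) - trace \<mu> u \<xi>) \<longlonglongrightarrow> 0"
    using a(1) e by (intro Lim_null_comparison[OF _ z] always_eventually) simp
  then show "(\<lambda>k. avg \<mu> u \<xi> (R / 2 ^ k)) \<longlonglongrightarrow> trace \<mu> u \<xi>" by (simp add: LIM_zero_iff)
qed

lemma osc_bound_powr:
  assumes x: "\<xi> \<in> closure (space \<mu>)" and R: "0 < R"
  shows "osc_bound mg R \<xi> k powr p
    = (R / 2 ^ k) powr p * (vol mg \<xi> (3 * l * (R / 2 ^ k)) / vol \<mu> \<xi> (R / 2 ^ k))"
  using R p vol_pos[OF x, of "R / 2 ^ k"] unfolding osc_bound_def
  by (subst powr_mult) (auto simp: powr_powr)

end

end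

locale codim_space = pi_space \<mu> Cd p Cp l + m: finite_borel m
  for \<mu> :: "'a::metric_space measure" and Cd p Cp l and m :: "'a measure" +
  fixes \<Theta> Cm R :: real
  assumes m_space: "space m \<subseteq> closure (space \<mu>)"
    and \<Theta>: "0 \<le> \<Theta>" "\<Theta> < p" and Cm: "0 < Cm" and R: "0 < R"
    and m_le: "\<xi> \<in> space m \<Longrightarrow> 0 < r \<Longrightarrow> r \<le> R \<Longrightarrow> r \<le> s \<Longrightarrow> vol m \<xi> s \<le> Cm * r powr (- \<Theta>) * vol \<mu> \<xi> s"
    and m_ge: "\<xi> \<in> space m \<Longrightarrow> 0 < r \<Longrightarrow> r \<le> R \<Longrightarrow> r powr (- \<Theta>) * vol \<mu> \<xi> r \<le> Cm * vol m \<xi> r"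
begin

lemma m_pos: "\<xi> \<in> space m \<Longrightarrow> 0 < r \<Longrightarrow> r \<le> R \<Longrightarrow> 0 < vol m \<xi> r"
  using m_ge[of \<xi> r] vol_pos[of \<xi> r] m_space Cm
  by (smt (verit, ccfv_SIG) mult_pos_pos powr_gt_zero subsetD zero_less_mult_pos)

text \<open>Codimension is used from above for the large ball and from below for the small one, both
  with the power of the small radius. The powers cancel, and doubling of \<mu> remains.\<close>

lemma m_doubling:
  assumes x: "\<xi> \<in> space m" and r: "0 < r" "r \<le> R" and s: "s \<le> 2 ^ n * r"
  shows "vol m \<xi> s \<le> Cm ^ 2 * Cd ^ n * vol m \<xi> r"
proof -
  have "vol m \<xi> s \<le> vol m \<xi> (max s r)" by (intro m.vol_mono) auto
  also have "\<dots> \<le> Cm * r powr (- \<Theta>) * vol \<mu> \<xi> (max s r)" using assms by (intro m_le) auto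
  also have "\<dots> \<le> Cm * r powr (- \<Theta>) * (Cd ^ n * vol \<mu> \<xi> r)"
  proof (intro mult_left_mono vol_le)
    have "1 * r \<le> 2 ^ n * r" using r by (intro mult_right_mono) auto
    then show "dist \<xi> \<xi> + max s r \<le> 2 ^ n * r" using s by simp
  qed (use x r m_space Cm in auto)
  also have "\<dots> = Cm * Cd ^ n * (r powr (- \<Theta>) * vol \<mu> \<xi> r)" by simp
  also have "\<dots> \<le> Cm * Cd ^ n * (Cm * vol m \<xi> r)"
    using x r Cm Cd by (intro mult_left_mono m_ge) auto
  finally show ?thesis by (simp add: power2_eq_square mult_ac)
qed

lemma dist_measurable_m:
  assumes "f \<in> measurable K m" "g \<in> measurable K M" "finite_borel M"
  shows "(\<lambda>z. dist (f z) (g z)) \<in> borel_measurable K"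
  using dist_measurable[OF assms(1,2) m.sets_eq m_space] finite_borel.sets_eq[OF assms(3)] by simp

lemma vol_measurable:
  assumes M: "finite_borel M"
  shows "(\<lambda>\<xi>. vol M \<xi> r) \<in> borel_measurable m"
proof -
  interpret M: finite_borel M by fact
  let ?Q = "{z \<in> space (m \<Otimes>\<^sub>M M). dist (fst z) (snd z) < r}"
  have [measurable]: "(\<lambda>z. dist (fst z) (snd z)) \<in> borel_measurable (m \<Otimes>\<^sub>M M)"
    using M by (intro dist_measurable_m) auto
  have "?Q \<in> sets (m \<Otimes>\<^sub>M M)" by measurable
  then have "(\<lambda>\<xi>. emeasure M (Pair \<xi> -` ?Q)) \<in> borel_measurable m" by (rule M.measurable_emeasure_Pair)
  then have "(\<lambda>\<xi>. enn2real (emeasure M (Pair \<xi> -` ?Q))) \<in> borel_measurable m" by measurable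
  moreover have "Pair \<xi> -` ?Q = ball \<xi> r \<inter> space M" if "\<xi> \<in> space m" for \<xi>
    using that by (auto simp: space_pair_measure)
  ultimately show ?thesis
    by (subst measurable_cong[where g = "\<lambda>\<xi>. enn2real (emeasure M (Pair \<xi> -` ?Q))"])
      (auto simp: M.emeasure_ball)
qed

text \<open>The point \<open>z\<close> may be far from \<open>space m\<close>, so
  \<open>vol m z \<rho>\<close> may vanish; then the integrand lives on a null set. Otherwise the
  hypothesis bounds the integrand by a constant divided by the mass of the ball.\<close>

lemma inner_bound:
  assumes C: "0 \<le> C" "\<And>\<xi>. \<xi> \<in> space m \<Longrightarrow> dist z \<xi> < \<rho> \<Longrightarrow> vol m z \<rho> \<le> C * vol m \<xi> r"
    and r: "0 < r" "r \<le> R"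
  shows "(\<integral>\<^sup>+\<xi>. ennreal (1 / vol m \<xi> r) * indicator (ball z \<rho>) \<xi> \<partial>m) \<le> ennreal C"
proof (cases "vol m z \<rho> = 0")
  case True
  have "(\<integral>\<^sup>+\<xi>. ennreal (1 / vol m \<xi> r) * indicator (ball z \<rho>) \<xi> \<partial>m)
    \<le> (\<integral>\<^sup>+\<xi>. top * indicator (ball z \<rho> \<inter> space m) \<xi> \<partial>m)"
    by (intro nn_integral_mono) (auto split: split_indicator)
  also have "\<dots> = 0" using True by (simp add: nn_integral_cmult_indicator m.ball_in_sets m.emeasure_ball)
  finally show ?thesis by simp
next
  case False
  then have pos: "0 < vol m z \<rho>" by (simp add: less_le)
  have "(\<integral>\<^sup>+\<xi>. ennreal (1 / vol m \<xi> r) * indicator (ball z \<rho>) \<xi> \<partial>m)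
    \<le> (\<integral>\<^sup>+\<xi>. ennreal (C / vol m z \<rho>) * indicator (ball z \<rho> \<inter> space m) \<xi> \<partial>m)"
  proof (intro nn_integral_mono)
    fix \<xi> assume x: "\<xi> \<in> space m"
    have "1 / vol m \<xi> r \<le> C / vol m z \<rho>" if "dist z \<xi> < \<rho>"
      using C(2)[OF x that] pos m_pos[OF x r] by (simp add: field_simps)
    then show "ennreal (1 / vol m \<xi> r) * indicator (ball z \<rho>) \<xi> \<le> ennreal (C / vol m z \<rho>) * indicator (ball z \<rho> \<inter> space m) \<xi>"
      using x by (auto split: split_indicator intro: ennreal_leI)
  qed
  also have "\<dots> = ennreal C"
    using pos C(1) by (simp add: nn_integral_cmult_indicator m.ball_in_sets m.emeasure_ball ennreal_mult[symmetric])
  finally show ?thesis .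
qed

text \<open>After exchanging the integrals, \<open>z\<close> is counted with the integral of
  \<open>1 / vol m \<xi> r\<close> over the \<xi> in the ball of radius \<open>A * r\<close> about
  it, and doubling of \<open>m\<close> bounds this weight. The condition on \<open>2 * A\<close>
  arises because that ball lies in the ball of radius \<open>2 * A * r\<close> about each such
  \<xi>.\<close>

lemma tonelli_ball:
  assumes M: "finite_borel M" and r: "0 < r" "r \<le> R" and A: "2 * A \<le> 2 ^ n"
  shows "(\<integral>\<^sup>+\<xi>. ennreal (vol M \<xi> (A * r) / vol m \<xi> r) \<partial>m) \<le> ennreal (Cm ^ 2 * Cd ^ n) * emeasure M (space M)"
proof -
  interpret M: finite_borel M by fact
  interpret P: pair_sigma_finite m M ..
  have [measurable]: "(\<lambda>z. dist (fst z) (snd z)) \<in> borel_measurable (m \<Otimes>\<^sub>M M)"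
    using M by (intro dist_measurable_m) auto
  have [measurable]: "(\<lambda>\<xi>. vol m \<xi> r) \<in> borel_measurable m" by (rule vol_measurable) unfold_locales
  define F where "F \<xi> z = (if dist \<xi> z < A * r then ennreal (1 / vol m \<xi> r) else 0)" for \<xi> z
  have F[measurable]: "case_prod F \<in> borel_measurable (m \<Otimes>\<^sub>M M)"
    unfolding F_def case_prod_beta by measurable
  have "(\<integral>\<^sup>+\<xi>. ennreal (vol M \<xi> (A * r) / vol m \<xi> r) \<partial>m) = (\<integral>\<^sup>+\<xi>. \<integral>\<^sup>+z. F \<xi> z \<partial>M \<partial>m)"
  proof (intro nn_integral_cong)
    fix \<xi> assume "\<xi> \<in> space m"
    have "(\<integral>\<^sup>+z. F \<xi> z \<partial>M) = (\<integral>\<^sup>+z. ennreal (1 / vol m \<xi> r) * indicator (ball \<xi> (A * r) \<inter> space M) z \<partial>M)"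
      unfolding F_def by (intro nn_integral_cong) (auto split: split_indicator)
    also have "\<dots> = ennreal (vol M \<xi> (A * r) / vol m \<xi> r)"
      by (simp add: nn_integral_cmult_indicator M.ball_in_sets M.emeasure_ball ennreal_mult[symmetric])
    finally show "ennreal (vol M \<xi> (A * r) / vol m \<xi> r) = (\<integral>\<^sup>+z. F \<xi> z \<partial>M)" by simp
  qed
  also have "\<dots> = (\<integral>\<^sup>+z. \<integral>\<^sup>+\<xi>. F \<xi> z \<partial>m \<partial>M)"
    using P.Fubini'[OF F] by simp
  also have "\<dots> \<le> (\<integral>\<^sup>+z. ennreal (Cm ^ 2 * Cd ^ n) \<partial>M)"
  proof (intro nn_integral_mono)
    fix z assume "z \<in> space M"
    have "(\<integral>\<^sup>+\<xi>. F \<xi> z \<partial>m) = (\<integral>\<^sup>+\<xi>. ennreal (1 / vol m \<xi> r) * indicator (ball z (A * r)) \<xi> \<partial>m)"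
      unfolding F_def by (intro nn_integral_cong) (auto split: split_indicator simp: dist_commute)
    also have "\<dots> \<le> ennreal (Cm ^ 2 * Cd ^ n)"
    proof (rule inner_bound[OF _ _ r])
      fix \<xi> assume x: "\<xi> \<in> space m" and d: "dist z \<xi> < A * r"
      have "vol m z (A * r) \<le> vol m \<xi> (2 * A * r)" using d by (intro m.vol_mono) simp
      also have "\<dots> \<le> Cm ^ 2 * Cd ^ n * vol m \<xi> r"
        using A r by (intro m_doubling x) (auto intro: mult_right_mono)
      finally show "vol m z (A * r) \<le> Cm ^ 2 * Cd ^ n * vol m \<xi> r" .
    qed (use Cd in auto)
    finally show "(\<integral>\<^sup>+\<xi>. F \<xi> z \<partial>m) \<le> ennreal (Cm ^ 2 * Cd ^ n)" .
  qed
  finally show ?thesis by simp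
qed

end

subsection \<open>Traces and Lebesgue points\<close>

context codim_space
begin

definition decay :: real where "decay = (p - \<Theta>) / 2"

definition dil_exp :: nat where "dil_exp = (SOME n. 2 * (3 * l) \<le> 2 ^ n)"

lemma dil_exp: "2 * (3 * l) \<le> 2 ^ dil_exp"
proof -
  have "\<exists>n. 2 * (3 * l) \<le> 2 ^ n" using real_arch_pow[of 2 "2 * (3 * l)"] by (auto intro: less_imp_le)
  then show ?thesis unfolding dil_exp_def by (rule someI_ex)
qed

lemma decay: "0 < decay" "2 powr (- decay) < 1" "2 powr (- decay / p) < 1"
  using \<Theta> p by (auto simp: decay_def powr_less_one divide_less_0_iff)

text \<open>By \<open>epowr_suminf_le\<close> it controls the p-th power of the sum of all
  \<open>osc_bound mg R \<xi> k\<close>; unlike that power, it can be integrated term by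
  term.\<close>

definition scale_sum :: "'a measure \<Rightarrow> 'a \<Rightarrow> ennreal" where
  "scale_sum mg \<xi> = (\<Sum>k. ennreal (2 powr (decay * real k)) * epowr (ennreal (osc_bound mg R \<xi> k)) p)"

definition scale_sum_const :: real where
  "scale_sum_const = Cm * (Cm ^ 2 * Cd ^ dil_exp) * R powr (p - \<Theta>) / (1 - 2 powr (- decay))"

definition geom_const :: real where "geom_const = (1 / (1 - 2 powr (- decay / p))) powr p"

lemma scale_sum_const_nonneg: "0 \<le> scale_sum_const"
  using Cm Cd decay unfolding scale_sum_const_def by (intro divide_nonneg_nonneg mult_nonneg_nonneg) auto

lemma osc_bound_nonneg: "0 \<le> osc_bound mg R \<xi> k"
  using R by (simp add: osc_bound_def)

lemma radius_bounds: "0 < R / 2 ^ k" "R / 2 ^ k \<le> R"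
  using R by (auto simp: field_simps)

lemma avg_measurable:
  assumes f: "f \<in> borel_measurable \<mu>"
  shows "(\<lambda>\<xi>. avg \<mu> f \<xi> r) \<in> borel_measurable m"
proof -
  have fb: "finite_borel \<mu>" by unfold_locales
  have [measurable]: "(\<lambda>z. dist (fst z) (snd z)) \<in> borel_measurable (m \<Otimes>\<^sub>M \<mu>)"
    using fb by (intro dist_measurable_m) auto
  have [measurable]: "(\<lambda>\<xi>. vol \<mu> \<xi> r) \<in> borel_measurable m" by (rule vol_measurable[OF fb])
  note f [measurable]
  have "(\<lambda>\<xi>. LINT y|\<mu>. (if dist \<xi> y < r then f y else 0)) \<in> borel_measurable m"
    by (intro borel_measurable_lebesgue_integral) (simp add: case_prod_beta)
  moreover have "(LINT y|\<mu>. (if dist \<xi> y < r then f y else 0)) = (LINT y:ball \<xi> r \<inter> space \<mu>|\<mu>. f y)" for \<xi>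
    unfolding set_lebesgue_integral_def
    by (intro Bochner_Integration.integral_cong) (auto split: split_indicator)
  ultimately show ?thesis unfolding avg_def by simp
qed

context
  fixes u mg
  assumes um: "pi_pair u mg"
begin

interpretation mg: finite_borel mg using pi_pairD[OF um] by simp

lemma osc_bound_measurable: "(\<lambda>\<xi>. osc_bound mg R \<xi> k) \<in> borel_measurable m"
proof -
  have fb: "finite_borel \<mu>" "finite_borel mg" by unfold_locales
  have [measurable]: "(\<lambda>\<xi>. vol \<mu> \<xi> r) \<in> borel_measurable m" "(\<lambda>\<xi>. vol mg \<xi> r) \<in> borel_measurable m" for r
    by (rule vol_measurable[OF fb(1)], rule vol_measurable[OF fb(2)])
  show ?thesis unfolding osc_bound_def by measurable
qed

text \<open>The volume for \<mu> is traded for the volume for \<open>m\<close> at the price of a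
  power of the radius, which brings the quotient into the form that \<open>tonelli_ball\<close>
  integrates.\<close>

lemma osc_bound_powr_le:
  assumes x: "\<xi> \<in> space m"
  shows "osc_bound mg R \<xi> k powr p
     \<le> Cm * (R / 2 ^ k) powr (p - \<Theta>) * (vol mg \<xi> (3 * l * (R / 2 ^ k)) / vol m \<xi> (R / 2 ^ k))"
proof -
  let ?r = "R / 2 ^ k"
  have xc: "\<xi> \<in> closure (space \<mu>)" using x m_space by auto
  have "1 / vol \<mu> \<xi> ?r \<le> Cm * ?r powr (- \<Theta>) / vol m \<xi> ?r"
    using m_le[OF x radius_bounds order_refl] m_pos[OF x radius_bounds] vol_pos[OF xc radius_bounds(1)] by (simp add: field_simps)
  then have "?r powr p * vol mg \<xi> (3 * l * ?r) * (1 / vol \<mu> \<xi> ?r)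
      \<le> ?r powr p * vol mg \<xi> (3 * l * ?r) * (Cm * ?r powr (- \<Theta>) / vol m \<xi> ?r)"
    by (intro mult_left_mono) auto
  moreover have "?r powr (p - \<Theta>) = ?r powr p * ?r powr (- \<Theta>)" by (simp add: powr_add[symmetric])
  ultimately show ?thesis by (simp add: osc_bound_powr[OF um xc R] mult_ac)
qed

lemma scale_sum_measurable [measurable]: "scale_sum mg \<in> borel_measurable m"
proof -
  have [measurable]: "(\<lambda>\<xi>. osc_bound mg R \<xi> k) \<in> borel_measurable m" for k by (rule osc_bound_measurable)
  show ?thesis unfolding scale_sum_def[abs_def] by measurable
qed

lemma scale_sum_integral: "(\<integral>\<^sup>+\<xi>. scale_sum mg \<xi> \<partial>m) \<le> ennreal scale_sum_const * emeasure mg (space mg)"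
proof -
  have [measurable]: "(\<lambda>\<xi>. osc_bound mg R \<xi> k) \<in> borel_measurable m" for k by (rule osc_bound_measurable)
  define K0 where "K0 = Cm * (Cm ^ 2 * Cd ^ dil_exp) * R powr (p - \<Theta>)"
  have K0: "0 \<le> K0" using Cm Cd by (simp add: K0_def)
  have "(\<integral>\<^sup>+\<xi>. ennreal (2 powr (decay * real k)) * epowr (ennreal (osc_bound mg R \<xi> k)) p \<partial>m)
      \<le> ennreal (K0 * (2 powr (- decay)) ^ k) * emeasure mg (space mg)" for k
  proof -
    let ?r = "R / 2 ^ k"
    have "(\<integral>\<^sup>+\<xi>. ennreal (2 powr (decay * real k)) * epowr (ennreal (osc_bound mg R \<xi> k)) p \<partial>m)
       \<le> (\<integral>\<^sup>+\<xi>. ennreal (2 powr (decay * real k) * Cm * ?r powr (p - \<Theta>)) * ennreal (vol mg \<xi> (3 * l * ?r) / vol m \<xi> ?r) \<partial>m)"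
    proof (intro nn_integral_mono)
      fix \<xi> assume x: "\<xi> \<in> space m"
      have "2 powr (decay * real k) * (osc_bound mg R \<xi> k powr p)
        \<le> 2 powr (decay * real k) * (Cm * ?r powr (p - \<Theta>) * (vol mg \<xi> (3 * l * ?r) / vol m \<xi> ?r))"
        by (intro mult_left_mono osc_bound_powr_le x) auto
      then show "ennreal (2 powr (decay * real k)) * epowr (ennreal (osc_bound mg R \<xi> k)) p
        \<le> ennreal (2 powr (decay * real k) * Cm * ?r powr (p - \<Theta>)) * ennreal (vol mg \<xi> (3 * l * ?r) / vol m \<xi> ?r)"
        using Cm by (simp add: epowr_ennreal osc_bound_nonneg ennreal_mult[symmetric] mult.assoc ennreal_leI)
    qed
    also have "\<dots> = ennreal (2 powr (decay * real k) * Cm * ?r powr (p - \<Theta>)) * (\<integral>\<^sup>+\<xi>. ennreal (vol mg \<xi> (3 * l * ?r) / vol m \<xi> ?r) \<partial>m)"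
    proof (intro nn_integral_cmult)
      have fb: "finite_borel m" "finite_borel mg" by unfold_locales
      have [measurable]: "(\<lambda>\<xi>. vol m \<xi> r) \<in> borel_measurable m" "(\<lambda>\<xi>. vol mg \<xi> r) \<in> borel_measurable m" for r
        by (rule vol_measurable[OF fb(1)], rule vol_measurable[OF fb(2)])
      show "(\<lambda>\<xi>. ennreal (vol mg \<xi> (3 * l * ?r) / vol m \<xi> ?r)) \<in> borel_measurable m" by measurable
    qed
    also have "\<dots> \<le> ennreal (2 powr (decay * real k) * Cm * ?r powr (p - \<Theta>)) * (ennreal (Cm ^ 2 * Cd ^ dil_exp) * emeasure mg (space mg))"
      by (intro mult_left_mono tonelli_ball dil_exp radius_bounds) (auto intro: mg.finite_borel_axioms)
    also have "\<dots> = ennreal (2 powr (decay * real k) * Cm * ?r powr (p - \<Theta>) * (Cm ^ 2 * Cd ^ dil_exp)) * emeasure mg (space mg)"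
      using Cm Cd by (simp add: ennreal_mult[symmetric] mult.assoc[symmetric])
    \<comment> \<open>The power p - \<Theta> of the radius decays like 2^(-2 \<open>decay\<close>
      k); the weight consumes half of the exponent, and a geometric series is left.\<close>
    also have "2 powr (decay * real k) * Cm * ?r powr (p - \<Theta>) * (Cm ^ 2 * Cd ^ dil_exp) = K0 * (2 powr (- decay)) ^ k"
    proof -
      have "2 * decay * real k = real k * (p - \<Theta>)" by (simp add: decay_def)
      with R have "?r powr (p - \<Theta>) = R powr (p - \<Theta>) * 2 powr (- (2 * decay * real k))"
        by (simp only: powr_minus_divide) (simp add: powr_divide powr_realpow[symmetric] powr_powr)
      moreover have "2 powr (decay * real k) * 2 powr (- (2 * decay * real k)) = (2 powr (- decay)) ^ k"
        by (simp add: powr_add[symmetric] powr_realpow[symmetric] powr_powr mult.commute)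
      ultimately show ?thesis by (simp add: K0_def mult_ac)
    qed
    finally show ?thesis .
  qed
  then have "(\<Sum>k. \<integral>\<^sup>+\<xi>. ennreal (2 powr (decay * real k)) * epowr (ennreal (osc_bound mg R \<xi> k)) p \<partial>m)
     \<le> (\<Sum>k. ennreal (K0 * (2 powr (- decay)) ^ k) * emeasure mg (space mg))"
    by (intro suminf_le) auto
  also have "\<dots> = ennreal (\<Sum>k. K0 * (2 powr (- decay)) ^ k) * emeasure mg (space mg)"
    using K0 decay by (simp add: suminf_ennreal2 summable_mult)
  also have "(\<Sum>k. K0 * (2 powr (- decay)) ^ k) = scale_sum_const"
    using decay by (simp add: suminf_mult suminf_geometric scale_sum_const_def K0_def)
  finally show ?thesis unfolding scale_sum_def by (subst nn_integral_suminf) auto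
qed

lemma AE_scale_sum_finite: "AE \<xi> in m. scale_sum mg \<xi> < top"
proof -
  have "(\<integral>\<^sup>+\<xi>. scale_sum mg \<xi> \<partial>m) \<noteq> \<infinity>"
    using scale_sum_integral mg.emeasure_finite[of "space mg"]
    by (auto simp: top_unique ennreal_mult_eq_top_iff)
  from nn_integral_PInf_AE[OF scale_sum_measurable this] show ?thesis by (auto simp: less_top)
qed

lemma scale_sum_summable:
  assumes "scale_sum mg \<xi> < top"
  shows "summable (osc_bound mg R \<xi>)" "ennreal ((\<Sum>k. osc_bound mg R \<xi> k) powr p) \<le> ennreal geom_const * scale_sum mg \<xi>"
proof -
  have e: "epowr (\<Sum>k. ennreal (osc_bound mg R \<xi> k)) p \<le> ennreal geom_const * scale_sum mg \<xi>"
    unfolding geom_const_def scale_sum_def using p decay by (intro epowr_suminf_le) auto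
  also have "\<dots> < top" using assms by (simp add: ennreal_mult_less_top)
  finally have "(\<Sum>k. ennreal (osc_bound mg R \<xi> k)) < top" by simp
  then show s: "summable (osc_bound mg R \<xi>)" using osc_bound_nonneg by (intro summable_suminf_not_top) auto
  then have "(\<Sum>k. ennreal (osc_bound mg R \<xi> k)) = ennreal (\<Sum>k. osc_bound mg R \<xi> k)"
    using osc_bound_nonneg by (intro suminf_ennreal2) auto
  with e show "ennreal ((\<Sum>k. osc_bound mg R \<xi> k) powr p) \<le> ennreal geom_const * scale_sum mg \<xi>"
    using suminf_nonneg[OF s osc_bound_nonneg] by (simp add: epowr_ennreal)
qed

lemma AE_trace: "AE \<xi> in m. has_trace_value \<mu> u \<xi> (trace \<mu> u \<xi>)"
  using AE_scale_sum_finite AE_space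
  by eventually_elim (use trace_of_summable(1)[OF um _ R scale_sum_summable(1)] m_space in auto)

text \<open>Averages over balls of fixed radius are Borel functions of the centre, and so is their
  limit. The trace agrees with the limit off a null set, on which it is arbitrary; hence
  measurability for the completion.\<close>

lemma trace_measurable: "trace \<mu> u \<in> borel_measurable (completion m)"
proof (rule borel_measurable_completion_AE)
  have [measurable]: "(\<lambda>\<xi>. avg \<mu> u \<xi> (R / 2 ^ k)) \<in> borel_measurable m" for k
    using pi_pairD(1)[OF um] by (intro avg_measurable) auto
  show "(\<lambda>\<xi>. lim (\<lambda>k. avg \<mu> u \<xi> (R / 2 ^ k))) \<in> borel_measurable m" by measurable
  show "AE \<xi> in m. trace \<mu> u \<xi> = lim (\<lambda>k. avg \<mu> u \<xi> (R / 2 ^ k))"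
    using AE_scale_sum_finite AE_space
  proof eventually_elim
    case (elim \<xi>)
    then have "\<xi> \<in> closure (space \<mu>)" using m_space by auto
    from trace_of_summable(3)[OF um this R scale_sum_summable(1)[OF elim(1)]] show ?case
      by (intro limI[symmetric])
  qed
qed

text \<open>The telescoping estimate started at the largest radius. For \<open>m\<close> = \<mu> and
  \<open>R\<close> beyond the diameter the average is the global mean, and this becomes a global
  Poincare inequality.\<close>

lemma trace_Lp_bound:
  "(\<integral>\<^sup>+\<xi>. ennreal (\<bar>trace \<mu> u \<xi> - avg \<mu> u \<xi> R\<bar> powr p) \<partial>m)
    \<le> ennreal ((Cd * C1) powr p * geom_const * scale_sum_const) * emeasure mg (space mg)"
proof -
  have "(\<integral>\<^sup>+\<xi>. ennreal (\<bar>trace \<mu> u \<xi> - avg \<mu> u \<xi> R\<bar> powr p) \<partial>m)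
     \<le> (\<integral>\<^sup>+\<xi>. ennreal ((Cd * C1) powr p * geom_const) * scale_sum mg \<xi> \<partial>m)"
  proof (rule nn_integral_mono_AE)
    show "AE \<xi> in m. ennreal (\<bar>trace \<mu> u \<xi> - avg \<mu> u \<xi> R\<bar> powr p) \<le> ennreal ((Cd * C1) powr p * geom_const) * scale_sum mg \<xi>"
      using AE_scale_sum_finite AE_space
    proof eventually_elim
      case (elim \<xi>)
      then have "\<xi> \<in> closure (space \<mu>)" using m_space by auto
      from trace_of_summable(2)[OF um this R scale_sum_summable(1)[OF elim(1)], of 0]
      have "\<bar>trace \<mu> u \<xi> - avg \<mu> u \<xi> R\<bar> \<le> Cd * C1 * (\<Sum>j. osc_bound mg R \<xi> j)" by (simp add: abs_minus_commute)
      then have "\<bar>trace \<mu> u \<xi> - avg \<mu> u \<xi> R\<bar> powr p \<le> (Cd * C1 * (\<Sum>j. osc_bound mg R \<xi> j)) powr p"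
        using p by (intro powr_mono2) auto
      also have "\<dots> = (Cd * C1) powr p * (\<Sum>j. osc_bound mg R \<xi> j) powr p"
        using Cd C1_pos suminf_nonneg[OF scale_sum_summable(1)[OF elim(1)] osc_bound_nonneg] by (subst powr_mult) auto
      finally have "ennreal (\<bar>trace \<mu> u \<xi> - avg \<mu> u \<xi> R\<bar> powr p)
        \<le> ennreal ((Cd * C1) powr p) * ennreal ((\<Sum>j. osc_bound mg R \<xi> j) powr p)"
        by (simp add: ennreal_mult[symmetric] ennreal_leI)
      also have "\<dots> \<le> ennreal ((Cd * C1) powr p) * (ennreal geom_const * scale_sum mg \<xi>)"
        by (intro mult_left_mono scale_sum_summable(2) elim) auto
      finally show ?case by (simp add: ennreal_mult geom_const_def mult.assoc)
    qed
  qed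
  also have "\<dots> \<le> ennreal ((Cd * C1) powr p * geom_const) * (ennreal scale_sum_const * emeasure mg (space mg))"
    using scale_sum_integral by (simp add: nn_integral_cmult mult_left_mono)
  finally show ?thesis using scale_sum_const_nonneg by (simp add: ennreal_mult geom_const_def mult.assoc)
qed

end

end

context pi_space
begin

text \<open>For \<Theta> = 0 the powers of the radius are 1, so \<mu> is codimensional to itself
  with constant 1.\<close>

lemma codim_space_self: "0 < R \<Longrightarrow> codim_space \<mu> Cd p Cp l \<mu> 0 1 R"
  using p closure_subset by unfold_locales (auto simp: vol_mono)

text \<open>Lebesgue differentiation, deduced from the Poincare inequality alone.\<close>

lemma trace_ae_eq:
  assumes um: "pi_pair u mg"
  shows "AE x in \<mu>. trace \<mu> u x = u x"
proof -
  interpret c: codim_space \<mu> Cd p Cp l \<mu> 0 1 1 by (rule codim_space_self) simp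
  interpret mg: finite_borel mg using pi_pairD[OF um] by simp
  interpret P: pair_sigma_finite \<mu> \<mu> ..
  note u_int = pi_pairD(1)[OF um]
  have [measurable]: "u \<in> borel_measurable \<mu>" using u_int by auto
  define r :: "nat \<Rightarrow> real" where "r k = 1 / 2 ^ k" for k
  have r: "0 < r k" for k by (simp add: r_def)
  have fb: "finite_borel \<mu>" by unfold_locales
  have [measurable]: "(\<lambda>z. dist (fst z) (snd z)) \<in> borel_measurable (\<mu> \<Otimes>\<^sub>M \<mu>)"
    using fb by (intro c.dist_measurable_m) auto
  have [measurable]: "(\<lambda>\<xi>. vol \<mu> \<xi> t) \<in> borel_measurable \<mu>" for t by (rule c.vol_measurable[OF fb])
  have [measurable]: "(\<lambda>\<xi>. avg \<mu> u \<xi> t) \<in> borel_measurable \<mu>" for t by (rule c.avg_measurable) simp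
  \<comment> \<open>\<open>t k powr p\<close> is the reciprocal of the weight of the k-th term of
    \<open>scale_sum\<close>, which is therefore the p-th power of
    \<open>osc_bound mg 1 z k / t k\<close>.\<close>
  define t where "t k = 2 powr (- c.decay * real k / p)" for k :: nat
  \<comment> \<open>Integrated over \<open>z\<close>, this compares \<open>u x\<close> with averages
    about points near \<open>x\<close>. The volume is taken about \<open>z\<close> and not about
    \<open>x\<close>, so that integrating over \<open>x\<close> instead gives exactly the mean
    oscillation on the ball about \<open>z\<close>.\<close>
  define f where "f k x z = (if dist x z < r k then ennreal (1 / vol \<mu> z (r k)) * ennreal \<bar>u x - avg \<mu> u z (r k)\<bar> else 0)" for k x z
  have f [measurable]: "case_prod (f k) \<in> borel_measurable (\<mu> \<Otimes>\<^sub>M \<mu>)" for k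
    unfolding f_def case_prod_beta by measurable
  define F where "F k x = (\<integral>\<^sup>+z. f k x z \<partial>\<mu>)" for k x
  have F [measurable]: "F k \<in> borel_measurable \<mu>" for k
    unfolding F_def[abs_def] by measurable
  have cl: "x \<in> closure (space \<mu>)" if "x \<in> space \<mu>" for x using that closure_subset by auto
  have F_int: "(\<integral>\<^sup>+x. F k x \<partial>\<mu>) \<le> ennreal (C1 * t k) * (emeasure \<mu> (space \<mu>) + (\<integral>\<^sup>+z. c.scale_sum mg z \<partial>\<mu>))" for k
  proof -
    have "(\<integral>\<^sup>+x. F k x \<partial>\<mu>) = (\<integral>\<^sup>+z. \<integral>\<^sup>+x. f k x z \<partial>\<mu> \<partial>\<mu>)"
      unfolding F_def using P.Fubini'[OF f[of k]] by simp
    also have "\<dots> \<le> (\<integral>\<^sup>+z. ennreal (C1 * t k) * (1 + c.scale_sum mg z) \<partial>\<mu>)"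
    proof (intro nn_integral_mono)
      fix z assume z: "z \<in> space \<mu>"
      let ?a = "avg \<mu> u z (r k)"
      have "(\<integral>\<^sup>+x. f k x z \<partial>\<mu>)
        = (\<integral>\<^sup>+x. ennreal (1 / vol \<mu> z (r k)) * ennreal (indicator (ball z (r k) \<inter> space \<mu>) x *\<^sub>R \<bar>u x - ?a\<bar>) \<partial>\<mu>)"
        unfolding f_def by (intro nn_integral_cong) (auto split: split_indicator simp: dist_commute)
      also have "\<dots> = ennreal (1 / vol \<mu> z (r k)) * (\<integral>\<^sup>+x. ennreal (indicator (ball z (r k) \<inter> space \<mu>) x *\<^sub>R \<bar>u x - ?a\<bar>) \<partial>\<mu>)"
        by (intro nn_integral_cmult) (use ball_in_sets in measurable)
      also have "(\<integral>\<^sup>+x. ennreal (indicator (ball z (r k) \<inter> space \<mu>) x *\<^sub>R \<bar>u x - ?a\<bar>) \<partial>\<mu>)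
        = ennreal (LINT x:ball z (r k) \<inter> space \<mu>|\<mu>. \<bar>u x - ?a\<bar>)"
        unfolding set_lebesgue_integral_def
        using set_integrable_ball[OF integrable_abs_diff[OF u_int, of ?a], of z "r k"]
        by (intro nn_integral_eq_integral) (auto simp: set_integrable_def)
      also have "ennreal (1 / vol \<mu> z (r k)) * \<dots> = ennreal (avg \<mu> (\<lambda>x. \<bar>u x - ?a\<bar>) z (r k))"
        unfolding avg_def by (simp add: ennreal_mult'[symmetric])
      also have "\<dots> \<le> ennreal (C1 * osc_bound mg 1 z k)"
        using poincare_closure[OF um cl[OF z] r[of k]] by (intro ennreal_leI) (simp add: osc_bound_def r_def)
      also have "\<dots> = ennreal C1 * ennreal (osc_bound mg 1 z k)"
        using C1_pos c.osc_bound_nonneg by (simp add: ennreal_mult)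
      also have "ennreal (osc_bound mg 1 z k) \<le> ennreal (t k) * (1 + c.scale_sum mg z)"
      proof -
        let ?q = "osc_bound mg 1 z k / t k"
        have t: "0 < t k" by (simp add: t_def)
        have q0: "0 \<le> ?q" using t c.osc_bound_nonneg[of mg z k] by simp
        \<comment> \<open>Trades the first power for the p-th power, the one that
          \<open>scale_sum\<close> controls; the summand 1 is harmless because the total mass is
          finite and \<open>t k\<close> tends to zero.\<close>
        have "?q \<le> 1 + ?q powr p"
        proof (cases "?q \<le> 1")
          case False
          then have "?q powr 1 \<le> ?q powr p" using p by (intro powr_mono) auto
          then show ?thesis using q0 by (simp only: powr_one)
        qed (use q0 in \<open>simp add: add_increasing2\<close>)
        moreover have "?q powr p = 2 powr (c.decay * real k) * osc_bound mg 1 z k powr p"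
        proof -
          have "t k powr p = 2 powr (- c.decay * real k)" using p by (simp add: t_def powr_powr)
          then show ?thesis
            using t c.osc_bound_nonneg[of mg z k] by (simp add: powr_divide powr_minus divide_simps powr_add[symmetric])
              (metis mult.commute)
        qed
        ultimately have "osc_bound mg 1 z k \<le> t k * (1 + 2 powr (c.decay * real k) * osc_bound mg 1 z k powr p)"
          using t by (simp add: field_simps)
        then have "ennreal (osc_bound mg 1 z k) \<le> ennreal (t k) * (1 + ennreal (2 powr (c.decay * real k)) * epowr (ennreal (osc_bound mg 1 z k)) p)"
          using t c.osc_bound_nonneg[of mg z k]
          by (simp add: epowr_ennreal ennreal_mult[symmetric] ennreal_1[symmetric] ennreal_plus[symmetric] ennreal_leI
              del: ennreal_1 ennreal_plus)
        also have "ennreal (2 powr (c.decay * real k)) * epowr (ennreal (osc_bound mg 1 z k)) p \<le> c.scale_sum mg z"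
          unfolding c.scale_sum_def
          using sum_le_suminf[of "\<lambda>k. ennreal (2 powr (c.decay * real k)) * epowr (ennreal (osc_bound mg 1 z k)) p" "{k}"] by simp
        finally show ?thesis by (simp add: add_left_mono mult_left_mono)
      qed
      finally show "(\<integral>\<^sup>+x. f k x z \<partial>\<mu>) \<le> ennreal (C1 * t k) * (1 + c.scale_sum mg z)"
        using C1_pos by (simp add: ennreal_mult t_def mult.assoc mult_left_mono)
    qed
    also have "\<dots> = ennreal (C1 * t k) * (emeasure \<mu> (space \<mu>) + (\<integral>\<^sup>+z. c.scale_sum mg z \<partial>\<mu>))"
      using c.scale_sum_measurable[OF um] by (simp add: nn_integral_cmult nn_integral_add)
    finally show ?thesis .
  qed
  have "(\<integral>\<^sup>+z. c.scale_sum mg z \<partial>\<mu>) < top"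
    using c.scale_sum_integral[OF um] mg.emeasure_finite[of "space mg"]
    by (metis ennreal_less_top ennreal_mult_less_top le_less_trans less_top)
  then have "emeasure \<mu> (space \<mu>) + (\<integral>\<^sup>+z. c.scale_sum mg z \<partial>\<mu>) < top" by (simp add: less_top[symmetric])
  then obtain T where T: "emeasure \<mu> (space \<mu>) + (\<integral>\<^sup>+z. c.scale_sum mg z \<partial>\<mu>) = ennreal T" "0 \<le> T"
    by (cases "emeasure \<mu> (space \<mu>) + (\<integral>\<^sup>+z. c.scale_sum mg z \<partial>\<mu>)") auto
  have t_pow: "t k = (2 powr (- c.decay / p)) ^ k" for k by (simp add: t_def powr_realpow[symmetric] powr_powr)
  have "t \<longlonglongrightarrow> 0" unfolding t_pow[abs_def] using c.decay(3) by (intro LIMSEQ_realpow_zero) auto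
  then have "(\<lambda>k. C1 * t k * T) \<longlonglongrightarrow> 0" by (intro tendsto_mult_left_zero tendsto_mult_right_zero)
  then have "(\<lambda>k. ennreal (C1 * t k * T)) \<longlonglongrightarrow> ennreal 0" by (rule tendsto_ennrealI)
  then have "(\<lambda>k. ennreal (C1 * t k) * (emeasure \<mu> (space \<mu>) + (\<integral>\<^sup>+z. c.scale_sum mg z \<partial>\<mu>))) \<longlonglongrightarrow> 0"
    using T C1_pos by (simp add: ennreal_mult t_def)
  then have "(\<lambda>k. \<integral>\<^sup>+x. F k x \<partial>\<mu>) \<longlonglongrightarrow> 0"
    by (rule tendsto_sandwich[OF _ _ tendsto_const, rotated 2]) (intro always_eventually allI F_int zero_le)+
  then have "liminf (\<lambda>k. \<integral>\<^sup>+x. F k x \<partial>\<mu>) = 0" by (simp add: lim_imp_Liminf)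
  \<comment> \<open>Fatou's lemma: the integrals of \<open>F k\<close> tend to zero, so the lower
    limit vanishes almost everywhere and no subsequence has to be chosen.\<close>
  then have "(\<integral>\<^sup>+x. liminf (\<lambda>k. F k x) \<partial>\<mu>) = 0"
    using nn_integral_liminf[of F \<mu>] F by simp
  then have ae: "AE x in \<mu>. liminf (\<lambda>k. F k x) = 0"
    by (subst (asm) nn_integral_0_iff_AE) auto
  show ?thesis
    using ae c.AE_trace[OF um] AE_space
  proof eventually_elim
    case (elim x)
    note x = cl[OF elim(3)]
    define a where "a = trace \<mu> u x"
    define E where "E k = avg \<mu> (\<lambda>y. \<bar>u y - a\<bar>) x (2 * r k)" for k
    have "((\<lambda>r. avg \<mu> (\<lambda>y. \<bar>u y - a\<bar>) x r) \<longlongrightarrow> 0) (at_right 0)"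
      using elim(2) has_trace_value_iff[OF pi_pairD(1)[OF um] x] by (simp add: a_def)
    moreover have "filterlim (\<lambda>k. 2 * r k) (at_right 0) sequentially"
      unfolding filterlim_at r_def
      using tendsto_mult_right_zero[OF LIMSEQ_inverse_realpow_zero[of 2], of 2] by (simp add: divide_inverse)
    ultimately have E0: "E \<longlonglongrightarrow> 0" unfolding E_def by (rule filterlim_compose)
    \<comment> \<open>Averages about points \<open>z\<close> close to \<open>x\<close> are within
      \<open>Cd ^ 2 * E k\<close> of the trace value \<open>a\<close>, so \<open>F k x\<close>
      cannot be small unless \<open>u x\<close> is close to \<open>a\<close>.\<close>
    have low: "ennreal (\<bar>u x - a\<bar> - Cd ^ 2 * E k) \<le> ennreal Cd * F k x" for k
    proof -
      have "ennreal (\<bar>u x - a\<bar> - Cd ^ 2 * E k) =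
        ennreal Cd * (\<integral>\<^sup>+z. ennreal (1 / (Cd * vol \<mu> x (r k)) * max 0 (\<bar>u x - a\<bar> - Cd ^ 2 * E k)) * indicator (ball x (r k) \<inter> space \<mu>) z \<partial>\<mu>)"
        using Cd vol_pos[OF x r[of k]]
        by (simp add: nn_integral_cmult_indicator ball_in_sets emeasure_ball ennreal_mult'[symmetric] max_def ennreal_neg)
      also have "\<dots> \<le> ennreal Cd * F k x"
        unfolding F_def
      proof (intro mult_left_mono nn_integral_mono)
        fix z assume z: "z \<in> space \<mu>"
        show "ennreal (1 / (Cd * vol \<mu> x (r k)) * max 0 (\<bar>u x - a\<bar> - Cd ^ 2 * E k)) * indicator (ball x (r k) \<inter> space \<mu>) z \<le> f k x z"
        proof (cases "dist x z < r k")
          case True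
          have "\<bar>avg \<mu> u z (r k) - a\<bar> \<le> avg \<mu> (\<lambda>y. \<bar>u y - a\<bar>) z (r k)"
            by (intro abs_avg_diff_le u_int vol_pos cl z r)
          also have "\<dots> \<le> Cd ^ 2 * E k"
            unfolding E_def using True r[of k] x cl[OF z]
            by (intro avg_abs_diff_le u_int) (auto simp: dist_commute)
          finally have 1: "\<bar>u x - a\<bar> - Cd ^ 2 * E k \<le> \<bar>u x - avg \<mu> u z (r k)\<bar>" by linarith
          have "vol \<mu> z (r k) \<le> Cd ^ 1 * vol \<mu> x (r k)"
            using True by (intro vol_le x r) (simp add: dist_commute)
          then have 2: "1 / (Cd * vol \<mu> x (r k)) \<le> 1 / vol \<mu> z (r k)"
            using vol_pos[OF cl[OF z] r[of k]] by (intro divide_left_mono) auto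
          have "1 / (Cd * vol \<mu> x (r k)) * max 0 (\<bar>u x - a\<bar> - Cd ^ 2 * E k) \<le> 1 / vol \<mu> z (r k) * \<bar>u x - avg \<mu> u z (r k)\<bar>"
            using 1 2 by (intro mult_mono) auto
          then show ?thesis using True z by (simp add: f_def ennreal_mult'[symmetric] ennreal_leI)
        qed (auto split: split_indicator)
      qed auto
      finally show ?thesis .
    qed
    have low': "ennreal (1 / Cd * (\<bar>u x - a\<bar> - Cd ^ 2 * E k)) \<le> F k x" for k
    proof -
      have "ennreal (1 / Cd) * ennreal (\<bar>u x - a\<bar> - Cd ^ 2 * E k) \<le> ennreal (1 / Cd) * (ennreal Cd * F k x)"
        by (intro mult_left_mono low) auto
      also have "\<dots> = F k x" using Cd by (simp add: mult.assoc[symmetric] ennreal_mult[symmetric])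
      finally show ?thesis using Cd by (subst ennreal_mult') auto
    qed
    have "(\<lambda>k. ennreal (1 / Cd * (\<bar>u x - a\<bar> - Cd ^ 2 * E k))) \<longlonglongrightarrow> ennreal (1 / Cd * (\<bar>u x - a\<bar> - Cd ^ 2 * 0))"
      by (intro tendsto_intros E0)
    then have "ennreal (1 / Cd * \<bar>u x - a\<bar>) = liminf (\<lambda>k. ennreal (1 / Cd * (\<bar>u x - a\<bar> - Cd ^ 2 * E k)))"
      by (simp add: lim_imp_Liminf)
    also have "\<dots> \<le> liminf (\<lambda>k. F k x)"
      by (intro Liminf_mono always_eventually allI low')
    also have "\<dots> = 0" by (rule elim(1))
    finally have "1 / Cd * \<bar>u x - a\<bar> \<le> 0" by (simp add: ennreal_eq_0_iff)
    then have "\<bar>u x - a\<bar> \<le> 0" using Cd by (simp add: field_simps)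
    then show ?case by (simp add: a_def)
  qed
qed

lemma Lp_poincare:
  shows "\<exists>K. \<forall>u mg. pi_pair u mg \<longrightarrow>
    (\<integral>\<^sup>+x. ennreal (\<bar>u x - (LINT y|\<mu>. u y) / measure \<mu> (space \<mu>)\<bar> powr p) \<partial>\<mu>) \<le> ennreal K * emeasure mg (space mg)"
proof -
  obtain D where D: "\<And>x y. x \<in> space \<mu> \<Longrightarrow> y \<in> space \<mu> \<Longrightarrow> dist x y \<le> D"
    using bounded_space unfolding bounded_two_points by auto
  \<comment> \<open>Larger than the diameter, so that every ball of radius \<open>R\<close> is the
    whole space and its average is the global mean.\<close>
  define R where "R = max 0 D + 1"
  have R: "0 < R" by (simp add: R_def)
  have b: "ball x R \<inter> space \<mu> = space \<mu>" if "x \<in> space \<mu>" for x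
  proof -
    have "dist x y < R" if "y \<in> space \<mu>" for y
      using D[OF \<open>x \<in> space \<mu>\<close> that] by (simp add: R_def)
    then show ?thesis by auto
  qed
  interpret c: codim_space \<mu> Cd p Cp l \<mu> 0 1 R by (rule codim_space_self) fact
  have "(\<integral>\<^sup>+x. ennreal (\<bar>u x - (LINT y|\<mu>. u y) / measure \<mu> (space \<mu>)\<bar> powr p) \<partial>\<mu>)
      \<le> ennreal ((Cd * C1) powr p * c.geom_const * c.scale_sum_const) * emeasure mg (space mg)" if um: "pi_pair u mg" for u mg
  proof -
    have "(\<integral>\<^sup>+x. ennreal (\<bar>u x - (LINT y|\<mu>. u y) / measure \<mu> (space \<mu>)\<bar> powr p) \<partial>\<mu>)
       = (\<integral>\<^sup>+x. ennreal (\<bar>trace \<mu> u x - avg \<mu> u x R\<bar> powr p) \<partial>\<mu>)"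
    proof (rule nn_integral_cong_AE)
      show "AE x in \<mu>. ennreal (\<bar>u x - (LINT y|\<mu>. u y) / measure \<mu> (space \<mu>)\<bar> powr p)
          = ennreal (\<bar>trace \<mu> u x - avg \<mu> u x R\<bar> powr p)"
        using trace_ae_eq[OF um] AE_space
        by eventually_elim (simp add: avg_def vol_def b set_integral_space[OF pi_pairD(1)[OF um]])
    qed
    then show ?thesis using c.trace_Lp_bound[OF um] by simp
  qed
  then show ?thesis by blast
qed

end

subsection \<open>Whitney layers and the Besov estimate\<close>

text \<open>\<open>R\<close> is a quarter of the diameter of the boundary. For every radius up to
  \<open>R\<close> there is then a second boundary point far enough away for
  \<open>corkscrew\<close>, and the intervals from \<open>2 * R / 2 ^ j\<close> to
  \<open>4 * R / 2 ^ j\<close> exhaust the positive distances between boundary points.\<close>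

locale trace_space = codim_space \<mu> Cd p Cp l \<nu> \<Theta> Cm R
  for \<mu> :: "'a::metric_space measure" and Cd p Cp l \<nu> \<Theta> Cm R +
  fixes Cu :: real
  assumes space_nu: "space \<nu> = bdry (space \<mu>)"
    and diam: "diameter (space \<nu>) = 4 * R"
    and Cu: "1 \<le> Cu"
    and uniform: "x \<in> space \<mu> \<Longrightarrow> y \<in> space \<mu> \<Longrightarrow> x \<noteq> y \<Longrightarrow>
      \<exists>\<gamma>. path \<gamma> \<and> path_image \<gamma> \<subseteq> space \<mu> \<and> pathstart \<gamma> = x \<and> pathfinish \<gamma> = y \<and>
        curve_length \<gamma> 0 1 \<le> ennreal (Cu * dist x y) \<and>
        (\<forall>t\<in>{0..1}. min (curve_length \<gamma> 0 t) (curve_length \<gamma> t 1) \<le> ennreal (Cu * infdist (\<gamma> t) (bdry (space \<mu>))))"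
begin

abbreviation "bdry_dist x \<equiv> infdist x (bdry (space \<mu>))"

section \<open>Corkscrew points and chains of balls away from the boundary\<close>

lemma bdry_ne: "bdry (space \<mu>) \<noteq> {}"
proof
  assume "bdry (space \<mu>) = {}"
  then have "diameter (space \<nu>) = 0" unfolding space_nu by simp
  then show False using diam R by simp
qed

lemma bdry_dist_triangle: "bdry_dist x \<le> bdry_dist y + dist x y"
  by (rule infdist_triangle)

text \<open>Since the diameter exceeds \<open>3 * r\<close>, some boundary point \<eta> is more than
  \<open>3 / 2 * r\<close> away. A curve from near \<xi> to near \<eta> crosses the sphere of radius
  \<open>3 / 4 * r\<close> about \<xi>. There both subcurves have length at least
  \<open>r / 2\<close>, and the condition on uniform curves keeps the crossing point away from the
  boundary.\<close>

lemma corkscrew: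
  assumes x: "\<xi> \<in> bdry (space \<mu>)" and r: "0 < r" "r \<le> R"
  shows "\<exists>w\<in>space \<mu>. dist w \<xi> \<le> r \<and> r / (2 * Cu) \<le> bdry_dist w"
proof -
  have "\<exists>\<eta>\<in>bdry (space \<mu>). 3 / 2 * r < dist \<xi> \<eta>"
  proof (rule ccontr)
    assume "\<not> ?thesis"
    then have d: "dist \<xi> \<eta> \<le> 3 / 2 * r" if "\<eta> \<in> bdry (space \<mu>)" for \<eta> using that by (auto simp: not_less)
    have "diameter (space \<nu>) \<le> 3 * r"
    proof -
      have "dist x y \<le> 3 * r" if xy: "x \<in> bdry (space \<mu>)" "y \<in> bdry (space \<mu>)" for x y
      proof -
        have "dist x y \<le> dist \<xi> x + dist \<xi> y" by (metis dist_commute dist_triangle)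
        then show ?thesis using d[OF xy(1)] d[OF xy(2)] by simp
      qed
      then show ?thesis unfolding space_nu diameter_def using bdry_ne by (auto intro!: cSUP_least)
    qed
    then show False using diam r R by simp
  qed
  then obtain \<eta> where \<eta>: "\<eta> \<in> bdry (space \<mu>)" "3 / 2 * r < dist \<xi> \<eta>" by blast
  have cl: "\<xi> \<in> closure (space \<mu>)" "\<eta> \<in> closure (space \<mu>)" using x \<eta> by (auto simp: bdry_def)
  have "0 < r / 4" using r by simp
  then obtain x y where xy: "x \<in> space \<mu>" "dist x \<eta> < r / 4" "y \<in> space \<mu>" "dist y \<xi> < r / 4"
    using cl by (metis closure_approachable)
  have "dist \<xi> \<eta> \<le> dist x \<xi> + dist x \<eta>" by (metis dist_commute dist_triangle)
  then have x\<xi>: "5 / 4 * r < dist x \<xi>" using \<eta> xy by simp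
  then have "y \<noteq> x" using xy r by auto
  then obtain \<gamma> where \<gamma>: "path \<gamma>" "path_image \<gamma> \<subseteq> space \<mu>" "\<gamma> 0 = y" "\<gamma> 1 = x"
      "\<And>t. t \<in> {0..1} \<Longrightarrow> min (curve_length \<gamma> 0 t) (curve_length \<gamma> t 1) \<le> ennreal (Cu * bdry_dist (\<gamma> t))"
    using uniform[OF xy(3) xy(1)] by (auto simp: pathstart_def pathfinish_def)
  have "continuous_on {0..1} (\<lambda>t. dist (\<gamma> t) \<xi>)"
    using \<gamma>(1) unfolding path_def by (intro continuous_intros)
  then obtain t where t: "t \<in> {0..1}" "dist (\<gamma> t) \<xi> = 3 / 4 * r"
    using IVT'[of "\<lambda>t. dist (\<gamma> t) \<xi>" 0 "3 / 4 * r" 1] xy x\<xi> r \<gamma>(3,4) by auto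
  have "dist (\<gamma> t) \<xi> \<le> dist (\<gamma> 0) (\<gamma> t) + dist y \<xi>" using \<gamma>(3) by (metis dist_commute dist_triangle)
  then have "r / 2 \<le> dist (\<gamma> 0) (\<gamma> t)" using t xy by simp
  moreover have "dist x \<xi> \<le> dist (\<gamma> t) (\<gamma> 1) + dist (\<gamma> t) \<xi>" using \<gamma>(4) by (metis dist_commute dist_triangle)
  then have "r / 2 \<le> dist (\<gamma> t) (\<gamma> 1)" using t x\<xi> by simp
  ultimately have "ennreal (r / 2) \<le> min (curve_length \<gamma> 0 t) (curve_length \<gamma> t 1)"
    using dist_le_curve_length[of 0 t \<gamma>] dist_le_curve_length[of t 1 \<gamma>] t
    by (auto intro: order_trans[OF ennreal_leI])
  also note \<gamma>(5)[OF t(1)]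
  finally have "r / 2 \<le> Cu * bdry_dist (\<gamma> t)" using Cu by (simp add: infdist_nonneg)
  then have "r / (2 * Cu) \<le> bdry_dist (\<gamma> t)" using Cu by (simp add: field_simps)
  moreover have "\<gamma> t \<in> space \<mu>" using \<gamma>(2) t by (auto simp: path_image_def)
  ultimately show ?thesis using t r by (intro bexI[of _ "\<gamma> t"]) auto
qed

text \<open>Points equally spaced in arc length on a uniform curve. Where both subcurves have length
  at least \<open>c * r / 2\<close>, the uniform condition bounds the distance to the boundary from
  below. Elsewhere the point is within \<open>c * r / 2\<close> of an end of the curve and inherits
  half of that end's distance.\<close>

lemma chain_points:
  assumes xy: "x \<in> space \<mu>" "y \<in> space \<mu>" and c: "0 < c" "c * r \<le> bdry_dist x" "c * r \<le> bdry_dist y"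
    and r: "0 < r" and d: "dist x y \<le> 6 * r" and N: "0 < (N::nat)"
  shows "\<exists>z. z 0 = x \<and> z N = y \<and> (\<forall>i\<le>N. z i \<in> space \<mu> \<and> c * r / (2 * Cu) \<le> bdry_dist (z i) \<and> dist (z i) x \<le> 6 * Cu * r)
    \<and> (\<forall>i<N. dist (z i) (z (Suc i)) \<le> 6 * Cu * r / N)"
proof (cases "x = y")
  case True
  have "c * r / (2 * Cu) \<le> c * r / 1" using c r Cu by (intro divide_left_mono) auto
  then show ?thesis using True xy c r Cu by (intro exI[of _ "\<lambda>_. x"]) auto
next
  case False
  obtain \<gamma> where \<gamma>: "path \<gamma>" "path_image \<gamma> \<subseteq> space \<mu>" "\<gamma> 0 = x" "\<gamma> 1 = y"
      "curve_length \<gamma> 0 1 \<le> ennreal (Cu * dist x y)"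
      "\<And>t. t \<in> {0..1} \<Longrightarrow> min (curve_length \<gamma> 0 t) (curve_length \<gamma> t 1) \<le> ennreal (Cu * bdry_dist (\<gamma> t))"
    using uniform[OF xy False] by (auto simp: pathstart_def pathfinish_def)
  have fin: "curve_length \<gamma> 0 1 < \<infinity>" using \<gamma>(5) by (auto intro: le_less_trans)
  define L where "L = enn2real (curve_length \<gamma> 0 1)"
  have L: "curve_length \<gamma> 0 1 = ennreal L" "0 \<le> L" using fin by (auto simp: L_def)
  have "L \<le> Cu * dist x y" using \<gamma>(5) L Cu by simp
  also have "\<dots> \<le> Cu * (6 * r)" using d Cu by (intro mult_left_mono) auto
  finally have L6: "L \<le> 6 * Cu * r" by simp
  define z where "z i = arc_param \<gamma> (real i * L / N)" for i :: nat
  have zi: "z i \<in> space \<mu> \<and> c * r / (2 * Cu) \<le> bdry_dist (z i) \<and> dist (z i) x \<le> 6 * Cu * r" if i: "i \<le> N" for i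
  proof -
    define s where "s = real i * L / N"
    have "real i * L \<le> real N * L" using i L by (intro mult_right_mono) auto
    then have s: "0 \<le> s" "s \<le> L" using L N by (auto simp: s_def field_simps)
    obtain t where t: "t \<in> {0..1}" "curve_length \<gamma> 0 t = ennreal s" "z i = \<gamma> t"
      using arc_param_eq[OF \<gamma>(1) fin, of s] s unfolding z_def L_def[symmetric] s_def by auto
    have "ennreal s + curve_length \<gamma> t 1 = ennreal s + ennreal (L - s)"
      using curve_length_add[of 0 t 1 \<gamma>] t L s by (simp add: ennreal_plus[symmetric] del: ennreal_plus)
    then have t1: "curve_length \<gamma> t 1 = ennreal (L - s)"
      using ennreal_add_left_cancel[of "ennreal s"] by simp
    have m: "min s (L - s) \<le> Cu * bdry_dist (\<gamma> t)"
      using \<gamma>(6)[OF t(1)] s Cu unfolding t(2) t1 by (auto simp: min_def infdist_nonneg split: if_splits)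
    have d1: "dist x (\<gamma> t) \<le> s" using dist_le_curve_length[of 0 t \<gamma>] t s \<gamma>(3) by simp
    have d2: "dist (\<gamma> t) y \<le> L - s" using dist_le_curve_length[of t 1 \<gamma>] t t1 s \<gamma>(4) by simp
    have "c * r / 2 / Cu \<le> bdry_dist (\<gamma> t)"
    proof (cases "c * r / 2 \<le> min s (L - s)")
      case True
      then have "c * r / 2 \<le> Cu * bdry_dist (\<gamma> t)" using m by linarith
      then show ?thesis using Cu by (simp add: field_simps)
    next
      case False
      then have "c * r / 2 \<le> bdry_dist (\<gamma> t)"
        using d1 d2 c bdry_dist_triangle[of x "\<gamma> t"] bdry_dist_triangle[of y "\<gamma> t"] by (auto simp: min_def dist_commute split: if_splits)
      moreover have "c * r / 2 / Cu \<le> c * r / 2 / 1" using c r Cu by (intro divide_left_mono) auto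
      ultimately show ?thesis by simp
    qed
    then show ?thesis using t d1 s L6 \<gamma>(2) by (auto simp: path_image_def dist_commute)
  qed
  have "dist (z i) (z (Suc i)) \<le> 6 * Cu * r / N" if i: "i < N" for i
  proof -
    have "real (Suc i) * L \<le> real N * L" using i L by (intro mult_right_mono) auto
    then have "dist (z i) (z (Suc i)) \<le> real (Suc i) * L / N - real i * L / N"
      unfolding z_def using L N
      by (intro arc_param_lipschitz[OF \<gamma>(1) fin]) (auto simp: divide_right_mono mult_right_mono L_def[symmetric] field_simps)
    also have "\<dots> = L / N" by (simp add: distrib_right add_divide_distrib)
    also have "\<dots> \<le> 6 * Cu * r / N" using L6 by (intro divide_right_mono) auto
    finally show ?thesis .
  qed
  moreover have "z 0 = x" "z N = y"
    using arc_param_ends[OF \<gamma>(1) fin] \<gamma>(3,4) N by (auto simp: z_def L_def)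
  ultimately show ?thesis using zi by blast
qed

text \<open>Chains start from points at distance at least \<open>scale k / (4 * Cu)\<close> from the
  boundary, so by \<open>chain_points\<close> their points stay at distance
  \<open>scale k / (8 * Cu ^ 2)\<close>. \<open>whitney_const\<close> is half of that; the other
  half is room for balls about these points, and \<open>chain_radius\<close> makes the dilated balls
  fit. \<open>chain_exp\<close> collects four needs: the volume comparison in a chain step, the
  dilation in \<open>tonelli_ball\<close>, the overlap of layers, and the comparison of corkscrew
  balls with balls about the boundary point. \<open>chain_length\<close> steps of at most
  \<open>chain_radius\<close> cover a curve of length \<open>6 * Cu\<close>, in units of the
  scale.\<close>

definition whitney_const :: real where "whitney_const = 1 / (16 * Cu ^ 2)"
definition chain_radius :: real where "chain_radius = whitney_const / (2 * l)"
definition chain_exp :: nat where "chain_exp = (SOME n. 8 * Cu \<le> 2 ^ n * chain_radius \<and> 16 * Cu \<le> 2 ^ n \<and> 8 * Cu / whitney_const \<le> 2 ^ n \<and> 3 \<le> 2 ^ n * chain_radius)"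
definition chain_length :: nat where "chain_length = nat \<lceil>6 * Cu / chain_radius\<rceil>"
definition C2 :: real where "C2 = Cd ^ 2 * Cp * (2 * chain_radius) * (Cd ^ chain_exp) powr (1 / p)"

lemma whitney_const: "0 < whitney_const" "whitney_const \<le> 1" "whitney_const \<le> Cu"
proof -
  show "0 < whitney_const" using Cu by (simp add: whitney_const_def)
  have "1 \<le> Cu ^ 2" using Cu by simp
  then have "1 / (16 * Cu ^ 2) \<le> 1 / 1" by (intro divide_left_mono) auto
  then show "whitney_const \<le> 1" by (simp add: whitney_const_def)
  then show "whitney_const \<le> Cu" using Cu by simp
qed

lemma chain_radius: "0 < chain_radius" "2 * l * chain_radius = whitney_const" "chain_radius \<le> 1"
proof -
  show "0 < chain_radius" "2 * l * chain_radius = whitney_const" using whitney_const l by (auto simp: chain_radius_def)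
  show "chain_radius \<le> 1" using whitney_const l unfolding chain_radius_def by (simp add: field_simps)
qed

lemma chain_exp: "8 * Cu \<le> 2 ^ chain_exp * chain_radius" "16 * Cu \<le> 2 ^ chain_exp" "8 * Cu / whitney_const \<le> 2 ^ chain_exp" "3 \<le> 2 ^ chain_exp * chain_radius"
proof -
  obtain n where "Max {8 * Cu / chain_radius, 16 * Cu, 8 * Cu / whitney_const, 3 / chain_radius} < 2 ^ n"
    using real_arch_pow[of "2::real" "Max {8 * Cu / chain_radius, 16 * Cu, 8 * Cu / whitney_const, 3 / chain_radius}"] by force
  then have "8 * Cu \<le> 2 ^ n * chain_radius \<and> 16 * Cu \<le> 2 ^ n \<and> 8 * Cu / whitney_const \<le> 2 ^ n \<and> 3 \<le> 2 ^ n * chain_radius"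
    using chain_radius by (auto simp: pos_divide_less_eq)
  then have "8 * Cu \<le> 2 ^ chain_exp * chain_radius \<and> 16 * Cu \<le> 2 ^ chain_exp \<and> 8 * Cu / whitney_const \<le> 2 ^ chain_exp \<and> 3 \<le> 2 ^ chain_exp * chain_radius"
    unfolding chain_exp_def by (rule someI)
  then show "8 * Cu \<le> 2 ^ chain_exp * chain_radius" "16 * Cu \<le> 2 ^ chain_exp" "8 * Cu / whitney_const \<le> 2 ^ chain_exp" "3 \<le> 2 ^ chain_exp * chain_radius" by auto
qed

lemma chain_length: "0 < chain_length" "6 * Cu / chain_length \<le> chain_radius"
proof -
  have "0 < 6 * Cu / chain_radius" using chain_radius Cu by simp
  then show N0: "0 < chain_length" by (simp add: chain_length_def)
  have "6 * Cu / chain_radius \<le> chain_length" unfolding chain_length_def by linarith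
  then show "6 * Cu / chain_length \<le> chain_radius" using chain_radius N0 by (simp add: field_simps)
qed

lemma C2: "0 < C2" using Cd Cp chain_radius by (simp add: C2_def)

text \<open>Each link of a chain costs two applications of \<open>step_bound\<close>; the last
  summand pays for halving the radius at the end.\<close>

definition C3 :: real where "C3 = real chain_length * (2 * C2) + C2"

lemma C3: "0 < C3" using C2 by (simp add: C3_def add_nonneg_pos)

definition scale :: "nat \<Rightarrow> real" where "scale k = R / 2 ^ k"

lemma scale: "0 < scale k" "scale k \<le> R" "scale k = 2 * scale (Suc k)"
  using R by (auto simp: scale_def field_simps)

text \<open>A point lies in boundedly many of these Whitney layers, which is what avoids a logarithmic loss
  in the trace estimate.\<close>

definition layer :: "nat \<Rightarrow> 'a set" where
  "layer k = {z \<in> space \<mu>. whitney_const * scale k \<le> bdry_dist z \<and> bdry_dist z < 8 * Cu * scale k}"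

definition layer_measure :: "'a measure \<Rightarrow> nat \<Rightarrow> 'a measure" where
  "layer_measure mg k = density mg (indicator (layer k))"

text \<open>The counterpart of \<open>osc_bound\<close> that sees only the mass of \<open>mg\<close>
  in layer \<open>k\<close>. This localisation allows the sum over all scales to be bounded by the
  total mass once.\<close>

definition layer_bound :: "'a measure \<Rightarrow> 'a \<Rightarrow> nat \<Rightarrow> real" where
  "layer_bound mg \<xi> k = scale k * (vol (layer_measure mg k) \<xi> (8 * Cu * scale k) / vol \<mu> \<xi> (scale k)) powr (1 / p)"

text \<open>The choice need not depend measurably on \<xi>: these points enter pointwise estimates
  only, and what gets integrated is \<open>layer_bound\<close>.\<close>

definition corkscrew_point :: "'a \<Rightarrow> nat \<Rightarrow> 'a" where
  "corkscrew_point \<xi> k = (SOME w. w \<in> space \<mu> \<and> dist w \<xi> \<le> scale k \<and> scale k / (2 * Cu) \<le> bdry_dist w)"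

lemma corkscrew_point:
  assumes "\<xi> \<in> bdry (space \<mu>)"
  shows "corkscrew_point \<xi> k \<in> space \<mu>" "dist (corkscrew_point \<xi> k) \<xi> \<le> scale k" "scale k / (2 * Cu) \<le> bdry_dist (corkscrew_point \<xi> k)"
proof -
  have "\<exists>w. w \<in> space \<mu> \<and> dist w \<xi> \<le> scale k \<and> scale k / (2 * Cu) \<le> bdry_dist w"
    using corkscrew[OF assms scale(1,2)] by blast
  from someI_ex[OF this] show "corkscrew_point \<xi> k \<in> space \<mu>" "dist (corkscrew_point \<xi> k) \<xi> \<le> scale k" "scale k / (2 * Cu) \<le> bdry_dist (corkscrew_point \<xi> k)"
    unfolding corkscrew_point_def by auto
qed

lemma layer_bound_nonneg: "0 \<le> layer_bound mg \<xi> k"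
  using scale(1)[of k] by (simp add: layer_bound_def)

lemma layer_sets: "layer k \<in> sets \<mu>"
proof -
  have "continuous_on UNIV (\<lambda>z. bdry_dist z)" by (intro continuous_intros)
  then have "(\<lambda>z. bdry_dist z) \<in> borel_measurable borel" by (rule borel_measurable_continuous_onI)
  from measurable_compose[OF measurable_id_borel this] have [measurable]: "(\<lambda>z. bdry_dist z) \<in> borel_measurable \<mu>" .
  show ?thesis unfolding layer_def by measurable
qed

context
  fixes u mg
  assumes um: "pi_pair u mg"
begin

interpretation mg: finite_borel mg using pi_pairD[OF um] by simp

lemma layer_sets_mg: "layer k \<in> sets mg" "ball x r \<inter> space \<mu> \<in> sets mg" "space mg = space \<mu>"
  using layer_sets ball_in_sets pi_pairD[OF um] by auto

lemma layer_measure: "finite_borel (layer_measure mg k)" "space (layer_measure mg k) = space \<mu>" "sets (layer_measure mg k) = sets \<mu>"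
  "A \<in> sets \<mu> \<Longrightarrow> emeasure (layer_measure mg k) A = emeasure mg (layer k \<inter> A)"
proof -
  show sp: "space (layer_measure mg k) = space \<mu>" and st: "sets (layer_measure mg k) = sets \<mu>"
    using pi_pairD[OF um] by (auto simp: layer_measure_def)
  show e: "emeasure (layer_measure mg k) A = emeasure mg (layer k \<inter> A)" if "A \<in> sets \<mu>" for A
    unfolding layer_measure_def using that pi_pairD(4)[OF um] layer_sets_mg by (intro emeasure_restricted) auto
  have "emeasure (layer_measure mg k) (space (layer_measure mg k)) \<noteq> \<infinity>" using e[of "space \<mu>"] sp by simp
  moreover have "sets (layer_measure mg k) = sets (restrict_space borel (space (layer_measure mg k)))"
    unfolding sp st by (rule sets_eq)
  ultimately show "finite_borel (layer_measure mg k)"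
    by (intro finite_borel.intro finite_borel_axioms.intro finite_measureI)
qed

text \<open>The ball of radius \<open>2 * l * s\<close> about \<open>z\<close> has radius at most
  \<open>whitney_const * scale k\<close>, so it keeps half of the distance of \<open>z\<close> to
  the boundary and stays in layer \<open>k\<close>. The range of \<open>s\<close> covers a move at
  full radius as well as a halving of the radius.\<close>

lemma step_bound:
  assumes x: "\<xi> \<in> bdry (space \<mu>)" and z: "z \<in> space \<mu>" "2 * whitney_const * scale k \<le> bdry_dist z" "dist z \<xi> \<le> 7 * Cu * scale k"
    and y: "y \<in> closure (space \<mu>)" "dist z y \<le> s" and s: "chain_radius * scale k / 2 \<le> s" "s \<le> chain_radius * scale k"
  shows "\<bar>avg \<mu> u y s - avg \<mu> u z (2 * s)\<bar> \<le> C2 * layer_bound mg \<xi> k"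
proof -
  let ?r = "scale k"
  interpret layer_measure: finite_borel "layer_measure mg k" by (rule layer_measure)
  have r: "0 < ?r" by (rule scale)
  have s0: "0 < s" using s chain_radius r by (smt (verit) half_gt_zero mult_pos_pos)
  have xc: "\<xi> \<in> closure (space \<mu>)" using x by (auto simp: bdry_def)
  have zc: "z \<in> closure (space \<mu>)" using z closure_subset by auto
  have "\<bar>avg \<mu> u y s - avg \<mu> u z (2 * s)\<bar> \<le> avg \<mu> (\<lambda>t. \<bar>u t - avg \<mu> u z (2 * s)\<bar>) y s"
    by (intro abs_avg_diff_le pi_pairD(1)[OF um] vol_pos y s0)
  also have "\<dots> \<le> Cd ^ 2 * Cp * (2 * s) * (vol mg z (2 * l * s) / vol \<mu> z (2 * s)) powr (1 / p)"
    by (intro avg_abs_diff_step[OF um] z y s0)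
  also have "\<dots> \<le> Cd ^ 2 * Cp * (2 * (chain_radius * ?r)) * (Cd ^ chain_exp * (vol (layer_measure mg k) \<xi> (8 * Cu * ?r) / vol \<mu> \<xi> ?r)) powr (1 / p)"
  proof (intro mult_mono powr_mono2)
    have ls: "2 * l * s \<le> whitney_const * ?r"
    proof -
      have "2 * l * s \<le> 2 * l * (chain_radius * ?r)" using s l by (intro mult_left_mono) auto
      also have "\<dots> = whitney_const * ?r" using chain_radius(2) by (metis mult.assoc)
      finally show ?thesis .
    qed
    have "ball z (2 * l * s) \<inter> space \<mu> \<subseteq> layer k \<inter> (ball \<xi> (8 * Cu * ?r) \<inter> space \<mu>)"
    proof clarify
      fix t assume t: "t \<in> ball z (2 * l * s)" "t \<in> space \<mu>"
      then have dt: "dist z t < whitney_const * ?r" using ls by simp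
      have "whitney_const * ?r \<le> bdry_dist t" using bdry_dist_triangle[of z t] dt z by simp
      moreover have "dist \<xi> t < 8 * Cu * ?r"
      proof -
        have "dist \<xi> t \<le> dist z \<xi> + dist z t" by (metis dist_commute dist_triangle)
        moreover have "whitney_const * ?r \<le> Cu * ?r" using whitney_const r by (intro mult_right_mono) auto
        ultimately show ?thesis using dt z by simp
      qed
      moreover have "bdry_dist t \<le> dist \<xi> t" using infdist_le[OF x, of t] by (simp add: dist_commute)
      ultimately show "t \<in> layer k \<inter> (ball \<xi> (8 * Cu * ?r) \<inter> space \<mu>)" using t by (auto simp: layer_def)
    qed
    then have "emeasure mg (ball z (2 * l * s) \<inter> space \<mu>) \<le> emeasure (layer_measure mg k) (ball \<xi> (8 * Cu * ?r) \<inter> space \<mu>)"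
      using layer_sets_mg by (subst layer_measure(4)) (auto intro!: emeasure_mono ball_in_sets)
    then have v: "vol mg z (2 * l * s) \<le> vol (layer_measure mg k) \<xi> (8 * Cu * ?r)"
      using mg.emeasure_ball[of z "2 * l * s"] layer_measure.emeasure_ball[of \<xi> "8 * Cu * ?r"] layer_sets_mg(3) layer_measure(2) by simp
    have "vol \<mu> \<xi> ?r \<le> Cd ^ chain_exp * vol \<mu> z (2 * s)"
    proof (intro vol_le zc)
      have "?r \<le> Cu * ?r" using Cu r by simp
      then have "dist \<xi> z + ?r \<le> 8 * Cu * ?r" using z(3) by (simp add: dist_commute)
      also have "\<dots> \<le> 2 ^ chain_exp * chain_radius * ?r" using chain_exp(1) r by (intro mult_right_mono) auto
      also have "\<dots> \<le> 2 ^ chain_exp * (2 * s)" using s by simp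
      finally show "dist \<xi> z + ?r \<le> 2 ^ chain_exp * (2 * s)" .
    qed (use s0 in simp)
    then have "1 / vol \<mu> z (2 * s) \<le> Cd ^ chain_exp / vol \<mu> \<xi> ?r"
      using vol_pos[OF xc r] vol_pos[OF zc, of "2 * s"] s0 by (simp add: field_simps)
    then have "vol mg z (2 * l * s) * (1 / vol \<mu> z (2 * s)) \<le> vol (layer_measure mg k) \<xi> (8 * Cu * ?r) * (Cd ^ chain_exp / vol \<mu> \<xi> ?r)"
      using v by (intro mult_mono) auto
    then show "vol mg z (2 * l * s) / vol \<mu> z (2 * s) \<le> Cd ^ chain_exp * (vol (layer_measure mg k) \<xi> (8 * Cu * ?r) / vol \<mu> \<xi> ?r)"
      by (simp add: mult.commute)
  qed (use s s0 Cd Cp p r chain_radius in auto)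
  also have "\<dots> = C2 * layer_bound mg \<xi> k"
    using Cd unfolding C2_def layer_bound_def by (subst powr_mult) (auto simp: mult_ac)
  finally show ?thesis .
qed

text \<open>Averages about neighbouring chain points are compared through the ball of twice the
  radius about the first. The bound \<open>scale k / (4 * Cu)\<close> admits as \<open>y\<close> a
  corkscrew point of the next finer scale as well as one of the same scale at another boundary
  point.\<close>

lemma chain_bound:
  assumes x: "\<xi> \<in> bdry (space \<mu>)" and y: "y \<in> space \<mu>" "scale k / (4 * Cu) \<le> bdry_dist y" "dist (corkscrew_point \<xi> k) y \<le> 6 * scale k"
  shows "\<bar>avg \<mu> u (corkscrew_point \<xi> k) (chain_radius * scale k) - avg \<mu> u y (chain_radius * scale k)\<bar> \<le> real chain_length * (2 * C2 * layer_bound mg \<xi> k)"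
proof -
  let ?r = "scale k" and ?x = "corkscrew_point \<xi> k" and ?c = "1 / (4 * Cu)"
  have r: "0 < ?r" by (rule scale)
  have "?r / (4 * Cu) \<le> ?r / (2 * Cu)" using r Cu by (intro divide_left_mono) auto
  then have "?c * ?r \<le> bdry_dist ?x" using corkscrew_point(3)[OF x, of k] by simp
  then obtain z where z: "z 0 = ?x" "z chain_length = y"
    "\<And>i. i \<le> chain_length \<Longrightarrow> z i \<in> space \<mu> \<and> ?c * ?r / (2 * Cu) \<le> bdry_dist (z i) \<and> dist (z i) ?x \<le> 6 * Cu * ?r"
    "\<And>i. i < chain_length \<Longrightarrow> dist (z i) (z (Suc i)) \<le> 6 * Cu * ?r / chain_length"
    using chain_points[OF corkscrew_point(1)[OF x, of k] y(1), of ?c ?r chain_length] y(2,3) r Cu chain_length(1) by auto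
  have kpr: "?c * ?r / (2 * Cu) = 2 * whitney_const * ?r"
    using Cu by (simp add: whitney_const_def power2_eq_square)
  have step: "\<bar>avg \<mu> u (z i) (chain_radius * ?r) - avg \<mu> u (z (Suc i)) (chain_radius * ?r)\<bar> \<le> 2 * C2 * layer_bound mg \<xi> k" if i: "i < chain_length" for i
  proof -
    have zz: "z i \<in> space \<mu>" "2 * whitney_const * ?r \<le> bdry_dist (z i)" "z (Suc i) \<in> space \<mu>"
      using z(3)[of i] z(3)[of "Suc i"] i kpr by auto
    have "dist (z i) \<xi> \<le> dist (z i) ?x + dist ?x \<xi>" by (rule dist_triangle)
    also have "\<dots> \<le> 6 * Cu * ?r + 1 * ?r" using z(3)[of i] corkscrew_point(2)[OF x, of k] i by simp
    also have "\<dots> \<le> 6 * Cu * ?r + Cu * ?r" using Cu r by (intro add_left_mono mult_right_mono) auto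
    finally have d: "dist (z i) \<xi> \<le> 7 * Cu * ?r" by simp
    have "dist (z i) (z (Suc i)) \<le> 6 * Cu / chain_length * ?r" using z(4)[OF i] by simp
    also have "\<dots> \<le> chain_radius * ?r" using chain_length(2) r by (intro mult_right_mono) auto
    finally have d': "dist (z i) (z (Suc i)) \<le> chain_radius * ?r" .
    have sr: "0 \<le> chain_radius * ?r" "0 \<le> ?r * chain_radius" using chain_radius r by simp_all
    have "\<bar>avg \<mu> u (z i) (chain_radius * ?r) - avg \<mu> u (z i) (2 * (chain_radius * ?r))\<bar> \<le> C2 * layer_bound mg \<xi> k"
      using zz closure_subset sr by (intro step_bound x d) auto
    moreover have "\<bar>avg \<mu> u (z (Suc i)) (chain_radius * ?r) - avg \<mu> u (z i) (2 * (chain_radius * ?r))\<bar> \<le> C2 * layer_bound mg \<xi> k"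
      using zz closure_subset sr d' by (intro step_bound x d) auto
    ultimately show ?thesis by linarith
  qed
  have "\<bar>avg \<mu> u (z 0) (chain_radius * ?r) - avg \<mu> u (z n) (chain_radius * ?r)\<bar> \<le> real n * (2 * C2 * layer_bound mg \<xi> k)" if "n \<le> chain_length" for n
    using that
  proof (induction n)
    case (Suc n)
    then show ?case using step[of n] by (simp add: distrib_right)
  qed simp
  from this[of chain_length] show ?thesis using z(1,2) by simp
qed

lemma scale_bound:
  assumes x: "\<xi> \<in> bdry (space \<mu>)"
  shows "\<bar>avg \<mu> u (corkscrew_point \<xi> k) (chain_radius * scale k) - avg \<mu> u (corkscrew_point \<xi> (Suc k)) (chain_radius * scale (Suc k))\<bar> \<le> C3 * layer_bound mg \<xi> k"
proof -
  let ?r = "scale k" and ?y = "corkscrew_point \<xi> (Suc k)"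
  have r: "0 < ?r" "scale (Suc k) = ?r / 2" using scale(1,3)[of k] by auto
  have y: "?y \<in> space \<mu>" "dist ?y \<xi> \<le> ?r / 2" "?r / (4 * Cu) \<le> bdry_dist ?y"
    using corkscrew_point[OF x, of "Suc k"] r by auto
  have "dist (corkscrew_point \<xi> k) ?y \<le> dist (corkscrew_point \<xi> k) \<xi> + dist ?y \<xi>" by (metis dist_commute dist_triangle)
  then have "\<bar>avg \<mu> u (corkscrew_point \<xi> k) (chain_radius * ?r) - avg \<mu> u ?y (chain_radius * ?r)\<bar> \<le> real chain_length * (2 * C2 * layer_bound mg \<xi> k)"
    using y corkscrew_point(2)[OF x, of k] r by (intro chain_bound x) auto
  \<comment> \<open>The centre is kept and the radius halved: \<open>step_bound\<close> at the lower
    end of its range for \<open>s\<close>.\<close>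
  moreover have "\<bar>avg \<mu> u ?y (chain_radius * ?r / 2) - avg \<mu> u ?y (2 * (chain_radius * ?r / 2))\<bar> \<le> C2 * layer_bound mg \<xi> k"
  proof (intro step_bound x y)
    have "2 * whitney_const = 1 / (4 * Cu) / (2 * Cu)" using Cu by (simp add: whitney_const_def power2_eq_square)
    also have "\<dots> \<le> 1 / (4 * Cu) / 1" using Cu by (intro divide_left_mono) auto
    finally have "2 * whitney_const * ?r \<le> 1 / (4 * Cu) * ?r" using r by (intro mult_right_mono) auto
    then show "2 * whitney_const * ?r \<le> bdry_dist ?y" using y by simp
    have "?r \<le> 7 * Cu * ?r" using Cu r by simp
    then show "dist ?y \<xi> \<le> 7 * Cu * ?r" using y(2) r by linarith
  qed (use y chain_radius r closure_subset in auto)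
  ultimately show ?thesis unfolding C3_def r(2) by (simp add: distrib_right)
qed

lemma pair_bound:
  assumes x: "\<xi> \<in> bdry (space \<mu>)" "\<eta> \<in> bdry (space \<mu>)" "dist \<xi> \<eta> \<le> 4 * scale k"
  shows "\<bar>avg \<mu> u (corkscrew_point \<xi> k) (chain_radius * scale k) - avg \<mu> u (corkscrew_point \<eta> k) (chain_radius * scale k)\<bar> \<le> C3 * layer_bound mg \<xi> k"
proof -
  have "dist (corkscrew_point \<xi> k) (corkscrew_point \<eta> k) \<le> dist (corkscrew_point \<xi> k) \<xi> + dist \<xi> \<eta> + dist (corkscrew_point \<eta> k) \<eta>"
    using dist_triangle[of "corkscrew_point \<xi> k" "corkscrew_point \<eta> k" \<xi>] dist_triangle[of \<xi> "corkscrew_point \<eta> k" \<eta>] by (simp add: dist_commute)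
  then have d: "dist (corkscrew_point \<xi> k) (corkscrew_point \<eta> k) \<le> 6 * scale k" using corkscrew_point(2)[OF x(1), of k] corkscrew_point(2)[OF x(2), of k] x(3) by simp
  have "scale k / (4 * Cu) \<le> scale k / (2 * Cu)" using scale(1)[of k] Cu by (intro divide_left_mono) auto
  then have "scale k / (4 * Cu) \<le> bdry_dist (corkscrew_point \<eta> k)" using corkscrew_point(3)[OF x(2), of k] by simp
  then have "\<bar>avg \<mu> u (corkscrew_point \<xi> k) (chain_radius * scale k) - avg \<mu> u (corkscrew_point \<eta> k) (chain_radius * scale k)\<bar> \<le> real chain_length * (2 * C2 * layer_bound mg \<xi> k)"
    using d by (intro chain_bound x corkscrew_point(1)[OF x(2)])
  also have "\<dots> \<le> C3 * layer_bound mg \<xi> k" using C2 layer_bound_nonneg[of mg \<xi> k] by (simp add: C3_def distrib_right)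
  finally show ?thesis .
qed

text \<open>A corkscrew ball lies in a ball about \<xi> of comparable volume, so its averages tend
  to the trace value, and \<open>scale_bound\<close> is summed along the scales. The sum is taken in
  [0,\<infinity>], so nothing has to be known about its convergence.\<close>

lemma trace_chain:
  assumes x: "\<xi> \<in> bdry (space \<mu>)" and a: "has_trace_value \<mu> u \<xi> a"
  shows "ennreal \<bar>avg \<mu> u (corkscrew_point \<xi> j) (chain_radius * scale j) - a\<bar> \<le> ennreal C3 * (\<Sum>i. ennreal (layer_bound mg \<xi> (i + j)))"
proof -
  define c where "c k = avg \<mu> u (corkscrew_point \<xi> k) (chain_radius * scale k)" for k
  have xc: "\<xi> \<in> closure (space \<mu>)" using x by (auto simp: bdry_def)
  have "c \<longlonglongrightarrow> a"
  proof -
    have "((\<lambda>r. avg \<mu> (\<lambda>y. \<bar>u y - a\<bar>) \<xi> r) \<longlongrightarrow> 0) (at_right 0)"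
      using a has_trace_value_iff[OF pi_pairD(1)[OF um] xc] by simp
    moreover have "filterlim (\<lambda>k. 2 * scale k) (at_right 0) sequentially"
      unfolding filterlim_at scale_def
      using tendsto_mult_right_zero[OF LIMSEQ_inverse_realpow_zero[of 2], of "2 * R"] R by (simp add: divide_inverse)
    ultimately have "(\<lambda>k. avg \<mu> (\<lambda>y. \<bar>u y - a\<bar>) \<xi> (2 * scale k)) \<longlonglongrightarrow> 0" by (rule filterlim_compose)
    then have z: "(\<lambda>k. Cd ^ chain_exp * avg \<mu> (\<lambda>y. \<bar>u y - a\<bar>) \<xi> (2 * scale k)) \<longlonglongrightarrow> 0" by (rule tendsto_mult_right_zero)
    have "\<bar>c k - a\<bar> \<le> Cd ^ chain_exp * avg \<mu> (\<lambda>y. \<bar>u y - a\<bar>) \<xi> (2 * scale k)" for k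
    proof -
      have r: "0 < scale k" by (rule scale)
      have s: "0 < chain_radius * scale k" "chain_radius * scale k \<le> 1 * scale k" using chain_radius r by (auto intro!: mult_right_mono simp del: mult_1)
      have wc: "corkscrew_point \<xi> k \<in> closure (space \<mu>)" using corkscrew_point(1)[OF x] closure_subset by auto
      have "\<bar>c k - a\<bar> \<le> avg \<mu> (\<lambda>y. \<bar>u y - a\<bar>) (corkscrew_point \<xi> k) (chain_radius * scale k)"
        unfolding c_def by (intro abs_avg_diff_le pi_pairD(1)[OF um] vol_pos wc s)
      also have "\<dots> \<le> Cd ^ chain_exp * avg \<mu> (\<lambda>y. \<bar>u y - a\<bar>) \<xi> (2 * scale k)"
      proof (intro avg_abs_diff_le pi_pairD(1)[OF um] wc xc s)
        show "dist (corkscrew_point \<xi> k) \<xi> + chain_radius * scale k \<le> 2 * scale k" using corkscrew_point(2)[OF x, of k] s by simp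
        have "dist \<xi> (corkscrew_point \<xi> k) + 2 * scale k \<le> 3 * scale k" using corkscrew_point(2)[OF x, of k] by (simp add: dist_commute)
        also have "\<dots> \<le> 2 ^ chain_exp * chain_radius * scale k" using chain_exp(4) r by (intro mult_right_mono) auto
        finally show "dist \<xi> (corkscrew_point \<xi> k) + 2 * scale k \<le> 2 ^ chain_exp * (chain_radius * scale k)" by simp
      qed (use r in simp)
      finally show ?thesis .
    qed
    then have "(\<lambda>k. c k - a) \<longlonglongrightarrow> 0" by (intro Lim_null_comparison[OF _ z] always_eventually) simp
    then show ?thesis by (simp add: LIM_zero_iff)
  qed
  have fin: "\<bar>c j - c (n + j)\<bar> \<le> C3 * (\<Sum>i<n. layer_bound mg \<xi> (i + j))" for n
  proof (induction n)
    case (Suc n)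
    then show ?case using scale_bound[OF x, of "n + j"] unfolding c_def[symmetric] by (simp add: distrib_left)
  qed simp
  have "ennreal \<bar>c j - c (n + j)\<bar> \<le> ennreal C3 * (\<Sum>i. ennreal (layer_bound mg \<xi> (i + j)))" for n
  proof -
    have "ennreal \<bar>c j - c (n + j)\<bar> \<le> ennreal (C3 * (\<Sum>i<n. layer_bound mg \<xi> (i + j)))" by (intro ennreal_leI fin)
    also have "\<dots> = ennreal C3 * (\<Sum>i<n. ennreal (layer_bound mg \<xi> (i + j)))"
      using C3 by (simp add: ennreal_mult sum_nonneg layer_bound_nonneg)
    also have "\<dots> \<le> ennreal C3 * (\<Sum>i. ennreal (layer_bound mg \<xi> (i + j)))"
      by (intro mult_left_mono sum_le_suminf) auto
    finally show ?thesis .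
  qed
  moreover have lim: "(\<lambda>n. ennreal \<bar>c j - c (n + j)\<bar>) \<longlonglongrightarrow> ennreal \<bar>c j - a\<bar>"
    using LIMSEQ_ignore_initial_segment[OF \<open>c \<longlonglongrightarrow> a\<close>, of j] by (intro tendsto_ennrealI tendsto_rabs tendsto_diff tendsto_const)
  ultimately show ?thesis unfolding c_def[symmetric]
    by (intro LIMSEQ_le_const2[OF lim]) blast
qed

text \<open>From \<open>a\<close> to the corkscrew average at \<xi> of scale \<open>j\<close>,
  across to the one at \<eta>, and back to \<open>b\<close>. The step across is absorbed by the
  first term of the sum at \<xi>, which gives the factor 2.\<close>

lemma trace_diff_bound:
  assumes x: "\<xi> \<in> bdry (space \<mu>)" "\<eta> \<in> bdry (space \<mu>)" "dist \<xi> \<eta> \<le> 4 * scale j"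
    and a: "has_trace_value \<mu> u \<xi> a" "has_trace_value \<mu> u \<eta> b"
  shows "ennreal \<bar>a - b\<bar> \<le> ennreal (2 * C3) * ((\<Sum>i. ennreal (layer_bound mg \<xi> (i + j))) + (\<Sum>i. ennreal (layer_bound mg \<eta> (i + j))))"
proof -
  let ?A = "\<Sum>i. ennreal (layer_bound mg \<xi> (i + j))" and ?B = "\<Sum>i. ennreal (layer_bound mg \<eta> (i + j))"
  let ?x = "avg \<mu> u (corkscrew_point \<xi> j) (chain_radius * scale j)" and ?y = "avg \<mu> u (corkscrew_point \<eta> j) (chain_radius * scale j)"
  have "ennreal \<bar>?x - ?y\<bar> \<le> ennreal (C3 * layer_bound mg \<xi> j)" by (intro ennreal_leI pair_bound x)
  also have "\<dots> = ennreal C3 * ennreal (layer_bound mg \<xi> (0 + j))" using C3 layer_bound_nonneg by (simp add: ennreal_mult)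
  also have "\<dots> \<le> ennreal C3 * ?A"
    using sum_le_suminf[of "\<lambda>i. ennreal (layer_bound mg \<xi> (i + j))" "{0}"] by (intro mult_left_mono) auto
  finally have m: "ennreal \<bar>?x - ?y\<bar> \<le> ennreal C3 * ?A" .
  have "ennreal \<bar>a - b\<bar> \<le> ennreal (\<bar>?x - a\<bar> + \<bar>?x - ?y\<bar> + \<bar>?y - b\<bar>)" by (intro ennreal_leI) linarith
  also have "\<dots> = ennreal \<bar>?x - a\<bar> + ennreal \<bar>?x - ?y\<bar> + ennreal \<bar>?y - b\<bar>" by simp
  also have "\<dots> \<le> ennreal C3 * ?A + ennreal C3 * ?A + ennreal C3 * ?B"
    by (intro add_mono m trace_chain[OF x(1) a(1)] trace_chain[OF x(2) a(2)])
  also have "\<dots> \<le> (ennreal C3 * ?A + ennreal C3 * ?A) + (ennreal C3 * ?B + ennreal C3 * ?B)"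
    by (intro add_left_mono) simp
  also have "\<dots> = ennreal (2 * C3) * (?A + ?B)"
    using C3 by (simp add: ennreal_mult distrib_left mult_2[symmetric] mult.assoc)
  finally show ?thesis .
qed

end

end

section \<open>Integration of the chain estimates over pairs of boundary points\<close>

lemma suminf_shift_le: "(\<Sum>j. f (j + i)) \<le> (\<Sum>k. f k :: ennreal)"
proof -
  have "(\<Sum>j<n. f (j + i)) \<le> (\<Sum>k. f k)" for n
  proof -
    have "(\<Sum>j<n. f (j + i)) = sum f {i..<n + i}"
      using sum.shift_bounds_nat_ivl[of f 0 i n] by (simp add: atLeast0LessThan)
    also have "\<dots> \<le> (\<Sum>k. f k)" by (intro sum_le_suminf) auto
    finally show ?thesis .
  qed
  then show ?thesis by (simp add: suminf_eq_SUP SUP_le_iff)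
qed

context trace_space
begin

definition layer_avg :: "'a measure \<Rightarrow> nat \<Rightarrow> 'a \<Rightarrow> ennreal" where
  "layer_avg mg k \<xi> = ennreal (vol (layer_measure mg k) \<xi> (8 * Cu * scale k) / vol \<nu> \<xi> (scale k))"

definition tail_sum :: "'a measure \<Rightarrow> nat \<Rightarrow> 'a \<Rightarrow> ennreal" where
  "tail_sum mg j \<xi> = (\<Sum>i. ennreal ((2 powr (- decay)) ^ i) * layer_avg mg (i + j) \<xi>)"

text \<open>Majorizes the Besov integrand up to a constant and symmetrization. Instead of selecting
  the scale \<open>j\<close> that belongs to the distance, it sums over all \<open>j\<close> with
  distance below \<open>8 * scale j\<close>, which keeps it measurable. The volume of that same ball
  normalises it, so that the integral over \<open>x\<close> at each scale is at most 1.\<close>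

definition besov_kernel :: "'a measure \<Rightarrow> 'a \<Rightarrow> 'a \<Rightarrow> ennreal" where
  "besov_kernel mg y x = (\<Sum>i. ennreal ((2 powr (- decay)) ^ i) *
     (\<Sum>j. layer_avg mg (i + j) y * (if dist y x < 8 * scale j then ennreal (1 / vol \<nu> y (8 * scale j)) else 0)))"

definition C4 :: real where "C4 = (2 * C3) powr p * 2 powr p * (geom_const * Cm)"

definition nu_doubling_const :: real where "nu_doubling_const = Cm ^ 2 * Cd ^ 4"

definition kernel_const :: real where "kernel_const = 1 / (1 - 2 powr (- decay)) * (Cm ^ 2 * Cd ^ chain_exp * real (chain_exp + 1))"

lemma geom_const: "0 \<le> geom_const" by (simp add: geom_const_def)

context
  fixes u mg
  assumes um: "pi_pair u mg"
begin

interpretation mg: finite_borel mg using pi_pairD[OF um] by simp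

lemma layer_avg_measurable: "layer_avg mg k \<in> borel_measurable \<nu>"
proof -
  have fb: "finite_borel \<nu>" by unfold_locales
  have [measurable]: "(\<lambda>\<xi>. vol \<nu> \<xi> r) \<in> borel_measurable \<nu>" "(\<lambda>\<xi>. vol (layer_measure mg k) \<xi> r) \<in> borel_measurable \<nu>" for r
    by (rule vol_measurable[OF fb], rule vol_measurable[OF layer_measure(1)[OF um]])
  show ?thesis unfolding layer_avg_def[abs_def] by measurable
qed

lemma layer_avg_integral: "(\<integral>\<^sup>+\<xi>. layer_avg mg k \<xi> \<partial>\<nu>) \<le> ennreal (Cm ^ 2 * Cd ^ chain_exp) * emeasure mg (layer k)"
proof -
  have "(\<integral>\<^sup>+\<xi>. layer_avg mg k \<xi> \<partial>\<nu>) \<le> ennreal (Cm ^ 2 * Cd ^ chain_exp) * emeasure (layer_measure mg k) (space (layer_measure mg k))"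
    unfolding layer_avg_def using chain_exp(2) by (intro tonelli_ball layer_measure(1)[OF um] scale) auto
  also have "emeasure (layer_measure mg k) (space (layer_measure mg k)) = emeasure mg (layer k)"
    unfolding layer_measure(2)[OF um] by (subst layer_measure(4)[OF um]) (auto intro!: arg_cong[where f = "emeasure mg"] simp: layer_def)
  finally show ?thesis .
qed

lemma layer_bound_powr_le:
  assumes x: "\<xi> \<in> space \<nu>"
  shows "ennreal (layer_bound mg \<xi> k powr p) \<le> ennreal (Cm * scale k powr (p - \<Theta>)) * layer_avg mg k \<xi>"
proof -
  let ?r = "scale k" and ?v = "vol (layer_measure mg k) \<xi> (8 * Cu * scale k)"
  have xc: "\<xi> \<in> closure (space \<mu>)" using x m_space by auto
  have "1 / vol \<mu> \<xi> ?r \<le> Cm * ?r powr (- \<Theta>) / vol \<nu> \<xi> ?r"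
    using m_le[OF x scale(1,2) order_refl, of k] m_pos[OF x scale(1,2), of k] vol_pos[OF xc scale(1), of k] by (simp add: field_simps)
  then have "?r powr p * ?v * (1 / vol \<mu> \<xi> ?r) \<le> ?r powr p * ?v * (Cm * ?r powr (- \<Theta>) / vol \<nu> \<xi> ?r)"
    by (intro mult_left_mono) auto
  moreover have "?r powr (p - \<Theta>) = ?r powr p * ?r powr (- \<Theta>)" by (simp add: powr_add[symmetric])
  moreover have "layer_bound mg \<xi> k powr p = ?r powr p * ?v * (1 / vol \<mu> \<xi> ?r)"
    using scale(1)[of k] p vol_pos[OF xc, of ?r] unfolding layer_bound_def by (subst powr_mult) (auto simp: powr_powr)
  ultimately have "layer_bound mg \<xi> k powr p \<le> (Cm * ?r powr (p - \<Theta>)) * (?v / vol \<nu> \<xi> ?r)" by (simp add: mult_ac)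
  then have "ennreal (layer_bound mg \<xi> k powr p) \<le> ennreal ((Cm * ?r powr (p - \<Theta>)) * (?v / vol \<nu> \<xi> ?r))" by (rule ennreal_leI)
  then show ?thesis unfolding layer_avg_def using Cm by (subst (asm) ennreal_mult) auto
qed

text \<open>The weighting behind \<open>scale_sum\<close>, started at scale \<open>j\<close>. The
  power of \<open>scale j\<close> is split off because the power of the distance in the Besov
  integrand will cancel it.\<close>

lemma tail_bound:
  assumes x: "\<xi> \<in> space \<nu>"
  shows "epowr (\<Sum>i. ennreal (layer_bound mg \<xi> (i + j))) p \<le> ennreal (geom_const * Cm * scale j powr (p - \<Theta>)) * tail_sum mg j \<xi>"
proof -
  have "epowr (\<Sum>i. ennreal (layer_bound mg \<xi> (i + j))) p
      \<le> ennreal geom_const * (\<Sum>i. ennreal (2 powr (decay * real i)) * epowr (ennreal (layer_bound mg \<xi> (i + j))) p)"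
    unfolding geom_const_def using p decay by (intro epowr_suminf_le) auto
  also have "(\<Sum>i. ennreal (2 powr (decay * real i)) * epowr (ennreal (layer_bound mg \<xi> (i + j))) p)
     \<le> (\<Sum>i. ennreal (Cm * scale j powr (p - \<Theta>)) * (ennreal ((2 powr (- decay)) ^ i) * layer_avg mg (i + j) \<xi>))"
  proof (intro suminf_le)
    fix i
    have "ennreal (2 powr (decay * real i)) * epowr (ennreal (layer_bound mg \<xi> (i + j))) p
      \<le> ennreal (2 powr (decay * real i)) * (ennreal (Cm * scale (i + j) powr (p - \<Theta>)) * layer_avg mg (i + j) \<xi>)"
      using layer_bound_powr_le[OF x, of "i + j"] by (intro mult_left_mono) (auto simp: epowr_ennreal layer_bound_nonneg)
    also have "\<dots> = ennreal (2 powr (decay * real i) * (Cm * scale (i + j) powr (p - \<Theta>))) * layer_avg mg (i + j) \<xi>"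
      using Cm by (simp add: ennreal_mult mult.assoc)
    also have "2 powr (decay * real i) * (Cm * scale (i + j) powr (p - \<Theta>)) = Cm * scale j powr (p - \<Theta>) * (2 powr (- decay)) ^ i"
    proof -
      have "scale (i + j) = scale j * 2 powr (- real i)"
        by (simp add: scale_def power_add powr_minus powr_realpow divide_inverse)
      moreover have "p - \<Theta> = 2 * decay" by (simp add: decay_def)
      ultimately have "scale (i + j) powr (p - \<Theta>) = scale j powr (p - \<Theta>) * 2 powr (- (2 * decay * real i))"
        using scale(1)[of j] by (simp add: powr_mult powr_powr mult_ac)
      moreover have "2 powr (decay * real i) * 2 powr (- (2 * decay * real i)) = (2 powr (- decay)) ^ i"
        by (simp add: powr_add[symmetric] powr_realpow[symmetric] powr_powr mult.commute)
      ultimately show ?thesis by (simp add: mult_ac)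
    qed
    finally show "ennreal (2 powr (decay * real i)) * epowr (ennreal (layer_bound mg \<xi> (i + j))) p
      \<le> ennreal (Cm * scale j powr (p - \<Theta>)) * (ennreal ((2 powr (- decay)) ^ i) * layer_avg mg (i + j) \<xi>)"
      using Cm by (simp add: ennreal_mult mult.assoc)
  qed auto
  also have "\<dots> = ennreal (Cm * scale j powr (p - \<Theta>)) * tail_sum mg j \<xi>"
    by (simp add: tail_sum_def ennreal_suminf_cmult)
  finally show ?thesis using geom_const Cm by (simp add: mult_left_mono ennreal_mult mult.assoc)
qed

lemma tail_sum_le_besov_kernel:
  assumes "dist y x < 8 * scale j"
  shows "tail_sum mg j y * ennreal (1 / vol \<nu> y (8 * scale j)) \<le> besov_kernel mg y x"
proof -
  have "tail_sum mg j y * ennreal (1 / vol \<nu> y (8 * scale j))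
     = (\<Sum>i. ennreal ((2 powr (- decay)) ^ i) * (layer_avg mg (i + j) y * ennreal (1 / vol \<nu> y (8 * scale j))))"
    by (simp add: tail_sum_def mult.assoc[symmetric] ennreal_suminf_multc)
  also have "\<dots> \<le> besov_kernel mg y x"
    unfolding besov_kernel_def
  proof (intro suminf_le mult_left_mono)
    fix i
    let ?F = "\<lambda>j. layer_avg mg (i + j) y * (if dist y x < 8 * scale j then ennreal (1 / vol \<nu> y (8 * scale j)) else 0)"
    show "layer_avg mg (i + j) y * ennreal (1 / vol \<nu> y (8 * scale j)) \<le> (\<Sum>j. ?F j)"
      using sum_le_suminf[of ?F "{j}"] assms by simp
  qed auto
  finally show ?thesis .
qed

text \<open>Both balls of radius \<open>8 * scale j\<close> lie in the ball of radius
  \<open>16 * scale j\<close> about \<open>y\<close>, and the ball of radius \<open>dist y x\<close>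
  contains the one of radius \<open>scale j\<close>; the exponent 4 in
  \<open>nu_doubling_const\<close> comes from 16.\<close>

lemma nu_ball_compare:
  assumes x: "x \<in> space \<nu>" and y: "y \<in> space \<nu>" and d: "2 * scale j < dist y x" "dist y x \<le> 4 * scale j"
  shows "0 < vol \<nu> y (dist y x)" "1 / vol \<nu> y (dist y x) \<le> nu_doubling_const * (1 / vol \<nu> y (8 * scale j))"
    "1 / vol \<nu> y (dist y x) \<le> nu_doubling_const * (1 / vol \<nu> x (8 * scale j))"
proof -
  have r: "0 < scale j" "scale j \<le> R" by (rule scale)+
  have v: "0 < vol \<nu> y (scale j)" by (rule m_pos[OF y r])
  have vd: "vol \<nu> y (scale j) \<le> vol \<nu> y (dist y x)" using d r by (intro m.vol_mono) auto
  then show 0: "0 < vol \<nu> y (dist y x)" using v by simp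
  have key: "1 / vol \<nu> y (dist y x) \<le> nu_doubling_const * (1 / V)" if "V \<le> vol \<nu> y (16 * scale j)" "vol \<nu> y (scale j) \<le> V \<or> 0 < V" for V
  proof -
    have V: "0 < V" using that v by auto
    have "V \<le> nu_doubling_const * vol \<nu> y (scale j)"
      using that(1) m_doubling[OF y r, of "16 * scale j" 4] by (simp add: nu_doubling_const_def)
    also have "\<dots> \<le> nu_doubling_const * vol \<nu> y (dist y x)" using vd Cd by (intro mult_left_mono) (auto simp: nu_doubling_const_def)
    finally show ?thesis using V 0 by (simp add: field_simps)
  qed
  show "1 / vol \<nu> y (dist y x) \<le> nu_doubling_const * (1 / vol \<nu> y (8 * scale j))"
    using r by (intro key) (auto intro: m.vol_mono)
  have "0 < vol \<nu> x (scale j)" by (rule m_pos[OF x r])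
  also have "\<dots> \<le> vol \<nu> x (8 * scale j)" using r by (intro m.vol_mono) auto
  finally show "1 / vol \<nu> y (dist y x) \<le> nu_doubling_const * (1 / vol \<nu> x (8 * scale j))"
    using d by (intro key) (auto intro!: m.vol_mono simp: dist_commute)
qed

text \<open>Since \<open>\<theta> * p = p - \<Theta>\<close>, the denominator contains at least
  \<open>scale j powr (p - \<Theta>)\<close>, which is the factor gained in
  \<open>tail_bound\<close>. On the diagonal the integrand is zero.\<close>

lemma integrand_bound:
  assumes x: "x \<in> space \<nu>" and y: "y \<in> space \<nu>" and \<theta>: "\<theta> * p = p - \<Theta>"
    and tr: "has_trace_value \<mu> u y (f y)" "has_trace_value \<mu> u x (f x)"
  shows "ennreal (\<bar>f y - f x\<bar> powr p) / (ennreal (dist y x powr (\<theta> * p)) * emeasure \<nu> (ball y (dist y x) \<inter> space \<nu>))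
    \<le> ennreal (C4 * nu_doubling_const) * (besov_kernel mg y x + besov_kernel mg x y)"
proof (cases "x = y")
  case False
  then have d0: "0 < dist y x" by simp
  have "dist y x \<le> 4 * R"
    unfolding diam[symmetric]
    using x y bounded_subset[OF bounded_closure[OF bounded_space] m_space] by (intro diameter_bounded_bound)
  from dyadic_scale[OF d0 this] obtain j where "4 * R / 2 ^ Suc j < dist y x" "dist y x \<le> 4 * R / 2 ^ j" by blast
  then have d: "2 * scale j < dist y x" "dist y x \<le> 4 * scale j" by (auto simp: scale_def)
  let ?q = "scale j powr (p - \<Theta>)"
  let ?A = "\<Sum>i. ennreal (layer_bound mg y (i + j))" and ?B = "\<Sum>i. ennreal (layer_bound mg x (i + j))"
  have r: "0 < scale j" by (rule scale)
  have "ennreal (\<bar>f y - f x\<bar> powr p) = epowr (ennreal \<bar>f y - f x\<bar>) p" by (simp add: epowr_ennreal)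
  also have "\<dots> \<le> epowr (ennreal (2 * C3) * (?A + ?B)) p"
    using x y d(2) p tr by (intro epowr_mono trace_diff_bound[OF um]) (auto simp: space_nu)
  also have "\<dots> = ennreal ((2 * C3) powr p) * epowr (?A + ?B) p" using C3 by (simp add: epowr_mult epowr_ennreal)
  also have "\<dots> \<le> ennreal ((2 * C3) powr p) * (ennreal (2 powr p) *
      (ennreal (geom_const * Cm * ?q) * tail_sum mg j y + ennreal (geom_const * Cm * ?q) * tail_sum mg j x))"
  proof (intro mult_left_mono)
    have "epowr (?A + ?B) p \<le> ennreal (2 powr p) * (epowr ?A p + epowr ?B p)" using p by (intro epowr_add_le) simp
    also have "\<dots> \<le> ennreal (2 powr p) * (ennreal (geom_const * Cm * ?q) * tail_sum mg j y + ennreal (geom_const * Cm * ?q) * tail_sum mg j x)"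
      by (intro mult_left_mono add_mono tail_bound x y) auto
    finally show "epowr (?A + ?B) p \<le> ennreal (2 powr p) * (ennreal (geom_const * Cm * ?q) * tail_sum mg j y + ennreal (geom_const * Cm * ?q) * tail_sum mg j x)" .
  qed auto
  also have "\<dots> = ennreal (C4 * ?q) * (tail_sum mg j y + tail_sum mg j x)"
    using geom_const Cm C3 by (simp add: C4_def distrib_left[symmetric] ennreal_mult mult.assoc)
  finally have N: "ennreal (\<bar>f y - f x\<bar> powr p) \<le> ennreal (C4 * ?q) * (tail_sum mg j y + tail_sum mg j x)" .
  let ?V = "vol \<nu> y (dist y x)" and ?D = "dist y x powr (\<theta> * p)"
  note cmp = nu_ball_compare[OF x y d]
  have D: "0 < ?D" "?q \<le> ?D" using d0 d r \<Theta> unfolding \<theta> by (auto intro!: powr_mono2)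
  have q: "0 < ?q" using r by simp
  have "ennreal (\<bar>f y - f x\<bar> powr p) / (ennreal ?D * emeasure \<nu> (ball y (dist y x) \<inter> space \<nu>))
     = ennreal (\<bar>f y - f x\<bar> powr p) * ennreal (1 / (?D * ?V))"
    using D(1) cmp(1) by (simp add: m.emeasure_ball divide_ennreal_def inverse_ennreal ennreal_mult[symmetric] inverse_eq_divide)
  also have "\<dots> \<le> ennreal (C4 * ?q) * (tail_sum mg j y + tail_sum mg j x) * ennreal (1 / ?q * (1 / ?V))"
  proof (intro mult_mono N ennreal_leI)
    have "1 / ?D \<le> 1 / ?q" using D q by (intro divide_left_mono) auto
    then have "1 / ?D * (1 / ?V) \<le> 1 / ?q * (1 / ?V)" using cmp(1) by (intro mult_right_mono) auto
    then show "1 / (?D * ?V) \<le> 1 / ?q * (1 / ?V)" by simp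
  qed auto
  also have "\<dots> = ennreal C4 * (tail_sum mg j y * ennreal (1 / ?V) + tail_sum mg j x * ennreal (1 / ?V))"
  proof -
    have "ennreal (C4 * ?q) * (tail_sum mg j y + tail_sum mg j x) * ennreal (1 / ?q * (1 / ?V))
       = (ennreal (C4 * ?q) * ennreal (1 / ?q * (1 / ?V))) * (tail_sum mg j y + tail_sum mg j x)" by (simp add: mult_ac)
    also have "ennreal (C4 * ?q) * ennreal (1 / ?q * (1 / ?V)) = ennreal C4 * ennreal (1 / ?V)"
      using q cmp(1) geom_const Cm C3 by (simp add: ennreal_mult[symmetric] C4_def)
    finally show ?thesis by (simp add: distrib_left mult_ac)
  qed
  also have "\<dots> \<le> ennreal C4 * (ennreal nu_doubling_const * besov_kernel mg y x + ennreal nu_doubling_const * besov_kernel mg x y)"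
  proof (intro mult_left_mono add_mono)
    have "0 \<le> nu_doubling_const" using Cd by (simp add: nu_doubling_const_def)
    have "tail_sum mg j y * ennreal (1 / ?V) \<le> tail_sum mg j y * (ennreal nu_doubling_const * ennreal (1 / vol \<nu> y (8 * scale j)))"
      using cmp(2) \<open>0 \<le> nu_doubling_const\<close> by (intro mult_left_mono) (auto simp: ennreal_mult[symmetric] intro: ennreal_leI)
    also have "\<dots> = ennreal nu_doubling_const * (tail_sum mg j y * ennreal (1 / vol \<nu> y (8 * scale j)))" by (simp add: mult_ac)
    also have "\<dots> \<le> ennreal nu_doubling_const * besov_kernel mg y x" using d r by (intro mult_left_mono tail_sum_le_besov_kernel) auto
    finally show "tail_sum mg j y * ennreal (1 / ?V) \<le> ennreal nu_doubling_const * besov_kernel mg y x" .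
    have "tail_sum mg j x * ennreal (1 / ?V) \<le> tail_sum mg j x * (ennreal nu_doubling_const * ennreal (1 / vol \<nu> x (8 * scale j)))"
      using cmp(3) \<open>0 \<le> nu_doubling_const\<close> by (intro mult_left_mono) (auto simp: ennreal_mult[symmetric] intro: ennreal_leI)
    also have "\<dots> = ennreal nu_doubling_const * (tail_sum mg j x * ennreal (1 / vol \<nu> x (8 * scale j)))" by (simp add: mult_ac)
    also have "\<dots> \<le> ennreal nu_doubling_const * besov_kernel mg x y" using d r by (intro mult_left_mono tail_sum_le_besov_kernel) (auto simp: dist_commute)
    finally show "tail_sum mg j x * ennreal (1 / ?V) \<le> ennreal nu_doubling_const * besov_kernel mg x y" .
  qed auto
  also have "\<dots> = ennreal (C4 * nu_doubling_const) * (besov_kernel mg y x + besov_kernel mg x y)"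
    using geom_const Cm C3 Cd by (simp add: C4_def nu_doubling_const_def ennreal_mult distrib_left[symmetric] mult.assoc)
  finally show ?thesis .
qed simp

text \<open>If a point lies in layers \<open>k0\<close> and \<open>k\<close>, its distance to the
  boundary is at least \<open>whitney_const * scale k0\<close> and less than
  \<open>8 * Cu * scale k\<close>; so \<open>2 ^ (k - k0)\<close> is bounded, and the indicators of
  all layers sum to at most a constant.\<close>

lemma layer_overlap: "(\<Sum>k. emeasure mg (layer k)) \<le> ennreal (real (chain_exp + 1)) * emeasure mg (space mg)"
proof -
  have Wm [measurable]: "layer k \<in> sets mg" for k using layer_sets_mg(1)[OF um] .
  have pt: "(\<Sum>k. indicator (layer k) z) \<le> ennreal (real (chain_exp + 1))" for z
  proof (cases "\<exists>k. z \<in> layer k")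
    case True
    define k0 where "k0 = (LEAST k. z \<in> layer k)"
    have k0: "z \<in> layer k0" unfolding k0_def using True by (rule LeastI_ex)
    have sub: "k0 \<le> k \<and> k < k0 + (chain_exp + 1)" if "z \<in> layer k" for k
    proof
      show le: "k0 \<le> k" unfolding k0_def using that by (rule Least_le)
      have "whitney_const * scale k0 < 8 * Cu * scale k" using k0 that by (auto simp: layer_def)
      moreover have "scale k0 = 2 ^ (k - k0) * scale k" using le by (simp add: scale_def power_diff)
      ultimately have "whitney_const * 2 ^ (k - k0) < 8 * Cu" using scale(1)[of k] by (simp add: mult.assoc[symmetric])
      then have "2 ^ (k - k0) < 8 * Cu / whitney_const" using whitney_const(1) by (simp add: field_simps)
      also have "\<dots> \<le> 2 ^ chain_exp" by (rule chain_exp)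
      finally have "k - k0 < chain_exp" by (simp add: power_strict_increasing_iff)
      then show "k < k0 + (chain_exp + 1)" using le by simp
    qed
    have "(\<Sum>k. indicator (layer k) z :: ennreal) = (\<Sum>k\<in>{k0..<k0 + (chain_exp + 1)}. indicator (layer k) z)"
      using sub by (intro suminf_finite) (auto simp: indicator_def)
    also have "\<dots> \<le> (\<Sum>k\<in>{k0..<k0 + (chain_exp + 1)}. 1)" by (intro sum_mono) (auto simp: indicator_def)
    also have "\<dots> = ennreal (real (chain_exp + 1))" by (simp add: ennreal_of_nat_eq_real_of_nat)
    finally show ?thesis .
  qed (auto simp: indicator_def)
  have "(\<Sum>k. emeasure mg (layer k)) = (\<Sum>k. \<integral>\<^sup>+z. indicator (layer k) z \<partial>mg)" by simp
  also have "\<dots> = (\<integral>\<^sup>+z. (\<Sum>k. indicator (layer k) z) \<partial>mg)"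
    by (intro nn_integral_suminf[symmetric]) measurable
  also have "\<dots> \<le> (\<integral>\<^sup>+z. ennreal (real (chain_exp + 1)) \<partial>mg)" by (intro nn_integral_mono pt)
  finally show ?thesis by simp
qed

lemma besov_kernel_measurable: "case_prod (besov_kernel mg) \<in> borel_measurable (\<nu> \<Otimes>\<^sub>M \<nu>)"
proof -
  have fb: "finite_borel \<nu>" by unfold_locales
  have [measurable]: "(\<lambda>z. dist (fst z) (snd z)) \<in> borel_measurable (\<nu> \<Otimes>\<^sub>M \<nu>)"
    using fb by (intro dist_measurable_m) auto
  have [measurable]: "(\<lambda>\<xi>. vol \<nu> \<xi> r) \<in> borel_measurable \<nu>" for r by (rule vol_measurable[OF fb])
  have [measurable]: "layer_avg mg k \<in> borel_measurable \<nu>" for k by (rule layer_avg_measurable)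
  show ?thesis unfolding besov_kernel_def case_prod_beta by measurable
qed

text \<open>The integral over \<open>x\<close> removes the kernel, the one over \<open>y\<close>
  turns \<open>layer_avg\<close> into the mass of a layer, the sum over \<open>j\<close> is bounded
  by the overlap, and the sum over \<open>i\<close> is geometric.\<close>

lemma besov_kernel_integral: "(\<integral>\<^sup>+y. \<integral>\<^sup>+x. besov_kernel mg y x \<partial>\<nu> \<partial>\<nu>) \<le> ennreal kernel_const * emeasure mg (space mg)"
proof -
  have fb: "finite_borel \<nu>" by unfold_locales
  have tm [measurable]: "layer_avg mg k \<in> borel_measurable \<nu>" for k by (rule layer_avg_measurable)
  let ?q = "2 powr (- decay)"
  let ?C = "Cm ^ 2 * Cd ^ chain_exp"
  let ?h = "\<lambda>y j x. if dist y x < 8 * scale j then ennreal (1 / vol \<nu> y (8 * scale j)) else 0"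
  have h1: "(\<integral>\<^sup>+x. ?h y j x \<partial>\<nu>) \<le> 1" for y j
  proof -
    have "(\<integral>\<^sup>+x. ?h y j x \<partial>\<nu>) = (\<integral>\<^sup>+x. ennreal (1 / vol \<nu> y (8 * scale j)) * indicator (ball y (8 * scale j) \<inter> space \<nu>) x \<partial>\<nu>)"
      by (intro nn_integral_cong) (auto split: split_indicator)
    also have "\<dots> \<le> 1"
      by (cases "vol \<nu> y (8 * scale j) = 0")
        (auto simp: nn_integral_cmult_indicator m.ball_in_sets m.emeasure_ball ennreal_mult[symmetric])
    finally show ?thesis .
  qed
  have hm: "?h y j \<in> borel_measurable \<nu>" if "y \<in> space \<nu>" for y j
  proof -
    have "(\<lambda>x. dist ((\<lambda>_. y) x) x) \<in> borel_measurable \<nu>"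
      using fb that by (intro dist_measurable_m[where M = \<nu>]) auto
    then have [measurable]: "(\<lambda>x. dist y x) \<in> borel_measurable \<nu>" by simp
    show ?thesis by measurable
  qed
  have "(\<integral>\<^sup>+y. \<integral>\<^sup>+x. besov_kernel mg y x \<partial>\<nu> \<partial>\<nu>) \<le> (\<integral>\<^sup>+y. (\<Sum>i. ennreal (?q ^ i) * (\<Sum>j. layer_avg mg (i + j) y)) \<partial>\<nu>)"
  proof (intro nn_integral_mono)
    fix y assume y: "y \<in> space \<nu>"
    note hm[OF y, measurable]
    have "(\<integral>\<^sup>+x. besov_kernel mg y x \<partial>\<nu>) = (\<Sum>i. ennreal (?q ^ i) * (\<Sum>j. layer_avg mg (i + j) y * (\<integral>\<^sup>+x. ?h y j x \<partial>\<nu>)))"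
      unfolding besov_kernel_def by (simp add: nn_integral_suminf nn_integral_cmult)
    also have "\<dots> \<le> (\<Sum>i. ennreal (?q ^ i) * (\<Sum>j. layer_avg mg (i + j) y * 1))"
      by (intro suminf_le mult_left_mono h1) auto
    finally show "(\<integral>\<^sup>+x. besov_kernel mg y x \<partial>\<nu>) \<le> (\<Sum>i. ennreal (?q ^ i) * (\<Sum>j. layer_avg mg (i + j) y))" by simp
  qed
  also have "\<dots> = (\<Sum>i. ennreal (?q ^ i) * (\<Sum>j. \<integral>\<^sup>+y. layer_avg mg (i + j) y \<partial>\<nu>))"
    by (simp add: nn_integral_suminf nn_integral_cmult)
  also have "\<dots> \<le> (\<Sum>i. ennreal (?q ^ i) * (ennreal (?C * real (chain_exp + 1)) * emeasure mg (space mg)))"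
  proof (intro suminf_le mult_left_mono)
    fix i
    have "(\<Sum>j. \<integral>\<^sup>+y. layer_avg mg (i + j) y \<partial>\<nu>) \<le> (\<Sum>j. ennreal ?C * emeasure mg (layer (j + i)))"
      using layer_avg_integral by (intro suminf_le) (auto simp: add.commute)
    also have "\<dots> \<le> ennreal ?C * (\<Sum>k. emeasure mg (layer k))"
      unfolding ennreal_suminf_cmult by (intro mult_left_mono suminf_shift_le) auto
    also have "\<dots> \<le> ennreal ?C * (ennreal (real (chain_exp + 1)) * emeasure mg (space mg))"
      by (intro mult_left_mono layer_overlap) auto
    finally show "(\<Sum>j. \<integral>\<^sup>+y. layer_avg mg (i + j) y \<partial>\<nu>) \<le> ennreal (?C * real (chain_exp + 1)) * emeasure mg (space mg)"
      using Cd by (simp add: ennreal_mult mult.assoc)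
  qed auto
  also have "\<dots> = ennreal (1 / (1 - ?q)) * (ennreal (?C * real (chain_exp + 1)) * emeasure mg (space mg))"
    using decay geometric_sums[of ?q] by (simp add: suminf_ennreal_eq[of "\<lambda>i. ?q ^ i"] sums_iff)
  finally show ?thesis using Cd decay by (simp add: kernel_const_def ennreal_mult[symmetric] mult.assoc[symmetric])
qed

lemma besov_bound:
  assumes \<theta>: "\<theta> * p = p - \<Theta>"
  shows "(\<integral>\<^sup>+y. (\<integral>\<^sup>+x. ennreal (\<bar>trace \<mu> u y - trace \<mu> u x\<bar> powr p) /
       (ennreal (dist y x powr (\<theta> * p)) * emeasure \<nu> (ball y (dist y x) \<inter> space \<nu>)) \<partial>\<nu>) \<partial>\<nu>)
    \<le> ennreal (C4 * nu_doubling_const * (2 * kernel_const)) * emeasure mg (space mg)"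
proof -
  interpret P: pair_sigma_finite \<nu> \<nu> ..
  note besov_kernel_measurable[measurable]
  have tr: "AE y in \<nu>. has_trace_value \<mu> u y (trace \<mu> u y) \<and> y \<in> space \<nu>"
    using AE_trace[OF um] AE_space by eventually_elim simp
  have "(\<integral>\<^sup>+y. (\<integral>\<^sup>+x. ennreal (\<bar>trace \<mu> u y - trace \<mu> u x\<bar> powr p) /
       (ennreal (dist y x powr (\<theta> * p)) * emeasure \<nu> (ball y (dist y x) \<inter> space \<nu>)) \<partial>\<nu>) \<partial>\<nu>)
     \<le> (\<integral>\<^sup>+y. (\<integral>\<^sup>+x. ennreal (C4 * nu_doubling_const) * (besov_kernel mg y x + besov_kernel mg x y) \<partial>\<nu>) \<partial>\<nu>)"
  proof (rule nn_integral_mono_AE)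
    show "AE y in \<nu>. (\<integral>\<^sup>+x. ennreal (\<bar>trace \<mu> u y - trace \<mu> u x\<bar> powr p) /
       (ennreal (dist y x powr (\<theta> * p)) * emeasure \<nu> (ball y (dist y x) \<inter> space \<nu>)) \<partial>\<nu>)
      \<le> (\<integral>\<^sup>+x. ennreal (C4 * nu_doubling_const) * (besov_kernel mg y x + besov_kernel mg x y) \<partial>\<nu>)"
      using tr
    proof eventually_elim
      case (elim y)
      show ?case
      proof (rule nn_integral_mono_AE)
        show "AE x in \<nu>. ennreal (\<bar>trace \<mu> u y - trace \<mu> u x\<bar> powr p) /
          (ennreal (dist y x powr (\<theta> * p)) * emeasure \<nu> (ball y (dist y x) \<inter> space \<nu>))
          \<le> ennreal (C4 * nu_doubling_const) * (besov_kernel mg y x + besov_kernel mg x y)"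
          using tr by eventually_elim (intro integrand_bound \<theta>; use elim in simp)
      qed
    qed
  qed
  also have "\<dots> = ennreal (C4 * nu_doubling_const) * ((\<integral>\<^sup>+y. \<integral>\<^sup>+x. besov_kernel mg y x \<partial>\<nu> \<partial>\<nu>) + (\<integral>\<^sup>+y. \<integral>\<^sup>+x. besov_kernel mg x y \<partial>\<nu> \<partial>\<nu>))"
  proof -
    have [measurable]: "(\<lambda>z. besov_kernel mg (fst z) (snd z)) \<in> borel_measurable (\<nu> \<Otimes>\<^sub>M \<nu>)"
      using besov_kernel_measurable by (simp add: case_prod_beta')
    then have [measurable]: "(\<lambda>z. besov_kernel mg (snd z) (fst z)) \<in> borel_measurable (\<nu> \<Otimes>\<^sub>M \<nu>)"
      using measurable_compose[OF measurable_Pair[OF measurable_snd measurable_fst]] by fastforce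
    have m: "(\<lambda>y. \<integral>\<^sup>+x. besov_kernel mg y x \<partial>\<nu>) \<in> borel_measurable \<nu>" "(\<lambda>y. \<integral>\<^sup>+x. besov_kernel mg x y \<partial>\<nu>) \<in> borel_measurable \<nu>"
      using m.borel_measurable_nn_integral[of "\<lambda>y x. besov_kernel mg y x" \<nu>] m.borel_measurable_nn_integral[of "\<lambda>y x. besov_kernel mg x y" \<nu>]
      by (simp_all add: case_prod_beta')
    have "(\<integral>\<^sup>+y. (\<integral>\<^sup>+x. ennreal (C4 * nu_doubling_const) * (besov_kernel mg y x + besov_kernel mg x y) \<partial>\<nu>) \<partial>\<nu>)
      = (\<integral>\<^sup>+y. ennreal (C4 * nu_doubling_const) * ((\<integral>\<^sup>+x. besov_kernel mg y x \<partial>\<nu>) + (\<integral>\<^sup>+x. besov_kernel mg x y \<partial>\<nu>)) \<partial>\<nu>)"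
    proof (intro nn_integral_cong)
      fix y assume y: "y \<in> space \<nu>"
      have "(\<lambda>x. (y, x)) \<in> measurable \<nu> (\<nu> \<Otimes>\<^sub>M \<nu>)" using y by measurable
      from measurable_compose[OF this \<open>(\<lambda>z. besov_kernel mg (fst z) (snd z)) \<in> _\<close>]
        measurable_compose[OF this \<open>(\<lambda>z. besov_kernel mg (snd z) (fst z)) \<in> _\<close>]
      have "(\<lambda>x. besov_kernel mg y x) \<in> borel_measurable \<nu>" "(\<lambda>x. besov_kernel mg x y) \<in> borel_measurable \<nu>" by simp_all
      then show "(\<integral>\<^sup>+x. ennreal (C4 * nu_doubling_const) * (besov_kernel mg y x + besov_kernel mg x y) \<partial>\<nu>)
        = ennreal (C4 * nu_doubling_const) * ((\<integral>\<^sup>+x. besov_kernel mg y x \<partial>\<nu>) + (\<integral>\<^sup>+x. besov_kernel mg x y \<partial>\<nu>))"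
        by (subst nn_integral_cmult, simp, subst nn_integral_add) auto
    qed
    also have "\<dots> = ennreal (C4 * nu_doubling_const) * ((\<integral>\<^sup>+y. \<integral>\<^sup>+x. besov_kernel mg y x \<partial>\<nu> \<partial>\<nu>) + (\<integral>\<^sup>+y. \<integral>\<^sup>+x. besov_kernel mg x y \<partial>\<nu> \<partial>\<nu>))"
      using m by (subst nn_integral_cmult, simp, subst nn_integral_add) auto
    finally show ?thesis .
  qed
  \<comment> \<open>The kernel is not symmetric, but its two versions have the same double
    integral.\<close>
  also have "(\<integral>\<^sup>+y. \<integral>\<^sup>+x. besov_kernel mg x y \<partial>\<nu> \<partial>\<nu>) = (\<integral>\<^sup>+y. \<integral>\<^sup>+x. besov_kernel mg y x \<partial>\<nu> \<partial>\<nu>)"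
    using P.Fubini'[OF besov_kernel_measurable] by simp
  also have "ennreal (C4 * nu_doubling_const) * ((\<integral>\<^sup>+y. \<integral>\<^sup>+x. besov_kernel mg y x \<partial>\<nu> \<partial>\<nu>) + (\<integral>\<^sup>+y. \<integral>\<^sup>+x. besov_kernel mg y x \<partial>\<nu> \<partial>\<nu>))
     \<le> ennreal (C4 * nu_doubling_const) * (ennreal kernel_const * emeasure mg (space mg) + ennreal kernel_const * emeasure mg (space mg))"
    by (intro mult_left_mono add_mono besov_kernel_integral) auto
  also have "\<dots> = ennreal (C4 * nu_doubling_const * (2 * kernel_const)) * emeasure mg (space mg)"
  proof -
    have "0 \<le> C4 * nu_doubling_const" "0 \<le> kernel_const"
      using geom_const Cm C3 Cd decay by (auto simp: C4_def nu_doubling_const_def kernel_const_def intro!: mult_nonneg_nonneg divide_nonneg_nonneg)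
    moreover have "ennreal kernel_const + ennreal kernel_const = ennreal (2 * kernel_const)"
      unfolding mult_2 using \<open>0 \<le> kernel_const\<close> by (rule ennreal_plus[symmetric]) fact
    ultimately have "ennreal (C4 * nu_doubling_const * (2 * kernel_const)) = ennreal (C4 * nu_doubling_const) * (ennreal kernel_const + ennreal kernel_const)"
      by (simp only: ennreal_mult mult_nonneg_nonneg zero_le_numeral)
    then show ?thesis by (simp only: distrib_right distrib_left mult.assoc)
  qed
  finally show ?thesis .
qed

end

end

subsection \<open>Uniform convexity\<close>

definition nrm :: "('v::real_vector \<Rightarrow> 'v \<Rightarrow> real) \<Rightarrow> 'v \<Rightarrow> real" where
  "nrm b v = sqrt (b v v)"

context
  fixes b :: "'v::real_vector \<Rightarrow> 'v \<Rightarrow> real"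
  assumes ip: "inner_product b"
begin

lemma ip_facts:
  "b (v + w) z = b v z + b w z" "b z (v + w) = b z v + b z w"
  "b (v - w) z = b v z - b w z" "b z (v - w) = b z v - b z w"
  "b (c *\<^sub>R v) z = c * b v z" "b z (c *\<^sub>R v) = c * b z v" "b v w = b w v" "0 \<le> b v v" "b 0 z = 0" "b z 0 = 0"
proof -
  have bl: "bilinear b" using ip by (simp add: inner_product_def)
  show "b (v + w) z = b v z + b w z" "b z (v + w) = b z v + b z w"
    "b (v - w) z = b v z - b w z" "b z (v - w) = b z v - b z w"
    "b (c *\<^sub>R v) z = c * b v z" "b z (c *\<^sub>R v) = c * b z v" "b 0 z = 0" "b z 0 = 0"
    using bilinear_ladd[OF bl] bilinear_radd[OF bl] bilinear_lsub[OF bl] bilinear_rsub[OF bl]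
      bilinear_lmul[OF bl] bilinear_rmul[OF bl] bilinear_lzero[OF bl] bilinear_rzero[OF bl] by auto
  show "b v w = b w v" using ip unfolding inner_product_def by blast
  show "0 \<le> b v v"
    using ip bilinear_lzero[OF bl] unfolding inner_product_def by (cases "v = 0") (auto intro: less_imp_le)
qed

lemma nrm_nonneg: "0 \<le> nrm b v" by (simp add: nrm_def ip_facts(8))

lemma nrm_sq: "nrm b v ^ 2 = b v v" by (simp add: nrm_def ip_facts(8))

lemma nrm_zero: "nrm b 0 = 0" by (simp add: nrm_def ip_facts(9))

lemma nrm_scale: "nrm b (c *\<^sub>R v) = \<bar>c\<bar> * nrm b v"
  by (simp add: nrm_def ip_facts(5,6) real_sqrt_mult[symmetric] mult.assoc[symmetric] real_sqrt_mult)

lemma nrm_parallelogram: "nrm b (v + w) ^ 2 + nrm b (v - w) ^ 2 = 2 * nrm b v ^ 2 + 2 * nrm b w ^ 2"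
  unfolding nrm_sq by (simp add: ip_facts(1-4))

lemma nrm_triangle: "nrm b (v + w) \<le> nrm b v + nrm b w"
proof -
  have cs: "b v w \<le> nrm b v * nrm b w"
  proof (cases "w = 0")
    case False
    then have pos: "0 < b w w" using ip by (auto simp: inner_product_def)
    define c where "c = b v w / b w w"
    have "0 \<le> b (v - c *\<^sub>R w) (v - c *\<^sub>R w)" by (rule ip_facts(8))
    also have "\<dots> = b v v - 2 * c * b v w + c * c * b w w"
      using ip_facts(7)[of w v] by (simp add: ip_facts(3-6) algebra_simps)
    also have "\<dots> = b v v - b v w ^ 2 / b w w"
      using pos by (simp add: c_def power2_eq_square)
    finally have "b v w ^ 2 \<le> b v v * b w w" using pos by (simp add: field_simps)
    then have "b v w ^ 2 \<le> (nrm b v * nrm b w) ^ 2" by (simp add: power_mult_distrib nrm_sq)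
    then show ?thesis using nrm_nonneg by (meson mult_nonneg_nonneg power2_le_imp_le)
  qed (simp add: ip_facts nrm_zero)
  have "nrm b (v + w) ^ 2 = nrm b v ^ 2 + 2 * b v w + nrm b w ^ 2"
    unfolding nrm_sq using ip_facts(7)[of w v] by (simp add: ip_facts(1,2))
  also have "\<dots> \<le> (nrm b v + nrm b w) ^ 2" using cs by (simp add: power2_sum)
  finally show ?thesis using nrm_nonneg by (meson add_nonneg_nonneg power2_le_imp_le)
qed

lemma nrm_diff_le: "nrm b (v - w) \<le> nrm b v + nrm b w"
  using nrm_triangle[of v "(-1) *\<^sub>R w"] nrm_scale[of "-1" w] by simp

end

text \<open>Strict convexity at the midpoint: the mean value theorem on both sides of 1/2, with the
  strictly increasing derivative. Differentiability is needed in open intervals only, so the ends 0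
  and 1 are included.\<close>

lemma powr_midpoint_less:
  fixes s :: real
  assumes p: "1 < p" and s: "0 \<le> s" "s \<le> 1" "s \<noteq> 1 / 2"
  shows "(1 / 2) powr p < (s powr p + (1 - s) powr p) / 2"
proof -
  have main: "(1 / 2) powr p < (s powr p + (1 - s) powr p) / 2" if s: "1 / 2 < s" "s \<le> 1" for s
  proof -
    have cont: "continuous_on {a..b} (\<lambda>x. x powr p)" if "0 \<le> a" for a b :: real
      using that p by (intro continuous_on_powr' continuous_intros) auto
    have der: "((\<lambda>x. x powr p) has_derivative (\<lambda>h. h * (p * x powr (p - 1)))) (at x)" if "0 < x" for x :: real
      using has_real_derivative_powr[OF that, of p] unfolding has_field_derivative_def
      by (rule has_derivative_eq_rhs) (simp add: fun_eq_iff mult.commute)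
    obtain y where y: "1 / 2 < y" "y < s" "s powr p - (1 / 2) powr p = (s - 1 / 2) * (p * y powr (p - 1))"
      using mvt[OF s(1) cont der] by auto
    obtain z where z: "1 - s < z" "z < 1 / 2" "(1 / 2) powr p - (1 - s) powr p = (1 / 2 - (1 - s)) * (p * z powr (p - 1))"
      using mvt[of "1 - s" "1 / 2" "\<lambda>x. x powr p" "\<lambda>x h. h * (p * x powr (p - 1))"] cont der s by auto
    have "z powr (p - 1) < y powr (p - 1)" using y z s p by (intro powr_less_mono2) auto
    then have "(1 / 2 - (1 - s)) * (p * z powr (p - 1)) < (s - 1 / 2) * (p * y powr (p - 1))"
    proof -
      have "1 / 2 - (1 - s) = s - 1 / 2" by simp
      then show ?thesis using s p \<open>z powr (p - 1) < y powr (p - 1)\<close> by (simp only:) (intro mult_strict_left_mono; simp)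
    qed
    then have "(1 / 2) powr p - (1 - s) powr p < s powr p - (1 / 2) powr p" unfolding y(3) z(3) .
    then show ?thesis by simp
  qed
  show ?thesis using main[of s] main[of "1 - s"] s by (cases "1 / 2 < s") auto
qed

text \<open>Here \<open>s\<close>, \<open>t\<close>, \<open>h\<close> stand for the norms of v, w
  and v - w; by the parallelogram law the base of the first power is the squared norm of the
  midpoint. By homogeneity \<open>s + t = 1\<close> may be assumed, and \<open>d\<close> is the
  minimum of the continuous defect over the compact set \<open>K\<close>. The defect is positive: by
  strict convexity if \<open>s\<close> is not 1/2, and because \<open>h\<close> is at least
  \<open>e\<close> if it is.\<close>

lemma uniform_convexity_scalar:
  fixes p e :: real
  assumes p: "1 < p" and e: "0 < e"
  obtains d where "0 < d" "\<And>s t h. 0 \<le> s \<Longrightarrow> 0 \<le> t \<Longrightarrow> \<bar>s - t\<bar> \<le> h \<Longrightarrow> h \<le> s + t \<Longrightarrow> e * (s + t) \<le> h \<Longrightarrow>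
    ((s ^ 2 + t ^ 2) / 2 - h ^ 2 / 4) powr (p / 2) + d * (s + t) powr p \<le> (s powr p + t powr p) / 2"
proof -
  define K where "K = {(s, h) :: real \<times> real | s h. 0 \<le> s \<and> s \<le> 1 \<and> e \<le> h \<and> h \<le> 1 \<and> 2 * s - 1 \<le> h \<and> 1 - 2 * s \<le> h}"
  define m where "m z = (fst z ^ 2 + (1 - fst z) ^ 2) / 2 - snd z ^ 2 / 4" for z :: "real \<times> real"
  define F where "F z = (fst z powr p + (1 - fst z) powr p) / 2 - m z powr (p / 2)" for z
  have "K = {z. 0 \<le> fst z} \<inter> {z. fst z \<le> 1} \<inter> {z. e \<le> snd z} \<inter> {z. snd z \<le> 1} \<inter> {z. 2 * fst z - 1 \<le> snd z} \<inter> {z. 1 - 2 * fst z \<le> snd z}"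
    by (auto simp: K_def)
  then have "closed K" by (auto intro!: closed_Int closed_Collect_le continuous_intros)
  moreover have "bounded K"
    by (rule bounded_subset[OF bounded_Times[of "{0..1}" "{0..1}"]]) (use e in \<open>auto simp: K_def\<close>)
  ultimately have cpt: "compact K" by (simp add: compact_eq_bounded_closed)
  have m: "0 \<le> m z" "m z \<le> 1 / 4" if zK: "z \<in> K" for z
  proof -
    obtain s h where z: "z = (s, h)" "0 \<le> s" "s \<le> 1" "e \<le> h" "h \<le> 1" "2 * s - 1 \<le> h" "1 - 2 * s \<le> h"
      using zK by (cases z) (auto simp: K_def)
    have "0 \<le> (2 * s - 1) ^ 2" by simp
    moreover have "(2 * s - 1) ^ 2 \<le> h ^ 2" using z e by (intro abs_le_square_iff[THEN iffD1]) auto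
    moreover have "h ^ 2 \<le> 1" using z e by (simp add: power_le_one)
    moreover have "(s ^ 2 + (1 - s) ^ 2) / 2 = 1 / 4 + (2 * s - 1) ^ 2 / 4" by (simp add: power2_eq_square field_simps)
    ultimately show "0 \<le> m z" "m z \<le> 1 / 4" unfolding m_def z(1) fst_conv snd_conv by linarith+
  qed
  have "continuous_on K m" unfolding m_def by (intro continuous_intros) auto
  then have cF: "continuous_on K F"
    unfolding F_def using p m by (intro continuous_intros continuous_on_powr') (auto simp: K_def)
  have quarter: "(1 / 4 :: real) powr (p / 2) = (1 / 2) powr p"
  proof -
    have "(1 / 4 :: real) = (1 / 2) powr 2" by (simp add: powr_numeral power2_eq_square)
    then show ?thesis by (simp only: powr_powr) simp
  qed
  have Fpos: "0 < F z" if z: "z \<in> K" for z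
  proof (cases "fst z = 1 / 2")
    case True
    have "0 < snd z" using z e by (auto simp: K_def)
    moreover have "m z = 1 / 4 - snd z ^ 2 / 4" unfolding m_def True by (simp add: power2_eq_square)
    ultimately have "m z < 1 / 4" by simp
    then have "m z powr (p / 2) < (1 / 4) powr (p / 2)" using m[OF z] p by (intro powr_less_mono2) auto
    then show ?thesis unfolding F_def quarter True by simp
  next
    case False
    have "(1 / 2) powr p < (fst z powr p + (1 - fst z) powr p) / 2"
      using z False p by (intro powr_midpoint_less) (auto simp: K_def)
    moreover have "m z powr (p / 2) \<le> (1 / 4) powr (p / 2)" using m[OF z] p by (intro powr_mono2) auto
    ultimately show ?thesis unfolding F_def quarter by simp
  qed
  obtain d where d: "0 < d" "\<And>z. z \<in> K \<Longrightarrow> d \<le> F z"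
  proof (cases "K = {}")
    case False
    obtain z0 where "z0 \<in> K" "\<And>z. z \<in> K \<Longrightarrow> F z0 \<le> F z" using continuous_attains_inf[OF cpt False cF] by auto
    then show ?thesis using that[of "F z0"] Fpos by auto
  qed (use that[of 1] in auto)
  show ?thesis
  proof (rule that[OF d(1)])
    fix s t h :: real assume a: "0 \<le> s" "0 \<le> t" "\<bar>s - t\<bar> \<le> h" "h \<le> s + t" "e * (s + t) \<le> h"
    show "((s ^ 2 + t ^ 2) / 2 - h ^ 2 / 4) powr (p / 2) + d * (s + t) powr p \<le> (s powr p + t powr p) / 2"
    proof (cases "s + t = 0")
      case True
      then have "s = 0" "t = 0" "h = 0" using a by auto
      then show ?thesis by simp
    next
      case False
      then have c: "0 < s + t" using a by simp
      define c where "c = s + t"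
      define z where "z = (s / c, h / c)"
      have c0: "0 < c" using c by (simp add: c_def)
      have ct: "t = c - s" by (simp add: c_def)
      have "2 * (s / c) - 1 = (s - t) / c" "1 - 2 * (s / c) = (t - s) / c"
        using c0 unfolding ct by (simp_all add: field_simps)
      moreover have "(s - t) / c \<le> h / c" "(t - s) / c \<le> h / c" using a c0 by (auto intro!: divide_right_mono)
      moreover have "e \<le> h / c" "h / c \<le> 1" "0 \<le> s / c" "s / c \<le> 1" using a c0 by (auto simp: c_def pos_le_divide_eq)
      ultimately have "z \<in> K" by (simp add: K_def z_def)
      then have "d \<le> F z" by (rule d(2))
      have t: "1 - s / c = t / c" using c0 by (simp add: c_def field_simps)
      have mz: "m z = ((s ^ 2 + t ^ 2) / 2 - h ^ 2 / 4) / c ^ 2"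
        unfolding m_def z_def fst_conv snd_conv t using c0 by (simp add: power_divide field_simps)
      have nn: "0 \<le> (s ^ 2 + t ^ 2) / 2 - h ^ 2 / 4"
        using m(1)[OF \<open>z \<in> K\<close>] c0 unfolding mz by (simp add: zero_le_divide_iff)
      have "(c ^ 2) powr (p / 2) = c powr p" using c0 by (simp add: powr_numeral[symmetric] powr_powr del: powr_numeral)
      then have "F z = ((s powr p + t powr p) / 2 - ((s ^ 2 + t ^ 2) / 2 - h ^ 2 / 4) powr (p / 2)) / c powr p"
      proof -
        define Q where "Q = (s ^ 2 + t ^ 2) / 2 - h ^ 2 / 4"
        have "(Q / c ^ 2) powr (p / 2) = Q powr (p / 2) / (c ^ 2) powr (p / 2)"
          by (rule powr_divide)
        then have Q: "(Q / c ^ 2) powr (p / 2) = Q powr (p / 2) / c powr p"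
          using \<open>(c ^ 2) powr (p / 2) = c powr p\<close> by simp
        have st: "(s / c) powr p = s powr p / c powr p" "(t / c) powr p = t powr p / c powr p"
          by (rule powr_divide)+
        show ?thesis
          unfolding F_def mz unfolding z_def fst_conv t Q_def[symmetric] Q st
          by (simp add: diff_divide_distrib add_divide_distrib)
      qed
      then have "d * c powr p \<le> (s powr p + t powr p) / 2 - ((s ^ 2 + t ^ 2) / 2 - h ^ 2 / 4) powr (p / 2)"
        using \<open>d \<le> F z\<close> c0 by (simp add: pos_le_divide_eq)
      then show ?thesis unfolding c_def by linarith
    qed
  qed
qed

lemma powr_add_le:
  fixes a b :: real
  assumes "0 \<le> a" "0 \<le> b" "0 \<le> p"
  shows "(a + b) powr p \<le> 2 powr p * (a powr p + b powr p)"
proof -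
  have "(a + b) powr p \<le> (2 * max a b) powr p" using assms by (intro powr_mono2) auto
  also have "\<dots> = 2 powr p * max a b powr p" using assms by (simp add: powr_mult)
  also have "\<dots> \<le> 2 powr p * (a powr p + b powr p)" by (intro mult_left_mono) (auto simp: max_def)
  finally show ?thesis .
qed

text \<open>Replaces Minkowski's inequality where a constant 2^p is too lossy: as \<open>h\<close>
  tends to 0 the first coefficient tends to 1, while the second multiplies a quantity that is sent
  to zero beforehand.\<close>

lemma powr_add_le_eps:
  fixes a b h :: real
  assumes "0 \<le> a" "0 \<le> b" "0 \<le> p" "0 < h"
  shows "(a + b) powr p \<le> (1 + h) powr p * a powr p + (1 + 1 / h) powr p * b powr p"
proof (cases "b \<le> h * a")
  case True
  then have "(a + b) powr p \<le> ((1 + h) * a) powr p" using assms by (intro powr_mono2) (auto simp: algebra_simps)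
  also have "\<dots> = (1 + h) powr p * a powr p" using assms by (simp add: powr_mult)
  finally show ?thesis by (simp add: add_increasing2)
next
  case False
  then have "a + b \<le> (1 + 1 / h) * b" using assms by (simp add: field_simps)
  then have "(a + b) powr p \<le> ((1 + 1 / h) * b) powr p" using assms by (intro powr_mono2) auto
  also have "\<dots> = (1 + 1 / h) powr p * b powr p" using assms by (simp add: powr_mult)
  finally show ?thesis by (simp add: add_increasing)
qed

text \<open>If the difference is small relative to \<open>s + t\<close>, the term with
  \<open>e\<close> absorbs it, the convexity defect being nonnegative. Otherwise the scalar
  inequality bounds it by the defect. \<open>C\<close> is fixed before \<open>b\<close>, so one
  constant serves the different inner products at all points, and the inequality can be
  integrated.\<close>

lemma uniform_convexity:
  fixes p e :: real
  assumes p: "1 < p" and e: "0 < e"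
  obtains C where "0 < C" "\<And>(b :: 'v::real_vector \<Rightarrow> 'v \<Rightarrow> real) v w. inner_product b \<Longrightarrow>
    nrm b (v - w) powr p + C * nrm b ((1 / 2) *\<^sub>R (v + w)) powr p
      \<le> e * (nrm b v powr p + nrm b w powr p) + C * ((nrm b v powr p + nrm b w powr p) / 2)"
proof -
  \<comment> \<open>Chosen so that \<open>(2 * e') powr p = e\<close>; the 2 is the loss in
    \<open>powr_add_le\<close>.\<close>
  define e' where "e' = e powr (1 / p) / 2"
  have e': "0 < e'" using e by (simp add: e'_def)
  obtain d where d: "0 < d" "\<And>s t h. 0 \<le> s \<Longrightarrow> 0 \<le> t \<Longrightarrow> \<bar>s - t\<bar> \<le> h \<Longrightarrow> h \<le> s + t \<Longrightarrow> e' * (s + t) \<le> h \<Longrightarrow>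
    ((s ^ 2 + t ^ 2) / 2 - h ^ 2 / 4) powr (p / 2) + d * (s + t) powr p \<le> (s powr p + t powr p) / 2"
    using uniform_convexity_scalar[OF p e'] by blast
  show ?thesis
  proof (rule that[of "1 / d"])
    fix b :: "'v \<Rightarrow> 'v \<Rightarrow> real" and v w assume b: "inner_product b"
    define s t h where "s = nrm b v" and "t = nrm b w" and "h = nrm b (v - w)"
    define q where "q = nrm b ((1 / 2) *\<^sub>R (v + w))"
    have nn: "0 \<le> s" "0 \<le> t" "0 \<le> h" "0 \<le> q" unfolding s_def t_def h_def q_def by (rule nrm_nonneg[OF b])+
    have h2: "h \<le> s + t" unfolding s_def t_def h_def by (rule nrm_diff_le[OF b])
    have h1: "\<bar>s - t\<bar> \<le> h"
      using nrm_triangle[OF b, of "v - w" w] nrm_diff_le[OF b, of v "v - w"] unfolding s_def t_def h_def by simp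
    have "q ^ 2 = (s ^ 2 + t ^ 2) / 2 - h ^ 2 / 4"
      unfolding q_def nrm_scale[OF b] s_def t_def h_def
      using nrm_parallelogram[OF b, of v w] by (simp add: power_mult_distrib power2_eq_square[of "1/2"] field_simps)
    moreover have "(q ^ 2) powr (p / 2) = q powr p"
      using nn(4) by (cases "q = 0") (auto simp: powr_numeral[symmetric] powr_powr simp del: powr_numeral)
    ultimately have q: "((s ^ 2 + t ^ 2) / 2 - h ^ 2 / 4) powr (p / 2) = q powr p" by simp
    have "q powr p \<le> (s powr p + t powr p) / 2"
    proof -
      have "q \<le> (s + t) / 2" unfolding q_def nrm_scale[OF b] s_def t_def using nrm_triangle[OF b, of v w] by simp
      then have "q powr p \<le> ((s + t) / 2) powr p" using nn p by (intro powr_mono2) auto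
      also have "\<dots> \<le> (s powr p + t powr p) / 2"
      proof (cases "s + t = 0")
        case False
        then have c: "0 < s + t" using nn by simp
        have "(1 / 2) powr p \<le> ((s / (s + t)) powr p + (1 - s / (s + t)) powr p) / 2"
          using powr_midpoint_less[OF p, of "s / (s + t)"] nn c by (cases "s / (s + t) = 1 / 2") (auto simp: field_simps)
        also have "1 - s / (s + t) = t / (s + t)" using c by (simp add: field_simps)
        finally have "(1 / 2) powr p * (s + t) powr p \<le> (s powr p + t powr p) / 2"
          using c nn by (simp add: powr_divide add_divide_distrib[symmetric] field_simps)
        then show ?thesis using nn by (simp add: powr_mult[symmetric])
      qed (use nn p in simp)
      finally show ?thesis .
    qed
    then have low: "0 \<le> 1 / d * ((s powr p + t powr p) / 2 - q powr p)" using d(1) by simp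
    have "h powr p \<le> e * (s powr p + t powr p) + 1 / d * ((s powr p + t powr p) / 2 - q powr p)"
    proof (cases "e' * (s + t) \<le> h")
      case True
      have "h powr p \<le> (s + t) powr p" using h2 nn p by (intro powr_mono2) auto
      also have "\<dots> \<le> 1 / d * ((s powr p + t powr p) / 2 - q powr p)"
        using d(2)[OF nn(1,2) h1 h2 True] d(1) unfolding q by (simp add: field_simps)
      finally show ?thesis using e by (simp add: add_increasing)
    next
      case False
      then have "h powr p \<le> (e' * (s + t)) powr p" using nn p by (intro powr_mono2) auto
      also have "\<dots> = e' powr p * (s + t) powr p" using e' nn by (simp add: powr_mult)
      also have "\<dots> \<le> e' powr p * (2 powr p * (s powr p + t powr p))"
        using nn p by (intro mult_left_mono powr_add_le) auto
      also have "\<dots> = e * (s powr p + t powr p)"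
        using e p by (simp add: e'_def powr_divide powr_powr)
      finally show ?thesis using low by simp
    qed
    then show "nrm b (v - w) powr p + 1 / d * nrm b ((1 / 2) *\<^sub>R (v + w)) powr p
      \<le> e * (nrm b v powr p + nrm b w powr p) + 1 / d * ((nrm b v powr p + nrm b w powr p) / 2)"
      unfolding s_def t_def h_def q_def by (simp add: right_diff_distrib)
  qed (use d in simp)
qed

text \<open>The inner products are known to be measurable only for fixed pairs of vectors, so the
  norm of a varying vector is expanded in coordinates.\<close>

lemma nrm_measurable:
  fixes f :: "'a \<Rightarrow> real ^ 'n::finite"
  assumes ip: "\<And>x. x \<in> space M \<Longrightarrow> inner_product (b x)"
    and bm: "\<And>v w. (\<lambda>x. b x v w) \<in> borel_measurable M" and f: "f \<in> borel_measurable M"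
  shows "(\<lambda>x. nrm (b x) (f x)) \<in> borel_measurable M"
proof -
  have "b x (f x) (f x) = (\<Sum>i\<in>UNIV. \<Sum>j\<in>UNIV. (f x \<bullet> axis i 1) * (f x \<bullet> axis j 1) * b x (axis i 1) (axis j 1))"
    if x: "x \<in> space M" for x
  proof -
    have bl: "bilinear (b x)" using ip[OF x] by (simp add: inner_product_def)
    have e: "f x = (\<Sum>i\<in>UNIV. (f x \<bullet> axis i 1) *\<^sub>R axis i 1)"
      using basis_expansion[of "f x"] by (simp add: inner_axis scalar_mult_eq_scaleR)
    have "b x (f x) (f x) = b x (\<Sum>i\<in>UNIV. (f x \<bullet> axis i 1) *\<^sub>R axis i 1) (\<Sum>i\<in>UNIV. (f x \<bullet> axis i 1) *\<^sub>R axis i 1)"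
      using e by simp
    also have "\<dots> = (\<Sum>i\<in>UNIV. \<Sum>j\<in>UNIV. b x ((f x \<bullet> axis i 1) *\<^sub>R axis i 1) ((f x \<bullet> axis j 1) *\<^sub>R axis j 1))"
      by (subst bilinear_sum[OF bl]) (simp add: sum.cartesian_product)
    finally show ?thesis by (simp add: ip_facts(5,6)[OF ip[OF x]] mult_ac)
  qed
  moreover have "(\<lambda>x. \<Sum>i\<in>UNIV. \<Sum>j\<in>UNIV. (f x \<bullet> axis i 1) * (f x \<bullet> axis j 1) * b x (axis i 1) (axis j 1)) \<in> borel_measurable M"
    using bm f by (intro borel_measurable_sum borel_measurable_times borel_measurable_inner) auto
  ultimately have "(\<lambda>x. b x (f x) (f x)) \<in> borel_measurable M" by (simp cong: measurable_cong)
  then show ?thesis unfolding nrm_def by measurable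
qed

subsection \<open>Minimization of the energy\<close>

lemma has_trace_value_cong:
  assumes "AE x in \<mu>. u x = v x"
  shows "has_trace_value \<mu> u = has_trace_value \<mu> v"
proof -
  have "emean \<mu> B (\<lambda>x. ennreal \<bar>u x - a\<bar>) = emean \<mu> B (\<lambda>x. ennreal \<bar>v x - a\<bar>)" for B a
    unfolding emean_def nn_integral_completion using assms
    by (intro arg_cong2[where f = "(/)"] nn_integral_cong_AE refl) (auto elim: eventually_mono)
  then show ?thesis by (intro ext) (simp add: has_trace_value_def)
qed

lemma trace_cong: "AE x in \<mu>. u x = v x \<Longrightarrow> trace \<mu> u = trace \<mu> v"
  using has_trace_value_cong[of u v \<mu>] by (intro ext) (simp add: trace_def)

section \<open>Sobolev functions as functions with a Poincare inequality\<close>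

locale sobolev_space = pi_space \<mu> Cd p Cp l for \<mu> :: "'a::metric_space measure" and Cd p Cp l +
  assumes poincare_ug: "x \<in> space \<mu> \<Longrightarrow> 0 < r \<Longrightarrow> upper_gradient \<mu> u g \<Longrightarrow>
      set_integrable (completion \<mu>) (ball x r \<inter> space \<mu>) u \<Longrightarrow>
        emean \<mu> (ball x r \<inter> space \<mu>) (\<lambda>y. ennreal \<bar>u y - mean \<mu> (ball x r \<inter> space \<mu>) u\<bar>)
          \<le> ennreal (Cp * r) * epowr (emean \<mu> (ball x (l * r) \<inter> space \<mu>) (\<lambda>y. epowr (g y) p)) (1 / p)"
begin

lemma p0: "0 < p" using p by simp

lemma integrable_of_pint:
  assumes u: "u \<in> borel_measurable \<mu>" and fin: "pint p \<mu> (\<lambda>x. ennreal \<bar>u x\<bar>) < top"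
  shows "integrable \<mu> (u :: 'a \<Rightarrow> real)"
proof (rule integrableI_bounded[OF u])
  have "ennreal (norm (u x)) \<le> 1 + epowr (ennreal \<bar>u x\<bar>) p" for x
  proof -
    have "\<bar>u x\<bar> \<le> 1 + \<bar>u x\<bar> powr p"
    proof (cases "\<bar>u x\<bar> \<le> 1")
      case False
      then have "\<bar>u x\<bar> powr 1 \<le> \<bar>u x\<bar> powr p" using p by (intro powr_mono) auto
      then show ?thesis using False by simp
    qed (simp add: add_increasing2)
    then have "ennreal \<bar>u x\<bar> \<le> ennreal (1 + \<bar>u x\<bar> powr p)" by (rule ennreal_leI)
    then show ?thesis by (simp add: epowr_ennreal)
  qed
  then have "(\<integral>\<^sup>+x. ennreal (norm (u x)) \<partial>\<mu>) \<le> (\<integral>\<^sup>+x. 1 + epowr (ennreal \<bar>u x\<bar>) p \<partial>\<mu>)"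
    by (intro nn_integral_mono)
  also have "\<dots> = emeasure \<mu> (space \<mu>) + pint p \<mu> (\<lambda>x. ennreal \<bar>u x\<bar>)"
    unfolding pint_def using u by (subst nn_integral_add) auto
  also have "\<dots> < \<infinity>" using fin emeasure_finite[of "space \<mu>"] by (simp add: less_top[symmetric])
  finally show "(\<integral>\<^sup>+x. ennreal (norm (u x)) \<partial>\<mu>) < \<infinity>" .
qed

text \<open>The Poincare inequality is applied to \<open>u\<close>, of which \<open>g\<close> is an
  upper gradient, and only then read for the Borel version \<open>v\<close>, which need not have
  \<open>g\<close> as an upper gradient. The mean over the dilated ball is divided by the smaller
  volume of the original ball, which is the weaker form that \<open>pi_pair\<close> records.\<close>

lemma pi_pair_of_upper_gradient:
  assumes u: "u \<in> borel_measurable (completion \<mu>)" "pint p \<mu> (\<lambda>x. ennreal \<bar>u x\<bar>) < top"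
    and g: "upper_gradient \<mu> u g" "pint p \<mu> g < top"
  obtains v where "AE x in \<mu>. u x = v x" "pi_pair v (density \<mu> (\<lambda>x. epowr (g x) p))"
proof -
  obtain v where v [measurable]: "v \<in> borel_measurable \<mu>" and ae: "AE x in \<mu>. u x = v x"
    using completion_ex_borel_measurable_real[OF u(1)] by auto
  have [measurable]: "g \<in> borel_measurable \<mu>" using g by (simp add: upper_gradient_def)
  define mg where "mg = density \<mu> (\<lambda>x. epowr (g x) p)"
  have "pint p \<mu> (\<lambda>x. ennreal \<bar>v x\<bar>) = pint p \<mu> (\<lambda>x. ennreal \<bar>u x\<bar>)"
    unfolding pint_def using ae by (intro nn_integral_cong_AE) (auto elim: eventually_mono)
  then have vi: "integrable \<mu> v" using u(2) by (intro integrable_of_pint v) simp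
  have sp: "space mg = space \<mu>" and st: "sets mg = sets \<mu>" by (simp_all add: mg_def)
  have em: "emeasure mg A = (\<integral>\<^sup>+x. epowr (g x) p * indicator A x \<partial>\<mu>)" if "A \<in> sets \<mu>" for A
    unfolding mg_def using that by (intro emeasure_density) auto
  have "emeasure mg (space mg) = pint p \<mu> g"
    unfolding sp using em[of "space \<mu>"] by (auto simp: pint_def intro!: nn_integral_cong)
  then have fin: "finite_measure mg" using g(2) by (intro finite_measureI) auto
  then interpret mg: finite_borel mg
    by (intro finite_borel.intro finite_borel_axioms.intro) (simp_all only: st sp sets_eq[symmetric])
  have li: "(LINT x:ball z r \<inter> space \<mu>|completion \<mu>. u x) = (LINT x:ball z r \<inter> space \<mu>|\<mu>. v x)" for z r
  proof -
    have [measurable]: "ball z r \<inter> space \<mu> \<in> sets (completion \<mu>)" using ball_in_sets by simp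
    have vm: "v \<in> borel_measurable (completion \<mu>)" by (intro measurable_completion) measurable
    have "(LINT x:ball z r \<inter> space \<mu>|completion \<mu>. u x) = (LINT x:ball z r \<inter> space \<mu>|completion \<mu>. v x)"
      unfolding set_lebesgue_integral_def
    proof (intro integral_cong_AE)
      show "AE x in completion \<mu>. indicator (ball z r \<inter> space \<mu>) x *\<^sub>R u x = indicator (ball z r \<inter> space \<mu>) x *\<^sub>R v x"
        using AE_completion[OF ae] by eventually_elim simp
    qed (use u(1) vm in measurable)
    also have "\<dots> = (LINT x:ball z r \<inter> space \<mu>|\<mu>. v x)"
      unfolding set_lebesgue_integral_def using ball_in_sets by (intro integral_completion) measurable
    finally show ?thesis .
  qed
  have "integrable (completion \<mu>) u"
  proof -
    have vm: "v \<in> borel_measurable (completion \<mu>)" by (intro measurable_completion) measurable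
    have "integrable (completion \<mu>) v" using vi v by (simp add: integrable_completion)
    then show ?thesis using u(1) AE_completion[OF ae] vm by (subst integrable_cong_AE[where g = v]) auto
  qed
  then have si: "set_integrable (completion \<mu>) (ball z r \<inter> space \<mu>) u" for z r
    unfolding set_integrable_def using ball_in_sets by (intro integrable_mult_indicator) auto
  have "avg \<mu> (\<lambda>y. \<bar>v y - avg \<mu> v x r\<bar>) x r \<le> Cp * r * (vol mg x (l * r) / vol \<mu> x r) powr (1 / p)"
    if x: "x \<in> space \<mu>" and r: "0 < r" for x r
  proof -
    have xc: "x \<in> closure (space \<mu>)" using x closure_subset by auto
    have lr: "0 < l * r" "r \<le> l * r" using l r by auto
    have "mean \<mu> (ball x r \<inter> space \<mu>) u = avg \<mu> v x r"
      by (simp add: mean_def avg_def li vol_def)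
    then have "ennreal (avg \<mu> (\<lambda>y. \<bar>v y - avg \<mu> v x r\<bar>) x r)
      = emean \<mu> (ball x r \<inter> space \<mu>) (\<lambda>y. ennreal \<bar>u y - mean \<mu> (ball x r \<inter> space \<mu>) u\<bar>)"
      unfolding emean_avg[OF vi xc r, symmetric] unfolding emean_def nn_integral_completion
      using ae by (intro arg_cong2[where f = "(/)"] nn_integral_cong_AE refl) (auto elim: eventually_mono)
    also have "\<dots> \<le> ennreal (Cp * r) * epowr (emean \<mu> (ball x (l * r) \<inter> space \<mu>) (\<lambda>y. epowr (g y) p)) (1 / p)"
      by (rule poincare_ug[OF x r g(1) si])
    also have "emean \<mu> (ball x (l * r) \<inter> space \<mu>) (\<lambda>y. epowr (g y) p)
        = ennreal (vol mg x (l * r) / vol \<mu> x (l * r))"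
      unfolding emean_def nn_integral_completion em[OF ball_in_sets, symmetric]
      using vol_pos[OF xc lr(1)] mg.emeasure_ball[of x "l * r"] by (simp add: sp emeasure_ball divide_ennreal)
    also have "epowr \<dots> (1 / p) \<le> epowr (ennreal (vol mg x (l * r) / vol \<mu> x r)) (1 / p)"
      using p vol_pos[OF xc r] vol_pos[OF xc lr(1)] lr
      by (intro epowr_mono ennreal_leI divide_left_mono vol_mono) auto
    finally have "ennreal (avg \<mu> (\<lambda>y. \<bar>v y - avg \<mu> v x r\<bar>) x r)
        \<le> ennreal (Cp * r * (vol mg x (l * r) / vol \<mu> x r) powr (1 / p))"
      using Cp r by (simp add: epowr_ennreal ennreal_mult mult_left_mono)
    then show ?thesis using Cp r by (subst (asm) ennreal_le_iff) auto
  qed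
  then have "pi_pair v mg" unfolding pi_pair_def using vi fin st by auto
  then show ?thesis using that ae by (simp add: mg_def)
qed

lemma emeasure_density_space:
  assumes "g \<in> borel_measurable \<mu>"
  shows "emeasure (density \<mu> (\<lambda>x. epowr (g x) p)) (space (density \<mu> (\<lambda>x. epowr (g x) p))) = pint p \<mu> g"
  using assms by (simp add: emeasure_density pint_def)

lemma N1p_Lp_poincare:
  obtains KL where "0 \<le> KL" "\<And>u g. u \<in> N1p p \<mu> \<Longrightarrow> upper_gradient \<mu> u g \<Longrightarrow> pint p \<mu> g < top \<Longrightarrow>
    \<exists>c. pint p \<mu> (\<lambda>x. ennreal \<bar>u x - c\<bar>) \<le> ennreal KL * pint p \<mu> g"
proof -
  obtain KL where KL: "\<And>v mg. pi_pair v mg \<Longrightarrow>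
    (\<integral>\<^sup>+x. ennreal (\<bar>v x - (LINT y|\<mu>. v y) / measure \<mu> (space \<mu>)\<bar> powr p) \<partial>\<mu>) \<le> ennreal KL * emeasure mg (space mg)"
    using Lp_poincare by auto
  have "\<exists>c. pint p \<mu> (\<lambda>x. ennreal \<bar>u x - c\<bar>) \<le> ennreal (max 0 KL) * pint p \<mu> g"
    if u: "u \<in> N1p p \<mu>" and g: "upper_gradient \<mu> u g" "pint p \<mu> g < top" for u g
  proof -
    have "u \<in> borel_measurable (completion \<mu>)" "pint p \<mu> (\<lambda>x. ennreal \<bar>u x\<bar>) < top"
      using u by (auto simp: N1p_def)
    from pi_pair_of_upper_gradient[OF this g] obtain v where v: "AE x in \<mu>. u x = v x"
      "pi_pair v (density \<mu> (\<lambda>x. epowr (g x) p))" by blast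
    define c where "c = (LINT y|\<mu>. v y) / measure \<mu> (space \<mu>)"
    have "pint p \<mu> (\<lambda>x. ennreal \<bar>u x - c\<bar>) = (\<integral>\<^sup>+x. ennreal (\<bar>v x - c\<bar> powr p) \<partial>\<mu>)"
      unfolding pint_def using v(1) by (intro nn_integral_cong_AE) (auto simp: epowr_ennreal elim: eventually_mono)
    also have "\<dots> \<le> ennreal KL * pint p \<mu> g"
      using KL[OF v(2)] g(1) emeasure_density_space[of g] by (simp add: c_def upper_gradient_def)
    also have "\<dots> \<le> ennreal (max 0 KL) * pint p \<mu> g" by (intro mult_right_mono ennreal_leI) auto
    finally show ?thesis by blast
  qed
  then show ?thesis using that[of "max 0 KL"] by auto
qed

end

text \<open>The weight \<open>w = p\<close> in \<open>epowr_suminf_le\<close> gives the ratio 1/2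
  and the constant \<open>2 powr p\<close>; it consumes half of the decay of 4^(-p j), and 2^(-p j)
  remains to be summed.\<close>

lemma pint_suminf_geometric:
  assumes p: "1 < p" and C: "0 \<le> C"
    and h [measurable]: "\<And>j. h j \<in> borel_measurable M" and le: "\<And>j. pint p M (h j) \<le> ennreal (C * (1 / 4) powr (p * real j))"
  shows "pint p M (\<lambda>x. \<Sum>j. h (j + k) x) \<le> ennreal (2 powr p * (C / (1 - 2 powr (- p))) * (1 / 4) powr (p * real k))"
proof -
  let ?e = "\<lambda>j. (1 / 4 :: real) powr (p * real j)"
  have two: "(1 / (1 - 2 powr (- p / p))) powr p = 2 powr p"
    using p by (simp add: powr_minus_divide)
  have q: "2 powr (- p) < 1" using p by (simp add: powr_less_one)
  have "pint p M (\<lambda>x. \<Sum>j. h (j + k) x)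
      \<le> (\<integral>\<^sup>+x. ennreal (2 powr p) * (\<Sum>j. ennreal (2 powr (p * real j)) * epowr (h (j + k) x) p) \<partial>M)"
    unfolding pint_def using epowr_suminf_le[of p p "\<lambda>j. h (j + k) _"] p unfolding two
    by (intro nn_integral_mono) auto
  also have "\<dots> = ennreal (2 powr p) * (\<Sum>j. ennreal (2 powr (p * real j)) * pint p M (h (j + k)))"
    by (simp add: nn_integral_cmult nn_integral_suminf pint_def)
  also have "\<dots> \<le> ennreal (2 powr p) * (\<Sum>j. ennreal ((C * ?e k) * (2 powr (- p)) ^ j))"
  proof (intro mult_left_mono suminf_le)
    fix j
    have "ennreal (2 powr (p * real j)) * pint p M (h (j + k)) \<le> ennreal (2 powr (p * real j)) * ennreal (C * ?e (j + k))"
      by (intro mult_left_mono le) auto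
    also have "\<dots> = ennreal ((C * ?e k) * (2 powr (- p)) ^ j)"
    proof -
      have "(1 / 4 :: real) = 2 powr (- 2)" by (simp add: powr_minus_divide)
      then have "?e (j + k) = ?e k * 2 powr (- (2 * (p * real j)))"
        by (simp only: powr_powr powr_add[symmetric]) (simp add: algebra_simps)
      moreover have "2 powr (p * real j) * 2 powr (- (2 * (p * real j))) = (2 powr (- p)) ^ j"
        by (simp add: powr_add[symmetric] powr_realpow[symmetric] powr_powr)
      ultimately have "2 powr (p * real j) * (C * ?e (j + k)) = (C * ?e k) * (2 powr (- p)) ^ j"
        by (simp add: mult_ac)
      then show ?thesis using C by (simp add: ennreal_mult[symmetric])
    qed
    finally show "ennreal (2 powr (p * real j)) * pint p M (h (j + k)) \<le> ennreal ((C * ?e k) * (2 powr (- p)) ^ j)" .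
  qed auto
  also have "(\<Sum>j. ennreal ((C * ?e k) * (2 powr (- p)) ^ j)) = ennreal ((C * ?e k) * (1 / (1 - 2 powr (- p))))"
    using q C geometric_sums[of "2 powr (- p)"] by (intro suminf_ennreal_eq sums_mult) auto
  finally show ?thesis using C q by (simp add: ennreal_mult[symmetric] mult_ac)
qed

section \<open>The Cheeger energy and completeness with respect to it\<close>

locale cheeger_space = sobolev_space \<mu> Cd p Cp l for \<mu> :: "'a::metric_space measure" and Cd p Cp l +
  fixes ip :: "'a \<Rightarrow> real ^ 'n::finite \<Rightarrow> real ^ 'n \<Rightarrow> real" and D :: "('a \<Rightarrow> real) \<Rightarrow> 'a \<Rightarrow> real ^ 'n" and K :: real
  assumes K: "1 \<le> K"
    and ip: "x \<in> space \<mu> \<Longrightarrow> inner_product (ip x)"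
    and ip_measurable: "\<And>v w. (\<lambda>x. ip x v w) \<in> borel_measurable (completion \<mu>)"
    and D_measurable: "u \<in> N1p p \<mu> \<Longrightarrow> D u \<in> borel_measurable (completion \<mu>)"
    and D_linear: "u \<in> N1p p \<mu> \<Longrightarrow> v \<in> N1p p \<mu> \<Longrightarrow>
      AE x in completion \<mu>. D (\<lambda>y. a * u y + b * v y) x = a *\<^sub>R D u x + b *\<^sub>R D v x"
    and D_minimal: "u \<in> N1p p \<mu> \<Longrightarrow> \<exists>g. minimal_weak_upper_gradient p \<mu> u g \<and>
       (AE x in completion \<mu>. g x \<le> ennreal (K * sqrt (ip x (D u x) (D u x))) \<and>
          ennreal (sqrt (ip x (D u x) (D u x))) \<le> ennreal K * g x)"
begin

abbreviation E :: "('a \<Rightarrow> real) \<Rightarrow> real" where "E u \<equiv> cheeger_energy p \<mu> ip D u"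

lemma E_def: "E u = (LINT x|completion \<mu>. nrm (ip x) (D u x) powr p)"
  by (simp add: cheeger_energy_def nrm_def)

lemma nrm_D_nonneg: "AE x in completion \<mu>. 0 \<le> nrm (ip x) (D u x)"
  by (intro AE_I2) (auto intro: nrm_nonneg ip)

lemma nrm_D_measurable:
  assumes "u \<in> N1p p \<mu>"
  shows "(\<lambda>x. nrm (ip x) (D u x)) \<in> borel_measurable (completion \<mu>)"
  by (intro nrm_measurable ip ip_measurable D_measurable assms) simp

lemma pint_completion: "pint p (completion \<mu>) g = pint p \<mu> g"
  by (simp add: pint_def nn_integral_completion)

text \<open>Minimality extends the comparison with the minimal gradient to every weak upper
  gradient, so any weak upper gradient with small p-th power integral certifies a small
  energy.\<close>

lemma energy_nn:
  assumes u: "u \<in> N1p p \<mu>"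
  shows "integrable (completion \<mu>) (\<lambda>x. nrm (ip x) (D u x) powr p)"
    "ennreal (E u) = pint p \<mu> (\<lambda>x. ennreal (nrm (ip x) (D u x)))"
    "weak_upper_gradient p \<mu> u h \<Longrightarrow> ennreal (E u) \<le> ennreal (K powr p) * pint p \<mu> h"
proof -
  note [measurable] = nrm_D_measurable[OF u]
  obtain g where g: "minimal_weak_upper_gradient p \<mu> u g"
    "AE x in completion \<mu>. ennreal (nrm (ip x) (D u x)) \<le> ennreal K * g x"
    using D_minimal[OF u] unfolding nrm_def by auto
  have gm: "g \<in> borel_measurable \<mu>" and gfin: "pint p \<mu> g < top"
    using g(1) by (auto simp: minimal_weak_upper_gradient_def weak_upper_gradient_def)
  have "pint p (completion \<mu>) (\<lambda>x. ennreal (nrm (ip x) (D u x))) \<le> pint p (completion \<mu>) (\<lambda>x. ennreal K * g x)"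
    using p g(2) by (intro pint_mono_AE) auto
  also have "\<dots> = ennreal (K powr p) * pint p \<mu> g"
    using K gm by (simp add: pint_completion pint_cmult epowr_ennreal)
  finally have le: "pint p \<mu> (\<lambda>x. ennreal (nrm (ip x) (D u x))) \<le> ennreal (K powr p) * pint p \<mu> g"
    by (simp add: pint_completion)
  have nn: "pint p \<mu> (\<lambda>x. ennreal (nrm (ip x) (D u x))) = (\<integral>\<^sup>+x. ennreal (nrm (ip x) (D u x) powr p) \<partial>completion \<mu>)"
    unfolding pint_def nn_integral_completion
    by (intro nn_integral_cong) (simp add: epowr_ennreal nrm_nonneg ip)
  have "ennreal (K powr p) * pint p \<mu> g < top" using gfin by (simp add: ennreal_mult_less_top)
  with le have fin: "(\<integral>\<^sup>+x. ennreal (nrm (ip x) (D u x) powr p) \<partial>completion \<mu>) < top" unfolding nn by (rule le_less_trans)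
  have "(\<lambda>x. nrm (ip x) (D u x) powr p) \<in> borel_measurable (completion \<mu>)" by measurable
  then show int: "integrable (completion \<mu>) (\<lambda>x. nrm (ip x) (D u x) powr p)"
    using fin by (intro integrableI_bounded) simp_all
  show e: "ennreal (E u) = pint p \<mu> (\<lambda>x. ennreal (nrm (ip x) (D u x)))"
    unfolding nn E_def using int by (intro nn_integral_eq_integral[symmetric]) auto
  show "ennreal (E u) \<le> ennreal (K powr p) * pint p \<mu> h" if "weak_upper_gradient p \<mu> u h"
    unfolding e using le minimal_le_upper_gradient[OF p0 sets_eq g(1) that] by (meson mult_left_mono order_trans zero_le)
qed

lemma energy_nonneg: "0 \<le> E u"
  unfolding E_def by (intro Bochner_Integration.integral_nonneg) simp

text \<open>The converse passage, from energy to a genuine upper gradient as the Poincare inequality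
  demands; \<open>d\<close> pays for the improvement of the minimal weak upper gradient.\<close>

lemma energy_upper_gradient:
  assumes u: "u \<in> N1p p \<mu>" and d: "0 < d"
  obtains g where "upper_gradient \<mu> u g" "pint p \<mu> g \<le> ennreal (2 powr p * (K powr p * E u) + d)"
proof -
  note [measurable] = nrm_D_measurable[OF u]
  obtain g where g: "minimal_weak_upper_gradient p \<mu> u g"
    "AE x in completion \<mu>. g x \<le> ennreal (K * nrm (ip x) (D u x))"
    using D_minimal[OF u] unfolding nrm_def by auto
  have wg: "weak_upper_gradient p \<mu> u g" using g(1) by (simp add: minimal_weak_upper_gradient_def)
  have "pint p (completion \<mu>) g \<le> pint p (completion \<mu>) (\<lambda>x. ennreal K * ennreal (nrm (ip x) (D u x)))"
  proof (intro pint_mono_AE)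
    show "AE x in completion \<mu>. g x \<le> ennreal K * ennreal (nrm (ip x) (D u x))"
      using g(2) nrm_D_nonneg[of u] by eventually_elim (use K in \<open>simp add: ennreal_mult\<close>)
  qed (use p in simp)
  also have "\<dots> = epowr (ennreal K) p * pint p (completion \<mu>) (\<lambda>x. ennreal (nrm (ip x) (D u x)))"
    by (intro pint_cmult) measurable
  also have "\<dots> = ennreal (K powr p) * ennreal (E u)"
    using K by (simp add: epowr_ennreal energy_nn(2)[OF u] pint_completion)
  finally have le: "pint p \<mu> g \<le> ennreal (K powr p * E u)"
    using energy_nonneg by (simp add: pint_completion ennreal_mult)
  obtain g' where g': "upper_gradient \<mu> u g'" "pint p \<mu> g' \<le> ennreal (2 powr p) * pint p \<mu> g + ennreal d"
    using weak_upper_gradient_improve[OF p0 sets_eq wg d] by blast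
  note g'(2)
  also have "ennreal (2 powr p) * pint p \<mu> g + ennreal d \<le> ennreal (2 powr p) * ennreal (K powr p * E u) + ennreal d"
    by (intro add_right_mono mult_left_mono le) auto
  also have "\<dots> = ennreal (2 powr p * (K powr p * E u) + d)"
    using d energy_nonneg K by (simp add: ennreal_mult)
  finally show ?thesis using that g'(1) by blast
qed

lemma diff_lincomb: "(\<lambda>x. u x - v x) = (\<lambda>x. 1 * u x + (-1) * v x :: real)" by auto

lemma N1p_diff: "u \<in> N1p p \<mu> \<Longrightarrow> v \<in> N1p p \<mu> \<Longrightarrow> (\<lambda>x. u x - v x) \<in> N1p p \<mu>"
  unfolding diff_lincomb by (rule N1p_lincomb[OF p0 sets_eq])

lemma const_N1p: "(\<lambda>_. c) \<in> N1p p \<mu>"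
  using emeasure_finite[of "space \<mu>"] by (intro N1p_const[OF p0 sets_eq]) (simp add: less_top[symmetric])

lemma energy_const: "E (\<lambda>_. c) = 0"
proof -
  have "ennreal (E (\<lambda>_. c)) \<le> ennreal (K powr p) * pint p \<mu> (\<lambda>_. 0)"
    by (intro energy_nn(3) const_N1p upper_gradient_imp_weak upper_gradient_const[OF p0 sets_eq])
  then show ?thesis using energy_nonneg[of "\<lambda>_. c"] by (simp add: pint_def ennreal_eq_0_iff)
qed

lemma energy_uniform:
  assumes e: "0 < e"
  obtains C where "0 < C" "\<And>u v. u \<in> N1p p \<mu> \<Longrightarrow> v \<in> N1p p \<mu> \<Longrightarrow>
    E (\<lambda>x. u x - v x) + C * E (\<lambda>x. 1 / 2 * u x + 1 / 2 * v x) \<le> e * (E u + E v) + C * ((E u + E v) / 2)"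
proof -
  obtain C where C: "0 < C" "\<And>(b :: real ^ 'n \<Rightarrow> real ^ 'n \<Rightarrow> real) v w. inner_product b \<Longrightarrow>
    nrm b (v - w) powr p + C * nrm b ((1 / 2) *\<^sub>R (v + w)) powr p
      \<le> e * (nrm b v powr p + nrm b w powr p) + C * ((nrm b v powr p + nrm b w powr p) / 2)"
    using uniform_convexity[OF p e] by metis
  show ?thesis
  proof (rule that[OF C(1)])
    fix u v assume u: "u \<in> N1p p \<mu>" and v: "v \<in> N1p p \<mu>"
    let ?n = "\<lambda>u x. nrm (ip x) (D u x) powr p"
    let ?d = "\<lambda>x. u x - v x" and ?m = "\<lambda>x. 1 / 2 * u x + 1 / 2 * v x"
    have m: "?m \<in> N1p p \<mu>" by (rule N1p_lincomb[OF p0 sets_eq u v])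
    note i = energy_nn(1)[OF u] energy_nn(1)[OF v] energy_nn(1)[OF N1p_diff[OF u v]] energy_nn(1)[OF m]
    have "E ?d + C * E ?m = (LINT x|completion \<mu>. ?n ?d x + C * ?n ?m x)"
      unfolding E_def using i by simp
    also have "\<dots> \<le> (LINT x|completion \<mu>. e * (?n u x + ?n v x) + C * ((?n u x + ?n v x) / 2))"
    proof (intro integral_mono_AE)
      show "AE x in completion \<mu>. ?n ?d x + C * ?n ?m x \<le> e * (?n u x + ?n v x) + C * ((?n u x + ?n v x) / 2)"
        using D_linear[OF u v, of 1 "-1"] D_linear[OF u v, of "1/2" "1/2"] AE_space[of "completion \<mu>"]
      proof eventually_elim
        case (elim x)
        have "D ?d x = D u x - D v x" using elim(1) unfolding diff_lincomb by simp
        moreover have "D ?m x = (1 / 2) *\<^sub>R (D u x + D v x)" using elim(2) by (simp add: scaleR_add_right)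
        ultimately show ?case using C(2)[OF ip, of x "D u x" "D v x"] elim(3) by simp
      qed
    qed (use i in auto)
    also have "\<dots> = e * (E u + E v) + C * ((E u + E v) / 2)"
      unfolding E_def using i by simp
    finally show "E ?d + C * E ?m \<le> e * (E u + E v) + C * ((E u + E v) / 2)" .
  qed
qed

lemma energy_add_le:
  assumes u: "u \<in> N1p p \<mu>" and v: "v \<in> N1p p \<mu>" and h: "0 < h"
  shows "E u \<le> (1 + h) powr p * E v + (1 + 1 / h) powr p * E (\<lambda>x. u x - v x)"
proof -
  let ?n = "\<lambda>u x. nrm (ip x) (D u x) powr p"
  let ?d = "\<lambda>x. u x - v x"
  note i = energy_nn(1)[OF u] energy_nn(1)[OF v] energy_nn(1)[OF N1p_diff[OF u v]]
  have "E u \<le> (LINT x|completion \<mu>. (1 + h) powr p * ?n v x + (1 + 1 / h) powr p * ?n ?d x)"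
    unfolding E_def
  proof (intro integral_mono_AE)
    show "AE x in completion \<mu>. ?n u x \<le> (1 + h) powr p * ?n v x + (1 + 1 / h) powr p * ?n ?d x"
      using D_linear[OF u v, of 1 "-1"] AE_space[of "completion \<mu>"]
    proof eventually_elim
      case (elim x)
      have d: "D ?d x = D u x - D v x" using elim(1) unfolding diff_lincomb by simp
      have b: "inner_product (ip x)" using elim(2) ip by simp
      have "nrm (ip x) (D u x) \<le> nrm (ip x) (D v x) + nrm (ip x) (D ?d x)"
        unfolding d using nrm_triangle[OF b, of "D v x" "D u x - D v x"] by simp
      then have "?n u x \<le> (nrm (ip x) (D v x) + nrm (ip x) (D ?d x)) powr p"
        using p nrm_nonneg[OF b] by (intro powr_mono2) auto
      also have "\<dots> \<le> (1 + h) powr p * ?n v x + (1 + 1 / h) powr p * ?n ?d x"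
        using p h nrm_nonneg[OF b] by (intro powr_add_le_eps) auto
      finally show ?case .
    qed
  qed (use i in auto)
  also have "\<dots> = (1 + h) powr p * E v + (1 + 1 / h) powr p * E ?d"
    unfolding E_def using i by simp
  finally show ?thesis .
qed

text \<open>\<open>energy_add_le\<close> with the energy of the difference equal to zero, and
  \<open>h\<close> tending to 0. Applied to functions that differ by a constant, it shows that
  constants do not affect the energy.\<close>

lemma energy_cong:
  assumes u: "u \<in> N1p p \<mu>" and v: "v \<in> N1p p \<mu>" and 0: "E (\<lambda>x. u x - v x) = 0"
  shows "E u = E v"
proof -
  have le: "E u \<le> E v" if u: "u \<in> N1p p \<mu>" and v: "v \<in> N1p p \<mu>" and 0: "E (\<lambda>x. u x - v x) = 0" for u v
  proof -
    have "((\<lambda>h. (1 + h) powr p * E v) \<longlongrightarrow> (1 + 0) powr p * E v) (at_right 0)"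
      by (intro tendsto_intros) auto
    moreover have "\<forall>\<^sub>F h in at_right 0. E u \<le> (1 + h) powr p * E v"
      using energy_add_le[OF u v] 0 by (auto simp: eventually_at_right_field intro!: exI[of _ 1])
    ultimately have "E u \<le> (1 + 0) powr p * E v"
      by (intro tendsto_lowerbound) (auto simp: trivial_limit_at_right_real)
    then show ?thesis by simp
  qed
  have "(\<lambda>x. v x - u x) = (\<lambda>x. 0 * u x + (-1) * (u x - v x))" by auto
  then have "AE x in completion \<mu>. D (\<lambda>x. v x - u x) x = (-1) *\<^sub>R D (\<lambda>x. u x - v x) x"
    using D_linear[OF u N1p_diff[OF u v], of 0 "-1"] by simp
  then have "E (\<lambda>x. v x - u x) = E (\<lambda>x. u x - v x)"
    unfolding E_def
  proof (intro integral_cong_AE)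
    assume "AE x in completion \<mu>. D (\<lambda>x. v x - u x) x = (-1) *\<^sub>R D (\<lambda>x. u x - v x) x"
    then show "AE x in completion \<mu>. nrm (ip x) (D (\<lambda>x. v x - u x) x) powr p = nrm (ip x) (D (\<lambda>x. u x - v x) x) powr p"
      using AE_space by eventually_elim (use nrm_scale[OF ip, of _ "-1"] in simp)
  qed (use energy_nn(1)[OF N1p_diff[OF u v]] energy_nn(1)[OF N1p_diff[OF v u]] in auto)
  then show ?thesis using le[OF u v 0] le[OF v u] 0 by simp
qed

lemma energy_sub_const:
  assumes u: "u \<in> N1p p \<mu>"
  shows "(\<lambda>x. u x - c) \<in> N1p p \<mu>" "E (\<lambda>x. u x - c) = E u"
proof -
  show m: "(\<lambda>x. u x - c) \<in> N1p p \<mu>" by (rule N1p_diff[OF u const_N1p])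
  have "(\<lambda>x. u x - (u x - c)) = (\<lambda>_. c)" by auto
  then show "E (\<lambda>x. u x - c) = E u" using energy_cong[OF u m] energy_const by simp
qed

text \<open>Small energies of the increments give upper gradients \<open>g k\<close> with geometric
  bounds, and the Poincare inequality gives constants \<open>a k\<close> for which the increments
  minus \<open>a k\<close> are equally small in p-th power. After the correction both series
  converge, and the tails of the sum of the \<open>g k\<close> are weak upper gradients of the
  distance to the limit.\<close>

lemma energy_complete:
  fixes w :: "nat \<Rightarrow> 'a \<Rightarrow> real"
  assumes w: "\<And>k. w k \<in> N1p p \<mu>"
    and le: "\<And>k. E (\<lambda>x. w (Suc k) x - w k x) \<le> (1 / 4) powr (p * real k)"
  obtains U c where "U \<in> N1p p \<mu>" "(\<lambda>k. E (\<lambda>x. U x - (w k x - c k))) \<longlonglongrightarrow> 0"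
proof -
  let ?e = "\<lambda>k. (1 / 4 :: real) powr (p * real k)"
  let ?v = "\<lambda>k x. w (Suc k) x - w k x"
  define C5 where "C5 = 2 powr p * K powr p + 1"
  have C5: "0 \<le> C5" by (simp add: C5_def)
  have "\<exists>g. upper_gradient \<mu> (?v k) g \<and> pint p \<mu> g \<le> ennreal (C5 * ?e k)" for k
  proof -
    obtain g where g: "upper_gradient \<mu> (?v k) g" "pint p \<mu> g \<le> ennreal (2 powr p * (K powr p * E (?v k)) + ?e k)"
      using energy_upper_gradient[OF N1p_diff[OF w w], of "?e k" "Suc k" k] by auto
    note g(2)
    also have "ennreal (2 powr p * (K powr p * E (?v k)) + ?e k) \<le> ennreal (2 powr p * (K powr p * ?e k) + ?e k)"
      by (intro ennreal_leI add_right_mono mult_left_mono le) auto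
    also have "2 powr p * (K powr p * ?e k) + ?e k = C5 * ?e k" by (simp add: C5_def distrib_right mult.assoc)
    finally show ?thesis using g(1) by blast
  qed
  then obtain g where g: "\<And>k. upper_gradient \<mu> (?v k) (g k)" "\<And>k. pint p \<mu> (g k) \<le> ennreal (C5 * ?e k)" by metis
  have gm [measurable]: "g k \<in> borel_measurable \<mu>" for k using g(1) by (simp add: upper_gradient_def)
  have gfin: "pint p \<mu> (g k) < top" for k using g(2)[of k] by (rule le_less_trans) simp
  obtain KL where KL: "0 \<le> KL" "\<And>u g. u \<in> N1p p \<mu> \<Longrightarrow> upper_gradient \<mu> u g \<Longrightarrow> pint p \<mu> g < top \<Longrightarrow>
    \<exists>c. pint p \<mu> (\<lambda>x. ennreal \<bar>u x - c\<bar>) \<le> ennreal KL * pint p \<mu> g"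
    using N1p_Lp_poincare by blast
  have "\<exists>c. pint p \<mu> (\<lambda>x. ennreal \<bar>?v k x - c\<bar>) \<le> ennreal (KL * C5 * ?e k)" for k
  proof -
    obtain c where c: "pint p \<mu> (\<lambda>x. ennreal \<bar>?v k x - c\<bar>) \<le> ennreal KL * pint p \<mu> (g k)"
      using KL(2)[OF N1p_diff[OF w w] g(1) gfin] by blast
    also have "\<dots> \<le> ennreal KL * ennreal (C5 * ?e k)" by (intro mult_left_mono g) auto
    finally show ?thesis using KL(1) C5 by (auto simp: ennreal_mult mult.assoc)
  qed
  then obtain a where a: "\<And>k. pint p \<mu> (\<lambda>x. ennreal \<bar>?v k x - a k\<bar>) \<le> ennreal (KL * C5 * ?e k)" by metis
  \<comment> \<open>Partial sums, so that the increments of the corrected sequence \<open>z\<close>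
    are those of \<open>w\<close> minus \<open>a k\<close>.\<close>
  define c where "c k = (\<Sum>j<k. a j)" for k
  define z where "z k x = w k x - c k" for k x
  have zN: "z k \<in> N1p p \<mu>" for k unfolding z_def by (rule energy_sub_const(1)[OF w])
  have zm [measurable]: "z k \<in> borel_measurable (completion \<mu>)" for k using zN by (simp add: N1p_def)
  have zd: "z (Suc k) x - z k x = ?v k x - a k" for k x by (simp add: z_def c_def)
  have zug: "upper_gradient \<mu> (\<lambda>x. z (Suc k) x - z k x) (g k)" for k
  proof -
    have "(z (Suc k) x - z k x) - (z (Suc k) y - z k y) = ?v k x - ?v k y" for x y by (simp add: zd)
    then show ?thesis using g(1)[of k] by (simp only: upper_gradient_def upper_gradient_along_def) blast
  qed
  define B where "B = 2 powr p * (C5 / (1 - 2 powr (- p)))"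
  have G: "pint p \<mu> (\<lambda>x. \<Sum>j. g (j + k) x) \<le> ennreal (B * ?e k)" for k
    unfolding B_def by (intro pint_suminf_geometric p C5 g(2) gm)
  define V where "V k x = (\<Sum>j. ennreal \<bar>z (Suc (j + k)) x - z (j + k) x\<bar>)" for k x
  have Vle: "pint p (completion \<mu>) (V k) \<le> ennreal (2 powr p * (KL * C5 / (1 - 2 powr (- p))) * ?e k)" for k
    unfolding V_def
  proof (rule pint_suminf_geometric[where h = "\<lambda>j x. ennreal \<bar>z (Suc j) x - z j x\<bar>"])
    show "pint p (completion \<mu>) (\<lambda>x. ennreal \<bar>z (Suc j) x - z j x\<bar>) \<le> ennreal (KL * C5 * ?e j)" for j
      unfolding zd pint_completion by (rule a)
  qed (use p KL(1) C5 in \<open>simp_all add: mult.assoc\<close>)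
  have Vm [measurable]: "V k \<in> borel_measurable (completion \<mu>)" for k unfolding V_def[abs_def] by measurable
  have Vfin: "pint p (completion \<mu>) (V 0) < top" using Vle[of 0] by (rule le_less_trans) simp
  have ae: "AE x in completion \<mu>. V 0 x < top"
  proof -
    have "AE x in completion \<mu>. epowr (V 0 x) p \<noteq> \<infinity>"
      using Vfin by (intro nn_integral_PInf_AE) (auto simp: pint_def less_top)
    then show ?thesis by eventually_elim (metis epowr_less_top_iff infinity_ennreal_def less_top)
  qed
  have "pint p \<mu> (\<lambda>x. \<Sum>j. g (j + 0) x) < top" using G[of 0] by (rule le_less_trans) simp
  then obtain U where U: "\<And>x. convergent (\<lambda>k. z k x) \<Longrightarrow> (\<lambda>k. z k x) \<longlonglongrightarrow> U x"
    "\<And>k. weak_upper_gradient p \<mu> (\<lambda>x. U x - z k x) (\<lambda>x. \<Sum>j. g (j + k) x)"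
    using upper_gradient_limit[OF p0 sets_eq, of z g, OF zug] by auto
  have lim: "(\<lambda>k. z k x) \<longlonglongrightarrow> U x" "ennreal \<bar>U x - z k x\<bar> \<le> V k x" if x: "V 0 x < top" for x k
  proof -
    have s: "summable (\<lambda>j. \<bar>z (Suc j) x - z j x\<bar>)"
      using x unfolding V_def by (intro summable_suminf_not_top) auto
    have tel: "(\<Sum>j<n. z (Suc (j + k)) x - z (j + k) x) = z (n + k) x - z k x" for n k
      by (induction n) auto
    have "convergent (\<lambda>n. z n x - z 0 x)"
      using summable_rabs_cancel[OF s] tel[where k = 0] by (simp add: summable_iff_convergent)
    then have "convergent (\<lambda>n. (z n x - z 0 x) + z 0 x)" by (intro convergent_add convergent_const)
    then show L: "(\<lambda>k. z k x) \<longlonglongrightarrow> U x" by (intro U(1)) simp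
    have "ennreal \<bar>z (n + k) x - z k x\<bar> \<le> V k x" for n
    proof -
      have "ennreal \<bar>z (n + k) x - z k x\<bar> \<le> ennreal (\<Sum>j<n. \<bar>z (Suc (j + k)) x - z (j + k) x\<bar>)"
        unfolding tel[symmetric] by (intro ennreal_leI sum_abs)
      also have "\<dots> = (\<Sum>j<n. ennreal \<bar>z (Suc (j + k)) x - z (j + k) x\<bar>)" by simp
      also have "\<dots> \<le> V k x" unfolding V_def by (intro sum_le_suminf) auto
      finally show ?thesis .
    qed
    moreover have lm: "(\<lambda>n. ennreal \<bar>z (n + k) x - z k x\<bar>) \<longlonglongrightarrow> ennreal \<bar>U x - z k x\<bar>"
      using LIMSEQ_ignore_initial_segment[OF L, of k] by (intro tendsto_ennrealI tendsto_rabs tendsto_diff tendsto_const)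
    ultimately show "ennreal \<bar>U x - z k x\<bar> \<le> V k x" by (intro LIMSEQ_le_const2[OF lm]) blast
  qed
  \<comment> \<open>\<open>U\<close> is known to be the limit of the \<open>z k\<close> only almost
    everywhere, and the \<open>z k\<close> are measurable only for the completion; the limit of
    Borel versions of all of them is a Borel function equal to \<open>U\<close> almost
    everywhere.\<close>
  have Um [measurable]: "U \<in> borel_measurable (completion \<mu>)"
  proof -
    have "\<forall>k. \<exists>y. y \<in> borel_measurable \<mu> \<and> (AE x in \<mu>. z k x = y x)"
      using completion_ex_borel_measurable_real[OF zm] by blast
    then obtain y where y [measurable]: "\<And>k. y k \<in> borel_measurable \<mu>" and ye: "\<And>k. AE x in \<mu>. z k x = y k x" by metis
    have "AE x in \<mu>. \<forall>k. z k x = y k x" using ye by (simp add: AE_all_countable)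
    then have "AE x in \<mu>. U x = lim (\<lambda>k. y k x)"
      using ae[unfolded AE_completion_iff]
    proof eventually_elim
      case (elim x)
      then show ?case using lim(1)[of x] by (simp add: limI)
    qed
    then show ?thesis by (intro borel_measurable_completion_AE) auto
  qed
  have dN: "(\<lambda>x. U x - z 0 x) \<in> N1p p \<mu>"
  proof -
    have "pint p (completion \<mu>) (\<lambda>x. ennreal \<bar>U x - z 0 x\<bar>) \<le> pint p (completion \<mu>) (V 0)"
      using p ae lim(2)[of _ 0] by (intro pint_mono_AE) (auto elim: eventually_mono)
    then have "pint p \<mu> (\<lambda>x. ennreal \<bar>U x - z 0 x\<bar>) < top"
      using Vfin unfolding pint_completion by (rule le_less_trans)
    moreover have "pint p \<mu> (\<lambda>x. \<Sum>j. g (j + 0) x) < top" using G[of 0] by (rule le_less_trans) simp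
    ultimately show ?thesis unfolding N1p_def using U(2)[of 0] by auto
  qed
  have UN: "U \<in> N1p p \<mu>"
    using N1p_lincomb[OF p0 sets_eq dN zN[of 0], of 1 1] by simp
  have "(\<lambda>k. E (\<lambda>x. U x - z k x)) \<longlonglongrightarrow> 0"
  proof (rule tendsto_sandwich[OF _ _ tendsto_const])
    show "\<forall>\<^sub>F k in sequentially. 0 \<le> E (\<lambda>x. U x - z k x)" by (intro always_eventually allI energy_nonneg)
    have B0: "0 \<le> B" using C5 p powr_less_one[of 2 "-p"] unfolding B_def
      by (intro mult_nonneg_nonneg divide_nonneg_nonneg) auto
    show "\<forall>\<^sub>F k in sequentially. E (\<lambda>x. U x - z k x) \<le> K powr p * B * ((1 / 4) powr p) ^ k"
    proof (intro always_eventually allI)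
      fix k
      have "ennreal (E (\<lambda>x. U x - z k x)) \<le> ennreal (K powr p) * pint p \<mu> (\<lambda>x. \<Sum>j. g (j + k) x)"
        by (intro energy_nn(3) N1p_diff UN zN U(2))
      also have "\<dots> \<le> ennreal (K powr p) * ennreal (B * ?e k)" by (intro mult_left_mono G) auto
      also have "\<dots> = ennreal (K powr p * B * ((1 / 4) powr p) ^ k)"
        using B0 by (simp add: ennreal_mult[symmetric] powr_realpow[symmetric] powr_powr mult.assoc)
      finally show "E (\<lambda>x. U x - z k x) \<le> K powr p * B * ((1 / 4) powr p) ^ k"
        using B0 by (subst (asm) ennreal_le_iff) auto
    qed
    have "(1 / 4 :: real) powr p < 1" using p powr_less_mono2[of p "1/4" 1] by simp
    then show "(\<lambda>k. K powr p * B * ((1 / 4) powr p) ^ k) \<longlonglongrightarrow> 0"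
      by (intro tendsto_mult_right_zero LIMSEQ_realpow_zero) auto
  qed
  then show ?thesis using that UN unfolding z_def by blast
qed

end

section \<open>Existence of minimizers for a linear functional bounded by the energy\<close>

context cheeger_space
begin

text \<open>The bound by the power 1/p of the energy has three effects: \<open>J\<close> is coercive
  because p > 1, \<open>ell\<close> vanishes on constants, and \<open>ell\<close> is continuous
  along sequences whose differences to the limit lose their energy.\<close>

lemma minimizer_exists:
  assumes lin: "\<And>u v a b. u \<in> N1p p \<mu> \<Longrightarrow> v \<in> N1p p \<mu> \<Longrightarrow> ell (\<lambda>x. a * u x + b * v x) = a * ell u + b * ell v"
    and bd: "\<And>u. u \<in> N1p p \<mu> \<Longrightarrow> \<bar>ell u\<bar> \<le> Cl * E u powr (1 / p)"
  shows "\<exists>u\<in>N1p p \<mu>. \<forall>v\<in>N1p p \<mu>. 1 / p * E u - ell u \<le> 1 / p * E v - ell v"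
proof -
  define J where "J u = 1 / p * E u - ell u" for u
  \<comment> \<open>The threshold beyond which \<open>t powr p / p\<close> exceeds
    \<open>(max 0 Cl + 1) * t\<close>, so that \<open>J u\<close> is at least
    \<open>t\<close>.\<close>
  define T where "T = (p * (max 0 Cl + 1)) powr (1 / (p - 1))"
  have T: "0 \<le> T" by (simp add: T_def)
  have tE: "(E u powr (1 / p)) powr p = E u" for u using p energy_nonneg[of u] by (simp add: powr_powr)
  have coercive: "E u powr (1 / p) \<le> max T (J u)" "- (max 0 Cl * T) \<le> J u" if u: "u \<in> N1p p \<mu>" for u
  proof -
    define t where "t = E u powr (1 / p)"
    have t0: "0 \<le> t" by (simp add: t_def)
    have "\<bar>ell u\<bar> \<le> max 0 Cl * t"
      using bd[OF u] mult_right_mono[of Cl "max 0 Cl" t] t0 by (simp add: t_def)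
    then have J: "t powr p / p - max 0 Cl * t \<le> J u"
      unfolding J_def t_def tE by (simp add: abs_le_iff)
    have big: "t \<le> J u" if "T \<le> t" "0 < t"
    proof -
      have "T powr (p - 1) = p * (max 0 Cl + 1)" using p by (simp add: T_def powr_powr)
      then have "p * (max 0 Cl + 1) \<le> t powr (p - 1)" using that T p powr_mono2[of "p - 1" T t] by simp
      then have "t * (p * (max 0 Cl + 1)) \<le> t * t powr (p - 1)" using t0 by (intro mult_left_mono)
      also have "\<dots> = t powr p" using that(2) by (simp add: powr_diff)
      finally have "t * (max 0 Cl + 1) \<le> t powr p / p" using p by (simp add: field_simps)
      then show ?thesis using J by (simp add: algebra_simps)
    qed
    show "E u powr (1 / p) \<le> max T (J u)"
      unfolding t_def[symmetric] using big t0 T by (cases "T \<le> t \<and> 0 < t") auto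
    show "- (max 0 Cl * T) \<le> J u"
    proof (cases "T \<le> t \<and> 0 < t")
      case True
      then show ?thesis using big t0 T by (intro order_trans[of "- (max 0 Cl * T)" 0 "J u"]) auto
    next
      case False
      then have "t \<le> T" using t0 T by auto
      then have "max 0 Cl * t \<le> max 0 Cl * T" by (intro mult_left_mono) auto
      moreover have "0 \<le> t powr p / p" using p by simp
      ultimately show ?thesis using J by linarith
    qed
  qed
  define m where "m = Inf (J ` N1p p \<mu>)"
  have ne: "J ` N1p p \<mu> \<noteq> {}" using const_N1p by auto
  have bb: "bdd_below (J ` N1p p \<mu>)" using coercive(2) by (intro bdd_belowI2)
  have m_le: "m \<le> J u" if "u \<in> N1p p \<mu>" for u unfolding m_def using that bb by (intro cINF_lower)
  define B where "B = (max T (m + 1)) powr p"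
  have EB: "E u \<le> B" if "u \<in> N1p p \<mu>" "J u \<le> m + 1" for u
  proof -
    have "E u powr (1 / p) \<le> max T (m + 1)" using coercive(1)[OF that(1)] that(2) by linarith
    then have "(E u powr (1 / p)) powr p \<le> B" unfolding B_def using p by (intro powr_mono2) auto
    then show ?thesis unfolding tE .
  qed
  have B: "0 \<le> B" by (simp add: B_def)
  \<comment> \<open>At the midpoint of two almost minimizers \<open>J\<close> is at least
    \<open>m\<close>, and \<open>ell\<close> cancels by linearity; hence the convexity defect of the
    energy is small, and \<open>energy_uniform\<close> turns this into a small energy of the
    difference.\<close>
  have cauchy: "\<exists>h>0. \<forall>u\<in>N1p p \<mu>. \<forall>v\<in>N1p p \<mu>. J u \<le> m + h \<longrightarrow> J v \<le> m + h \<longrightarrow> E (\<lambda>x. u x - v x) \<le> e"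
    if e: "0 < e" for e
  proof -
    have pos: "0 < e / (4 * (B + 1))" using e B by simp
    obtain C where C: "0 < C" "\<And>u v. u \<in> N1p p \<mu> \<Longrightarrow> v \<in> N1p p \<mu> \<Longrightarrow>
      E (\<lambda>x. u x - v x) + C * E (\<lambda>x. 1 / 2 * u x + 1 / 2 * v x) \<le> e / (4 * (B + 1)) * (E u + E v) + C * ((E u + E v) / 2)"
      by (rule energy_uniform[OF pos], rule that)
    \<comment> \<open>The cap 1 keeps both functions in the range where \<open>B\<close> bounds
      their energies, so that the coefficient \<open>e / (4 * (B + 1))\<close> costs at most
      \<open>e / 2\<close>; the second entry makes the defect cost at most the other half.\<close>
    define h where "h = min 1 (e / (2 * C * p))"
    have h: "0 < h" "h \<le> 1" "C * p * h \<le> e / 2"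
      using e C p by (auto simp: h_def min_def field_simps)
    have "E (\<lambda>x. u x - v x) \<le> e" if u: "u \<in> N1p p \<mu>" "J u \<le> m + h" and v: "v \<in> N1p p \<mu>" "J v \<le> m + h" for u v
    proof -
      let ?w = "\<lambda>x. 1 / 2 * u x + 1 / 2 * v x"
      have "m \<le> J ?w" by (intro m_le N1p_lincomb[OF p0 sets_eq] u v)
      moreover have "ell ?w = 1 / 2 * ell u + 1 / 2 * ell v" by (rule lin[OF u(1) v(1)])
      ultimately have "1 / p * ((E u + E v) / 2 - E ?w) \<le> h"
        using u(2) v(2) unfolding J_def by (simp add: algebra_simps)
      then have "(E u + E v) / 2 - E ?w \<le> p * h" using p by (simp add: field_simps)
      then have "C * ((E u + E v) / 2 - E ?w) \<le> C * (p * h)" using C(1) by (intro mult_left_mono) auto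
      also have "C * (p * h) \<le> e / 2" using h(3) by (simp only: mult.assoc)
      finally have 1: "C * ((E u + E v) / 2) - C * E ?w \<le> e / 2" unfolding right_diff_distrib .
      have "E u + E v \<le> 2 * (B + 1)" using EB[of u] EB[of v] u v h(2) by simp
      then have "e / (4 * (B + 1)) * (E u + E v) \<le> e / (4 * (B + 1)) * (2 * (B + 1))"
        using e B by (intro mult_left_mono) auto
      also have "\<dots> = e / 2" using B by (simp add: field_simps)
      finally show ?thesis using C(2)[OF u(1) v(1)] 1 by linarith
    qed
    then show ?thesis using h(1) by blast
  qed
  have "\<exists>f. \<forall>k. 0 < f k \<and> (\<forall>u\<in>N1p p \<mu>. \<forall>v\<in>N1p p \<mu>. J u \<le> m + f k \<longrightarrow> J v \<le> m + f k \<longrightarrow>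
      E (\<lambda>x. u x - v x) \<le> (1 / 4) powr (p * real k))"
    by (intro choice allI) (use cauchy in simp)
  then obtain f where f0: "\<forall>k. 0 < f k \<and> (\<forall>u\<in>N1p p \<mu>. \<forall>v\<in>N1p p \<mu>. J u \<le> m + f k \<longrightarrow> J v \<le> m + f k \<longrightarrow>
      E (\<lambda>x. u x - v x) \<le> (1 / 4) powr (p * real k))" by (rule exE)
  have f: "0 < f k" for k using f0 by blast
  have f2:"\<And>k u v. u \<in> N1p p \<mu> \<Longrightarrow> v \<in> N1p p \<mu> \<Longrightarrow> J u \<le> m + f k \<Longrightarrow> J v \<le> m + f k \<Longrightarrow>
      E (\<lambda>x. u x - v x) \<le> (1 / 4) powr (p * real k)" using f0 by blast
  \<comment> \<open>The minimum over all indices up to \<open>k\<close> makes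
    \<open>h (Suc k)\<close> at most \<open>f k\<close> as well, so that consecutive members of the
    sequence satisfy the same tolerance. The entry \<open>1 / real (Suc k)\<close> makes the
    sequence minimizing.\<close>
  define h where "h k = min (1 / real (Suc k)) (Min (f ` {..k}))" for k
  have h: "0 < h k" "h k \<le> 1 / real (Suc k)" "h k \<le> f k" "h (Suc k) \<le> f k" for k
  proof -
    have "0 < Min (f ` {..k})" using f by (subst Min_gr_iff) auto
    then show "0 < h k" "h k \<le> 1 / real (Suc k)" by (auto simp: h_def)
    have "Min (f ` {..k}) \<le> f k" "Min (f ` {..Suc k}) \<le> f k" by (rule Min_le; simp)+
    then show "h k \<le> f k" "h (Suc k) \<le> f k" by (auto simp: h_def min_le_iff_disj)
  qed
  have "\<exists>w. w \<in> N1p p \<mu> \<and> J w < m + h k" for k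
  proof -
    have "Inf (J ` N1p p \<mu>) < m + h k" using h(1)[of k] by (simp add: m_def)
    then show ?thesis using cInf_lessD[OF ne] by blast
  qed
  then obtain w where w: "\<And>k. w k \<in> N1p p \<mu>" "\<And>k. J (w k) < m + h k" by metis
  have dec: "E (\<lambda>x. w (Suc k) x - w k x) \<le> (1 / 4) powr (p * real k)" for k
  proof (rule f2[OF w(1) w(1)])
    show "J (w (Suc k)) \<le> m + f k" using w(2)[of "Suc k"] h(4)[of k] by linarith
    show "J (w k) \<le> m + f k" using w(2)[of k] h(3)[of k] by linarith
  qed
  obtain U c where U: "U \<in> N1p p \<mu>" "(\<lambda>k. E (\<lambda>x. U x - (w k x - c k))) \<longlonglongrightarrow> 0"
    by (rule energy_complete[of w, OF w(1) dec], rule that)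
  define z where "z k = (\<lambda>x. w k x - c k)" for k
  have zN: "z k \<in> N1p p \<mu>" and Ez: "E (z k) = E (w k)" for k
    unfolding z_def using energy_sub_const[OF w(1)] by auto
  have ell_diff: "ell (\<lambda>x. u x - v x) = ell u - ell v" if "u \<in> N1p p \<mu>" "v \<in> N1p p \<mu>" for u v
    unfolding diff_lincomb using lin[OF that, of 1 "-1"] by simp
  \<comment> \<open>Constants have energy zero, so the functional ignores them, and correcting
    \<open>w k\<close> by \<open>c k\<close> leaves \<open>J\<close> unchanged.\<close>
  have ell_const: "ell (\<lambda>_. c) = 0" for c using bd[OF const_N1p[of c]] p by (simp add: energy_const)
  have Jz: "J (z k) = J (w k)" for k
    unfolding J_def Ez unfolding z_def using ell_diff[OF w(1) const_N1p] by (simp add: ell_const)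
  have dz: "(\<lambda>k. E (\<lambda>x. U x - z k x)) \<longlonglongrightarrow> 0" using U(2) by (simp add: z_def)
  have "(\<lambda>k. ell U - ell (z k)) \<longlonglongrightarrow> 0"
  proof (rule Lim_null_comparison)
    show "\<forall>\<^sub>F k in sequentially. norm (ell U - ell (z k)) \<le> Cl * E (\<lambda>x. U x - z k x) powr (1 / p)"
      using bd[OF N1p_diff[OF U(1) zN]] ell_diff[OF U(1) zN] by (intro always_eventually) simp
    have "(\<lambda>k. E (\<lambda>x. U x - z k x) powr (1 / p)) \<longlonglongrightarrow> 0 powr (1 / p)"
      using p energy_nonneg by (intro tendsto_powr' dz tendsto_const) auto
    then show "(\<lambda>k. Cl * E (\<lambda>x. U x - z k x) powr (1 / p)) \<longlonglongrightarrow> 0" using p by (intro tendsto_mult_right_zero) simp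
  qed
  then have ellz: "(\<lambda>k. ell (z k)) \<longlonglongrightarrow> ell U"
    using tendsto_diff[OF tendsto_const[of "ell U"]] by fastforce
  have Jm: "(\<lambda>k. J (z k)) \<longlonglongrightarrow> m"
  proof (rule tendsto_sandwich[OF _ _ tendsto_const])
    show "\<forall>\<^sub>F k in sequentially. m \<le> J (z k)" using m_le[OF zN] by simp
    show "\<forall>\<^sub>F k in sequentially. J (z k) \<le> m + 1 / real (Suc k)"
      unfolding Jz using w(2) h(2) by (intro always_eventually allI) (smt (verit))
    have "(\<lambda>k. m + 1 / real (Suc k)) \<longlonglongrightarrow> m + 0"
      using LIMSEQ_inverse_real_of_nat by (intro tendsto_intros) (simp add: inverse_eq_divide)
    then show "(\<lambda>k. m + 1 / real (Suc k)) \<longlonglongrightarrow> m" by simp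
  qed
  \<comment> \<open>Convergence of \<open>J\<close> and \<open>ell\<close> determines the limit of
    the energies; \<open>energy_add_le\<close>, first with \<open>k\<close> tending to infinity and
    then with \<open>h\<close> tending to 0, bounds \<open>E U\<close> by this limit.\<close>
  have "(\<lambda>k. p * (J (z k) + ell (z k))) \<longlonglongrightarrow> p * (m + ell U)" by (intro tendsto_intros Jm ellz)
  moreover have "p * (J (z k) + ell (z k)) = E (z k)" for k using p by (simp add: J_def)
  ultimately have Elim: "(\<lambda>k. E (z k)) \<longlonglongrightarrow> p * (m + ell U)" by simp
  have le: "E U \<le> (1 + h) powr p * (p * (m + ell U))" if "0 < h" for h
  proof -
    have "(\<lambda>k. (1 + h) powr p * E (z k) + (1 + 1 / h) powr p * E (\<lambda>x. U x - z k x))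
        \<longlonglongrightarrow> (1 + h) powr p * (p * (m + ell U)) + (1 + 1 / h) powr p * 0"
      by (intro tendsto_intros Elim dz)
    then show ?thesis
      using energy_add_le[OF U(1) zN that] by (intro LIMSEQ_le_const) auto
  qed
  have "((\<lambda>h. (1 + h) powr p * (p * (m + ell U))) \<longlongrightarrow> (1 + 0) powr p * (p * (m + ell U))) (at_right 0)"
    by (intro tendsto_intros) auto
  moreover have "\<forall>\<^sub>F h in at_right 0. E U \<le> (1 + h) powr p * (p * (m + ell U))"
    using le by (auto simp: eventually_at_right_field intro!: exI[of _ 1])
  ultimately have "E U \<le> (1 + 0) powr p * (p * (m + ell U))"
    by (intro tendsto_lowerbound) (auto simp: trivial_limit_at_right_real)
  then have "J U \<le> m" using p by (simp add: J_def field_simps)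
  then show ?thesis using U(1) m_le unfolding J_def by (meson order_trans)
qed

end

subsection \<open>The Neumann problem\<close>

context pi_space
begin

lemma has_trace_value_lincomb:
  assumes x: "\<xi> \<in> closure (space \<mu>)" and u: "integrable \<mu> u" "has_trace_value \<mu> u \<xi> c"
    and v: "integrable \<mu> v" "has_trace_value \<mu> v \<xi> d"
  shows "has_trace_value \<mu> (\<lambda>x. a * u x + b * v x) \<xi> (a * c + b * d)"
proof -
  let ?w = "\<lambda>x. a * u x + b * v x"
  have w: "integrable \<mu> ?w" using u(1) v(1) by simp
  have le: "avg \<mu> (\<lambda>y. \<bar>?w y - (a * c + b * d)\<bar>) \<xi> r \<le> \<bar>a\<bar> * avg \<mu> (\<lambda>y. \<bar>u y - c\<bar>) \<xi> r + \<bar>b\<bar> * avg \<mu> (\<lambda>y. \<bar>v y - d\<bar>) \<xi> r" for r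
  proof -
    have "avg \<mu> (\<lambda>y. \<bar>?w y - (a * c + b * d)\<bar>) \<xi> r \<le> avg \<mu> (\<lambda>y. \<bar>a\<bar> * \<bar>u y - c\<bar> + \<bar>b\<bar> * \<bar>v y - d\<bar>) \<xi> r"
    proof (intro avg_mono integrable_abs_diff w Bochner_Integration.integrable_add integrable_mult_right u v)
      fix y
      have "?w y - (a * c + b * d) = a * (u y - c) + b * (v y - d)" by (simp add: algebra_simps)
      then show "\<bar>?w y - (a * c + b * d)\<bar> \<le> \<bar>a\<bar> * \<bar>u y - c\<bar> + \<bar>b\<bar> * \<bar>v y - d\<bar>"
        by (metis abs_mult abs_triangle_ineq)
    qed
    also have "\<dots> = avg \<mu> (\<lambda>y. \<bar>a\<bar> * \<bar>u y - c\<bar>) \<xi> r + avg \<mu> (\<lambda>y. \<bar>b\<bar> * \<bar>v y - d\<bar>) \<xi> r"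
      by (intro avg_add integrable_mult_right integrable_abs_diff u v)
    finally show ?thesis by (simp add: avg_def)
  qed
  have "((\<lambda>r. \<bar>a\<bar> * avg \<mu> (\<lambda>y. \<bar>u y - c\<bar>) \<xi> r + \<bar>b\<bar> * avg \<mu> (\<lambda>y. \<bar>v y - d\<bar>) \<xi> r) \<longlongrightarrow> \<bar>a\<bar> * 0 + \<bar>b\<bar> * 0) (at_right 0)"
    using u v has_trace_value_iff[OF _ x] by (intro tendsto_intros) auto
  then have "((\<lambda>r. \<bar>a\<bar> * avg \<mu> (\<lambda>y. \<bar>u y - c\<bar>) \<xi> r + \<bar>b\<bar> * avg \<mu> (\<lambda>y. \<bar>v y - d\<bar>) \<xi> r) \<longlongrightarrow> 0) (at_right 0)" by simp
  then have "((\<lambda>r. avg \<mu> (\<lambda>y. \<bar>?w y - (a * c + b * d)\<bar>) \<xi> r) \<longlongrightarrow> 0) (at_right 0)"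
    by (rule tendsto_sandwich[OF _ _ tendsto_const, rotated 2]) (intro always_eventually allI avg_nonneg abs_ge_zero le)+
  then show ?thesis using has_trace_value_iff[OF w x] by simp
qed

end

context sobolev_space
begin

lemma N1p_borel_version:
  assumes u: "u \<in> N1p p \<mu>"
  obtains v where "AE x in \<mu>. u x = v x" "integrable \<mu> v"
proof -
  obtain g where "upper_gradient \<mu> u g" "pint p \<mu> g < top" using u unfolding N1p_iff[OF p0 sets_eq] by blast
  moreover have "u \<in> borel_measurable (completion \<mu>)" "pint p \<mu> (\<lambda>x. ennreal \<bar>u x\<bar>) < top"
    using u by (auto simp: N1p_def)
  ultimately show ?thesis using pi_pair_of_upper_gradient pi_pairD(1) that by metis
qed

lemma trace_eq_N1p:
  assumes u: "u \<in> N1p p \<mu>" and x: "\<xi> \<in> closure (space \<mu>)" and a: "has_trace_value \<mu> u \<xi> a"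
  shows "trace \<mu> u \<xi> = a"
proof -
  obtain v where v: "AE x in \<mu>. u x = v x" "integrable \<mu> v" using N1p_borel_version[OF u] by blast
  show ?thesis using trace_eq[OF v(2) x, of a] a has_trace_value_cong[OF v(1)] trace_cong[OF v(1)] by simp
qed

text \<open>Linearity is claimed only where both trace values exist; elsewhere the default value
  \<open>0\<close> can violate it.\<close>

lemma trace_lincomb:
  assumes u: "u \<in> N1p p \<mu>" and v: "v \<in> N1p p \<mu>" and x: "\<xi> \<in> closure (space \<mu>)"
    and tu: "has_trace_value \<mu> u \<xi> (trace \<mu> u \<xi>)" and tv: "has_trace_value \<mu> v \<xi> (trace \<mu> v \<xi>)"
  shows "trace \<mu> (\<lambda>x. a * u x + b * v x) \<xi> = a * trace \<mu> u \<xi> + b * trace \<mu> v \<xi>"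
proof (rule trace_eq_N1p[OF N1p_lincomb[OF p0 sets_eq u v] x])
  obtain u' where u': "AE x in \<mu>. u x = u' x" "integrable \<mu> u'" using N1p_borel_version[OF u] by blast
  obtain v' where v': "AE x in \<mu>. v x = v' x" "integrable \<mu> v'" using N1p_borel_version[OF v] by blast
  have "AE x in \<mu>. a * u x + b * v x = a * u' x + b * v' x" using u'(1) v'(1) by eventually_elim simp
  moreover have "has_trace_value \<mu> (\<lambda>x. a * u' x + b * v' x) \<xi> (a * trace \<mu> u \<xi> + b * trace \<mu> v \<xi>)"
    using tu tv has_trace_value_cong[OF u'(1)] has_trace_value_cong[OF v'(1)] u'(2) v'(2)
    by (intro has_trace_value_lincomb x) simp_all
  ultimately show "has_trace_value \<mu> (\<lambda>x. a * u x + b * v x) \<xi> (a * trace \<mu> u \<xi> + b * trace \<mu> v \<xi>)"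
    using has_trace_value_cong by metis
qed

end

section \<open>The trace of Sobolev functions and the functional composed with it\<close>

lemma HB_class_eq:
  assumes f: "f \<in> besov \<theta> p \<nu>" and g: "g \<in> besov \<theta> p \<nu>" and c: "AE x in completion \<nu>. f x - g x = c"
  shows "HB_class \<theta> p \<nu> f = HB_class \<theta> p \<nu> g"
proof -
  have "\<exists>d'. AE x in completion \<nu>. g x - h x = d'" if "AE x in completion \<nu>. f x - h x = d" for h d
  proof (rule exI)
    show "AE x in completion \<nu>. g x - h x = d - c" using that c by eventually_elim simp
  qed
  moreover have "\<exists>d'. AE x in completion \<nu>. f x - h x = d'" if "AE x in completion \<nu>. g x - h x = d" for h d
  proof (rule exI)
    show "AE x in completion \<nu>. f x - h x = d + c" using that c by eventually_elim simp
  qed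
  ultimately show ?thesis using f g by (auto simp: HB_rel_def)
qed

lemma besov_norm_cong:
  assumes "AE x in completion \<nu>. f x = g x"
  shows "besov_norm \<theta> p \<nu> f = besov_norm \<theta> p \<nu> g"
proof -
  let ?q = "\<lambda>f y x. ennreal (\<bar>f y - f x\<bar> powr p) / (ennreal (dist y x powr (\<theta> * p)) * emeasure \<nu> (ball y (dist y x) \<inter> space \<nu>))"
  have "(\<integral>\<^sup>+y. (\<integral>\<^sup>+x. ?q f y x \<partial>completion \<nu>) \<partial>completion \<nu>) = (\<integral>\<^sup>+y. (\<integral>\<^sup>+x. ?q g y x \<partial>completion \<nu>) \<partial>completion \<nu>)"
  proof (rule nn_integral_cong_AE)
    show "AE y in completion \<nu>. (\<integral>\<^sup>+x. ?q f y x \<partial>completion \<nu>) = (\<integral>\<^sup>+x. ?q g y x \<partial>completion \<nu>)"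
      using assms
    proof eventually_elim
      case (elim y)
      show ?case
      proof (rule nn_integral_cong_AE)
        show "AE x in completion \<nu>. ?q f y x = ?q g y x"
          using assms by eventually_elim (simp add: elim)
      qed
    qed
  qed
  then show ?thesis by (simp add: besov_norm_def)
qed

locale neumann_space =
  cheeger_space \<mu> Cd p Cp l ip D K + trace_space \<mu> Cd p Cp l \<nu> \<Theta> Cm R Cu
  for \<mu> :: "'a::metric_space measure" and Cd p Cp l
    and ip :: "'a \<Rightarrow> real ^ 'n::finite \<Rightarrow> real ^ 'n \<Rightarrow> real" and D :: "('a \<Rightarrow> real) \<Rightarrow> 'a \<Rightarrow> real ^ 'n" and K
    and \<nu> \<Theta> Cm R Cu +
  fixes \<theta> :: real
  assumes \<theta>: "\<theta> = 1 - \<Theta> / p"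
begin

lemma \<theta>p: "\<theta> * p = p - \<Theta>" using p by (simp add: \<theta> field_simps)

lemma trace_of_pi_pair:
  assumes u: "u \<in> N1p p \<mu>" and g: "upper_gradient \<mu> u g" "pint p \<mu> g < top"
  shows "AE \<xi> in \<nu>. has_trace_value \<mu> u \<xi> (trace \<mu> u \<xi>)" "trace \<mu> u \<in> borel_measurable (completion \<nu>)"
    "besov_norm \<theta> p \<nu> (trace \<mu> u) \<le> epowr (ennreal (max 0 (C4 * nu_doubling_const * (2 * kernel_const))) * pint p \<mu> g) (1 / p)"
proof -
  have "u \<in> borel_measurable (completion \<mu>)" "pint p \<mu> (\<lambda>x. ennreal \<bar>u x\<bar>) < top"
    using u by (auto simp: N1p_def)
  from pi_pair_of_upper_gradient[OF this g] obtain v where v: "AE x in \<mu>. u x = v x"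
    "pi_pair v (density \<mu> (\<lambda>x. epowr (g x) p))" by blast
  note e = has_trace_value_cong[OF v(1)] trace_cong[OF v(1)]
  show "AE \<xi> in \<nu>. has_trace_value \<mu> u \<xi> (trace \<mu> u \<xi>)" using AE_trace[OF v(2)] by (simp add: e)
  show "trace \<mu> u \<in> borel_measurable (completion \<nu>)" using trace_measurable[OF v(2)] by (simp add: e)
  have "g \<in> borel_measurable \<mu>" using g(1) by (simp add: upper_gradient_def)
  then have "(\<integral>\<^sup>+y. (\<integral>\<^sup>+x. ennreal (\<bar>trace \<mu> u y - trace \<mu> u x\<bar> powr p) /
       (ennreal (dist y x powr (\<theta> * p)) * emeasure \<nu> (ball y (dist y x) \<inter> space \<nu>)) \<partial>completion \<nu>) \<partial>completion \<nu>)
    \<le> ennreal (C4 * nu_doubling_const * (2 * kernel_const)) * pint p \<mu> g"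
    using besov_bound[OF v(2) \<theta>p] emeasure_density_space by (simp add: e nn_integral_completion)
  also have "\<dots> \<le> ennreal (max 0 (C4 * nu_doubling_const * (2 * kernel_const))) * pint p \<mu> g"
    by (intro mult_right_mono ennreal_leI) auto
  finally show "besov_norm \<theta> p \<nu> (trace \<mu> u) \<le> epowr (ennreal (max 0 (C4 * nu_doubling_const * (2 * kernel_const))) * pint p \<mu> g) (1 / p)"
    unfolding besov_norm_def using p by (intro epowr_mono) auto
qed

definition CT :: real where "CT = (max 0 (C4 * nu_doubling_const * (2 * kernel_const)) * (2 powr p * K powr p)) powr (1 / p)"

lemma trace_besov:
  assumes u: "u \<in> N1p p \<mu>"
  shows "AE \<xi> in \<nu>. has_trace_value \<mu> u \<xi> (trace \<mu> u \<xi>)" "trace \<mu> u \<in> besov \<theta> p \<nu>"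
    "besov_norm \<theta> p \<nu> (trace \<mu> u) \<le> ennreal (CT * E u powr (1 / p))"
proof -
  obtain g where g: "upper_gradient \<mu> u g" "pint p \<mu> g < top" using u unfolding N1p_iff[OF p0 sets_eq] by blast
  show "AE \<xi> in \<nu>. has_trace_value \<mu> u \<xi> (trace \<mu> u \<xi>)" by (rule trace_of_pi_pair(1)[OF u g])
  define A where "A = max 0 (C4 * nu_doubling_const * (2 * kernel_const))"
  have A: "0 \<le> A" by (simp add: A_def)
  have "epowr (besov_norm \<theta> p \<nu> (trace \<mu> u)) p \<le> ennreal (A * (2 powr p * (K powr p * E u)))"
  proof (rule ennreal_le_epsilon)
    fix e :: real assume e: "0 < e"
    \<comment> \<open>With this error in the upper gradient, multiplication by \<open>A\<close>
      loses at most \<open>e\<close>; the \<open>A + 1\<close> keeps the quotient meaningful for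
      \<open>A = 0\<close>.\<close>
    have d: "0 < e / (A + 1)" using A e by simp
    obtain g where g: "upper_gradient \<mu> u g" "pint p \<mu> g \<le> ennreal (2 powr p * (K powr p * E u) + e / (A + 1))"
      using energy_upper_gradient[OF u d] by blast
    have "pint p \<mu> g < top" using g(2) by (rule le_less_trans) simp
    from trace_of_pi_pair(3)[OF u g(1) this]
    have "epowr (besov_norm \<theta> p \<nu> (trace \<mu> u)) p \<le> epowr (epowr (ennreal A * pint p \<mu> g) (1 / p)) p"
      using p unfolding A_def by (intro epowr_mono) auto
    also have "\<dots> = ennreal A * pint p \<mu> g" using p by (simp add: epowr_epowr)
    also have "\<dots> \<le> ennreal A * ennreal (2 powr p * (K powr p * E u) + e / (A + 1))" by (intro mult_left_mono g) auto
    also have "\<dots> = ennreal (A * (2 powr p * (K powr p * E u)) + A * (e / (A + 1)))"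
      using A by (simp add: ennreal_mult'[symmetric] distrib_left)
    also have "\<dots> \<le> ennreal (A * (2 powr p * (K powr p * E u)) + e)"
      using A e by (intro ennreal_leI add_left_mono) (simp add: field_simps)
    also have "\<dots> = ennreal (A * (2 powr p * (K powr p * E u))) + ennreal e"
      using A e energy_nonneg[of u] by (intro ennreal_plus) auto
    finally show "epowr (besov_norm \<theta> p \<nu> (trace \<mu> u)) p \<le> ennreal (A * (2 powr p * (K powr p * E u))) + ennreal e" .
  qed
  then have "epowr (epowr (besov_norm \<theta> p \<nu> (trace \<mu> u)) p) (1 / p) \<le> epowr (ennreal (A * (2 powr p * (K powr p * E u)))) (1 / p)"
    using p by (intro epowr_mono) auto
  also have "\<dots> = ennreal ((A * (2 powr p * (K powr p * E u))) powr (1 / p))"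
    using A energy_nonneg[of u] by (intro epowr_ennreal) simp
  also have "(A * (2 powr p * (K powr p * E u))) powr (1 / p) = CT * E u powr (1 / p)"
    by (simp only: CT_def A_def powr_mult mult.assoc)
  finally show le: "besov_norm \<theta> p \<nu> (trace \<mu> u) \<le> ennreal (CT * E u powr (1 / p))"
    using p by (simp add: epowr_inverse)
  then show "trace \<mu> u \<in> besov \<theta> p \<nu>"
    using trace_of_pi_pair(2)[OF u g] unfolding besov_def by (auto intro: le_less_trans)
qed

lemma trace_lincomb_AE:
  assumes u: "u \<in> N1p p \<mu>" and v: "v \<in> N1p p \<mu>"
  shows "AE \<xi> in completion \<nu>. trace \<mu> (\<lambda>x. a * u x + b * v x) \<xi> = a * trace \<mu> u \<xi> + b * trace \<mu> v \<xi>"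
  unfolding AE_completion_iff using trace_besov(1)[OF u] trace_besov(1)[OF v] AE_space
proof eventually_elim
  case (elim \<xi>)
  then show ?case using m_space by (intro trace_lincomb u v) auto
qed

text \<open>The trace is linear only almost everywhere, so the equation passes through equality of
  classes. That the combination of traces lies in the Besov space follows from its agreement almost
  everywhere with the trace of a Sobolev function.\<close>

lemma functional_linear:
  assumes L: "L \<in> HB_dual \<theta> p \<nu>" and u: "u \<in> N1p p \<mu>" and v: "v \<in> N1p p \<mu>"
  shows "L (HB_class \<theta> p \<nu> (trace \<mu> (\<lambda>x. a * u x + b * v x)))
    = a * L (HB_class \<theta> p \<nu> (trace \<mu> u)) + b * L (HB_class \<theta> p \<nu> (trace \<mu> v))"
proof -
  let ?w = "\<lambda>x. a * u x + b * v x" and ?f = "\<lambda>\<xi>. a * trace \<mu> u \<xi> + b * trace \<mu> v \<xi>"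
  have w: "?w \<in> N1p p \<mu>" by (rule N1p_lincomb[OF p0 sets_eq u v])
  note ae = trace_lincomb_AE[OF u v, of a b]
  have [measurable]: "trace \<mu> u \<in> borel_measurable (completion \<nu>)" "trace \<mu> v \<in> borel_measurable (completion \<nu>)"
    using trace_besov(2)[OF u] trace_besov(2)[OF v] by (auto simp: besov_def)
  have "?f \<in> besov \<theta> p \<nu>"
    using trace_besov(2)[OF w] besov_norm_cong[OF ae] by (simp add: besov_def)
  moreover have "AE \<xi> in completion \<nu>. trace \<mu> ?w \<xi> - ?f \<xi> = 0" using ae by eventually_elim simp
  ultimately have "HB_class \<theta> p \<nu> (trace \<mu> ?w) = HB_class \<theta> p \<nu> ?f"
    by (intro HB_class_eq trace_besov(2)[OF w])
  then show ?thesis using L trace_besov(2)[OF u] trace_besov(2)[OF v] by (simp add: HB_dual_def)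
qed

lemma functional_bounded:
  assumes L: "L \<in> HB_dual \<theta> p \<nu>"
  obtains C where "\<And>u. u \<in> N1p p \<mu> \<Longrightarrow> \<bar>L (HB_class \<theta> p \<nu> (trace \<mu> u))\<bar> \<le> C * E u powr (1 / p)"
proof -
  obtain C where "\<forall>f\<in>besov \<theta> p \<nu>. ennreal \<bar>L (HB_class \<theta> p \<nu> f)\<bar> \<le> ennreal C * besov_norm \<theta> p \<nu> f"
    using L unfolding HB_dual_def by blast
  then have C: "ennreal \<bar>L (HB_class \<theta> p \<nu> f)\<bar> \<le> ennreal C * besov_norm \<theta> p \<nu> f" if "f \<in> besov \<theta> p \<nu>" for f
    using that by blast
  have "\<bar>L (HB_class \<theta> p \<nu> (trace \<mu> u))\<bar> \<le> max 0 C * CT * E u powr (1 / p)" if u: "u \<in> N1p p \<mu>" for u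
  proof -
    have "ennreal \<bar>L (HB_class \<theta> p \<nu> (trace \<mu> u))\<bar> \<le> ennreal C * besov_norm \<theta> p \<nu> (trace \<mu> u)"
      by (intro C trace_besov u)
    also have "\<dots> \<le> ennreal (max 0 C) * ennreal (CT * E u powr (1 / p))"
      by (intro mult_mono ennreal_leI trace_besov u) auto
    also have "\<dots> = ennreal (max 0 C * CT * E u powr (1 / p))"
      by (simp add: ennreal_mult'[symmetric] mult.assoc)
    finally show ?thesis by (subst (asm) ennreal_le_iff) (auto simp: CT_def)
  qed
  then show ?thesis using that by blast
qed

end

section \<open>Passage to classes modulo constants\<close>

context cheeger_space
begin

text \<open>The vanishing norm splits in two: its p-th power part gives equality almost everywhere
  up to a constant, and the infimum over weak upper gradients makes the energy of the difference
  zero. Hence energy and trace are well defined on classes.\<close>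

lemma HN_member:
  assumes w: "(u, w) \<in> HN_rel p \<mu>"
  obtains c where "u \<in> N1p p \<mu>" "w \<in> N1p p \<mu>" "E w = E u" "AE x in \<mu>. u x = w x + c"
proof -
  obtain c where u: "u \<in> N1p p \<mu>" and w: "w \<in> N1p p \<mu>" and c: "N1p_norm p \<mu> (\<lambda>x. u x - w x - c) = 0"
    using w by (auto simp: HN_rel_def)
  let ?z = "\<lambda>x. u x - w x - c"
  have dN: "(\<lambda>x. u x - w x) \<in> N1p p \<mu>" by (rule N1p_diff[OF u w])
  have z: "?z \<in> N1p p \<mu>" "E ?z = E (\<lambda>x. u x - w x)" using energy_sub_const[OF dN, of c] by auto
  have 0: "pint p \<mu> (\<lambda>x. ennreal \<bar>?z x\<bar>) = 0"
    and inf: "(INF g \<in> {g. weak_upper_gradient p \<mu> ?z g}. Lp_norm p \<mu> g) = 0"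
    using c by (auto simp: N1p_norm_def)
  have [measurable]: "?z \<in> borel_measurable (completion \<mu>)" using z by (simp add: N1p_def)
  have "AE x in completion \<mu>. epowr (ennreal \<bar>?z x\<bar>) p = 0"
    using 0 by (subst nn_integral_0_iff_AE[symmetric]) (auto simp: pint_def nn_integral_completion)
  then have "AE x in completion \<mu>. u x = w x + c" by eventually_elim (simp add: ennreal_eq_0_iff)
  then have ae: "AE x in \<mu>. u x = w x + c" by (simp add: AE_completion_iff)
  have "epowr (ennreal (E ?z)) (1 / p) \<le> ennreal K * Lp_norm p \<mu> g" if "weak_upper_gradient p \<mu> ?z g" for g
  proof -
    have "epowr (ennreal (E ?z)) (1 / p) \<le> epowr (ennreal (K powr p) * pint p \<mu> g) (1 / p)"
      using p by (intro epowr_mono energy_nn(3) z that) auto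
    also have "\<dots> = ennreal K * Lp_norm p \<mu> g"
      using p K by (simp add: epowr_mult epowr_ennreal powr_powr Lp_norm_pint)
    finally show ?thesis .
  qed
  then have "ennreal (1 / K) * epowr (ennreal (E ?z)) (1 / p) \<le> Lp_norm p \<mu> g" if "weak_upper_gradient p \<mu> ?z g" for g
  proof -
    have "ennreal (1 / K) * epowr (ennreal (E ?z)) (1 / p) \<le> ennreal (1 / K) * (ennreal K * Lp_norm p \<mu> g)"
      using \<open>\<And>g. weak_upper_gradient p \<mu> ?z g \<Longrightarrow> _\<close> that by (intro mult_left_mono) auto
    also have "\<dots> = Lp_norm p \<mu> g" using K by (simp add: mult.assoc[symmetric] ennreal_mult[symmetric])
    finally show ?thesis .
  qed
  then have "ennreal (1 / K) * epowr (ennreal (E ?z)) (1 / p) \<le> 0" unfolding inf[symmetric] by (intro INF_greatest) auto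
  then have "E ?z = 0" using K energy_nonneg[of ?z] by (simp add: ennreal_eq_0_iff)
  then have "E w = E u" using energy_cong[OF u w] z(2) by simp
  then show ?thesis using that u w ae by blast
qed

lemma HN_refl:
  assumes "u \<in> N1p p \<mu>"
  shows "(u, u) \<in> HN_rel p \<mu>"
proof -
  have "(INF g \<in> {g. weak_upper_gradient p \<mu> (\<lambda>_. 0) g}. Lp_norm p \<mu> g) \<le> Lp_norm p \<mu> (\<lambda>_. 0)"
    by (intro INF_lower CollectI upper_gradient_imp_weak upper_gradient_const[OF p0 sets_eq])
  then have "N1p_norm p \<mu> (\<lambda>_. 0) = 0" by (simp add: N1p_norm_def Lp_norm_pint pint_def)
  then show ?thesis using assms by (auto simp: HN_rel_def intro!: exI[of _ 0])
qed

lemma HN_energy_class: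
  assumes u: "u \<in> N1p p \<mu>"
  shows "HN_energy p \<mu> ip D (HN_rel p \<mu> `` {u}) = E u"
proof -
  have "E ` (HN_rel p \<mu> `` {u}) = {E u}" using HN_member HN_refl[OF u] by (auto simp: image_iff)
  then show ?thesis by (simp add: HN_energy_def)
qed

end

context neumann_space
begin

lemma HN_trace_class:
  assumes u: "u \<in> N1p p \<mu>"
  shows "HN_trace \<theta> p \<mu> \<nu> (HN_rel p \<mu> `` {u}) = HB_class \<theta> p \<nu> (trace \<mu> u)"
proof -
  have *: "HB_class \<theta> p \<nu> (trace \<mu> w) = HB_class \<theta> p \<nu> (trace \<mu> u)" if w: "(u, w) \<in> HN_rel p \<mu>" for w
  proof -
    obtain c where wN: "w \<in> N1p p \<mu>" and c: "AE x in \<mu>. u x = w x + c" using HN_member[OF w] by blast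
    \<comment> \<open>The constant is written as a multiple of the function 1, so that linearity of
      the trace applies.\<close>
    have "AE x in \<mu>. u x = 1 * w x + c * 1" using c by simp
    then have t: "trace \<mu> u = trace \<mu> (\<lambda>x. 1 * w x + c * 1)" by (rule trace_cong)
    have one: "trace \<mu> (\<lambda>_. 1) \<xi> = 1" if "\<xi> \<in> space \<nu>" for \<xi>
    proof (rule trace_eq_N1p[OF const_N1p])
      show "\<xi> \<in> closure (space \<mu>)" using that m_space by auto
      then show "has_trace_value \<mu> (\<lambda>_. 1) \<xi> 1"
        by (subst has_trace_value_iff) (simp_all add: avg_def[abs_def])
    qed
    have "AE \<xi> in completion \<nu>. trace \<mu> w \<xi> - trace \<mu> u \<xi> = - c"
      using trace_lincomb_AE[OF wN const_N1p, of 1 c 1] AE_space[of "completion \<nu>"]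
      by eventually_elim (simp add: t one)
    then show ?thesis by (intro HB_class_eq trace_besov wN u)
  qed
  show ?thesis
    unfolding HN_trace_def
  proof (rule SUP_eq_const)
    show "HN_rel p \<mu> `` {u} \<noteq> {}" using HN_refl[OF u] by blast
    fix w assume "w \<in> HN_rel p \<mu> `` {u}"
    then have "(u, w) \<in> HN_rel p \<mu>" by blast
    then show "HB_class \<theta> p \<nu> (trace \<mu> w) = HB_class \<theta> p \<nu> (trace \<mu> u)" by (rule *)
  qed
qed

lemma neumann_solution:
  assumes L: "L \<in> HB_dual \<theta> p \<nu>"
  shows "\<exists>u\<in>HN p \<mu>. \<forall>v\<in>HN p \<mu>. 1 / p * HN_energy p \<mu> ip D u - L (HN_trace \<theta> p \<mu> \<nu> u)
             \<le> 1 / p * HN_energy p \<mu> ip D v - L (HN_trace \<theta> p \<mu> \<nu> v)"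
proof -
  obtain C where C: "\<And>u. u \<in> N1p p \<mu> \<Longrightarrow> \<bar>L (HB_class \<theta> p \<nu> (trace \<mu> u))\<bar> \<le> C * E u powr (1 / p)"
    using functional_bounded[OF L] by blast
  obtain u where u: "u \<in> N1p p \<mu>" and min: "\<And>v. v \<in> N1p p \<mu> \<Longrightarrow>
      1 / p * E u - L (HB_class \<theta> p \<nu> (trace \<mu> u)) \<le> 1 / p * E v - L (HB_class \<theta> p \<nu> (trace \<mu> v))"
    using minimizer_exists[of "\<lambda>u. L (HB_class \<theta> p \<nu> (trace \<mu> u))" C] functional_linear[OF L] C by blast
  show ?thesis
  proof (intro bexI[of _ "HN_rel p \<mu> `` {u}"] ballI)
    show "HN_rel p \<mu> `` {u} \<in> HN p \<mu>" unfolding HN_def using u by (rule quotientI)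
    fix V assume "V \<in> HN p \<mu>"
    then obtain v where "v \<in> N1p p \<mu>" "V = HN_rel p \<mu> `` {v}" unfolding HN_def by (rule quotientE)
    then show "1 / p * HN_energy p \<mu> ip D (HN_rel p \<mu> `` {u}) - L (HN_trace \<theta> p \<mu> \<nu> (HN_rel p \<mu> `` {u}))
      \<le> 1 / p * HN_energy p \<mu> ip D V - L (HN_trace \<theta> p \<mu> \<nu> V)"
      using min u by (simp add: HN_energy_class HN_trace_class)
  qed
qed

end

text \<open>A one-point boundary: the codimension condition is void, but so is the Besov space.\<close>

lemma trivial_functional:
  assumes one: "space \<nu> = {\<xi>}" and sets: "sets \<nu> = sets (restrict_space borel (space \<nu>))"
    and L: "L \<in> HB_dual \<theta> p \<nu>"
  shows "HB_class \<theta> p \<nu> f = UNIV" "L UNIV = 0"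
proof -
  have b: "f \<in> besov \<theta> p \<nu>" for f
  proof -
    have "f \<in> borel_measurable (completion \<nu>)"
    proof (rule measurableI)
      fix A :: "real set"
      have "f -` A \<inter> space (completion \<nu>) = {} \<or> f -` A \<inter> space (completion \<nu>) = space (completion \<nu>)"
        using one by auto
      then show "f -` A \<inter> space (completion \<nu>) \<in> sets (completion \<nu>)" by (metis sets.empty_sets sets.top)
    qed simp
    moreover have "besov_norm \<theta> p \<nu> f = 0"
    proof -
      let ?q = "\<lambda>y x. ennreal (\<bar>f y - f x\<bar> powr p) / (ennreal (dist y x powr (\<theta> * p)) * emeasure \<nu> (ball y (dist y x) \<inter> space \<nu>))"
      have "(\<integral>\<^sup>+y. (\<integral>\<^sup>+x. ?q y x \<partial>completion \<nu>) \<partial>completion \<nu>) = (\<integral>\<^sup>+y. (\<integral>\<^sup>+x. 0 \<partial>completion \<nu>) \<partial>completion \<nu>)"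
        using one by (intro nn_integral_cong) auto
      then show ?thesis by (simp add: besov_norm_def)
    qed
    ultimately show ?thesis by (simp add: besov_def)
  qed
  have c: "HB_class \<theta> p \<nu> f = UNIV" for f
  proof -
    have "\<exists>c. AE x in completion \<nu>. f x - h x = c" for h
      using one by (intro exI[of _ "f \<xi> - h \<xi>"] AE_I2) simp
    then show ?thesis using b by (auto simp: HB_rel_def)
  qed
  then show "HB_class \<theta> p \<nu> f = UNIV" .
  have "L (HB_class \<theta> p \<nu> (\<lambda>x. 0 * f x + 0 * f x)) = 0 * L (HB_class \<theta> p \<nu> f) + 0 * L (HB_class \<theta> p \<nu> f)"
    using L b[of f] unfolding HB_dual_def by blast
  then show "L UNIV = 0" unfolding c by simp
qed

section \<open>Deriving the structural constants from the hypotheses\<close>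

theorem theorem3p13:
  fixes \<Omega> :: "'a::complete_space set"
    and \<mu> \<nu> :: "'a measure"
    and p \<Theta> \<theta> :: real
    and I :: "nat set"
    and U :: "nat \<Rightarrow> 'a set"
    and \<phi> :: "nat \<Rightarrow> 'a \<Rightarrow> real ^ 'n::finite"
    and ip :: "'a \<Rightarrow> real ^ 'n \<Rightarrow> real ^ 'n \<Rightarrow> real"
    and D :: "('a \<Rightarrow> real) \<Rightarrow> 'a \<Rightarrow> real ^ 'n"
    and L :: "('a \<Rightarrow> real) set \<Rightarrow> real"
  assumes "1 < p"
    and "bounded \<Omega>" and "locally compact \<Omega>" and "\<not> complete \<Omega>"
    and "uniform_domain \<Omega>"
    and "borel_measure_on \<Omega> \<mu>" and "balls_pos_finite \<mu>" and "doubling \<mu>"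
    and "poincare p \<mu>"
    and "cheeger_structure p \<mu> I U \<phi> ip D"
    and "borel_measure_on (bdry \<Omega>) \<nu>" and "codimensional \<Theta> \<mu> \<nu>"
    and "0 < \<Theta>" and "\<Theta> < p" and "\<theta> = 1 - \<Theta> / p"
    and "L \<in> HB_dual \<theta> p \<nu>"
  shows "\<exists>u\<in>HN p \<mu>. \<forall>v\<in>HN p \<mu>.
           1 / p * HN_energy p \<mu> ip D u - L (HN_trace \<theta> p \<mu> \<nu> u)
             \<le> 1 / p * HN_energy p \<mu> ip D v - L (HN_trace \<theta> p \<mu> \<nu> v)"
proof -
  have sets_eq_space: "space M = A" "sets M = sets (restrict_space borel (space M))"
    if "borel_measure_on A M" for A and M :: "'a measure"
  proof -
    show s: "space M = A"
      using sets_eq_imp_space_eq[OF that[unfolded borel_measure_on_def]] by (simp add: space_restrict_space)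
    show "sets M = sets (restrict_space borel (space M))" unfolding s using that by (simp only: borel_measure_on_def)
  qed
  note \<mu> = sets_eq_space[OF assms(6)] and \<nu> = sets_eq_space[OF assms(11)]
  have "\<not> closed \<Omega>" using assms(4) by (simp add: complete_eq_closed)
  then have bne: "bdry \<Omega> \<noteq> {}" by (auto simp: bdry_def closure_subset_eq[symmetric])
  then have one: "\<Omega> \<noteq> {}" by (auto simp: bdry_def)
  obtain Cd where "doubling_space \<mu> Cd"
    using doubling_space_exists[OF \<mu>(2)] assms(2,7,8) one \<mu>(1) by auto
  then interpret doubling_space \<mu> Cd .
  obtain Cp l where Cp: "0 < Cp" "1 \<le> l" and PI: "\<And>x r u g. x \<in> space \<mu> \<Longrightarrow> 0 < r \<Longrightarrow> upper_gradient \<mu> u g \<Longrightarrow>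
        set_integrable (completion \<mu>) (ball x r \<inter> space \<mu>) u \<Longrightarrow>
        emean \<mu> (ball x r \<inter> space \<mu>) (\<lambda>y. ennreal \<bar>u y - mean \<mu> (ball x r \<inter> space \<mu>) u\<bar>)
          \<le> ennreal (Cp * r) * epowr (emean \<mu> (ball x (l * r) \<inter> space \<mu>) (\<lambda>y. epowr (g y) p)) (1 / p)"
    using assms(9) unfolding poincare_def by blast
  obtain K where K: "1 \<le> K" "\<And>u. u \<in> N1p p \<mu> \<Longrightarrow> \<exists>g. minimal_weak_upper_gradient p \<mu> u g \<and>
       (AE x in completion \<mu>. g x \<le> ennreal (K * sqrt (ip x (D u x) (D u x))) \<and>
          ennreal (sqrt (ip x (D u x) (D u x))) \<le> ennreal K * g x)"
    using assms(10) unfolding cheeger_structure_def by blast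
  interpret cheeger_space \<mu> Cd p Cp l ip D K
  proof unfold_locales
    show "x \<in> space \<mu> \<Longrightarrow> inner_product (ip x)" "(\<lambda>x. ip x v w) \<in> borel_measurable (completion \<mu>)"
      "u \<in> N1p p \<mu> \<Longrightarrow> D u \<in> borel_measurable (completion \<mu>)"
      "u \<in> N1p p \<mu> \<Longrightarrow> v' \<in> N1p p \<mu> \<Longrightarrow> AE x in completion \<mu>. D (\<lambda>y. a * u y + b * v' y) x = a *\<^sub>R D u x + b *\<^sub>R D v' x"
      for x v w u v' a b
      using assms(10) unfolding cheeger_structure_def by blast+
  qed (use assms(1) Cp K PI in blast)+
  have bcl: "bdry \<Omega> \<subseteq> closure \<Omega>" by (auto simp: bdry_def)
  have bb: "bounded (bdry \<Omega>)" using bounded_subset[OF bounded_closure[OF assms(2)] bcl] .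
  show ?thesis
  proof (cases "diameter (bdry \<Omega>) = 0")
    case True
    obtain \<xi> where \<xi>: "\<xi> \<in> bdry \<Omega>" using bne by blast
    have "x = \<xi>" if "x \<in> bdry \<Omega>" for x using diameter_bounded_bound[OF bb that \<xi>] True by simp
    then have "space \<nu> = {\<xi>}" unfolding \<nu>(1) using \<xi> by blast
    note triv = trivial_functional[OF this \<nu>(2) assms(16)]
    \<comment> \<open>Every Besov class is the same one here and \<open>L\<close> vanishes on it, so
      only the energy remains to be minimized, and a constant has energy zero.\<close>
    have tr: "L (HN_trace \<theta> p \<mu> \<nu> (HN_rel p \<mu> `` {v})) = 0" if "v \<in> N1p p \<mu>" for v
      using HN_refl[OF that] triv by (auto simp: HN_trace_def)
    show ?thesis
    proof (intro bexI[of _ "HN_rel p \<mu> `` {\<lambda>_. 0}"] ballI)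
      show "HN_rel p \<mu> `` {\<lambda>_. 0} \<in> HN p \<mu>" unfolding HN_def by (intro quotientI const_N1p)
      fix V assume "V \<in> HN p \<mu>"
      then obtain v where "v \<in> N1p p \<mu>" "V = HN_rel p \<mu> `` {v}" unfolding HN_def by (rule quotientE)
      then show "1 / p * HN_energy p \<mu> ip D (HN_rel p \<mu> `` {\<lambda>_. 0}) - L (HN_trace \<theta> p \<mu> \<nu> (HN_rel p \<mu> `` {\<lambda>_. 0}))
        \<le> 1 / p * HN_energy p \<mu> ip D V - L (HN_trace \<theta> p \<mu> \<nu> V)"
        using p by (simp add: HN_energy_class tr const_N1p energy_const energy_nonneg)
    qed
  next
    case False
    define d where "d = diameter (bdry \<Omega>)"
    have d: "0 < d" using False diameter_ge_0[OF bb] by (simp add: d_def)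
    obtain C where C: "0 < C" "\<And>x r. x \<in> bdry \<Omega> \<Longrightarrow> 0 < r \<Longrightarrow> r < 2 * d \<Longrightarrow>
        ennreal (r powr (- \<Theta>) / C) * emeasure \<mu> (ball x r \<inter> space \<mu>) \<le> emeasure \<nu> (ball x r \<inter> space \<nu>) \<and>
        emeasure \<nu> (ball x r \<inter> space \<nu>) \<le> ennreal (C * r powr (- \<Theta>)) * emeasure \<mu> (ball x r \<inter> space \<mu>)"
      using assms(12) unfolding codimensional_def \<nu>(1) d_def by blast
    have big: "ball \<xi> s \<inter> space \<nu> = space \<nu>" if "\<xi> \<in> bdry \<Omega>" "d < s" for \<xi> s
    proof -
      have "dist \<xi> x < s" if "x \<in> bdry \<Omega>" for x
        using diameter_bounded_bound[OF bb \<open>\<xi> \<in> bdry \<Omega>\<close> that] \<open>d < s\<close> by (simp add: d_def)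
      then show ?thesis unfolding \<nu>(1) by auto
    qed
    obtain \<xi>0 where \<xi>0: "\<xi>0 \<in> bdry \<Omega>" using bne by blast
    \<comment> \<open>The radius \<open>3 / 2 * d\<close> exceeds the diameter, so the ball is the
      whole boundary, and it is still within the range of the codimension condition; so \<nu> is
      finite.\<close>
    have "emeasure \<nu> (ball \<xi>0 (3 / 2 * d) \<inter> space \<nu>)
        \<le> ennreal (C * (3 / 2 * d) powr (- \<Theta>)) * emeasure \<mu> (ball \<xi>0 (3 / 2 * d) \<inter> space \<mu>)"
      using C(2)[OF \<xi>0, of "3 / 2 * d"] d by simp
    also have "\<dots> < top" by (simp add: emeasure_ball ennreal_mult_less_top)
    finally have "emeasure \<nu> (space \<nu>) \<noteq> \<infinity>" using big[OF \<xi>0, of "3 / 2 * d"] d by simp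
    then interpret \<nu>: finite_borel \<nu>
      by (intro finite_borel.intro finite_borel_axioms.intro finite_measureI \<nu>(2))
    have up: "vol \<nu> x r \<le> C * r powr (- \<Theta>) * vol \<mu> x r" and low: "r powr (- \<Theta>) * vol \<mu> x r \<le> C * vol \<nu> x r"
      if x: "x \<in> bdry \<Omega>" "0 < r" "r < 2 * d" for x r
    proof -
      have "ennreal (vol \<nu> x r) \<le> ennreal (C * r powr (- \<Theta>) * vol \<mu> x r)"
        using C(2)[OF x] C(1) by (simp add: emeasure_ball \<nu>.emeasure_ball ennreal_mult)
      then show "vol \<nu> x r \<le> C * r powr (- \<Theta>) * vol \<mu> x r"
        using C(1) by (subst (asm) ennreal_le_iff) auto
      have "ennreal (r powr (- \<Theta>) / C * vol \<mu> x r) \<le> ennreal (vol \<nu> x r)"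
        using C(2)[OF x] C(1) by (simp add: emeasure_ball \<nu>.emeasure_ball ennreal_mult'[symmetric])
      then have "r powr (- \<Theta>) / C * vol \<mu> x r \<le> vol \<nu> x r" by simp
      then show "r powr (- \<Theta>) * vol \<mu> x r \<le> C * vol \<nu> x r" using C(1) by (simp add: field_simps)
    qed
    from assms(5)[unfolded uniform_domain_def] obtain Cu where Cu: "1 \<le> Cu \<and>
      (\<forall>x\<in>\<Omega>. \<forall>y\<in>\<Omega>. x \<noteq> y \<longrightarrow>
        (\<exists>\<gamma>. path \<gamma> \<and> path_image \<gamma> \<subseteq> \<Omega> \<and> pathstart \<gamma> = x \<and> pathfinish \<gamma> = y \<and>
             curve_length \<gamma> 0 1 \<le> ennreal (Cu * dist x y) \<and>
             (\<forall>t\<in>{0..1}. min (curve_length \<gamma> 0 t) (curve_length \<gamma> t 1)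
                           \<le> ennreal (Cu * infdist (\<gamma> t) (bdry \<Omega>)))))" by (rule exE)
    interpret neumann_space \<mu> Cd p Cp l ip D K \<nu> \<Theta> C "d / 4" Cu \<theta>
    proof unfold_locales
      show "space \<nu> \<subseteq> closure (space \<mu>)" unfolding \<nu>(1) \<mu>(1) by (rule bcl)
      fix \<xi> r s assume \<xi>: "\<xi> \<in> space \<nu>" and r: "0 < r" "r \<le> d / 4"
      then have \<xi>': "\<xi> \<in> bdry \<Omega>" using \<nu>(1) by simp
      show "r powr (- \<Theta>) * vol \<mu> \<xi> r \<le> C * vol \<nu> \<xi> r" using r d by (intro low \<xi>') auto
      assume s: "r \<le> s"
      show "vol \<nu> \<xi> s \<le> C * r powr (- \<Theta>) * vol \<mu> \<xi> s"
      proof -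
        \<comment> \<open>Radii beyond the range of the codimension condition are cut back to
          \<open>3 / 2 * d\<close>, where the ball already contains the whole boundary.\<close>
        define t where "t = min s (3 / 2 * d)"
        have t: "0 < t" "t < 2 * d" "r \<le> t" "t \<le> s" using r s d by (auto simp: t_def)
        have "vol \<nu> \<xi> s = vol \<nu> \<xi> t"
          using big[OF \<xi>', of s] big[OF \<xi>', of t] d by (auto simp: t_def vol_def min_def)
        also have "\<dots> \<le> C * t powr (- \<Theta>) * vol \<mu> \<xi> t" by (intro up \<xi>' t)
        also have "\<dots> \<le> C * r powr (- \<Theta>) * vol \<mu> \<xi> s"
          using t C(1) r assms(13) by (intro mult_mono powr_mono2' vol_mono) auto
        finally show ?thesis .
      qed
    next
      show "diameter (space \<nu>) = 4 * (d / 4)" by (simp add: \<nu>(1) d_def)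
      show "space \<nu> = bdry (space \<mu>)" by (simp add: \<nu>(1) \<mu>(1))
      fix x y assume "x \<in> space \<mu>" "y \<in> space \<mu>" "x \<noteq> y"
      then show "\<exists>\<gamma>. path \<gamma> \<and> path_image \<gamma> \<subseteq> space \<mu> \<and> pathstart \<gamma> = x \<and> pathfinish \<gamma> = y \<and>
        curve_length \<gamma> 0 1 \<le> ennreal (Cu * dist x y) \<and>
        (\<forall>t\<in>{0..1}. min (curve_length \<gamma> 0 t) (curve_length \<gamma> t 1) \<le> ennreal (Cu * infdist (\<gamma> t) (bdry (space \<mu>))))"
        unfolding \<mu>(1) by (rule Cu[THEN conjunct2, rule_format])
    qed (use assms(13,14,15) C(1) d Cu[THEN conjunct1] in auto)
    show ?thesis by (rule neumann_solution[OF assms(16)])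
  qed
qed

end
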